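(* Consider the equation \[ i\partial_t u + \partial_x^2 u - |D_y| u = \mu |u|^{p-1}u, \qquad (t,x,y)\in\mathbb{R}^3, \] where $|D_y| = (-\partial_y^2)^{1/2}$. Let $p>1$ be an odd integer and $\mu=\pm1$. For any $s_1,s_2\leq 0$, any $0<\delta,\varepsilon<1$ and any $t>0$, there exist $C>0$ and solutions $u_1,u_2$ of this equation with initial data $u_1(0),u_2(0)\in\mathcal{S}(\mathbb{R}^2)$ such that \[ \|u_1(0)\|_{H^{s_1,s_2}},\ \|u_2(0)\|_{H^{s_1,s_2}}\leq C\varepsilon,\qquad \|u_1(0)-u_2(0)\|_{H^{s_1,s_2}}\leq C\delta,\qquad \|u_1(t)-u_2(t)\|_{H^{s_1,s_2}}\geq C\varepsilon. \] If $p>1$ is not an odd integer, the same conclusion holds provided that there exists an integer $k>\frac32$ such that $p\geq k+1$ and $s_1,s_2\leq 0$.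
   Context: $\hat f$ denotes the Fourier transform of $f$ in both spatial variables $(x,y)\mapsto(\xi,\eta)$. The anisotropic Sobolev space $H^{s_1,s_2}(\mathbb{R}^2)$ is the set of tempered distributions $f$ with finite norm $\|f\|_{H^{s_1,s_2}}=\left(\int_{\mathbb{R}^2}\langle\xi\rangle^{2s_1}\langle\eta\rangle^{2s_2}|\hat f(\xi,\eta)|^2\,d\xi\,d\eta\right)^{1/2}$, where $\langle\cdot\rangle=\sqrt{1+|\cdot|^2}$. $\mathcal{S}(\mathbb{R}^2)$ is the Schwartz space. *)

theory Defs
  imports "HOL-Analysis.Analysis"
begin

type_synonym fun2 = "real \<times> real \<Rightarrow> complex"

definition px :: "fun2 \<Rightarrow> fun2" where
  "px f = (\<lambda>(x,y). vector_derivative (\<lambda>s. f (s,y)) (at x))"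

definition py :: "fun2 \<Rightarrow> fun2" where
  "py f = (\<lambda>(x,y). vector_derivative (\<lambda>s. f (x,s)) (at y))"

definition pd :: "nat \<Rightarrow> nat \<Rightarrow> fun2 \<Rightarrow> fun2" where
  "pd m n f = (px ^^ m) ((py ^^ n) f)"

definition schwartz :: "fun2 \<Rightarrow> bool" where
  "schwartz f \<longleftrightarrow>
     (\<forall>m n. \<forall>z. pd m n f differentiable (at z)) \<and>
     (\<forall>m n a b. bounded (range (\<lambda>z. ((fst z) ^ a * (snd z) ^ b) *\<^sub>R pd m n f z)))"

definition sq_int :: "fun2 \<Rightarrow> bool" where
  "sq_int f \<longleftrightarrow> f \<in> borel_measurable lborel \<and> integrable lborel (\<lambda>z. (cmod (f z))\<^sup>2)"

definition fourier1 :: "fun2 \<Rightarrow> fun2" where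
  "fourier1 f = (\<lambda>\<zeta>. \<integral>z. f z * cis (- (fst z * fst \<zeta> + snd z * snd \<zeta>)) \<partial>lborel)"

text \<open>Plancherel Fourier transform of an L^2 function: the L^2-limit of the Fourier
  transforms of the truncations to balls of radius R (determined almost everywhere).\<close>
definition fourier :: "fun2 \<Rightarrow> fun2" where
  "fourier f = (SOME g. sq_int g \<and>
      ((\<lambda>R. \<integral>\<zeta>. (cmod (fourier1 (\<lambda>z. indicator (cball 0 R) z * f z) \<zeta> - g \<zeta>))\<^sup>2 \<partial>lborel)
        \<longlongrightarrow> 0) at_top)"

definition jbr :: "real \<Rightarrow> real" where
  "jbr r = sqrt (1 + r\<^sup>2)"

definition hnorm :: "real \<Rightarrow> real \<Rightarrow> fun2 \<Rightarrow> real" where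
  "hnorm s1 s2 f = sqrt (\<integral>\<zeta>. (jbr (fst \<zeta>)) powr (2 * s1) * (jbr (snd \<zeta>)) powr (2 * s2)
                                 * (cmod (fourier f \<zeta>))\<^sup>2 \<partial>lborel)"

definition nonlin :: "real \<Rightarrow> fun2 \<Rightarrow> fun2" where
  "nonlin p f = (\<lambda>z. complex_of_real (cmod (f z) powr (p - 1)) * f z)"

text \<open>Dispersion relation: symbol of -d_x^2 + |D_y|.\<close>
definition omega :: "real \<times> real \<Rightarrow> real" where
  "omega \<zeta> = (fst \<zeta>)\<^sup>2 + \<bar>snd \<zeta>\<bar>"

text \<open>(Mild) solution on the time interval [0,T]: u in C([0,T];L^2) with
  |u|^(p-1)u in C([0,T];L^2), satisfying the Duhamel formula
  hat u(t) = e^{-it omega} hat u(0) - i mu int_0^t e^{-i(t-tau) omega} F(|u|^(p-1)u)(tau) dtau,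
  in the weak L^2 sense on the Fourier side.\<close>
definition nls_solution :: "real \<Rightarrow> real \<Rightarrow> real \<Rightarrow> (real \<Rightarrow> fun2) \<Rightarrow> bool" where
  "nls_solution \<mu> p T u \<longleftrightarrow>
     (\<forall>\<tau>\<in>{0..T}. sq_int (u \<tau>) \<and> sq_int (nonlin p (u \<tau>))) \<and>
     (\<forall>\<tau>0\<in>{0..T}.
        ((\<lambda>\<tau>. \<integral>z. (cmod (u \<tau> z - u \<tau>0 z))\<^sup>2 \<partial>lborel) \<longlongrightarrow> 0) (at \<tau>0 within {0..T}) \<and>
        ((\<lambda>\<tau>. \<integral>z. (cmod (nonlin p (u \<tau>) z - nonlin p (u \<tau>0) z))\<^sup>2 \<partial>lborel) \<longlongrightarrow> 0)
           (at \<tau>0 within {0..T})) \<and>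
     (\<forall>s\<in>{0..T}. \<forall>\<psi>. sq_int \<psi> \<longrightarrow>
        (\<integral>\<zeta>. fourier (u s) \<zeta> * cnj (\<psi> \<zeta>) \<partial>lborel) =
        (\<integral>\<zeta>. cis (- (s * omega \<zeta>)) * fourier (u 0) \<zeta> * cnj (\<psi> \<zeta>) \<partial>lborel)
        - \<i> * complex_of_real \<mu> *
          (LINT \<tau>:{0..s}|lborel.
             (\<integral>\<zeta>. cis (- ((s - \<tau>) * omega \<zeta>)) * fourier (nonlin p (u \<tau>)) \<zeta> * cnj (\<psi> \<zeta>) \<partial>lborel)))"

end

theory Submission
  imports Defs "HOL-Probability.Probability"
begin

text \<open>For widely spread data the dispersion is negligible and the equation is close to the ordinary
  differential equation \<open>i u' = \<mu> |u|^(p-1) u\<close>, whose solution with datum \<open>A \<phi>\<close> is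
  \<open>A \<phi> exp (-i \<mu> t (A \<phi>)^(p-1))\<close>. Take the Gaussian \<open>\<phi>(x, y) = exp (-(e x^2 + e^2 y^2) / 2)\<close> and the two
  amplitudes \<open>A\<close> and \<open>A (1 + r)\<close> with small \<open>r\<close>. If \<open>A\<close> is large, the phases of the two solutions at time \<open>t\<close>
  differ by \<open>k \<phi>^(p-1)\<close> with an integer \<open>k\<close> for which \<open>\<phi> (1 - exp (i k \<phi>^(p-1)))\<close> is at least 1.3 times
  as large as \<open>\<phi>\<close> in \<open>L\<^sup>2\<close>; such a \<open>k\<close> exists because the Cesaro means of \<open>cos (k x)\<close> vanish for \<open>0 < x \<le> 1\<close>.

  Write \<open>z\<close> for the explicit solution and \<open>v\<close> for the true one. The symbol \<open>omega\<close> has size \<open>O(e)\<close> on the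
  frequencies of \<open>z\<close>, so Gronwall's inequality bounds \<open>v - z\<close> in \<open>L\<^sup>2\<close>. Applied to time translates it shows that
  \<open>t \<mapsto> exp (i t omega) FT (v - z)\<close> is Lipschitz with a small constant, hence \<open>omega * FT (v - z)\<close> is small in
  \<open>L\<^sup>2\<close>. As \<open>1 / (1 + omega)\<close> is square integrable in two dimensions, \<open>v - z\<close> is also small in sup norm. Therefore the
  nonlinearity may be replaced from the start by a globally Lipschitz truncation, for which \<open>v\<close> exists by the
  Picard theorem in \<open>L\<^sup>2\<close>. Finally, on frequencies with small \<open>omega\<close> the Sobolev weights are close to 1, so all the
  norms in question are comparable to \<open>L\<^sup>2\<close> norms.\<close>

subsection \<open>Square integrable functions as a Hilbert space\<close>

text \<open>The same C bounds the data from above and the final difference from below, so the data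
  need not be normalised, but the final difference must be at least as large as each datum. Complete
  decorrelation of the phases would give the factor sqrt 2; the weaker 1.3 is secured, and its
  surplus over 1 pays for the amplitude gap r <= 1/10 and for the dispersive error. The widths are
  matched to the symbol: x-frequencies of size sqrt e and y-frequencies of size e make xi^2 and
  |eta| both O(e). The L2 norm of \<phi> is then of order e^(-3/4), so an error O(e) relative to it
  also tends to 0 absolutely, like e^(1/4). This absolute smallness keeps the solution within
  distance 1 of the explicit one in sup norm, so that the truncation is never felt. Control of
  \<open>omega * FT (v - z)\<close> is bought with time regularity: the nonlinearity is only
  compared at two times and never commuted with |D_y|, which asks for no more than a locally
  Lipschitz derivative of |u|^q u, supplied by q = p - 1 >= 2.\<close>

lemma sq_intI:
  assumes "f \<in> borel_measurable borel" "integrable lborel (\<lambda>z. (cmod (f z))\<^sup>2)"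
  shows "sq_int f"
  using assms by (simp add: sq_int_def)

lemma sq_int_measurable[measurable_dest]: "sq_int f \<Longrightarrow> f \<in> borel_measurable borel"
  by (simp add: sq_int_def)

lemma sq_int_integrable: "sq_int f \<Longrightarrow> integrable lborel (\<lambda>z. (cmod (f z))\<^sup>2)"
  by (simp add: sq_int_def)

lemma sq_int_dominated:
  assumes "sq_int g" and [measurable]: "f \<in> borel_measurable borel"
    and "AE z in lborel. cmod (f z) \<le> c * cmod (g z)"
  shows "sq_int f"
proof (rule sq_intI)
  show "integrable lborel (\<lambda>z. (cmod (f z))\<^sup>2)"
  proof (rule Bochner_Integration.integrable_bound)
    show "integrable lborel (\<lambda>z. c\<^sup>2 * (cmod (g z))\<^sup>2)"
      using sq_int_integrable[OF assms(1)] by simp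
    show "AE z in lborel. norm ((cmod (f z))\<^sup>2) \<le> norm (c\<^sup>2 * (cmod (g z))\<^sup>2)"
      using assms(3)
    proof eventually_elim
      case (elim z)
      then have "(cmod (f z))\<^sup>2 \<le> (c * cmod (g z))\<^sup>2" by (intro power_mono) auto
      then show ?case by (simp add: power_mult_distrib)
    qed
  qed simp
qed simp

lemma sq_int_zero [simp]: "sq_int (\<lambda>z. 0)"
  by (rule sq_intI) auto

lemma sq_int_add:
  assumes f: "sq_int f" and g: "sq_int g"
  shows "sq_int (\<lambda>z. f z + g z)"
proof (rule sq_intI)
  note [measurable] = sq_int_measurable[OF f] sq_int_measurable[OF g]
  show "integrable lborel (\<lambda>z. (cmod (f z + g z))\<^sup>2)"
  proof (rule Bochner_Integration.integrable_bound)
    show "integrable lborel (\<lambda>z. 2 * (cmod (f z))\<^sup>2 + 2 * (cmod (g z))\<^sup>2)"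
      using sq_int_integrable[OF f] sq_int_integrable[OF g] by simp
    have "(cmod (f z + g z))\<^sup>2 \<le> 2 * (cmod (f z))\<^sup>2 + 2 * (cmod (g z))\<^sup>2" for z
    proof -
      have "(cmod (f z + g z))\<^sup>2 \<le> (cmod (f z) + cmod (g z))\<^sup>2"
        by (intro power_mono norm_triangle_ineq) auto
      also have "\<dots> \<le> 2 * (cmod (f z))\<^sup>2 + 2 * (cmod (g z))\<^sup>2"
        using sum_squares_bound[of "cmod (f z)" "cmod (g z)"] by (simp add: power2_sum)
      finally show ?thesis .
    qed
    then show "AE z in lborel. norm ((cmod (f z + g z))\<^sup>2) \<le> norm (2 * (cmod (f z))\<^sup>2 + 2 * (cmod (g z))\<^sup>2)"
      by simp
  qed simp
  show "(\<lambda>z. f z + g z) \<in> borel_measurable borel" by simp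
qed

lemma sq_int_mult_bounded:
  assumes "sq_int f" "m \<in> borel_measurable borel" "\<And>z. cmod (m z) \<le> c"
  shows "sq_int (\<lambda>z. m z * f z)"
proof (rule sq_int_dominated[OF assms(1)])
  show "AE z in lborel. cmod (m z * f z) \<le> c * cmod (f z)"
    using assms(3) by (simp add: norm_mult mult_right_mono)
qed (use assms(2) sq_int_measurable[OF assms(1)] in simp)

lemma sq_int_cmult: "sq_int f \<Longrightarrow> sq_int (\<lambda>z. c * f z)"
  by (rule sq_int_mult_bounded[of f "\<lambda>z. c" "cmod c"]) auto

lemma sq_int_uminus: "sq_int f \<Longrightarrow> sq_int (\<lambda>z. - f z)"
  using sq_int_cmult[of f "-1"] by simp

lemma sq_int_diff: "sq_int f \<Longrightarrow> sq_int g \<Longrightarrow> sq_int (\<lambda>z. f z - g z)"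
  using sq_int_add[of f "\<lambda>z. - g z"] sq_int_uminus[of g] by simp

lemma borel_measurable_cnj [measurable]: "cnj \<in> borel_measurable borel"
  by (intro borel_measurable_continuous_onI continuous_intros)

lemma sq_int_cnj:
  assumes "sq_int f"
  shows "sq_int (\<lambda>z. cnj (f z))"
proof (rule sq_int_dominated[OF assms])
  note [measurable] = sq_int_measurable[OF assms]
  show "(\<lambda>z. cnj (f z)) \<in> borel_measurable borel" by measurable
  show "AE z in lborel. cmod (cnj (f z)) \<le> 1 * cmod (f z)" by simp
qed

lemma sq_int_mult_integrable:
  assumes f: "sq_int f" and g: "sq_int g"
  shows "integrable lborel (\<lambda>z. f z * g z)"
proof (rule Bochner_Integration.integrable_bound)
  note [measurable] = sq_int_measurable[OF f] sq_int_measurable[OF g]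
  show "(\<lambda>z. f z * g z) \<in> borel_measurable lborel" by simp
  show "integrable lborel (\<lambda>z. (cmod (f z))\<^sup>2 + (cmod (g z))\<^sup>2)"
    using sq_int_integrable[OF f] sq_int_integrable[OF g] by simp
  have "cmod (f z) * cmod (g z) \<le> (cmod (f z))\<^sup>2 + (cmod (g z))\<^sup>2" for z
  proof -
    have "0 \<le> cmod (f z) * cmod (g z)" by simp
    with sum_squares_bound[of "cmod (f z)" "cmod (g z)"] show ?thesis by linarith
  qed
  then show "AE z in lborel. norm (f z * g z) \<le> norm ((cmod (f z))\<^sup>2 + (cmod (g z))\<^sup>2)"
    by (simp add: norm_mult)
qed

lemma sq_int_mult_cnj_integrable:
  "sq_int f \<Longrightarrow> sq_int g \<Longrightarrow> integrable lborel (\<lambda>z. f z * cnj (g z))"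
  by (intro sq_int_mult_integrable sq_int_cnj)

text \<open>The relation is partial: it holds only between square integrable functions, so the
  quotient is exactly L2 modulo null sets. With L2 as a type, Banach space calculus (fixed points,
  vector derivatives, integrals of curves) applies to it.\<close>

definition l2_rel :: "fun2 \<Rightarrow> fun2 \<Rightarrow> bool" where
  "l2_rel f g \<longleftrightarrow> sq_int f \<and> sq_int g \<and> (AE z in lborel. f z = g z)"

quotient_type l2 = fun2 / partial: l2_rel
proof (rule part_equivpI)
  show "\<exists>f. l2_rel f f"
    by (rule exI[of _ "\<lambda>z. 0"]) (simp add: l2_rel_def)
  show "symp l2_rel"
    by (auto simp: symp_def l2_rel_def elim: eventually_mono)
  show "transp l2_rel"
    unfolding transp_def l2_rel_def by (auto elim: eventually_elim2)
qed

lemma sq_int_rep [simp, intro]: "sq_int (rep_l2 f)"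
  using Quotient3_rep_reflp[OF Quotient3_l2, of f] by (simp add: l2_rel_def)

lemma rep_measurable [measurable]: "rep_l2 f \<in> borel_measurable borel"
  by (rule sq_int_measurable) simp

lemma rep_abs:
  assumes "sq_int f"
  shows "AE z in lborel. rep_l2 (abs_l2 f) z = f z"
proof -
  have "l2_rel f f" using assms by (simp add: l2_rel_def)
  then have "l2_rel (rep_l2 (abs_l2 f)) f"
    by (rule rep_abs_rsp_left[OF Quotient3_l2])
  then show ?thesis by (simp add: l2_rel_def)
qed

lemma l2_eqI:
  assumes "AE z in lborel. rep_l2 f z = rep_l2 g z"
  shows "f = g"
  using assms by (intro iffD1[OF Quotient3_rel_rep[OF Quotient3_l2, of f g]]) (simp add: l2_rel_def)

lemma abs_rep [simp]: "abs_l2 (rep_l2 f) = f"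
  by (rule Quotient3_abs_rep[OF Quotient3_l2])

text \<open>\<open>real_inner\<close> asks for a real inner product, hence the real part of the
  Hermitian pairing. The norm is the usual one; multiplication by complex scalars comes back later
  as the operator \<open>cmul\<close>.\<close>

instantiation l2 :: real_inner
begin

definition "zero_l2 = abs_l2 (\<lambda>z. 0)"
definition "plus_l2 f g = abs_l2 (\<lambda>z. rep_l2 f z + rep_l2 g z)"
definition "minus_l2 f g = abs_l2 (\<lambda>z. rep_l2 f z - rep_l2 g z)"
definition "uminus_l2 f = abs_l2 (\<lambda>z. - rep_l2 f z)"
definition "scaleR_l2 c f = abs_l2 (\<lambda>z. complex_of_real c * rep_l2 f z)"
definition "inner_l2 f g = Re (\<integral>z. rep_l2 f z * cnj (rep_l2 g z) \<partial>lborel)"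
definition "norm_l2 (f::l2) = sqrt (inner f f)"
definition "sgn_l2 (f::l2) = scaleR (inverse (norm f)) f"
definition "dist_l2 (f::l2) g = norm (f - g)"
definition "(uniformity :: (l2 \<times> l2) filter) = (INF e\<in>{0 <..}. principal {(x, y). dist x y < e})"
definition "open (U :: l2 set) \<longleftrightarrow> (\<forall>x\<in>U. eventually (\<lambda>(x', y). x' = x \<longrightarrow> y \<in> U) uniformity)"

lemma rep_zero: "AE z in lborel. rep_l2 0 z = 0"
  unfolding zero_l2_def by (rule rep_abs) simp

lemma rep_plus: "AE z in lborel. rep_l2 (f + g) z = rep_l2 f z + rep_l2 g z"
  unfolding plus_l2_def by (rule rep_abs[OF sq_int_add[OF sq_int_rep sq_int_rep]])

lemma rep_minus: "AE z in lborel. rep_l2 (f - g) z = rep_l2 f z - rep_l2 g z"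
  unfolding minus_l2_def by (rule rep_abs[OF sq_int_diff[OF sq_int_rep sq_int_rep]])

lemma rep_uminus: "AE z in lborel. rep_l2 (- f) z = - rep_l2 f z"
  unfolding uminus_l2_def by (rule rep_abs[OF sq_int_uminus[OF sq_int_rep]])

lemma rep_scaleR: "AE z in lborel. rep_l2 (c *\<^sub>R f) z = c *\<^sub>R rep_l2 f z"
  unfolding scaleR_l2_def scaleR_conv_of_real by (rule rep_abs[OF sq_int_cmult[OF sq_int_rep]])

lemma inner_l2_self: "inner f f = (\<integral>z. (cmod (rep_l2 f z))\<^sup>2 \<partial>lborel)" for f :: l2
  unfolding inner_l2_def complex_norm_square[symmetric] by (simp only: integral_complex_of_real Re_complex_of_real)

instance
proof
  fix f g h :: l2 and a b :: real
  show "f + g + h = f + (g + h)"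
    by (rule l2_eqI) (use rep_plus[of "f+g" h] rep_plus[of f g] rep_plus[of f "g+h"] rep_plus[of g h] in \<open>eventually_elim, simp\<close>)
  show "f + g = g + f"
    by (rule l2_eqI) (use rep_plus[of f g] rep_plus[of g f] in \<open>eventually_elim, simp\<close>)
  show "0 + f = f"
    by (rule l2_eqI) (use rep_plus[of 0 f] rep_zero in \<open>eventually_elim, simp\<close>)
  show "- f + f = 0"
    by (rule l2_eqI) (use rep_plus[of "-f" f] rep_uminus[of f] rep_zero in \<open>eventually_elim, simp\<close>)
  show "f - g = f + - g"
    by (rule l2_eqI) (use rep_plus[of f "-g"] rep_uminus[of g] rep_minus[of f g] in \<open>eventually_elim, simp\<close>)
  show "a *\<^sub>R (f + g) = a *\<^sub>R f + a *\<^sub>R g"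
    by (rule l2_eqI) (use rep_plus[of f g] rep_scaleR[of a "f+g"] rep_scaleR[of a f] rep_scaleR[of a g]
         rep_plus[of "a *\<^sub>R f" "a *\<^sub>R g"] in \<open>eventually_elim, simp add: scaleR_add_right\<close>)
  show "(a + b) *\<^sub>R f = a *\<^sub>R f + b *\<^sub>R f"
    by (rule l2_eqI) (use rep_scaleR[of "a+b" f] rep_scaleR[of a f] rep_scaleR[of b f]
         rep_plus[of "a *\<^sub>R f" "b *\<^sub>R f"] in \<open>eventually_elim, simp add: scaleR_add_left\<close>)
  show "a *\<^sub>R b *\<^sub>R f = (a * b) *\<^sub>R f"
    by (rule l2_eqI) (use rep_scaleR[of "a*b" f] rep_scaleR[of a "b *\<^sub>R f"] rep_scaleR[of b f] in \<open>eventually_elim, simp\<close>)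
  show "1 *\<^sub>R f = f"
    by (rule l2_eqI) (use rep_scaleR[of 1 f] in \<open>eventually_elim, simp\<close>)
  show "sgn f = scaleR (inverse (norm f)) f" by (rule sgn_l2_def)
  show "dist f g = norm (f - g)" by (rule dist_l2_def)
  show "(uniformity :: (l2 \<times> l2) filter) = (INF e\<in>{0 <..}. principal {(x, y). dist x y < e})"
    by (rule uniformity_l2_def)
  show "open (U :: l2 set) \<longleftrightarrow> (\<forall>x\<in>U. eventually (\<lambda>(x', y). x' = x \<longrightarrow> y \<in> U) uniformity)" for U
    by (rule open_l2_def)
  show "norm f = sqrt (inner f f)" by (rule norm_l2_def)
  have int: "integrable lborel (\<lambda>z. rep_l2 f z * cnj (rep_l2 g z))" for f g
    by (simp add: sq_int_mult_cnj_integrable)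
  show "inner f g = inner g f"
  proof -
    have "(\<integral>z. rep_l2 g z * cnj (rep_l2 f z) \<partial>lborel) = cnj (\<integral>z. rep_l2 f z * cnj (rep_l2 g z) \<partial>lborel)"
      using Bochner_Integration.integral_cnj[of lborel "\<lambda>z. rep_l2 f z * cnj (rep_l2 g z)"] by (simp add: mult.commute)
    then show ?thesis unfolding inner_l2_def by simp
  qed
  show "inner (f + g) h = inner f h + inner g h"
  proof -
    have "(\<integral>z. rep_l2 (f+g) z * cnj (rep_l2 h z) \<partial>lborel) =
      (\<integral>z. rep_l2 f z * cnj (rep_l2 h z) + rep_l2 g z * cnj (rep_l2 h z) \<partial>lborel)"
      by (rule integral_cong_AE) (simp, simp, use rep_plus[of f g] in \<open>eventually_elim, simp add: algebra_simps\<close>)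
    then show ?thesis unfolding inner_l2_def by (simp add: Bochner_Integration.integral_add[OF int int])
  qed
  show "inner (a *\<^sub>R f) g = a * inner f g"
  proof -
    have "(\<integral>z. rep_l2 (a *\<^sub>R f) z * cnj (rep_l2 g z) \<partial>lborel) =
      (\<integral>z. complex_of_real a * (rep_l2 f z * cnj (rep_l2 g z)) \<partial>lborel)"
      by (rule integral_cong_AE) (simp, simp, use rep_scaleR[of a f] in \<open>eventually_elim, simp add: scaleR_conv_of_real\<close>)
    then show ?thesis unfolding inner_l2_def by simp
  qed
  show "0 \<le> inner f f" unfolding inner_l2_self by simp
  show "inner f f = 0 \<longleftrightarrow> f = 0"
  proof
    assume "inner f f = 0"
    then have "AE z in lborel. (cmod (rep_l2 f z))\<^sup>2 = 0"
      unfolding inner_l2_self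
      by (subst (asm) integral_nonneg_eq_0_iff_AE) (auto simp: sq_int_integrable)
    then show "f = 0"
      by (intro l2_eqI) (use rep_zero in \<open>auto elim: eventually_elim2\<close>)
  next
    assume "f = 0"
    then have "(\<integral>z. (cmod (rep_l2 f z))\<^sup>2 \<partial>lborel) = (\<integral>z. 0 \<partial>(lborel :: (real \<times> real) measure))"
      by (intro integral_cong_AE) (simp, simp, use rep_zero in \<open>auto elim: eventually_mono\<close>)
    then show "inner f f = 0" unfolding inner_l2_self by simp
  qed
qed

end

lemma norm_l2_sq: "(norm f)\<^sup>2 = (\<integral>z. (cmod (rep_l2 f z))\<^sup>2 \<partial>lborel)" for f :: l2
  by (simp add: power2_norm_eq_inner inner_l2_self)

lemma norm_abs_sq:
  assumes "sq_int f"
  shows "(norm (abs_l2 f))\<^sup>2 = (\<integral>z. (cmod (f z))\<^sup>2 \<partial>lborel)"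
  unfolding norm_l2_sq
  by (rule integral_cong_AE) (use rep_abs[OF assms] sq_int_measurable[OF assms] in \<open>auto elim: eventually_mono\<close>)

lemma norm_l2_le:
  assumes "AE z in lborel. cmod (rep_l2 f z) \<le> c * cmod (rep_l2 g z)" "0 \<le> c"
  shows "norm f \<le> c * norm g"
proof (rule power2_le_imp_le)
  have "(\<integral>z. (cmod (rep_l2 f z))\<^sup>2 \<partial>lborel) \<le> (\<integral>z. c\<^sup>2 * (cmod (rep_l2 g z))\<^sup>2 \<partial>lborel)"
  proof (rule integral_mono_AE)
    show "AE z in lborel. (cmod (rep_l2 f z))\<^sup>2 \<le> c\<^sup>2 * (cmod (rep_l2 g z))\<^sup>2"
      using assms(1)
    proof eventually_elim
      case (elim z)
      then have "(cmod (rep_l2 f z))\<^sup>2 \<le> (c * cmod (rep_l2 g z))\<^sup>2" by (intro power_mono) auto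
      then show ?case by (simp add: power_mult_distrib)
    qed
  qed (auto simp: sq_int_integrable)
  then show "(norm f)\<^sup>2 \<le> (c * norm g)\<^sup>2"
    by (simp add: norm_l2_sq power_mult_distrib)
  show "0 \<le> c * norm g" using assms(2) by simp
qed

lemma norm_l2_eq:
  assumes "AE z in lborel. cmod (rep_l2 f z) = cmod (rep_l2 g z)"
  shows "norm f = norm g"
proof (rule antisym)
  have "AE z in lborel. cmod (rep_l2 f z) \<le> 1 * cmod (rep_l2 g z)"
    using assms by eventually_elim simp
  from norm_l2_le[OF this] show "norm f \<le> norm g" by simp
  have "AE z in lborel. cmod (rep_l2 g z) \<le> 1 * cmod (rep_l2 f z)"
    using assms by eventually_elim simp
  from norm_l2_le[OF this] show "norm g \<le> norm f" by simp
qed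

lemma nn_integral_l2: "(\<integral>\<^sup>+z. ennreal ((cmod (rep_l2 f z))\<^sup>2) \<partial>lborel) = ennreal ((norm f)\<^sup>2)"
  by (simp add: nn_integral_eq_integral sq_int_integrable norm_l2_sq)

lemma norm_l2_le_nn:
  assumes "(\<integral>\<^sup>+z. ennreal ((cmod (rep_l2 f z))\<^sup>2) \<partial>lborel) \<le> ennreal (B\<^sup>2)" "0 \<le> B"
  shows "norm f \<le> B"
  using assms by (simp add: nn_integral_l2 power2_le_iff_abs_le)

lemma sq_int_nn:
  assumes [measurable]: "f \<in> borel_measurable borel" and "(\<integral>\<^sup>+z. ennreal ((cmod (f z))\<^sup>2) \<partial>lborel) < \<infinity>"
  shows "sq_int f"
  by (rule sq_intI) (use assms(2) in \<open>auto intro!: integrableI_bounded\<close>)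

text \<open>Lower semicontinuity of the L2 norm under convergence almost everywhere, without any
  domination. It serves twice: to identify the limit in the completeness proof, and to place a
  function in the domain of \<open>omega\<close>. The bound is asked from \<open>N\<close> on
  because Cauchy estimates concern later terms only.\<close>

lemma fatou_l2:
  assumes [measurable]: "f \<in> borel_measurable borel" "\<And>n. g n \<in> borel_measurable borel"
    and lim: "AE z in lborel. (\<lambda>n. g n z) \<longlonglongrightarrow> (f z :: complex)"
    and bd: "\<And>n. n \<ge> N \<Longrightarrow> (\<integral>\<^sup>+z. ennreal ((cmod (g n z))\<^sup>2) \<partial>lborel) \<le> C"
  shows "(\<integral>\<^sup>+z. ennreal ((cmod (f z))\<^sup>2) \<partial>(lborel :: (real \<times> real) measure)) \<le> C"
proof -
  have "(\<integral>\<^sup>+z. ennreal ((cmod (f z))\<^sup>2) \<partial>lborel) = (\<integral>\<^sup>+z. liminf (\<lambda>n. ennreal ((cmod (g n z))\<^sup>2)) \<partial>lborel)"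
  proof (rule nn_integral_cong_AE)
    show "AE z in lborel. ennreal ((cmod (f z))\<^sup>2) = liminf (\<lambda>n. ennreal ((cmod (g n z))\<^sup>2))"
      using lim
    proof eventually_elim
      case (elim z)
      have "(\<lambda>n. ennreal ((cmod (g n z))\<^sup>2)) \<longlonglongrightarrow> ennreal ((cmod (f z))\<^sup>2)"
        by (intro tendsto_intros elim)
      then show ?case using lim_imp_Liminf[OF sequentially_bot] by metis
    qed
  qed
  also have "\<dots> \<le> liminf (\<lambda>n. \<integral>\<^sup>+z. ennreal ((cmod (g n z))\<^sup>2) \<partial>lborel)"
    by (rule nn_integral_liminf) simp
  also have "\<dots> \<le> C"
  proof -
    have "liminf (\<lambda>n. \<integral>\<^sup>+z. ennreal ((cmod (g n z))\<^sup>2) \<partial>lborel) \<le> liminf (\<lambda>n. C)"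
      by (rule Liminf_mono) (use bd eventually_sequentially in blast)
    then show ?thesis by (simp add: Liminf_const)
  qed
  finally show ?thesis .
qed

text \<open>Riesz-Fischer for geometrically small steps: such a sequence converges almost
  everywhere, and Fatou's lemma turns the pointwise limit into an L2 limit with the same
  rate.\<close>

lemma Cauchy_l2_rapid_convergent:
  fixes X :: "nat \<Rightarrow> l2"
  assumes X: "\<And>m n. m \<ge> n \<Longrightarrow> norm (X m - X n) \<le> (1/2) ^ n"
  shows "\<exists>f. \<forall>n. norm (f - X n) \<le> (1/2) ^ n"
proof -
  define d where "d = (\<lambda>n z. cmod (rep_l2 (X (Suc n)) z - rep_l2 (X n) z))"
  have [measurable]: "d n \<in> borel_measurable borel" for n by (simp add: d_def)
  have nd: "(\<integral>\<^sup>+z. ennreal ((d n z)\<^sup>2) \<partial>lborel) \<le> ennreal ((1/4) ^ n)" for n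
  proof -
    have "(\<integral>\<^sup>+z. ennreal ((d n z)\<^sup>2) \<partial>lborel) = (\<integral>\<^sup>+z. ennreal ((cmod (rep_l2 (X (Suc n) - X n) z))\<^sup>2) \<partial>lborel)"
      by (rule nn_integral_cong_AE) (use rep_minus[of "X (Suc n)" "X n"] in \<open>eventually_elim, simp add: d_def\<close>)
    also have "\<dots> = ennreal ((norm (X (Suc n) - X n))\<^sup>2)" by (rule nn_integral_l2)
    also have "\<dots> \<le> ennreal (((1/2) ^ n)\<^sup>2)"
      by (intro ennreal_leI power_mono X) auto
    also have "((1/2::real) ^ n)\<^sup>2 = ((1/2)\<^sup>2) ^ n" by (simp only: power_mult[symmetric] mult.commute)
    also have "((1/2::real)\<^sup>2) ^ n = (1/4) ^ n" by (simp add: power2_eq_square)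
    finally show ?thesis .
  qed
  \<comment> \<open>Weighting the squares by \<open>2 ^ n\<close> still leaves the summable bound
    \<open>(1/2) ^ n\<close>. Finiteness almost everywhere then forces \<open>d n z\<close> to be
    O(2^(-n/2)), which is summable without the square.\<close>
  have "(\<integral>\<^sup>+z. (\<Sum>n. ennreal (2 ^ n * (d n z)\<^sup>2)) \<partial>lborel) = (\<Sum>n. \<integral>\<^sup>+z. ennreal (2 ^ n * (d n z)\<^sup>2) \<partial>lborel)"
    by (rule nn_integral_suminf) simp
  also have "\<dots> \<le> (\<Sum>n. ennreal ((1/2) ^ n))"
  proof (rule suminf_le)
    fix n
    have "(\<integral>\<^sup>+z. ennreal (2 ^ n * (d n z)\<^sup>2) \<partial>lborel) = ennreal (2 ^ n) * (\<integral>\<^sup>+z. ennreal ((d n z)\<^sup>2) \<partial>lborel)"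
      by (simp add: ennreal_mult nn_integral_cmult)
    also have "\<dots> \<le> ennreal (2 ^ n) * ennreal ((1/4) ^ n)" by (intro mult_left_mono nd) simp
    also have "\<dots> = ennreal ((1/2) ^ n)"
      by (simp only: ennreal_mult[symmetric] zero_le_power zero_le_numeral zero_le_divide_1_iff power_mult_distrib[symmetric]) simp
    finally show "(\<integral>\<^sup>+z. ennreal (2 ^ n * (d n z)\<^sup>2) \<partial>lborel) \<le> ennreal ((1/2) ^ n)" .
  qed auto
  also have "\<dots> = ennreal 2"
    by (rule suminf_ennreal_eq) (use geometric_sums[of "1/2::real"] in auto)
  finally have "AE z in lborel. (\<Sum>n. ennreal (2 ^ n * (d n z)\<^sup>2)) \<noteq> \<infinity>"
    by (intro nn_integral_PInf_AE) (auto simp: top_unique)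
  then have conv: "AE z in lborel. convergent (\<lambda>n. rep_l2 (X n) z)"
  proof eventually_elim
    case (elim z)
    have "summable (\<lambda>n. 2 ^ n * (d n z)\<^sup>2)"
      by (rule summable_suminf_not_top) (use elim in auto)
    then have "Bseq (\<lambda>n. 2 ^ n * (d n z)\<^sup>2)"
      by (intro convergent_imp_Bseq) (auto dest: summable_LIMSEQ_zero simp: convergent_def)
    then obtain K where K: "K > 0" "\<And>n. 2 ^ n * (d n z)\<^sup>2 \<le> K"
      unfolding Bseq_def by (auto simp: abs_mult)
    have dn: "d n z \<le> sqrt K * (1 / sqrt 2) ^ n" for n
    proof -
      have "(d n z)\<^sup>2 \<le> K / 2 ^ n" using K(2)[of n] by (simp add: field_simps)
      then have "d n z \<le> sqrt (K / 2 ^ n)" by (rule real_le_rsqrt)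
      then show ?thesis by (simp add: real_sqrt_divide real_sqrt_power power_divide)
    qed
    have "summable (\<lambda>n. rep_l2 (X (Suc n)) z - rep_l2 (X n) z)"
    proof (rule summable_comparison_test)
      show "summable (\<lambda>n. sqrt K * (1 / sqrt 2) ^ n)"
        by (intro summable_mult summable_geometric) simp
      show "\<exists>N. \<forall>n\<ge>N. norm (rep_l2 (X (Suc n)) z - rep_l2 (X n) z) \<le> sqrt K * (1 / sqrt 2) ^ n"
        using dn by (auto simp: d_def)
    qed
    then have "convergent (\<lambda>n. \<Sum>i<n. rep_l2 (X (Suc i)) z - rep_l2 (X i) z)"
      by (simp add: summable_iff_convergent)
    then have "convergent (\<lambda>n. rep_l2 (X n) z - rep_l2 (X 0) z)"
      using sum_lessThan_telescope[of "\<lambda>n. rep_l2 (X n) z"] by simp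
    then show ?case by (subst (asm) convergent_diff_const_right_iff)
  qed
  define f where "f = (\<lambda>z. lim (\<lambda>n. rep_l2 (X n) z))"
  have [measurable]: "f \<in> borel_measurable borel" unfolding f_def by measurable
  have lim: "AE z in lborel. (\<lambda>n. rep_l2 (X n) z) \<longlonglongrightarrow> f z"
    using conv by eventually_elim (simp add: f_def convergent_LIMSEQ_iff)
  have fat: "(\<integral>\<^sup>+z. ennreal ((cmod (f z - rep_l2 (X n) z))\<^sup>2) \<partial>lborel) \<le> ennreal (((1/2) ^ n)\<^sup>2)" for n
  proof (rule fatou_l2[where N = n])
    show "AE z in lborel. (\<lambda>m. rep_l2 (X m) z - rep_l2 (X n) z) \<longlonglongrightarrow> f z - rep_l2 (X n) z"
      using lim by eventually_elim (intro tendsto_diff tendsto_const)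
    fix m assume "m \<ge> n"
    have "(\<integral>\<^sup>+z. ennreal ((cmod (rep_l2 (X m) z - rep_l2 (X n) z))\<^sup>2) \<partial>lborel) =
       (\<integral>\<^sup>+z. ennreal ((cmod (rep_l2 (X m - X n) z))\<^sup>2) \<partial>lborel)"
      by (rule nn_integral_cong_AE) (use rep_minus[of "X m" "X n"] in \<open>eventually_elim, simp\<close>)
    also have "\<dots> \<le> ennreal (((1/2) ^ n)\<^sup>2)"
      unfolding nn_integral_l2 by (intro ennreal_leI power_mono X \<open>m \<ge> n\<close>) simp
    finally show "(\<integral>\<^sup>+z. ennreal ((cmod (rep_l2 (X m) z - rep_l2 (X n) z))\<^sup>2) \<partial>lborel) \<le> ennreal (((1/2) ^ n)\<^sup>2)" .
  qed auto
  have "sq_int (\<lambda>z. f z - rep_l2 (X 0) z)"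
    by (rule sq_int_nn) (simp, rule le_less_trans[OF fat[of 0]], simp)
  then have sf: "sq_int f" using sq_int_add[of "\<lambda>z. f z - rep_l2 (X 0) z" "rep_l2 (X 0)"] by simp
  have "norm (abs_l2 f - X n) \<le> (1/2) ^ n" for n
  proof (rule norm_l2_le_nn)
    have "(\<integral>\<^sup>+z. ennreal ((cmod (rep_l2 (abs_l2 f - X n) z))\<^sup>2) \<partial>lborel) =
        (\<integral>\<^sup>+z. ennreal ((cmod (f z - rep_l2 (X n) z))\<^sup>2) \<partial>lborel)"
      by (rule nn_integral_cong_AE) (use rep_minus[of "abs_l2 f" "X n"] rep_abs[OF sf] in \<open>eventually_elim, simp\<close>)
    then show "(\<integral>\<^sup>+z. ennreal ((cmod (rep_l2 (abs_l2 f - X n) z))\<^sup>2) \<partial>lborel) \<le> ennreal (((1/2) ^ n)\<^sup>2)"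
      using fat[of n] by simp
  qed simp
  then show ?thesis by blast
qed

instance l2 :: banach
proof
  fix X :: "nat \<Rightarrow> l2"
  assume "Cauchy X"
  have "\<exists>M. \<forall>m\<ge>M. \<forall>n\<ge>M. norm (X m - X n) < (1/2) ^ k" for k
    using \<open>Cauchy X\<close> unfolding Cauchy_iff by (meson half_gt_zero_iff zero_less_one zero_less_power)
  then obtain M where M: "\<And>k m n. m \<ge> M k \<Longrightarrow> n \<ge> M k \<Longrightarrow> norm (X m - X n) < (1/2) ^ k"
    by metis
  \<comment> \<open>Summing the thresholds makes the index sequence exceed every earlier
    \<open>M n\<close> although \<open>M\<close> need not be monotone.\<close>
  define r where "r k = (\<Sum>j\<le>k. M j) + k" for k
  have rM: "M n \<le> r m" if "n \<le> m" for n m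
    unfolding r_def using that member_le_sum[of n "{..m}" M] by (simp add: le_add1 trans_le_add1)
  have "norm (X (r m) - X (r n)) \<le> (1/2) ^ n" if "m \<ge> n" for m n
    using M[of n "r m" "r n"] rM[of n m] rM[of n n] that by simp
  then obtain f where f: "\<And>n. norm (f - X (r n)) \<le> (1/2) ^ n"
    using Cauchy_l2_rapid_convergent[of "\<lambda>n. X (r n)"] by blast
  have "X \<longlonglongrightarrow> f"
  proof (rule LIMSEQ_I)
    fix e :: real assume "e > 0"
    obtain k where k: "(1/2) ^ k < e / 2"
      using real_arch_pow_inv[of "e/2" "1/2"] \<open>e > 0\<close> by auto
    have "norm (X n - f) < e" if "n \<ge> M k" for n
    proof -
      have "norm (X n - f) \<le> norm (X n - X (r k)) + norm (X (r k) - f)"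
        using norm_triangle_ineq[of "X n - X (r k)" "X (r k) - f"] by simp
      also have "\<dots> < (1/2) ^ k + (1/2) ^ k"
        using M[of k n "r k"] rM[of k k] that f[of k] by (simp add: norm_minus_commute)
      finally show ?thesis using k by simp
    qed
    then show "\<exists>no. \<forall>n\<ge>no. norm (X n - f) < e" by blast
  qed
  then show "convergent X" by (rule convergentI)
qed

subsection \<open>Continuity of translations\<close>

lemma lborel_affine_integral:
  fixes f :: "'a::euclidean_space \<Rightarrow> 'b::{banach, second_countable_topology}"
  assumes [measurable]: "f \<in> borel_measurable borel" and c: "c \<noteq> 0"
  shows "(\<integral>x. f x \<partial>lborel) = \<bar>c\<bar> ^ DIM('a) *\<^sub>R (\<integral>x. f (t + c *\<^sub>R x) \<partial>lborel)"
  by (subst lborel_affine[OF c, of t], subst integral_density) (auto simp: integral_distr)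

lemma lborel_affine_integrable:
  fixes f :: "'a::euclidean_space \<Rightarrow> 'b::{banach, second_countable_topology}"
  assumes f: "integrable lborel f" and c: "c \<noteq> 0"
  shows "integrable lborel (\<lambda>x. f (t + c *\<^sub>R x))"
proof -
  have [measurable]: "f \<in> borel_measurable borel" using f by auto
  let ?k = "\<bar>c\<bar> ^ DIM('a)"
  have "integrable (density (distr lborel borel (\<lambda>x. t + c *\<^sub>R x)) (\<lambda>_. ennreal ?k)) f"
    using f arg_cong[OF lborel_affine[OF c, of t], of "\<lambda>M. integrable M f"] by simp
  then have "integrable (distr lborel borel (\<lambda>x. t + c *\<^sub>R x)) (\<lambda>x. ?k *\<^sub>R f x)"
    by (subst (asm) integrable_density) auto
  then have "integrable (distr lborel borel (\<lambda>x. t + c *\<^sub>R x)) (\<lambda>x. (1 / ?k) *\<^sub>R (?k *\<^sub>R f x))"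
    by (rule integrable_scaleR_right)
  then have "integrable (distr lborel borel (\<lambda>x. t + c *\<^sub>R x)) f"
    using c by simp
  then show ?thesis by (simp add: integrable_distr_eq)
qed

lemma lborel_translation_integral:
  fixes f :: "'a::euclidean_space \<Rightarrow> 'b::{banach, second_countable_topology}"
  assumes "f \<in> borel_measurable borel"
  shows "(\<integral>x. f (t + x) \<partial>lborel) = (\<integral>x. f x \<partial>lborel)"
  using lborel_affine_integral[of f 1 t] assms by simp

lemma lborel_translation_integrable:
  fixes f :: "'a::euclidean_space \<Rightarrow> 'b::{banach, second_countable_topology}"
  assumes "integrable lborel f"
  shows "integrable lborel (\<lambda>x. f (t + x))"
  using lborel_affine_integrable[of f 1 t] assms by simp

text \<open>For indicators |a - b| = a + b - 2 a b, so by translation invariance only the overlap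
  integral matters. Openness gives its pointwise convergence on \<open>U\<close>, and off
  \<open>U\<close> the product vanishes, so boundary points do no harm.\<close>

lemma translation_L1_continuous_open:
  fixes h :: "nat \<Rightarrow> 'a::euclidean_space"
  assumes h: "h \<longlonglongrightarrow> 0" and U: "open U" "emeasure lborel U < \<infinity>"
  shows "(\<lambda>n. \<integral>z. \<bar>indicator U (h n + z) - indicator U z :: real\<bar> \<partial>lborel) \<longlonglongrightarrow> 0"
proof -
  have [measurable]: "U \<in> sets borel" using U by auto
  let ?I = "indicator U :: 'a \<Rightarrow> real"
  have int: "integrable lborel ?I" using U by (simp add: integrable_indicator_iff)
  have int': "integrable lborel (\<lambda>z. ?I (h n + z))" for n
    by (rule lborel_translation_integrable[OF int])
  have int2: "integrable lborel (\<lambda>z. ?I (h n + z) * ?I z)" for n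
    by (rule Bochner_Integration.integrable_bound[OF int]) (auto simp: indicator_def)
  have eq: "(\<integral>z. \<bar>?I (h n + z) - ?I z\<bar> \<partial>lborel) = 2 * (\<integral>z. ?I z \<partial>lborel) - 2 * (\<integral>z. ?I (h n + z) * ?I z \<partial>lborel)" for n
  proof -
    have "(\<integral>z. \<bar>?I (h n + z) - ?I z\<bar> \<partial>lborel) = (\<integral>z. (?I (h n + z) + ?I z) - 2 * (?I (h n + z) * ?I z) \<partial>lborel)"
      by (rule Bochner_Integration.integral_cong) (auto simp: indicator_def)
    also have "\<dots> = (\<integral>z. ?I (h n + z) \<partial>lborel) + (\<integral>z. ?I z \<partial>lborel) - 2 * (\<integral>z. ?I (h n + z) * ?I z \<partial>lborel)"
      by (subst Bochner_Integration.integral_diff) (use int int' int2 in \<open>auto simp: Bochner_Integration.integral_add\<close>)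
    also have "(\<integral>z. ?I (h n + z) \<partial>lborel) = (\<integral>z. ?I z \<partial>lborel)"
      by (rule lborel_translation_integral) simp
    finally show ?thesis by simp
  qed
  have "(\<lambda>n. \<integral>z. ?I (h n + z) * ?I z \<partial>lborel) \<longlonglongrightarrow> (\<integral>z. ?I z \<partial>lborel)"
  proof (rule integral_dominated_convergence[where w = ?I])
    show "AE z in lborel. (\<lambda>n. ?I (h n + z) * ?I z) \<longlonglongrightarrow> ?I z"
    proof (rule AE_I2)
      fix z :: 'a
      show "(\<lambda>n. ?I (h n + z) * ?I z) \<longlonglongrightarrow> ?I z"
      proof (cases "z \<in> U")
        case True
        have "(\<lambda>n. h n + z) \<longlonglongrightarrow> 0 + z" by (intro tendsto_add h tendsto_const)
        then have "eventually (\<lambda>n. h n + z \<in> U) sequentially"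
          using True U(1) by (auto dest: topological_tendstoD)
        then show ?thesis
          by (intro tendsto_eventually) (auto simp: True elim: eventually_mono)
      qed simp
    qed
  qed (use int in \<open>auto simp: indicator_def\<close>)
  then have "(\<lambda>n. 2 * (\<integral>z. ?I z \<partial>lborel) - 2 * (\<integral>z. ?I (h n + z) * ?I z \<partial>lborel)) \<longlonglongrightarrow> 2 * (\<integral>z. ?I z \<partial>lborel) - 2 * (\<integral>z. ?I z \<partial>lborel)"
    by (intro tendsto_intros)
  then show ?thesis unfolding eq by simp
qed

text \<open>Three-epsilon argument, in which translation invariance makes the approximation errors
  of \<open>f\<close> and of its translate equal. It lets continuity pass to L1 limits.\<close>

lemma translation_L1_approx:
  fixes f :: "'a::euclidean_space \<Rightarrow> real" and h :: "nat \<Rightarrow> 'a"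
  assumes f: "integrable lborel f"
    and ap: "\<And>e. e > 0 \<Longrightarrow> \<exists>g. integrable lborel g \<and> (\<integral>z. \<bar>f z - g z\<bar> \<partial>lborel) < e \<and>
       (\<lambda>n. \<integral>z. \<bar>g (h n + z) - g z\<bar> \<partial>lborel) \<longlonglongrightarrow> 0"
  shows "(\<lambda>n. \<integral>z. \<bar>f (h n + z) - f z\<bar> \<partial>lborel) \<longlonglongrightarrow> 0"
proof (rule LIMSEQ_I)
  fix e :: real assume "e > 0"
  then obtain g where g: "integrable lborel g" "(\<integral>z. \<bar>f z - g z\<bar> \<partial>lborel) < e/3"
      "(\<lambda>n. \<integral>z. \<bar>g (h n + z) - g z\<bar> \<partial>lborel) \<longlonglongrightarrow> 0"
    using ap[of "e/3"] by auto
  note [measurable] = borel_measurable_integrable[OF f] borel_measurable_integrable[OF g(1)]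
  obtain N where N: "\<And>n. n \<ge> N \<Longrightarrow> norm ((\<integral>z. \<bar>g (h n + z) - g z\<bar> \<partial>lborel) - 0) < e/3"
    using LIMSEQ_D[OF g(3), of "e/3"] \<open>e > 0\<close> by auto
  have "norm ((\<integral>z. \<bar>f (h n + z) - f z\<bar> \<partial>lborel) - 0) < e" if "n \<ge> N" for n
  proof -
    have i: "integrable lborel (\<lambda>z. f (h n + z))" "integrable lborel (\<lambda>z. g (h n + z))"
      by (intro lborel_translation_integrable f g)+
    have "(\<integral>z. \<bar>f (h n + z) - f z\<bar> \<partial>lborel) \<le>
       (\<integral>z. \<bar>f (h n + z) - g (h n + z)\<bar> + \<bar>g (h n + z) - g z\<bar> + \<bar>f z - g z\<bar> \<partial>lborel)"
      by (rule integral_mono) (use f g i in auto)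
    also have "\<dots> = (\<integral>z. \<bar>f (h n + z) - g (h n + z)\<bar> \<partial>lborel) + (\<integral>z. \<bar>g (h n + z) - g z\<bar> \<partial>lborel)
        + (\<integral>z. \<bar>f z - g z\<bar> \<partial>lborel)"
      using f g i by (simp add: Bochner_Integration.integral_add)
    also have "(\<integral>z. \<bar>f (h n + z) - g (h n + z)\<bar> \<partial>lborel) = (\<integral>z. \<bar>f z - g z\<bar> \<partial>lborel)"
      by (rule lborel_translation_integral[of "\<lambda>z. \<bar>f z - g z\<bar>"]) simp
    finally show ?thesis using g(2) N[OF that] by simp
  qed
  then show "\<exists>no. \<forall>n\<ge>no. norm ((\<integral>z. \<bar>f (h n + z) - f z\<bar> \<partial>lborel) - 0) < e" by blast
qed

text \<open>Approximation in stages: open sets, measurable sets of finite measure by outer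
  regularity, then sums and dominated limits through \<open>integrable_induct\<close>.\<close>

lemma translation_L1_continuous:
  fixes f :: "'a::euclidean_space \<Rightarrow> real" and h :: "nat \<Rightarrow> 'a"
  assumes f: "integrable lborel f" and h: "h \<longlonglongrightarrow> 0"
  shows "(\<lambda>n. \<integral>z. \<bar>f (h n + z) - f z\<bar> \<partial>lborel) \<longlonglongrightarrow> 0"
  using f
proof (induction rule: integrable_induct)
  case (base A c)
  have [measurable]: "A \<in> sets borel" using base by simp
  have intA: "integrable lborel (indicator A :: 'a \<Rightarrow> real)"
    using base by (simp add: integrable_indicator_iff)
  have "(\<lambda>n. \<integral>z. \<bar>indicator A (h n + z) - indicator A z :: real\<bar> \<partial>lborel) \<longlonglongrightarrow> 0"
  proof (rule translation_L1_approx[OF intA])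
    fix e :: real assume "e > 0"
    then obtain U where U: "open U" "A \<subseteq> U" "emeasure lborel (U - A) < e"
      using outer_regular_lborel[of A e] by auto
    have [measurable]: "U \<in> sets borel" using U by auto
    have "emeasure lborel U = emeasure lborel A + emeasure lborel (U - A)"
      using U(2) by (subst plus_emeasure) (auto intro!: arg_cong[where f="emeasure lborel"])
    also have "\<dots> < \<infinity>" using base U(3) by (auto simp: less_top[symmetric])
    finally have fin: "emeasure lborel U < \<infinity>" .
    have "(\<integral>z. \<bar>indicator A z - indicator U z :: real\<bar> \<partial>lborel) = (\<integral>z. indicator (U - A) z \<partial>lborel)"
      by (rule Bochner_Integration.integral_cong) (use U(2) in \<open>auto simp: indicator_def\<close>)
    also have "\<dots> = measure lborel (U - A)" by simp
    also have "\<dots> < e"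
    proof -
      have "emeasure lborel (U - A) = ennreal (measure lborel (U - A))"
        using U(3) by (intro emeasure_eq_ennreal_measure) auto
      then show ?thesis using U(3) by (simp add: ennreal_less_iff)
    qed
    finally have "(\<integral>z. \<bar>indicator A z - indicator U z :: real\<bar> \<partial>lborel) < e" .
    then show "\<exists>g. integrable lborel g \<and> (\<integral>z. \<bar>indicator A z - g z :: real\<bar> \<partial>lborel) < e \<and>
       (\<lambda>n. \<integral>z. \<bar>g (h n + z) - g z\<bar> \<partial>lborel) \<longlonglongrightarrow> 0"
      by (intro exI[of _ "indicator U"] conjI translation_L1_continuous_open h U fin) (use fin in \<open>simp add: integrable_indicator_iff\<close>)
  qed
  then have "(\<lambda>n. (\<integral>z. \<bar>indicator A (h n + z) - indicator A z\<bar> \<partial>lborel) * \<bar>c\<bar>) \<longlonglongrightarrow> 0 * \<bar>c\<bar>"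
    by (intro tendsto_intros)
  then show ?case
    by (simp add: left_diff_distrib[symmetric] abs_mult)
next
  case (add f g)
  show ?case
  proof (rule tendsto_sandwich[OF _ _ tendsto_const])
    show "(\<lambda>n. (\<integral>z. \<bar>f (h n + z) - f z\<bar> \<partial>lborel) + (\<integral>z. \<bar>g (h n + z) - g z\<bar> \<partial>lborel)) \<longlonglongrightarrow> 0"
      using tendsto_add[OF add.IH] by simp
    have i: "integrable lborel (\<lambda>z. f (h n + z))" "integrable lborel (\<lambda>z. g (h n + z))" for n
      by (intro lborel_translation_integrable add.hyps)+
    have "(\<integral>z. \<bar>f (h n + z) + g (h n + z) - (f z + g z)\<bar> \<partial>lborel)
       \<le> (\<integral>z. \<bar>f (h n + z) - f z\<bar> + \<bar>g (h n + z) - g z\<bar> \<partial>lborel)" for n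
      by (rule integral_mono) (use add.hyps i in auto)
    moreover have "(\<integral>z. \<bar>f (h n + z) - f z\<bar> + \<bar>g (h n + z) - g z\<bar> \<partial>lborel) = (\<integral>z. \<bar>f (h n + z) - f z\<bar> \<partial>lborel) + (\<integral>z. \<bar>g (h n + z) - g z\<bar> \<partial>lborel)" for n
      by (rule Bochner_Integration.integral_add) (use add.hyps i in auto)
    ultimately show "\<forall>\<^sub>F n in sequentially. (\<integral>z. \<bar>f (h n + z) + g (h n + z) - (f z + g z)\<bar> \<partial>lborel)
       \<le> (\<integral>z. \<bar>f (h n + z) - f z\<bar> \<partial>lborel) + (\<integral>z. \<bar>g (h n + z) - g z\<bar> \<partial>lborel)"
      by simp
  qed auto
next
  case (lim f s)
  note [measurable] = borel_measurable_integrable[OF lim.hyps(1)] borel_measurable_integrable[OF lim.hyps(4)]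
  show ?case
  proof (rule translation_L1_approx[OF lim.hyps(4)])
    fix e :: real assume "e > 0"
    have "(\<lambda>i. \<integral>z. \<bar>f z - s i z\<bar> \<partial>lborel) \<longlonglongrightarrow> (\<integral>z. 0 \<partial>(lborel::'a measure))"
    proof (rule integral_dominated_convergence[where w = "\<lambda>z. 3 * \<bar>f z\<bar>"])
      show "AE z in lborel. (\<lambda>i. \<bar>f z - s i z\<bar>) \<longlonglongrightarrow> 0"
      proof (rule AE_I2)
        fix z :: 'a
        have "(\<lambda>i. \<bar>f z - s i z\<bar>) \<longlonglongrightarrow> \<bar>f z - f z\<bar>"
          by (intro tendsto_rabs tendsto_diff tendsto_const lim.hyps(2)) simp
        then show "(\<lambda>i. \<bar>f z - s i z\<bar>) \<longlonglongrightarrow> 0" by simp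
      qed
      have "norm \<bar>f z - s i z\<bar> \<le> 3 * \<bar>f z\<bar>" for i z
        using lim.hyps(3)[of z i] by simp
      then show "AE z in lborel. norm \<bar>f z - s i z\<bar> \<le> 3 * \<bar>f z\<bar>" for i by simp
    qed (use lim.hyps in auto)
    then obtain i where "(\<integral>z. \<bar>f z - s i z\<bar> \<partial>lborel) < e"
      using LIMSEQ_D[of _ 0 e] \<open>e > 0\<close> by fastforce
    then show "\<exists>g. integrable lborel g \<and> (\<integral>z. \<bar>f z - g z\<bar> \<partial>lborel) < e \<and>
       (\<lambda>n. \<integral>z. \<bar>g (h n + z) - g z\<bar> \<partial>lborel) \<longlonglongrightarrow> 0"
      using lim.hyps(1) lim.IH by blast
  qed
qed

text \<open>For nonnegative a and b one has (a - b)^2 <= |a^2 - b^2|, so L2 continuity for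
  \<open>f\<close> follows from L1 continuity for its square.\<close>

lemma translation_L2_continuous_nonneg:
  fixes f :: "'a::euclidean_space \<Rightarrow> real" and h :: "nat \<Rightarrow> 'a"
  assumes [measurable]: "f \<in> borel_measurable borel" and f: "integrable lborel (\<lambda>z. (f z)\<^sup>2)" "\<And>z. f z \<ge> 0"
    and h: "h \<longlonglongrightarrow> 0"
  shows "(\<lambda>n. \<integral>z. (f (h n + z) - f z)\<^sup>2 \<partial>lborel) \<longlonglongrightarrow> 0"
    and "integrable lborel (\<lambda>z. (f (h n + z) - f z)\<^sup>2)"
proof -
  have i: "integrable lborel (\<lambda>z. (f (h n + z))\<^sup>2)" for n
    by (rule lborel_translation_integrable[OF f(1)])
  have pt: "(a - b)\<^sup>2 \<le> \<bar>a\<^sup>2 - b\<^sup>2\<bar>" if "a \<ge> 0" "b \<ge> 0" for a b :: real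
  proof -
    have "(a - b)\<^sup>2 = \<bar>a - b\<bar> * \<bar>a - b\<bar>" by (simp add: power2_eq_square)
    also have "\<dots> \<le> \<bar>a - b\<bar> * \<bar>a + b\<bar>" using that by (intro mult_left_mono) auto
    also have "\<dots> = \<bar>a\<^sup>2 - b\<^sup>2\<bar>" by (simp add: abs_mult[symmetric] power2_eq_square algebra_simps)
    finally show ?thesis .
  qed
  show I: "integrable lborel (\<lambda>z. (f (h n + z) - f z)\<^sup>2)" for n
    by (rule Bochner_Integration.integrable_bound[of _ "\<lambda>z. (f (h n + z))\<^sup>2 - (f z)\<^sup>2"])
      (use f i pt in auto)
  show "(\<lambda>n. \<integral>z. (f (h n + z) - f z)\<^sup>2 \<partial>lborel) \<longlonglongrightarrow> 0"
  proof (rule tendsto_sandwich[OF _ _ tendsto_const])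
    show "(\<lambda>n. \<integral>z. \<bar>(f (h n + z))\<^sup>2 - (f z)\<^sup>2\<bar> \<partial>lborel) \<longlonglongrightarrow> 0"
      by (rule translation_L1_continuous[OF f(1) h])
    show "\<forall>\<^sub>F n in sequentially. (\<integral>z. (f (h n + z) - f z)\<^sup>2 \<partial>lborel) \<le> (\<integral>z. \<bar>(f (h n + z))\<^sup>2 - (f z)\<^sup>2\<bar> \<partial>lborel)"
      by (intro always_eventually allI integral_mono I pt f) (use f i in auto)
  qed auto
qed

lemma translation_L2_continuous:
  fixes f :: fun2
  assumes f: "sq_int f" and h: "h \<longlonglongrightarrow> 0"
  shows "(\<lambda>n. \<integral>z. (cmod (f (h n + z) - f z))\<^sup>2 \<partial>lborel) \<longlonglongrightarrow> 0"
proof -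
  note [measurable] = sq_int_measurable[OF f]
  \<comment> \<open>Positive and negative parts of the real and imaginary parts, to reduce to the
    nonnegative case.\<close>
  define g where "g = (\<lambda>(i::nat) z. if i = 0 then max (Re (f z)) 0 else if i = 1 then max (- Re (f z)) 0
     else if i = 2 then max (Im (f z)) 0 else max (- Im (f z)) 0)"
  have [measurable]: "g i \<in> borel_measurable borel" for i by (simp add: g_def)
  have g0: "g i z \<ge> 0" for i z by (simp add: g_def)
  have gb: "\<bar>g i z\<bar> \<le> cmod (f z)" for i z
    using abs_Re_le_cmod[of "f z"] abs_Im_le_cmod[of "f z"] by (auto simp: g_def)
  have gi: "integrable lborel (\<lambda>z. (g i z)\<^sup>2)" for i
    by (rule Bochner_Integration.integrable_bound[OF sq_int_integrable[OF f]])
      (use power_mono[OF gb abs_ge_zero, of _ _ 2] in auto)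
  note T = translation_L2_continuous_nonneg[OF _ gi g0 h, simplified]
  define G where "G = (\<lambda>n z. \<Sum>i<4. (g i (h n + z) - g i z)\<^sup>2)"
  have Gi: "integrable lborel (G n)" for n
    unfolding G_def by (intro Bochner_Integration.integrable_sum T)
  have sq: "(a - b)\<^sup>2 \<le> 2 * a\<^sup>2 + 2 * b\<^sup>2" for a b :: real
    using sum_squares_bound[of a "-b"] by (simp add: power2_diff)
  have pt: "(cmod (f (h n + z) - f z))\<^sup>2 \<le> 2 * G n z" for n z
  proof -
    have "Re (f (h n + z) - f z) = (g 0 (h n + z) - g 0 z) - (g 1 (h n + z) - g 1 z)"
      "Im (f (h n + z) - f z) = (g 2 (h n + z) - g 2 z) - (g 3 (h n + z) - g 3 z)"
      by (auto simp: g_def max_def)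
    then have "(cmod (f (h n + z) - f z))\<^sup>2 = ((g 0 (h n + z) - g 0 z) - (g 1 (h n + z) - g 1 z))\<^sup>2
       + ((g 2 (h n + z) - g 2 z) - (g 3 (h n + z) - g 3 z))\<^sup>2"
      unfolding cmod_power2 by simp
    also have "\<dots> \<le> 2 * G n z"
      using sq[of "g 0 (h n + z) - g 0 z" "g 1 (h n + z) - g 1 z"] sq[of "g 2 (h n + z) - g 2 z" "g 3 (h n + z) - g 3 z"]
      by (simp add: G_def eval_nat_numeral)
    finally show ?thesis .
  qed
  show ?thesis
  proof (rule tendsto_sandwich[OF _ _ tendsto_const])
    have "(\<lambda>n. 2 * (\<Sum>i<4. \<integral>z. (g i (h n + z) - g i z)\<^sup>2 \<partial>lborel)) \<longlonglongrightarrow> 2 * (\<Sum>i<(4::nat). 0)"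
      by (intro tendsto_mult tendsto_sum tendsto_const T)
    moreover have "(\<integral>z. 2 * G n z \<partial>lborel) = 2 * (\<Sum>i<4. \<integral>z. (g i (h n + z) - g i z)\<^sup>2 \<partial>lborel)" for n
      unfolding G_def by (simp add: Bochner_Integration.integral_sum T)
    ultimately show "(\<lambda>n. \<integral>z. 2 * G n z \<partial>lborel) \<longlonglongrightarrow> 0" by simp
    show "\<forall>\<^sub>F n in sequentially. (\<integral>z. (cmod (f (h n + z) - f z))\<^sup>2 \<partial>lborel) \<le> (\<integral>z. 2 * G n z \<partial>lborel)"
    proof (intro always_eventually allI integral_mono pt)
      fix n
      show "integrable lborel (\<lambda>z. 2 * G n z)" using Gi by simp
      then show "integrable lborel (\<lambda>z. (cmod (f (h n + z) - f z))\<^sup>2)"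
        by (rule Bochner_Integration.integrable_bound) (use pt in \<open>auto intro: order_trans[OF pt abs_ge_self]\<close>)
    qed
  qed auto
qed

subsection \<open>Fourier transforms of Gaussians\<close>

lemma integrable_gaussian1:
  assumes "a > 0"
  shows "integrable lborel (\<lambda>x::real. exp (- (a * x\<^sup>2 / 2)))"
proof -
  have "integrable lborel (\<lambda>x. sqrt (2 * pi) * std_normal_density x)"
    by (intro integrable_mult_right) (simp add: integrable_normal_density)
  then have "integrable lborel (\<lambda>x. sqrt (2 * pi) * std_normal_density (0 + sqrt a * x))"
    by (intro lborel_integrable_real_affine) (use assms in auto)
  then show ?thesis
    by (simp add: std_normal_density_def power_mult_distrib assms less_imp_le)
qed

text \<open>This is the characteristic function of the standard normal distribution, rescaled by
  \<open>sqrt a\<close>; the sign of \<open>s\<close> accounts for the kernel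
  \<open>cis (- (x * \<xi>))\<close>.\<close>

lemma gaussian1_fourier:
  assumes "a > 0"
  shows "(\<integral>x. complex_of_real (exp (- (a * x\<^sup>2 / 2))) * cis (- (x * \<xi>)) \<partial>lborel)
    = complex_of_real (sqrt (2 * pi / a) * exp (- (\<xi>\<^sup>2 / a / 2)))"
proof -
  define s where "s = - \<xi> / sqrt a"
  have "complex_of_real (exp (- (s\<^sup>2) / 2)) = char std_normal_distribution s"
    by (simp add: char_std_normal_distribution)
  also have "\<dots> = (\<integral>x. std_normal_density x *\<^sub>R iexp (s * x) \<partial>lborel)"
    unfolding char_def by (subst integral_density) (auto simp: normal_density_nonneg)
  also have "\<dots> = \<bar>sqrt a\<bar> *\<^sub>R (\<integral>x. std_normal_density (0 + sqrt a * x) *\<^sub>R iexp (s * (0 + sqrt a * x)) \<partial>lborel)"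
    by (rule lborel_integral_real_affine) (use assms in auto)
  also have "(\<lambda>x. std_normal_density (0 + sqrt a * x) *\<^sub>R iexp (s * (0 + sqrt a * x))) =
     (\<lambda>x. complex_of_real (1 / sqrt (2 * pi)) * (complex_of_real (exp (- (a * x\<^sup>2 / 2))) * cis (- (x * \<xi>))))"
    using assms by (auto simp: std_normal_density_def power_mult_distrib s_def cis_conv_exp scaleR_conv_of_real mult_ac)
  also have "(\<integral>x. complex_of_real (1 / sqrt (2 * pi)) * (complex_of_real (exp (- (a * x\<^sup>2 / 2))) * cis (- (x * \<xi>))) \<partial>lborel)
     = complex_of_real (1 / sqrt (2 * pi)) * (\<integral>x. complex_of_real (exp (- (a * x\<^sup>2 / 2))) * cis (- (x * \<xi>)) \<partial>lborel)"
    by (rule integral_mult_right_zero)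
  finally have "complex_of_real (exp (- (s\<^sup>2) / 2)) = complex_of_real (sqrt a / sqrt (2 * pi)) *
      (\<integral>x. complex_of_real (exp (- (a * x\<^sup>2 / 2))) * cis (- (x * \<xi>)) \<partial>lborel)" (is "_ = _ * ?I")
    using assms by (simp add: scaleR_conv_of_real)
  moreover have "s\<^sup>2 = \<xi>\<^sup>2 / a" using assms by (simp add: s_def power_divide)
  ultimately have "complex_of_real (sqrt (2 * pi) / sqrt a) * complex_of_real (exp (- (\<xi>\<^sup>2 / a / 2))) =
      complex_of_real (sqrt (2 * pi) / sqrt a) * (complex_of_real (sqrt a / sqrt (2 * pi)) * ?I)"
    by simp
  also have "\<dots> = ?I" using assms by (simp add: field_simps)
  finally show ?thesis by (simp add: real_sqrt_divide)
qed

lemma integrable_tensor: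
  fixes f g :: "real \<Rightarrow> complex"
  assumes f: "integrable lborel f" and g: "integrable lborel g"
  shows "integrable lborel (\<lambda>z::real\<times>real. f (fst z) * g (snd z))"
    and "(\<integral>z. f (fst z) * g (snd z) \<partial>lborel) = (\<integral>x. f x \<partial>lborel) * (\<integral>y. g y \<partial>lborel)"
proof -
  note [measurable] = borel_measurable_integrable[OF f] borel_measurable_integrable[OF g]
  have i: "integrable (lborel \<Otimes>\<^sub>M lborel) (\<lambda>z::real\<times>real. f (fst z) * g (snd z))"
  proof (rule lborel_pair.Fubini_integrable)
    show "integrable lborel (\<lambda>x. \<integral>y. norm (f (fst (x, y)) * g (snd (x, y))) \<partial>lborel)"
      using f by (simp add: norm_mult)
  qed (use g in auto)
  then show "integrable lborel (\<lambda>z::real\<times>real. f (fst z) * g (snd z))" by (simp add: lborel_prod)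
  from lborel_pair.integral_fst'[OF i]
  show "(\<integral>z. f (fst z) * g (snd z) \<partial>lborel) = (\<integral>x. f x \<partial>lborel) * (\<integral>y. g y \<partial>lborel)"
    by (simp add: lborel_prod)
qed

lemma cis_measurable [measurable]: "cis \<in> borel_measurable borel"
  by (intro borel_measurable_continuous_onI continuous_intros)

definition gaussian :: "real \<Rightarrow> real \<Rightarrow> fun2" where
  "gaussian a b z = complex_of_real (exp (- (a * (fst z)\<^sup>2 / 2) - b * (snd z)\<^sup>2 / 2))"

lemma gaussian_tensor:
  "gaussian a b z = complex_of_real (exp (- (a * (fst z)\<^sup>2 / 2))) * complex_of_real (exp (- (b * (snd z)\<^sup>2 / 2)))"
  unfolding gaussian_def of_real_mult[symmetric] exp_add[symmetric] by simp

lemma gaussian_measurable [measurable]: "gaussian a b \<in> borel_measurable borel"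
  unfolding gaussian_def by (auto intro!: borel_measurable_continuous_onI continuous_intros)

lemma integrable_gaussian:
  assumes "a > 0" "b > 0"
  shows "integrable lborel (gaussian a b)"
  unfolding gaussian_tensor
  by (rule integrable_tensor) (use integrable_gaussian1 assms in auto)

lemma gaussian_fourier1:
  assumes "a > 0" "b > 0"
  shows "fourier1 (gaussian a b) \<zeta> = complex_of_real (2 * pi / sqrt (a * b)) * gaussian (1/a) (1/b) \<zeta>"
proof -
  define f where "f = (\<lambda>a \<xi> x. complex_of_real (exp (- (a * x\<^sup>2 / 2))) * cis (- (x * \<xi>)))"
  have i: "integrable lborel (f a \<xi>)" if "a > 0" for a \<xi>
    unfolding f_def
    by (rule Bochner_Integration.integrable_bound[OF integrable_gaussian1[OF that]])
       (auto simp: norm_mult intro!: borel_measurable_continuous_onI continuous_intros)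
  have "fourier1 (gaussian a b) \<zeta> = (\<integral>z. f a (fst \<zeta>) (fst z) * f b (snd \<zeta>) (snd z) \<partial>lborel)"
    unfolding fourier1_def
    by (rule Bochner_Integration.integral_cong)
      (simp_all add: f_def gaussian_tensor cis_mult mult_ac)
  also have "\<dots> = complex_of_real (sqrt (2 * pi / a) * exp (- ((fst \<zeta>)\<^sup>2 / a / 2))) * complex_of_real (sqrt (2 * pi / b) * exp (- ((snd \<zeta>)\<^sup>2 / b / 2)))"
    using gaussian1_fourier[OF assms(1)] gaussian1_fourier[OF assms(2)]
    by (subst integrable_tensor(2)) (use i assms in \<open>auto simp: f_def\<close>)
  also have "\<dots> = complex_of_real (2 * pi / sqrt (a * b)) * gaussian (1/a) (1/b) \<zeta>"
    using assms by (simp add: gaussian_tensor real_sqrt_divide real_sqrt_mult mult_ac field_simps flip: of_real_mult)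
  finally show ?thesis .
qed

lemma fourier1_inner: "fourier1 f \<zeta> = (\<integral>z. f z * cis (- (z \<bullet> \<zeta>)) \<partial>lborel)"
  by (simp add: fourier1_def inner_prod_def)

lemma fourier1_measurable [measurable]:
  assumes [measurable]: "f \<in> borel_measurable borel"
  shows "fourier1 f \<in> borel_measurable borel"
  unfolding fourier1_inner[abs_def] by measurable

lemma integrable_mult_cis:
  assumes "integrable lborel f"
  shows "integrable lborel (\<lambda>z. f z * cis (- (z \<bullet> \<zeta>)))"
  by (rule Bochner_Integration.integrable_bound[OF assms])
    (use borel_measurable_integrable[OF assms] in \<open>simp_all add: norm_mult\<close>)

lemma fourier1_bound: "cmod (fourier1 f \<zeta>) \<le> (\<integral>z. cmod (f z) \<partial>lborel)"
  unfolding fourier1_inner by (rule order_trans[OF integral_norm_bound]) (simp add: norm_mult)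

lemma fourier1_add:
  assumes "integrable lborel f" "integrable lborel g"
  shows "fourier1 (\<lambda>z. f z + g z) \<zeta> = fourier1 f \<zeta> + fourier1 g \<zeta>"
  unfolding fourier1_inner distrib_right
  by (rule Bochner_Integration.integral_add) (use assms integrable_mult_cis in auto)

lemma fourier1_cmult: "fourier1 (\<lambda>z. c * f z) \<zeta> = c * fourier1 f \<zeta>"
  unfolding fourier1_inner mult.assoc by (rule integral_mult_right_zero)

lemma fourier1_diff:
  assumes "integrable lborel f" "integrable lborel g"
  shows "fourier1 (\<lambda>z. f z - g z) \<zeta> = fourier1 f \<zeta> - fourier1 g \<zeta>"
  using fourier1_add[OF assms(1), of "\<lambda>z. -1 * g z"] fourier1_cmult[of "-1" g] assms by simp

text \<open>Fubini for the kernel \<open>f z * cis (- (z \<bullet> \<zeta>)) * g \<zeta>\<close>,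
  which is absolutely integrable. Together with the explicit transform of Gaussians this identity
  replaces inversion in the proof of Plancherel's theorem; later it yields the adjoint of
  \<open>FT\<close>.\<close>

lemma fourier1_duality:
  assumes f: "integrable lborel f" and g: "integrable lborel g"
  shows "(\<integral>\<zeta>. fourier1 f \<zeta> * g \<zeta> \<partial>lborel) = (\<integral>z. f z * fourier1 g z \<partial>lborel)"
proof -
  have [measurable]: "f \<in> borel_measurable borel" "g \<in> borel_measurable borel" using f g by auto
  define K where "K = (\<lambda>z \<zeta> :: real \<times> real. f z * cis (- (z \<bullet> \<zeta>)) * g \<zeta>)"
  have i: "integrable (lborel \<Otimes>\<^sub>M lborel) (case_prod K)"
  proof (rule lborel_pair.Fubini_integrable)
    have "case_prod K \<in> borel_measurable (borel \<Otimes>\<^sub>M borel)" unfolding K_def by measurable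
    then show "case_prod K \<in> borel_measurable (lborel \<Otimes>\<^sub>M lborel)"
      by (simp cong: measurable_cong_sets sets_pair_measure_cong)
    show "integrable lborel (\<lambda>x. \<integral>y. norm (case (x, y) of (x, y) \<Rightarrow> K x y) \<partial>lborel)"
      using f by (simp add: K_def norm_mult)
    have "integrable lborel (\<lambda>\<zeta>. K z \<zeta>)" for z
      unfolding K_def mult.assoc
      by (intro integrable_mult_right) (use integrable_mult_cis[OF g, of z] in \<open>simp add: mult_ac inner_commute\<close>)
    then show "AE x in lborel. integrable lborel (\<lambda>y. case (x, y) of (x, y) \<Rightarrow> K x y)" by simp
  qed
  have "(\<integral>\<zeta>. fourier1 f \<zeta> * g \<zeta> \<partial>lborel) = (\<integral>\<zeta>. \<integral>z. K z \<zeta> \<partial>lborel \<partial>lborel)"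
    unfolding fourier1_inner K_def by simp
  also have "\<dots> = (\<integral>z. \<integral>\<zeta>. K z \<zeta> \<partial>lborel \<partial>lborel)"
    by (rule lborel_pair.Fubini_integral[OF i])
  also have "\<dots> = (\<integral>z. f z * fourier1 g z \<partial>lborel)"
    unfolding fourier1_inner K_def mult.assoc by (simp add: mult_ac inner_commute)
  finally show ?thesis .
qed

subsection \<open>Plancherel's theorem\<close>

text \<open>\<open>inner\<close> on \<open>l2\<close> sees only a real part, so Cauchy-Schwarz is
  applied to the moduli of \<open>f\<close> and \<open>g\<close>, where nothing is lost.\<close>

lemma sq_int_cauchy_schwarz:
  assumes f: "sq_int f" and g: "sq_int g"
  shows "cmod (\<integral>z. f z * g z \<partial>lborel) \<le> sqrt (\<integral>z. (cmod (f z))\<^sup>2 \<partial>lborel) * sqrt (\<integral>z. (cmod (g z))\<^sup>2 \<partial>lborel)"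
proof -
  note [measurable] = sq_int_measurable[OF f] sq_int_measurable[OF g]
  let ?f = "\<lambda>z. complex_of_real (cmod (f z))" and ?g = "\<lambda>z. complex_of_real (cmod (g z))"
  have sf: "sq_int ?f" by (rule sq_int_dominated[OF f, of _ 1]) auto
  have sg: "sq_int ?g" by (rule sq_int_dominated[OF g, of _ 1]) auto
  have "cmod (\<integral>z. f z * g z \<partial>lborel) \<le> (\<integral>z. cmod (f z) * cmod (g z) \<partial>lborel)"
    by (rule order_trans[OF integral_norm_bound]) (simp add: norm_mult)
  also have "(\<integral>z. cmod (f z) * cmod (g z) \<partial>lborel) = inner (abs_l2 ?f) (abs_l2 ?g)"
  proof -
    have "complex_of_real (\<integral>z. cmod (f z) * cmod (g z) \<partial>lborel) = (\<integral>z. rep_l2 (abs_l2 ?f) z * cnj (rep_l2 (abs_l2 ?g) z) \<partial>lborel)"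
    unfolding integral_complex_of_real[symmetric]
  proof (rule integral_cong_AE)
    show "AE z in lborel. complex_of_real (cmod (f z) * cmod (g z)) = rep_l2 (abs_l2 ?f) z * cnj (rep_l2 (abs_l2 ?g) z)"
      using rep_abs[OF sf] rep_abs[OF sg] by eventually_elim simp
  qed simp_all
    from arg_cong[OF this, of Re] show ?thesis
      by (simp only: inner_l2_def Re_complex_of_real)
  qed
  also have "\<dots> \<le> norm (abs_l2 ?f) * norm (abs_l2 ?g)" by (rule norm_cauchy_schwarz)
  also have "norm (abs_l2 ?f) = sqrt (\<integral>z. (cmod (f z))\<^sup>2 \<partial>lborel)"
    using norm_abs_sq[OF sf] by (simp add: real_sqrt_unique[symmetric])
  also have "norm (abs_l2 ?g) = sqrt (\<integral>z. (cmod (g z))\<^sup>2 \<partial>lborel)"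
    using norm_abs_sq[OF sg] by (simp add: real_sqrt_unique[symmetric])
  finally show ?thesis .
qed

lemma sq_int_translation:
  assumes "sq_int f"
  shows "sq_int (\<lambda>z. f (h + z))"
  by (rule sq_intI) (use sq_int_measurable[OF assms] lborel_translation_integrable[OF sq_int_integrable[OF assms]] in auto)

lemma cnj_fourier1:
  assumes [measurable]: "f \<in> borel_measurable borel"
  shows "cnj (fourier1 f \<zeta>) = fourier1 (\<lambda>z. cnj (f (- z))) \<zeta>"
proof -
  have "fourier1 (\<lambda>z. cnj (f (- z))) \<zeta> = (\<integral>z. cnj (f z) * cis (z \<bullet> \<zeta>) \<partial>lborel)"
    unfolding fourier1_inner by (subst lborel_affine_integral[of _ "-1" 0]) auto
  also have "\<dots> = (\<integral>z. cnj (f z * cis (- (z \<bullet> \<zeta>))) \<partial>lborel)" by (simp add: cis_cnj)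
  also have "\<dots> = cnj (fourier1 f \<zeta>)"
    unfolding fourier1_inner by (rule Bochner_Integration.integral_cnj)
  finally show ?thesis by simp
qed

lemma gaussian_norm_le_1: "a \<ge> 0 \<Longrightarrow> b \<ge> 0 \<Longrightarrow> cmod (gaussian a b z) \<le> 1"
proof -
  assume "a \<ge> 0" "b \<ge> 0"
  then have "0 \<le> a * (fst z)\<^sup>2" "0 \<le> b * (snd z)\<^sup>2" by simp_all
  then show ?thesis by (simp add: gaussian_def)
qed

text \<open>The function whose Fourier transform is the squared modulus of
  \<open>fourier1 f\<close>. Its value at 0 is the squared L2 norm of \<open>f\<close>, and that is
  how Plancherel's identity will appear.\<close>

definition autocorr :: "fun2 \<Rightarrow> fun2" where
  "autocorr f h = (\<integral>z. f (h + z) * cnj (f z) \<partial>lborel)"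

lemma autocorr_measurable [measurable]:
  assumes [measurable]: "f \<in> borel_measurable borel"
  shows "autocorr f \<in> borel_measurable borel"
  unfolding autocorr_def by measurable

lemma autocorr_bound:
  assumes f: "sq_int f"
  shows "cmod (autocorr f h) \<le> (\<integral>z. (cmod (f z))\<^sup>2 \<partial>lborel)"
proof -
  note [measurable] = sq_int_measurable[OF f]
  have "cmod (autocorr f h) \<le> sqrt (\<integral>z. (cmod (f (h + z)))\<^sup>2 \<partial>lborel) * sqrt (\<integral>z. (cmod (cnj (f z)))\<^sup>2 \<partial>lborel)"
    unfolding autocorr_def by (rule sq_int_cauchy_schwarz[OF sq_int_translation[OF f] sq_int_cnj[OF f]])
  also have "(\<integral>z. (cmod (f (h + z)))\<^sup>2 \<partial>lborel) = (\<integral>z. (cmod (f z))\<^sup>2 \<partial>lborel)"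
    by (rule lborel_translation_integral) simp
  finally show ?thesis by simp
qed

lemma autocorr_continuous:
  assumes f: "sq_int f" and h: "h \<longlonglongrightarrow> 0"
  shows "(\<lambda>n. autocorr f (h n)) \<longlonglongrightarrow> complex_of_real (\<integral>z. (cmod (f z))\<^sup>2 \<partial>lborel)"
proof -
  have eq0: "complex_of_real (\<integral>z. (cmod (f z))\<^sup>2 \<partial>lborel) = (\<integral>z. f z * cnj (f z) \<partial>lborel)"
    unfolding integral_complex_of_real[symmetric] by (simp only: complex_norm_square)
  have le: "cmod (autocorr f (h n) - complex_of_real (\<integral>z. (cmod (f z))\<^sup>2 \<partial>lborel))
     \<le> sqrt (\<integral>z. (cmod (f (h n + z) - f z))\<^sup>2 \<partial>lborel) * sqrt (\<integral>z. (cmod (cnj (f z)))\<^sup>2 \<partial>lborel)" for n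
  proof -
    have "autocorr f (h n) - complex_of_real (\<integral>z. (cmod (f z))\<^sup>2 \<partial>lborel) = (\<integral>z. (f (h n + z) - f z) * cnj (f z) \<partial>lborel)"
      unfolding eq0 autocorr_def left_diff_distrib
      by (rule Bochner_Integration.integral_diff[symmetric])
        (rule sq_int_mult_integrable[OF sq_int_translation[OF f] sq_int_cnj[OF f]], rule sq_int_mult_integrable[OF f sq_int_cnj[OF f]])
    then show ?thesis
      using sq_int_cauchy_schwarz[OF sq_int_diff[OF sq_int_translation[OF f, of "h n"] f] sq_int_cnj[OF f]] by (simp only:)
  qed
  have "(\<lambda>n. sqrt (\<integral>z. (cmod (f (h n + z) - f z))\<^sup>2 \<partial>lborel) * sqrt (\<integral>z. (cmod (cnj (f z)))\<^sup>2 \<partial>lborel)) \<longlonglongrightarrow>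
     sqrt 0 * sqrt (\<integral>z. (cmod (cnj (f z)))\<^sup>2 \<partial>lborel)"
    by (rule tendsto_mult[OF tendsto_real_sqrt[OF translation_L2_continuous[OF f h]] tendsto_const])
  then have lim0: "(\<lambda>n. sqrt (\<integral>z. (cmod (f (h n + z) - f z))\<^sup>2 \<partial>lborel) * sqrt (\<integral>z. (cmod (cnj (f z)))\<^sup>2 \<partial>lborel)) \<longlonglongrightarrow> 0"
    by simp
  have "(\<lambda>n. autocorr f (h n) - complex_of_real (\<integral>z. (cmod (f z))\<^sup>2 \<partial>lborel)) \<longlonglongrightarrow> 0"
    by (rule Lim_null_comparison[OF always_eventually[OF allI[OF le]] lim0])
  then show ?thesis by (simp add: LIM_zero_iff)
qed

text \<open>Regularised Plancherel identity. The Gaussian weight makes the squared modulus of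
  \<open>fourier1 f\<close> integrable, so that duality and Fubini apply; on the other side it
  becomes a Gaussian average of the autocorrelation at scale \<open>e\<close>.\<close>

lemma plancherel_gaussian:
  assumes f1: "integrable lborel f" and f2: "sq_int f" and e: "e > 0"
  shows "(\<integral>\<zeta>. gaussian (e\<^sup>2) (e\<^sup>2) \<zeta> * complex_of_real ((cmod (fourier1 f \<zeta>))\<^sup>2) \<partial>lborel)
     = (\<integral>w. complex_of_real (2 * pi) * gaussian 1 1 w * autocorr f (e *\<^sub>R w) \<partial>lborel)"
    and "integrable lborel (\<lambda>\<zeta>. gaussian (e\<^sup>2) (e\<^sup>2) \<zeta> * complex_of_real ((cmod (fourier1 f \<zeta>))\<^sup>2))"
proof -
  note [measurable] = sq_int_measurable[OF f2]
  define E where "E = gaussian (e\<^sup>2) (e\<^sup>2)"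
  have E: "integrable lborel E" unfolding E_def by (rule integrable_gaussian) (use e in auto)
  have [measurable]: "E \<in> borel_measurable borel" by (simp add: E_def)
  have E1: "cmod (E z) \<le> 1" for z unfolding E_def by (rule gaussian_norm_le_1) auto
  define M where "M = (\<integral>z. cmod (f z) \<partial>lborel)"
  have M: "cmod (fourier1 f \<zeta>) \<le> M" for \<zeta> unfolding M_def by (rule fourier1_bound)
  then have M0: "M \<ge> 0" using norm_ge_zero order_trans by blast
  define EF where "EF = (\<lambda>\<zeta>. E \<zeta> * fourier1 f \<zeta>)"
  have EF: "integrable lborel EF"
  proof (rule Bochner_Integration.integrable_bound)
    show "integrable lborel (\<lambda>\<zeta>. M *\<^sub>R E \<zeta>)" using E by simp
    show "AE z in lborel. norm (EF z) \<le> norm (M *\<^sub>R E z)"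
      using M M0 by (simp add: EF_def norm_mult mult.commute[of M] mult_left_mono)
  qed (simp add: EF_def)
  have [measurable]: "EF \<in> borel_measurable borel" using EF by auto
  \<comment> \<open>The transform of the reflected conjugate is the conjugate of
    \<open>fourier1 f\<close>, so \<open>EF\<close> times that transform is the weighted
    square.\<close>
  define k where "k = (\<lambda>z. cnj (f (- z)))"
  have k: "integrable lborel k"
    unfolding k_def using lborel_affine_integrable[OF f1, of "-1" 0] by (simp add: integrable_cnj)
  have [measurable]: "k \<in> borel_measurable borel" using k by auto
  define Eh where "Eh = fourier1 E"
  have [measurable]: "Eh \<in> borel_measurable borel" by (simp add: Eh_def)
  have Eh: "Eh z = complex_of_real (2 * pi / e\<^sup>2) * gaussian (1/e\<^sup>2) (1/e\<^sup>2) z" for z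
  proof -
    have "sqrt (e\<^sup>2 * e\<^sup>2) = e\<^sup>2" by (simp only: real_sqrt_abs2 abs_power2)
    then show ?thesis
      using gaussian_fourier1[of "e\<^sup>2" "e\<^sup>2" z] e by (simp only: Eh_def E_def zero_less_power)
  qed
  \<comment> \<open>Duality applied to a modulated weight: the transform of the product
    \<open>EF\<close> is \<open>f\<close> smoothed by the transform \<open>Eh\<close> of the
    weight.\<close>
  have fE: "fourier1 EF x = (\<integral>z. f z * Eh (x + z) \<partial>lborel)" for x
  proof -
    have "fourier1 EF x = (\<integral>\<zeta>. fourier1 f \<zeta> * (E \<zeta> * cis (- (\<zeta> \<bullet> x))) \<partial>lborel)"
      by (subst fourier1_inner) (simp add: EF_def mult_ac)
    also have "\<dots> = (\<integral>z. f z * fourier1 (\<lambda>\<zeta>. E \<zeta> * cis (- (\<zeta> \<bullet> x))) z \<partial>lborel)"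
      by (rule fourier1_duality[OF f1 integrable_mult_cis[OF E]])
    finally show ?thesis
      by (simp add: Eh_def fourier1_inner mult.assoc cis_mult inner_add_right)
  qed
  have sqeq: "gaussian (e\<^sup>2) (e\<^sup>2) \<zeta> * complex_of_real ((cmod (fourier1 f \<zeta>))\<^sup>2) = EF \<zeta> * fourier1 k \<zeta>" for \<zeta>
    unfolding k_def cnj_fourier1[symmetric, OF sq_int_measurable[OF f2]] EF_def E_def
    by (simp only: complex_norm_square mult.assoc)
  show "integrable lborel (\<lambda>\<zeta>. gaussian (e\<^sup>2) (e\<^sup>2) \<zeta> * complex_of_real ((cmod (fourier1 f \<zeta>))\<^sup>2))"
    unfolding sqeq
  proof (rule Bochner_Integration.integrable_bound)
    show "integrable lborel (\<lambda>\<zeta>. (\<integral>z. cmod (k z) \<partial>lborel) *\<^sub>R EF \<zeta>)" using EF by simp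
    show "AE z in lborel. norm (EF z * fourier1 k z) \<le> norm ((\<integral>z. cmod (k z) \<partial>lborel) *\<^sub>R EF z)"
      using fourier1_bound[of k] by (simp add: norm_mult mult.commute mult_left_mono)
  qed simp
  define K where "K = (\<lambda>z x. Eh z * (f (z + x) * cnj (f x)))"
  have Kfun: "K = (\<lambda>z x. Eh z * (f (z + x) * cnj (f x)))" by (simp add: K_def)
  have intK: "integrable (lborel \<Otimes>\<^sub>M lborel) (case_prod K)"
  proof (rule lborel_pair.Fubini_integrable)
    have "case_prod K \<in> borel_measurable (borel \<Otimes>\<^sub>M borel)" unfolding K_def by measurable
    then show "case_prod K \<in> borel_measurable (lborel \<Otimes>\<^sub>M lborel)"
      by (simp cong: measurable_cong_sets sets_pair_measure_cong)
    have ix: "integrable lborel (\<lambda>x. f (z + x) * cnj (f x))" for z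
      by (rule sq_int_mult_integrable[OF sq_int_translation[OF f2] sq_int_cnj[OF f2]])
    then show "AE z in lborel. integrable lborel (\<lambda>x. case (z, x) of (z, x) \<Rightarrow> K z x)"
      by (simp add: K_def)
    have iE: "integrable lborel Eh"
      unfolding Eh using integrable_gaussian[of "1/e\<^sup>2" "1/e\<^sup>2"] e by simp
    show "integrable lborel (\<lambda>z. \<integral>x. norm (case (z, x) of (z, x) \<Rightarrow> K z x) \<partial>lborel)"
    proof (rule Bochner_Integration.integrable_bound)
      let ?N = "\<integral>z. (cmod (f z))\<^sup>2 \<partial>lborel"
      show "integrable lborel (\<lambda>z. ?N *\<^sub>R Eh z)" using iE by simp
      show "(\<lambda>z. \<integral>x. norm (case (z, x) of (z, x) \<Rightarrow> K z x) \<partial>lborel) \<in> borel_measurable lborel"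
        unfolding K_def by simp
      have b: "(\<integral>x. cmod (f (z + x)) * cmod (f x) \<partial>lborel) \<le> ?N" for z
      proof -
        let ?g = "\<lambda>z. complex_of_real (cmod (f z))"
        have sg: "sq_int ?g" by (rule sq_int_dominated[OF f2, of _ 1]) auto
        have "complex_of_real (\<integral>x. cmod (f (z + x)) * cmod (f x) \<partial>lborel) = autocorr ?g z"
          unfolding autocorr_def integral_complex_of_real[symmetric] by simp
        from arg_cong[OF this, of cmod]
        have "\<bar>\<integral>x. cmod (f (z + x)) * cmod (f x) \<partial>lborel\<bar> = cmod (autocorr ?g z)"
          by (simp only: norm_of_real)
        also have "\<dots> \<le> ?N" using autocorr_bound[OF sg, of z] by simp
        finally show ?thesis by simp
      qed
      have "(\<integral>x. norm (K z x) \<partial>lborel) = cmod (Eh z) * (\<integral>x. cmod (f (z + x)) * cmod (f x) \<partial>lborel)" for z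
        by (simp add: K_def norm_mult)
      then show "AE z in lborel. norm (\<integral>x. norm (case (z, x) of (z, x) \<Rightarrow> K z x) \<partial>lborel) \<le> norm (?N *\<^sub>R Eh z)"
        using b by (simp add: mult.commute mult_left_mono)
    qed
  qed
  have "(\<integral>\<zeta>. gaussian (e\<^sup>2) (e\<^sup>2) \<zeta> * complex_of_real ((cmod (fourier1 f \<zeta>))\<^sup>2) \<partial>lborel)
     = (\<integral>\<zeta>. EF \<zeta> * fourier1 k \<zeta> \<partial>lborel)" by (simp only: sqeq)
  also have "\<dots> = (\<integral>x. fourier1 EF x * k x \<partial>lborel)"
    by (rule fourier1_duality[OF EF k, symmetric])
  also have "\<dots> = (\<integral>x. (\<integral>z. f z * Eh (x + z) \<partial>lborel) * cnj (f (- x)) \<partial>lborel)"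
    by (simp only: fE k_def)
  also have "\<dots> = (\<integral>x. (\<integral>z. f z * Eh (z - x) \<partial>lborel) * cnj (f x) \<partial>lborel)"
    by (subst lborel_affine_integral[of _ "-1" 0]) auto
  also have "\<dots> = (\<integral>x. \<integral>z. K z x \<partial>lborel \<partial>lborel)"
  proof (rule Bochner_Integration.integral_cong[OF refl])
    fix x
    have "(\<integral>z. f z * Eh (z - x) \<partial>lborel) = (\<integral>z. f (x + z) * Eh z \<partial>lborel)"
      by (subst lborel_translation_integral[of _ x, symmetric]) auto
    then have "(\<integral>z. f z * Eh (z - x) \<partial>lborel) * cnj (f x) = (\<integral>z. f (x + z) * Eh z * cnj (f x) \<partial>lborel)"
      by (simp only: integral_mult_left_zero)
    then show "(\<integral>z. f z * Eh (z - x) \<partial>lborel) * cnj (f x) = (\<integral>z. K z x \<partial>lborel)"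
      by (simp add: K_def mult_ac add.commute)
  qed
  also have "\<dots> = (\<integral>z. \<integral>x. K z x \<partial>lborel \<partial>lborel)"
    by (rule lborel_pair.Fubini_integral[OF intK])
  also have "\<dots> = (\<integral>z. Eh z * autocorr f z \<partial>lborel)"
    by (simp add: K_def autocorr_def)
  \<comment> \<open>Substituting z = e w in the plane produces the Jacobian
    \<open>e\<^sup>2\<close>, which cancels the prefactor of \<open>Eh\<close> and leaves a fixed
    Gaussian.\<close>
  also have "\<dots> = e\<^sup>2 *\<^sub>R (\<integral>w. Eh (e *\<^sub>R w) * autocorr f (e *\<^sub>R w) \<partial>lborel)"
    using e by (subst lborel_affine_integral[of _ e 0]) (auto simp: power2_eq_square)
  also have "\<dots> = (\<integral>w. e\<^sup>2 *\<^sub>R (Eh (e *\<^sub>R w) * autocorr f (e *\<^sub>R w)) \<partial>lborel)"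
    by (rule integral_scaleR_right[symmetric])
  also have "\<dots> = (\<integral>w. complex_of_real (2 * pi) * gaussian 1 1 w * autocorr f (e *\<^sub>R w) \<partial>lborel)"
    using e by (simp add: Eh gaussian_def power_mult_distrib scaleR_conv_of_real)
  finally show "(\<integral>\<zeta>. gaussian (e\<^sup>2) (e\<^sup>2) \<zeta> * complex_of_real ((cmod (fourier1 f \<zeta>))\<^sup>2) \<partial>lborel)
     = (\<integral>w. complex_of_real (2 * pi) * gaussian 1 1 w * autocorr f (e *\<^sub>R w) \<partial>lborel)" .
qed

lemma integral_gaussian: 
  assumes "a > 0" "b > 0" shows "(\<integral>z. gaussian a b z \<partial>lborel) = complex_of_real (2 * pi / sqrt (a * b))"
proof -
  have "(\<integral>z. gaussian a b z \<partial>lborel) = fourier1 (gaussian a b) 0" by (simp add: fourier1_def)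
  also have "\<dots> = complex_of_real (2 * pi / sqrt (a * b))"
    by (subst gaussian_fourier1[OF assms]) (simp add: gaussian_def)
  finally show ?thesis .
qed

text \<open>The regularisation is removed by letting e tend to 0. The weighted integrals increase,
  so monotone convergence also yields square integrability of \<open>fourier1 f\<close>; the
  autocorrelation side converges by dominated convergence. One factor 2 pi is the prefactor of the
  regularised identity, the other the mass of \<open>gaussian 1 1\<close>.\<close>

theorem plancherel:
  assumes f1: "integrable lborel f" and f2: "sq_int f"
  shows "sq_int (fourier1 f)"
    and "(\<integral>\<zeta>. (cmod (fourier1 f \<zeta>))\<^sup>2 \<partial>lborel) = (2 * pi)\<^sup>2 * (\<integral>z. (cmod (f z))\<^sup>2 \<partial>lborel)"
proof -
  note [measurable] = sq_int_measurable[OF f2]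
  let ?N = "\<integral>z. (cmod (f z))\<^sup>2 \<partial>lborel"
  define e where "e n = 1 / (1 + real n)" for n
  have e: "e n > 0" for n by (simp add: e_def)
  have e0: "e \<longlonglongrightarrow> 0" unfolding e_def
    using LIMSEQ_inverse_real_of_nat by (simp add: inverse_eq_divide)
  define G where "G = (\<lambda>n \<zeta>. exp (- ((e n)\<^sup>2 * (norm \<zeta>)\<^sup>2 / 2)) * (cmod (fourier1 f \<zeta>))\<^sup>2)"
  have Gg: "gaussian ((e n)\<^sup>2) ((e n)\<^sup>2) \<zeta> * complex_of_real ((cmod (fourier1 f \<zeta>))\<^sup>2) = complex_of_real (G n \<zeta>)" for n \<zeta>
    by (simp add: gaussian_def G_def norm_Pair[of "fst \<zeta>" "snd \<zeta>", simplified] add_divide_distrib distrib_left)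
  note P = plancherel_gaussian[OF f1 f2 e, unfolded Gg]
  have Gi: "integrable lborel (G n)" for n
    using integrable_Re[OF P(2)[of n]] by simp
  have "(\<lambda>n. \<integral>w. complex_of_real (2 * pi) * gaussian 1 1 w * autocorr f (e n *\<^sub>R w) \<partial>lborel)
     \<longlonglongrightarrow> (\<integral>w. complex_of_real (2 * pi) * gaussian 1 1 w * complex_of_real ?N \<partial>lborel)"
  proof (rule integral_dominated_convergence[where w = "\<lambda>w. 2 * pi * cmod (gaussian 1 1 w) * ?N"])
    show "integrable lborel (\<lambda>w. 2 * pi * cmod (gaussian 1 1 w) * ?N)"
      by (intro integrable_mult_left integrable_mult_right integrable_norm integrable_gaussian) auto
    show "AE w in lborel. (\<lambda>n. complex_of_real (2 * pi) * gaussian 1 1 w * autocorr f (e n *\<^sub>R w))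
        \<longlonglongrightarrow> complex_of_real (2 * pi) * gaussian 1 1 w * complex_of_real ?N"
    proof (intro AE_I2 tendsto_mult tendsto_const autocorr_continuous f2)
      fix w :: "real \<times> real"
      show "(\<lambda>n. e n *\<^sub>R w) \<longlonglongrightarrow> 0" using tendsto_scaleR[OF e0 tendsto_const, of w] by simp
    qed
    show "AE w in lborel. norm (complex_of_real (2 * pi) * gaussian 1 1 w * autocorr f (e n *\<^sub>R w)) \<le> 2 * pi * cmod (gaussian 1 1 w) * ?N" for n
      using autocorr_bound[OF f2] by (auto simp: norm_mult intro!: mult_left_mono)
  qed simp_all
  also have "(\<integral>w. complex_of_real (2 * pi) * gaussian 1 1 w * complex_of_real ?N \<partial>lborel) = complex_of_real ((2 * pi)\<^sup>2 * ?N)"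
    by (simp add: integral_gaussian power2_eq_square mult_ac)
  finally have "(\<lambda>n. complex_of_real (integral\<^sup>L lborel (G n))) \<longlonglongrightarrow> complex_of_real ((2 * pi)\<^sup>2 * ?N)"
    unfolding P(1)[symmetric] integral_complex_of_real .
  then have lim: "(\<lambda>n. integral\<^sup>L lborel (G n)) \<longlonglongrightarrow> (2 * pi)\<^sup>2 * ?N"
    by (simp only: tendsto_of_real_iff)
  have mono: "AE \<zeta> in lborel. mono (\<lambda>n. G n \<zeta>)"
  proof (intro AE_I2 monoI)
    fix \<zeta> :: "real \<times> real" and m n :: nat assume "m \<le> n"
    then have "(e n)\<^sup>2 \<le> (e m)\<^sup>2" by (intro power_mono) (auto simp: e_def frac_le)
    then show "G m \<zeta> \<le> G n \<zeta>" by (auto simp: G_def mult_right_mono)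
  qed
  have pt: "AE \<zeta> in lborel. (\<lambda>n. G n \<zeta>) \<longlonglongrightarrow> (cmod (fourier1 f \<zeta>))\<^sup>2"
  proof (rule AE_I2)
    fix \<zeta> :: "real \<times> real"
    have "(\<lambda>n. G n \<zeta>) \<longlonglongrightarrow> exp (- (0\<^sup>2 * (norm \<zeta>)\<^sup>2 / 2)) * (cmod (fourier1 f \<zeta>))\<^sup>2"
      unfolding G_def by (intro tendsto_intros e0) simp
    then show "(\<lambda>n. G n \<zeta>) \<longlonglongrightarrow> (cmod (fourier1 f \<zeta>))\<^sup>2" by simp
  qed
  note I = integrable_monotone_convergence[OF Gi mono pt lim] integral_monotone_convergence[OF Gi mono pt lim]
  show "sq_int (fourier1 f)" by (rule sq_intI) (simp, rule I(1), simp)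
  show "(\<integral>\<zeta>. (cmod (fourier1 f \<zeta>))\<^sup>2 \<partial>lborel) = (2 * pi)\<^sup>2 * ?N" by (rule I(2)) simp
qed

subsection \<open>The Fourier transform on square integrable functions\<close>

lemma abs_l2_add: "sq_int f \<Longrightarrow> sq_int g \<Longrightarrow> abs_l2 (\<lambda>z. f z + g z) = abs_l2 f + abs_l2 g"
proof (rule l2_eqI)
  assume f: "sq_int f" and g: "sq_int g"
  show "AE z in lborel. rep_l2 (abs_l2 (\<lambda>z. f z + g z)) z = rep_l2 (abs_l2 f + abs_l2 g) z"
    using rep_abs[OF sq_int_add[OF f g]] rep_plus[of "abs_l2 f" "abs_l2 g"] rep_abs[OF f] rep_abs[OF g]
    by eventually_elim simp
qed

lemma abs_l2_diff: "sq_int f \<Longrightarrow> sq_int g \<Longrightarrow> abs_l2 (\<lambda>z. f z - g z) = abs_l2 f - abs_l2 g"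
proof (rule l2_eqI)
  assume f: "sq_int f" and g: "sq_int g"
  show "AE z in lborel. rep_l2 (abs_l2 (\<lambda>z. f z - g z)) z = rep_l2 (abs_l2 f - abs_l2 g) z"
    using rep_abs[OF sq_int_diff[OF f g]] rep_minus[of "abs_l2 f" "abs_l2 g"] rep_abs[OF f] rep_abs[OF g]
    by eventually_elim simp
qed

lemma norm_abs_diff_sq:
  assumes "sq_int f" "sq_int g"
  shows "(norm (abs_l2 f - abs_l2 g))\<^sup>2 = (\<integral>z. (cmod (f z - g z))\<^sup>2 \<partial>lborel)"
  unfolding abs_l2_diff[OF assms, symmetric] by (rule norm_abs_sq[OF sq_int_diff[OF assms]])

text \<open>On a ball a square integrable function is integrable, so \<open>fourier1\<close> applies
  to truncations. They are the same ones as in the definition of \<open>fourier\<close>.\<close>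

definition trunc :: "real \<Rightarrow> fun2 \<Rightarrow> fun2" where
  "trunc R f = (\<lambda>z. indicator (cball 0 R) z * f z)"

lemma trunc_measurable [measurable]: "f \<in> borel_measurable borel \<Longrightarrow> trunc R f \<in> borel_measurable borel"
  unfolding trunc_def by (intro borel_measurable_times borel_measurable_indicator) auto

lemma sq_int_trunc: "sq_int f \<Longrightarrow> sq_int (trunc R f)"
  unfolding trunc_def by (rule sq_int_mult_bounded[where c = 1]) (auto simp: indicator_def intro!: borel_measurable_indicator)

lemma integrable_trunc:
  assumes "sq_int f"
  shows "integrable lborel (trunc R f)"
  unfolding trunc_def
proof (rule sq_int_mult_integrable[OF _ assms], rule sq_intI)
  have "(\<lambda>z. (cmod (indicator (cball 0 R) z))\<^sup>2) = (indicator (cball (0::real\<times>real) R) :: _ \<Rightarrow> real)"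
    by (auto simp: indicator_def)
  moreover have "integrable lborel (indicator (cball (0::real\<times>real) R) :: _ \<Rightarrow> real)"
    using emeasure_lborel_cball_finite[of "0::real\<times>real" R] by (simp add: integrable_indicator_iff)
  ultimately show "integrable lborel (\<lambda>z. (cmod (indicator (cball (0::real\<times>real) R) z))\<^sup>2)" by simp
qed (rule borel_measurable_indicator, simp)

lemma trunc_tendsto:
  assumes f: "sq_int f"
  shows "((\<lambda>R. abs_l2 (trunc R f)) \<longlongrightarrow> abs_l2 f) at_top"
proof -
  note [measurable] = sq_int_measurable[OF f]
  have "((\<lambda>R. \<integral>z. (cmod (trunc R f z - f z))\<^sup>2 \<partial>lborel) \<longlongrightarrow> (\<integral>z. 0 \<partial>(lborel :: (real\<times>real) measure))) at_top"
  proof (rule integral_dominated_convergence_at_top[where w = "\<lambda>z. (cmod (f z))\<^sup>2"])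
    show "integrable lborel (\<lambda>z. (cmod (f z))\<^sup>2)" by (rule sq_int_integrable[OF f])
    show "AE z in lborel. ((\<lambda>R. (cmod (trunc R f z - f z))\<^sup>2) \<longlongrightarrow> 0) at_top"
    proof (rule AE_I2)
      fix z :: "real \<times> real"
      have "eventually (\<lambda>R. (cmod (trunc R f z - f z))\<^sup>2 = 0) at_top"
        using eventually_ge_at_top[of "norm z"] by eventually_elim (simp add: trunc_def)
      then show "((\<lambda>R. (cmod (trunc R f z - f z))\<^sup>2) \<longlongrightarrow> 0) at_top"
        by (rule tendsto_eventually)
    qed
    show "\<forall>\<^sub>F R in at_top. AE z in lborel. norm ((cmod (trunc R f z - f z))\<^sup>2) \<le> (cmod (f z))\<^sup>2"
      by (intro always_eventually allI AE_I2) (simp add: trunc_def indicator_def)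
  qed simp_all
  then have "((\<lambda>R. (norm (abs_l2 (trunc R f) - abs_l2 f))\<^sup>2) \<longlongrightarrow> 0) at_top"
    by (simp add: norm_abs_diff_sq[OF sq_int_trunc[OF f] f])
  then have "((\<lambda>R. sqrt ((norm (abs_l2 (trunc R f) - abs_l2 f))\<^sup>2)) \<longlongrightarrow> sqrt 0) at_top"
    by (rule tendsto_real_sqrt)
  then have "((\<lambda>R. norm (abs_l2 (trunc R f) - abs_l2 f)) \<longlongrightarrow> 0) at_top" by simp
  then show ?thesis by (rule Lim_null[THEN iffD2, OF tendsto_norm_zero_cancel])
qed

lemma trunc_tendsto_seq: "(\<lambda>n. abs_l2 (trunc (real n) (rep_l2 f))) \<longlonglongrightarrow> f"
  using filterlim_compose[OF trunc_tendsto[OF sq_int_rep[of f]] filterlim_real_sequentially] by simp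

lemma plancherel_diff:
  assumes f: "integrable lborel f" "sq_int f" and g: "integrable lborel g" "sq_int g"
  shows "norm (abs_l2 (fourier1 f) - abs_l2 (fourier1 g)) = 2 * pi * norm (abs_l2 f - abs_l2 g)"
proof -
  have d: "integrable lborel (\<lambda>z. f z - g z)" "sq_int (\<lambda>z. f z - g z)"
    using f g by (auto intro: sq_int_diff)
  have "(norm (abs_l2 (fourier1 f) - abs_l2 (fourier1 g)))\<^sup>2 = (\<integral>\<zeta>. (cmod (fourier1 (\<lambda>z. f z - g z) \<zeta>))\<^sup>2 \<partial>lborel)"
    unfolding norm_abs_diff_sq[OF plancherel(1)[OF f] plancherel(1)[OF g]] fourier1_diff[OF f(1) g(1)] ..
  also have "\<dots> = (2 * pi)\<^sup>2 * (norm (abs_l2 f - abs_l2 g))\<^sup>2"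
    unfolding plancherel(2)[OF d] norm_abs_diff_sq[OF f(2) g(2)] ..
  finally have "(norm (abs_l2 (fourier1 f) - abs_l2 (fourier1 g)))\<^sup>2 = (2 * pi * norm (abs_l2 f - abs_l2 g))\<^sup>2"
    by (simp only: power_mult_distrib)
  then show ?thesis by (rule power2_eq_imp_eq) simp_all
qed

text \<open>The transform on classes, as an L2 limit along integer radii. \<open>fourier\<close>
  itself is a choice among representatives and is tied to this operator in
  \<open>fourier_FT\<close>.\<close>

definition FT :: "l2 \<Rightarrow> l2" where
  "FT f = lim (\<lambda>n. abs_l2 (fourier1 (trunc (real n) (rep_l2 f))))"

lemma FT_lim: "(\<lambda>n. abs_l2 (fourier1 (trunc (real n) (rep_l2 f)))) \<longlonglongrightarrow> FT f"
proof -
  have "Cauchy (\<lambda>n. abs_l2 (fourier1 (trunc (real n) (rep_l2 f))))"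
  proof (rule metric_CauchyI)
    fix e :: real assume "e > 0"
    have "Cauchy (\<lambda>n. abs_l2 (trunc (real n) (rep_l2 f)))"
      using trunc_tendsto_seq LIMSEQ_imp_Cauchy by blast
    then obtain M where M: "\<And>m n. m \<ge> M \<Longrightarrow> n \<ge> M \<Longrightarrow>
        dist (abs_l2 (trunc (real m) (rep_l2 f))) (abs_l2 (trunc (real n) (rep_l2 f))) < e / (2 * pi)"
      using metric_CauchyD[of _ "e / (2 * pi)"] \<open>e > 0\<close> by (metis divide_pos_pos mult_pos_pos pi_gt_zero zero_less_numeral)
    have "dist (abs_l2 (fourier1 (trunc (real m) (rep_l2 f)))) (abs_l2 (fourier1 (trunc (real n) (rep_l2 f)))) < e"
      if "m \<ge> M" "n \<ge> M" for m n
      using M[OF that] unfolding dist_norm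
      by (subst plancherel_diff) (simp_all add: integrable_trunc sq_int_trunc field_simps)
    then show "\<exists>M. \<forall>m\<ge>M. \<forall>n\<ge>M. dist (abs_l2 (fourier1 (trunc (real m) (rep_l2 f)))) (abs_l2 (fourier1 (trunc (real n) (rep_l2 f)))) < e"
      by blast
  qed
  then show ?thesis
    unfolding FT_def by (simp only: Cauchy_convergent_iff convergent_LIMSEQ_iff)
qed

lemma FT_abs:
  assumes f: "integrable lborel f" "sq_int f"
  shows "FT (abs_l2 f) = abs_l2 (fourier1 f)"
proof (rule LIMSEQ_unique[OF FT_lim])
  let ?T = "\<lambda>n. trunc (real n) (rep_l2 (abs_l2 f))"
  have "(\<lambda>n. 2 * pi * norm (abs_l2 (?T n) - abs_l2 f)) \<longlonglongrightarrow> 2 * pi * norm (abs_l2 f - abs_l2 f)"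
    by (rule tendsto_mult[OF tendsto_const tendsto_norm[OF tendsto_diff[OF trunc_tendsto_seq tendsto_const]]])
  then have "(\<lambda>n. norm (abs_l2 (fourier1 (?T n)) - abs_l2 (fourier1 f))) \<longlonglongrightarrow> 0"
    by (simp add: plancherel_diff[OF integrable_trunc[OF sq_int_rep] sq_int_trunc[OF sq_int_rep] f])
  then show "(\<lambda>n. abs_l2 (fourier1 (?T n))) \<longlonglongrightarrow> abs_l2 (fourier1 f)"
    by (rule Lim_null[THEN iffD2, OF tendsto_norm_zero_cancel])
qed

lemma norm_FT_diff: "norm (FT f - FT g) = 2 * pi * norm (f - g)"
proof (rule LIMSEQ_unique)
  let ?T = "\<lambda>f n. trunc (real n) (rep_l2 f)"
  show "(\<lambda>n. norm (abs_l2 (fourier1 (?T f n)) - abs_l2 (fourier1 (?T g n)))) \<longlonglongrightarrow> norm (FT f - FT g)"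
    by (rule tendsto_norm[OF tendsto_diff[OF FT_lim FT_lim]])
  have "(\<lambda>n. 2 * pi * norm (abs_l2 (?T f n) - abs_l2 (?T g n))) \<longlonglongrightarrow> 2 * pi * norm (f - g)"
    by (rule tendsto_mult[OF tendsto_const tendsto_norm[OF tendsto_diff[OF trunc_tendsto_seq trunc_tendsto_seq]]])
  then show "(\<lambda>n. norm (abs_l2 (fourier1 (?T f n)) - abs_l2 (fourier1 (?T g n)))) \<longlonglongrightarrow> 2 * pi * norm (f - g)"
    by (simp only: plancherel_diff[OF integrable_trunc[OF sq_int_rep] sq_int_trunc[OF sq_int_rep] integrable_trunc[OF sq_int_rep] sq_int_trunc[OF sq_int_rep]])
qed

lemma fourier1_cong_AE:
  assumes [measurable]: "f \<in> borel_measurable borel" "g \<in> borel_measurable borel" and "AE z in lborel. f z = g z"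
  shows "fourier1 f = fourier1 g"
proof
  fix \<zeta>
  show "fourier1 f \<zeta> = fourier1 g \<zeta>"
    unfolding fourier1_inner by (rule integral_cong_AE) (use assms(3) in \<open>auto elim: eventually_mono\<close>)
qed

lemma FT_add: "FT (f + g) = FT f + FT g"
proof (rule LIMSEQ_unique[OF FT_lim])
  let ?T = "\<lambda>f n. trunc (real n) (rep_l2 f)"
  have "abs_l2 (fourier1 (?T f n)) + abs_l2 (fourier1 (?T g n)) = abs_l2 (fourier1 (?T (f + g) n))" for n
  proof -
    note i = integrable_trunc[OF sq_int_rep] sq_int_trunc[OF sq_int_rep]
    have "fourier1 (?T (f + g) n) = fourier1 (\<lambda>z. ?T f n z + ?T g n z)"
      by (rule fourier1_cong_AE) (simp, simp, use rep_plus[of f g] in \<open>eventually_elim, simp add: trunc_def distrib_left\<close>)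
    also have "\<dots> = (\<lambda>\<zeta>. fourier1 (?T f n) \<zeta> + fourier1 (?T g n) \<zeta>)"
      by (rule ext, rule fourier1_add[OF i(1) i(1)])
    finally show ?thesis
      by (simp only: abs_l2_add[OF plancherel(1)[OF i] plancherel(1)[OF i]])
  qed
  then show "(\<lambda>n. abs_l2 (fourier1 (?T (f + g) n))) \<longlonglongrightarrow> FT f + FT g"
    using tendsto_add[OF FT_lim[of f] FT_lim[of g]] by (simp only:)
qed

lemma norm_FT: "norm (FT f) = 2 * pi * norm f"
proof -
  have "FT 0 = 0" using FT_add[of 0 0] by simp
  then show ?thesis using norm_FT_diff[of f 0] by simp
qed

lemma additive_bounded_linear:
  fixes F :: "'a::real_normed_vector \<Rightarrow> 'b::real_normed_vector"
  assumes add: "\<And>x y. F (x + y) = F x + F y" and sc: "\<And>c x. F (c *\<^sub>R x) = c *\<^sub>R F x"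
    and b: "\<And>x. norm (F x) \<le> norm x * K"
  shows "bounded_linear F"
  by (rule bounded_linear_intro[OF add sc b])

lemma FT_scaleR: "FT (c *\<^sub>R f) = c *\<^sub>R FT f"
proof (rule LIMSEQ_unique[OF FT_lim])
  let ?T = "\<lambda>f n. trunc (real n) (rep_l2 f)"
  have "c *\<^sub>R abs_l2 (fourier1 (?T f n)) = abs_l2 (fourier1 (?T (c *\<^sub>R f) n))" for n
  proof -
    note i = integrable_trunc[OF sq_int_rep[of f], of "real n"] sq_int_trunc[OF sq_int_rep[of f], of "real n"]
    have *: "fourier1 (?T (c *\<^sub>R f) n) = fourier1 (\<lambda>z. complex_of_real c * ?T f n z)"
      by (rule fourier1_cong_AE) (simp, simp, use rep_scaleR[of c f] in \<open>eventually_elim, simp add: trunc_def scaleR_conv_of_real mult_ac\<close>)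
    have **: "\<dots> = (\<lambda>\<zeta>. complex_of_real c * fourier1 (?T f n) \<zeta>)"
      by (rule ext, rule fourier1_cmult)
    show ?thesis unfolding * **
    proof (rule l2_eqI)
      show "AE z in lborel. rep_l2 (c *\<^sub>R abs_l2 (fourier1 (?T f n))) z = rep_l2 (abs_l2 (\<lambda>\<zeta>. complex_of_real c * fourier1 (?T f n) \<zeta>)) z"
        using rep_scaleR[of c "abs_l2 (fourier1 (?T f n))"] rep_abs[OF plancherel(1)[OF i]]
          rep_abs[OF sq_int_cmult[OF plancherel(1)[OF i], of "complex_of_real c"]]
        by eventually_elim (simp add: scaleR_conv_of_real)
    qed
  qed
  then show "(\<lambda>n. abs_l2 (fourier1 (?T (c *\<^sub>R f) n))) \<longlonglongrightarrow> c *\<^sub>R FT f"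
    using tendsto_scaleR[OF tendsto_const FT_lim[of f], of c] by (simp only:)
qed

lemma bounded_linear_FT: "bounded_linear FT"
  by (rule additive_bounded_linear[OF FT_add FT_scaleR, of "2 * pi"]) (simp add: norm_FT)

text \<open>The representative of \<open>FT (abs_l2 f)\<close> shows that the choice in
  \<open>fourier\<close> is not vacuous, and uniqueness of limits in \<open>l2\<close> shows that
  every admissible choice lies in the same class.\<close>

lemma fourier_FT:
  assumes f: "sq_int f"
  shows "sq_int (fourier f)" "abs_l2 (fourier f) = FT (abs_l2 f)"
proof -
  define P where "P g \<longleftrightarrow> sq_int g \<and>
      ((\<lambda>R. \<integral>\<zeta>. (cmod (fourier1 (\<lambda>z. indicator (cball 0 R) z * f z) \<zeta> - g \<zeta>))\<^sup>2 \<partial>lborel) \<longlongrightarrow> 0) at_top" for g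
  have eq: "(\<integral>\<zeta>. (cmod (fourier1 (\<lambda>z. indicator (cball 0 R) z * f z) \<zeta> - g \<zeta>))\<^sup>2 \<partial>lborel) = (norm (FT (abs_l2 (trunc R f)) - abs_l2 g))\<^sup>2"
    if "sq_int g" for g R
    unfolding trunc_def[symmetric] FT_abs[OF integrable_trunc[OF f] sq_int_trunc[OF f]]
    by (rule norm_abs_diff_sq[OF plancherel(1)[OF integrable_trunc[OF f] sq_int_trunc[OF f]] that, symmetric])
  have lim: "((\<lambda>R. FT (abs_l2 (trunc R f))) \<longlongrightarrow> FT (abs_l2 f)) at_top"
    by (rule bounded_linear.tendsto[OF bounded_linear_FT trunc_tendsto[OF f]])
  have "P (rep_l2 (FT (abs_l2 f)))"
  proof -
    have "((\<lambda>R. (norm (FT (abs_l2 (trunc R f)) - FT (abs_l2 f)))\<^sup>2) \<longlongrightarrow> (norm (FT (abs_l2 f) - FT (abs_l2 f)))\<^sup>2) at_top"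
      by (rule tendsto_power[OF tendsto_norm[OF tendsto_diff[OF lim tendsto_const]]])
    then show ?thesis unfolding P_def by (simp add: eq)
  qed
  then have "P (SOME g. P g)" by (rule someI[of P])
  then have P: "P (fourier f)" unfolding fourier_def P_def .
  then show s: "sq_int (fourier f)" by (simp add: P_def)
  have "((\<lambda>R. (norm (FT (abs_l2 (trunc R f)) - abs_l2 (fourier f)))\<^sup>2) \<longlongrightarrow> 0) at_top"
    using P unfolding P_def by (simp only: eq[OF s])
  then have "((\<lambda>R. sqrt ((norm (FT (abs_l2 (trunc R f)) - abs_l2 (fourier f)))\<^sup>2)) \<longlongrightarrow> sqrt 0) at_top"
    by (rule tendsto_real_sqrt)
  then have "((\<lambda>R. norm (FT (abs_l2 (trunc R f)) - abs_l2 (fourier f))) \<longlongrightarrow> 0) at_top" by simp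
  then have "((\<lambda>R. FT (abs_l2 (trunc R f))) \<longlongrightarrow> abs_l2 (fourier f)) at_top"
    by (rule Lim_null[THEN iffD2, OF tendsto_norm_zero_cancel])
  from tendsto_unique[OF _ this lim] show "abs_l2 (fourier f) = FT (abs_l2 f)" by simp
qed

lemma fourier_AE:
  assumes f: "sq_int f"
  shows "AE \<zeta> in lborel. fourier f \<zeta> = rep_l2 (FT (abs_l2 f)) \<zeta>"
  using rep_abs[OF fourier_FT(1)[OF f]] unfolding fourier_FT(2)[OF f] by eventually_elim simp

definition conj_l2 :: "l2 \<Rightarrow> l2" where
  "conj_l2 f = abs_l2 (\<lambda>z. cnj (rep_l2 f z))"

lemma rep_conj: "AE z in lborel. rep_l2 (conj_l2 f) z = cnj (rep_l2 f z)"
  unfolding conj_l2_def by (rule rep_abs[OF sq_int_cnj[OF sq_int_rep]])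

lemma conj_conj [simp]: "conj_l2 (conj_l2 f) = f"
  by (rule l2_eqI) (use rep_conj[of f] rep_conj[of "conj_l2 f"] in \<open>eventually_elim, simp\<close>)

lemma norm_conj [simp]: "norm (conj_l2 f) = norm f"
  by (rule norm_l2_eq) (use rep_conj[of f] in \<open>eventually_elim, simp\<close>)

lemma bounded_linear_conj: "bounded_linear conj_l2"
proof (rule additive_bounded_linear[where K = 1])
  show "conj_l2 (f + g) = conj_l2 f + conj_l2 g" for f g
    by (rule l2_eqI) (use rep_conj[of "f+g"] rep_conj[of f] rep_conj[of g] rep_plus[of f g] rep_plus[of "conj_l2 f" "conj_l2 g"] in \<open>eventually_elim, simp\<close>)
  show "conj_l2 (c *\<^sub>R f) = c *\<^sub>R conj_l2 f" for c f
    by (rule l2_eqI) (use rep_conj[of "c *\<^sub>R f"] rep_conj[of f] rep_scaleR[of c f] rep_scaleR[of c "conj_l2 f"] in \<open>eventually_elim, simp\<close>)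
qed simp

text \<open>Fourier inversion written with two conjugations, which avoids reflecting the
  argument.\<close>

definition iFT :: "l2 \<Rightarrow> l2" where
  "iFT f = (1 / (2 * pi)\<^sup>2) *\<^sub>R conj_l2 (FT (conj_l2 f))"

lemma bounded_linear_iFT: "bounded_linear iFT"
  unfolding iFT_def
  by (rule bounded_linear_compose[OF bounded_linear_scaleR_right bounded_linear_compose[OF bounded_linear_conj
     bounded_linear_compose[OF bounded_linear_FT bounded_linear_conj]]])

lemma inner_abs: 
  assumes f: "sq_int f" and g: "sq_int g"
  shows "inner (abs_l2 f) (abs_l2 g) = Re (\<integral>z. f z * cnj (g z) \<partial>lborel)"
proof -
  note [measurable] = sq_int_measurable[OF f] sq_int_measurable[OF g]
  have "(\<integral>z. rep_l2 (abs_l2 f) z * cnj (rep_l2 (abs_l2 g) z) \<partial>lborel) = (\<integral>z. f z * cnj (g z) \<partial>lborel)"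
    by (rule integral_cong_AE) (simp, simp, use rep_abs[OF f] rep_abs[OF g] in \<open>eventually_elim, simp\<close>)
  then show ?thesis by (simp add: inner_l2_def)
qed

lemma conj_abs:
  assumes f: "sq_int f" shows "conj_l2 (abs_l2 f) = abs_l2 (\<lambda>z. cnj (f z))"
  by (rule l2_eqI) (use rep_conj[of "abs_l2 f"] rep_abs[OF f] rep_abs[OF sq_int_cnj[OF f]] in \<open>eventually_elim, simp\<close>)

lemma FT_adjoint_L1:
  assumes f: "integrable lborel f" "sq_int f" and g: "integrable lborel g" "sq_int g"
  shows "inner (FT (abs_l2 f)) (abs_l2 g) = inner (abs_l2 f) (conj_l2 (FT (conj_l2 (abs_l2 g))))"
proof -
  have gc: "integrable lborel (\<lambda>z. cnj (g z))" "sq_int (\<lambda>z. cnj (g z))"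
    using g sq_int_cnj[OF g(2)] by simp_all
  note F = plancherel(1)[OF f] and G = plancherel(1)[OF gc]
  have "(\<integral>z. fourier1 f z * cnj (g z) \<partial>lborel) = (\<integral>z. f z * fourier1 (\<lambda>z. cnj (g z)) z \<partial>lborel)"
    by (rule fourier1_duality[OF f(1) gc(1)])
  then show ?thesis
    unfolding FT_abs[OF f] conj_abs[OF g(2)] FT_abs[OF gc] conj_abs[OF G] inner_abs[OF F g(2)] inner_abs[OF f(2) sq_int_cnj[OF G]]
    by simp
qed

lemma FT_adjoint: "inner (FT f) g = inner f (conj_l2 (FT (conj_l2 g)))"
proof (rule LIMSEQ_unique)
  let ?T = "\<lambda>f n. trunc (real n) (rep_l2 f)"
  show "(\<lambda>n. inner (FT (abs_l2 (?T f n))) (abs_l2 (?T g n))) \<longlonglongrightarrow> inner (FT f) g"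
    by (rule tendsto_inner[OF bounded_linear.tendsto[OF bounded_linear_FT trunc_tendsto_seq] trunc_tendsto_seq])
  have "(\<lambda>n. inner (abs_l2 (?T f n)) (conj_l2 (FT (conj_l2 (abs_l2 (?T g n)))))) \<longlonglongrightarrow> inner f (conj_l2 (FT (conj_l2 g)))"
    by (rule tendsto_inner[OF trunc_tendsto_seq bounded_linear.tendsto[OF bounded_linear_conj
        bounded_linear.tendsto[OF bounded_linear_FT bounded_linear.tendsto[OF bounded_linear_conj trunc_tendsto_seq]]]])
  then show "(\<lambda>n. inner (FT (abs_l2 (?T f n))) (abs_l2 (?T g n))) \<longlonglongrightarrow> inner f (conj_l2 (FT (conj_l2 g)))"
    by (simp only: FT_adjoint_L1[OF integrable_trunc[OF sq_int_rep] sq_int_trunc[OF sq_int_rep] integrable_trunc[OF sq_int_rep] sq_int_trunc[OF sq_int_rep]])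
qed

lemma inner_FT_FT: "inner (FT f) (FT g) = (2 * pi)\<^sup>2 * inner f g"
proof -
  have "4 * inner (FT f) (FT g) = (norm (FT (f + g)))\<^sup>2 - (norm (FT f - FT g))\<^sup>2"
    unfolding FT_add power2_norm_eq_inner by (simp add: inner_simps inner_commute)
  also have "\<dots> = (2 * pi)\<^sup>2 * ((norm (f + g))\<^sup>2 - (norm (f - g))\<^sup>2)"
    unfolding norm_FT norm_FT_diff by (simp add: power_mult_distrib algebra_simps)
  also have "\<dots> = (2 * pi)\<^sup>2 * (4 * inner f g)"
    unfolding power2_norm_eq_inner by (simp add: inner_simps inner_commute)
  finally show ?thesis by simp
qed

text \<open>The adjoint of \<open>FT\<close> is (2 pi)^2 times \<open>iFT\<close>, and
  \<open>FT\<close> multiplies inner products by (2 pi)^2. Hence \<open>iFT (FT f) - f\<close> is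
  orthogonal to everything, itself included.\<close>

lemma iFT_FT [simp]: "iFT (FT f) = f"
proof -
  have "inner (iFT (FT f) - f) h = 0" for h
  proof -
    have "inner h (iFT (FT f)) = (1 / (2 * pi)\<^sup>2) * inner (FT h) (FT f)"
      unfolding iFT_def by (simp add: FT_adjoint)
    also have "\<dots> = inner h f" by (simp add: inner_FT_FT)
    finally show ?thesis by (simp add: inner_diff_right inner_commute)
  qed
  from this[of "iFT (FT f) - f"] show ?thesis by simp
qed

lemma FT_iFT [simp]: "FT (iFT f) = f"
proof -
  have "FT (iFT f) = (1 / (2 * pi)\<^sup>2) *\<^sub>R FT (conj_l2 (FT (conj_l2 f)))"
    unfolding iFT_def by (rule FT_scaleR)
  also have "\<dots> = conj_l2 (iFT (FT (conj_l2 f)))"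
    unfolding iFT_def by (simp add: linear_scale[OF bounded_linear.linear[OF bounded_linear_conj]])
  finally show ?thesis by simp
qed

lemma norm_iFT: "norm (iFT f) = norm f / (2 * pi)"
  using norm_FT[of "iFT f"] by simp

text \<open>Inversion, followed by the trivial estimate of an integral with unimodular
  kernel.\<close>

lemma AE_bound_of_integrable_FT:
  assumes i: "integrable lborel (rep_l2 (FT f))"
  shows "AE z in lborel. cmod (rep_l2 f z) \<le> (\<integral>\<zeta>. cmod (rep_l2 (FT f) \<zeta>) \<partial>lborel) / (2 * pi)\<^sup>2"
proof -
  let ?g = "\<lambda>\<zeta>. cnj (rep_l2 (FT f) \<zeta>)"
  have g: "integrable lborel ?g" "sq_int ?g" using i sq_int_cnj[OF sq_int_rep] by simp_all
  have "f = (1 / (2 * pi)\<^sup>2) *\<^sub>R conj_l2 (abs_l2 (fourier1 ?g))"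
    using iFT_FT[of f] unfolding iFT_def conj_l2_def[of "FT f"] FT_abs[OF g] by simp
  then have "AE z in lborel. rep_l2 f z = (1 / (2 * pi)\<^sup>2) *\<^sub>R rep_l2 (conj_l2 (abs_l2 (fourier1 ?g))) z"
    using rep_scaleR[of "1 / (2 * pi)\<^sup>2" "conj_l2 (abs_l2 (fourier1 ?g))"] by simp
  with rep_conj[of "abs_l2 (fourier1 ?g)"] rep_abs[OF plancherel(1)[OF g]]
  show ?thesis
  proof eventually_elim
    case (elim z)
    then have "cmod (rep_l2 f z) = cmod (fourier1 ?g z) / (2 * pi)\<^sup>2" by simp
    also have "\<dots> \<le> (\<integral>\<zeta>. cmod (?g \<zeta>) \<partial>lborel) / (2 * pi)\<^sup>2"
      by (intro divide_right_mono fourier1_bound) simp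
    finally show ?case by simp
  qed
qed

subsection \<open>Ordinary differential equations in Banach spaces\<close>

lemma exp_integral_bound:
  assumes "l > 0" "(0::real) \<le> t"
  shows "integral {0..t} (\<lambda>s. exp (l * s)) = (exp (l * t) - 1) / l"
proof -
  have "((\<lambda>s. exp (l * s)) has_integral (exp (l * t) / l - exp (l * 0) / l)) {0..t}"
    by (rule fundamental_theorem_of_calculus[OF assms(2)])
      (use assms in \<open>auto intro!: derivative_eq_intros simp flip: has_real_derivative_iff_has_vector_derivative\<close>)
  then show ?thesis by (simp add: integral_unique diff_divide_distrib)
qed

text \<open>Picard's theorem on the whole interval at once. Continuity of the field is asked only
  along continuous curves, the form in which it is available for a field built from the strongly
  continuous \<open>flow\<close>.\<close>

lemma ode_exists:
  fixes F :: "real \<Rightarrow> 'a::banach \<Rightarrow> 'a"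
  assumes T: "T > 0" and K: "K > 0"
    and cont: "\<And>V. continuous_on {0..T} V \<Longrightarrow> continuous_on {0..T} (\<lambda>s. F s (V s))"
    and lip: "\<And>s x y. s \<in> {0..T} \<Longrightarrow> norm (F s x - F s y) \<le> K * norm (x - y)"
  shows "\<exists>V. continuous_on {0..T} V \<and> (\<forall>t\<in>{0..T}. V t = v0 + integral {0..t} (\<lambda>s. F s (V s)))"
proof -
  \<comment> \<open>Bielecki weight: solving for \<open>exp (- l * t)\<close> times the solution
    makes the integral operator a contraction with factor K / l = 1/2, whatever the length of the
    interval.\<close>
  define l where "l = 2 * K"
  have l: "l > 0" using K by (simp add: l_def)
  \<comment> \<open>Clamping time to the interval allows functions on the whole real line, so that
    the complete type of bounded continuous functions can carry the fixed point.\<close>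
  define c where "c t = max 0 (min T t)" for t :: real
  have c: "c t \<in> {0..T}" for t using T by (auto simp: c_def)
  have c_id: "c t = t" if "t \<in> {0..T}" for t using that by (auto simp: c_def)
  have contc: "continuous_on UNIV c" unfolding c_def by (intro continuous_intros)
  define E where "E W s = F s (exp (l * s) *\<^sub>R apply_bcontfun W s)" for W :: "real \<Rightarrow>\<^sub>C 'a" and s
  have contE: "continuous_on {0..T} (E W)" for W
    unfolding E_def by (intro cont continuous_intros continuous_on_apply_bcontfun)
  have contE': "continuous_on {0..c t} (E W)" for W t
    using contE by (rule continuous_on_subset) (use c[of t] in auto)
  note intE = integrable_continuous_real[OF contE']
  define P where "P W t = exp (- l * c t) *\<^sub>R (v0 + integral {0..c t} (E W))" for W t
  have P: "P W \<in> bcontfun" for W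
  proof -
    have ci: "continuous_on {0..T} (\<lambda>t. exp (- l * t) *\<^sub>R (v0 + integral {0..t} (E W)))"
      by (intro continuous_intros indefinite_integral_continuous_1 integrable_continuous_real contE)
    have eq: "P W = (\<lambda>t. exp (- l * t) *\<^sub>R (v0 + integral {0..t} (E W))) \<circ> c"
      by (simp add: P_def fun_eq_iff)
    have "continuous_on UNIV (P W)" unfolding eq
      by (rule continuous_on_compose[OF contc continuous_on_subset[OF ci]]) (use c in auto)
    moreover have "bounded (range (P W))"
    proof (rule bounded_subset)
      show "bounded ((\<lambda>t. exp (- l * t) *\<^sub>R (v0 + integral {0..t} (E W))) ` {0..T})"
        by (intro compact_imp_bounded compact_continuous_image ci) simp
      show "range (P W) \<subseteq> (\<lambda>t. exp (- l * t) *\<^sub>R (v0 + integral {0..t} (E W))) ` {0..T}"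
        unfolding eq using c by auto
    qed
    ultimately show ?thesis by (simp add: bcontfun_def)
  qed
  define \<Phi> where "\<Phi> W = Bcontfun (P W)" for W
  have \<Phi>: "apply_bcontfun (\<Phi> W) t = P W t" for W t
    unfolding \<Phi>_def by (simp add: Bcontfun_inverse[OF P])
  have "dist (\<Phi> W1) (\<Phi> W2) \<le> (1/2) * dist W1 W2" for W1 W2
  proof (rule dist_bound)
    fix t
    have pt: "norm (E W1 s - E W2 s) \<le> (K * dist W1 W2) * exp (l * s)" if "s \<in> {0..c t}" for s
    proof -
      have "s \<in> {0..T}" using that c[of t] by auto
      then have "norm (E W1 s - E W2 s) \<le> K * norm (exp (l * s) *\<^sub>R apply_bcontfun W1 s - exp (l * s) *\<^sub>R apply_bcontfun W2 s)"
        unfolding E_def by (rule lip)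
      also have "\<dots> = K * (exp (l * s) * dist (apply_bcontfun W1 s) (apply_bcontfun W2 s))"
        unfolding scaleR_diff_right[symmetric] by (simp add: dist_norm)
      also have "\<dots> \<le> K * (exp (l * s) * dist W1 W2)"
        using K by (intro mult_left_mono dist_bounded) auto
      finally show ?thesis by (simp add: mult_ac)
    qed
    have "dist (apply_bcontfun (\<Phi> W1) t) (apply_bcontfun (\<Phi> W2) t) = exp (- l * c t) * norm (integral {0..c t} (E W1) - integral {0..c t} (E W2))"
      unfolding \<Phi> P_def dist_norm scaleR_diff_right[symmetric] by simp
    also have "integral {0..c t} (E W1) - integral {0..c t} (E W2) = integral {0..c t} (\<lambda>s. E W1 s - E W2 s)"
      by (rule integral_diff[symmetric, OF intE intE])
    also have "norm \<dots> \<le> integral {0..c t} (\<lambda>s. (K * dist W1 W2) * exp (l * s))"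
      by (rule integral_norm_bound_integral) (intro integrable_diff intE integrable_continuous_real continuous_intros pt | assumption)+
    also have "\<dots> = (K * dist W1 W2) * ((exp (l * c t) - 1) / l)"
      using c[of t] by (simp add: exp_integral_bound[OF l])
    also have "exp (- l * c t) * \<dots> = dist W1 W2 * (1/2) * (1 - exp (- l * c t))"
      using K by (simp add: l_def field_simps exp_minus)
    also have "\<dots> \<le> dist W1 W2 * (1/2) * 1"
      by (intro mult_left_mono) auto
    finally show "dist (apply_bcontfun (\<Phi> W1) t) (apply_bcontfun (\<Phi> W2) t) \<le> (1/2) * dist W1 W2"
      by (simp add: mult_left_mono)
  qed
  then obtain W where W: "\<Phi> W = W"
    using banach_fix_type[of "1/2" \<Phi>] by auto
  define V where "V s = exp (l * s) *\<^sub>R apply_bcontfun W s" for s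
  have EV: "E W = (\<lambda>s. F s (V s))" by (simp add: E_def V_def fun_eq_iff)
  show ?thesis
  proof (intro exI[of _ V] conjI ballI)
    show "continuous_on {0..T} V" unfolding V_def by (intro continuous_intros continuous_on_apply_bcontfun)
    fix t assume t: "t \<in> {0..T}"
    have "apply_bcontfun W t = P W t" using \<Phi>[of W t] W by simp
    then show "V t = v0 + integral {0..t} (\<lambda>s. F s (V s))"
      using c_id[OF t] by (simp add: V_def P_def EV flip: exp_add)
  qed
qed

text \<open>The inequality is evaluated at the maximum \<open>m\<close> of
  \<open>\<phi> t * exp (- (2 * K * t))\<close>: there the integral term contributes at most m / 2
  after weighting, so m is controlled by c. The function \<phi> may change sign; the constants are
  not sharp.\<close>

lemma gronwall:
  fixes \<phi> :: "real \<Rightarrow> real"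
  assumes T: "T > 0" and K: "K > 0" and c: "c \<ge> 0" and cont: "continuous_on {0..T} \<phi>"
    and le: "\<And>t. t \<in> {0..T} \<Longrightarrow> \<phi> t \<le> c + K * integral {0..t} \<phi>"
    and t: "t \<in> {0..T}"
  shows "\<phi> t \<le> 2 * c * exp (2 * K * t)"
proof -
  have "continuous_on {0..T} (\<lambda>t. \<phi> t * exp (- (2 * K * t)))"
    by (intro continuous_intros cont)
  from continuous_attains_sup[OF compact_Icc _ this]
  obtain r where r: "r \<in> {0..T}" and sup: "\<And>s. s \<in> {0..T} \<Longrightarrow> \<phi> s * exp (- (2 * K * s)) \<le> \<phi> r * exp (- (2 * K * r))"
    using T by (metis atLeastAtMost_iff empty_iff less_eq_real_def)
  define m where "m = \<phi> r * exp (- (2 * K * r))"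
  have \<phi>le: "\<phi> s \<le> m * exp (2 * K * s)" if "s \<in> {0..T}" for s
    using sup[OF that] by (simp add: m_def exp_minus field_simps)
  have "m \<le> 2 * c"
  proof (cases "m \<ge> 0")
    case True
    have cr: "continuous_on {0..r} \<phi>" using cont by (rule continuous_on_subset) (use r in auto)
    have "integral {0..r} \<phi> \<le> integral {0..r} (\<lambda>s. m * exp (2 * K * s))"
      by (rule integral_le) (use r \<phi>le in \<open>auto intro!: integrable_continuous_real cr continuous_intros\<close>)
    also have "\<dots> = m * ((exp (2 * K * r) - 1) / (2 * K))"
      using r exp_integral_bound[of "2 * K" r] K by simp
    finally have "K * integral {0..r} \<phi> \<le> K * (m * ((exp (2 * K * r) - 1) / (2 * K)))"
      using K by (intro mult_left_mono) auto
    also have "\<dots> = m / 2 * (exp (2 * K * r) - 1)" using K by simp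
    finally have "\<phi> r \<le> c + m / 2 * (exp (2 * K * r) - 1)" using le[OF r] by simp
    moreover have "\<phi> r = m * exp (2 * K * r)" by (simp add: m_def flip: exp_add)
    ultimately have "m / 2 * exp (2 * K * r) \<le> c - m / 2" by (simp add: algebra_simps)
    moreover have "m / 2 * 1 \<le> m / 2 * exp (2 * K * r)"
      using True K r by (intro mult_left_mono) auto
    ultimately show ?thesis using True by simp
  qed (use c in simp)
  then have "m * exp (2 * K * t) \<le> 2 * c * exp (2 * K * t)" by (rule mult_right_mono) simp
  with \<phi>le[OF t] show ?thesis by (rule order_trans)
qed

section \<open>The map |z|^q z and its real derivative\<close>

definition gpow :: "real \<Rightarrow> complex \<Rightarrow> complex" where
  "gpow q z = complex_of_real (cmod z powr q) * z"

text \<open>The real derivative of \<open>gpow q\<close> at \<open>z\<close> in direction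
  \<open>v\<close>; the map is not holomorphic, hence the inner product of the plane. At q = 2 and z
  = 0 the value of \<open>0 powr 0\<close> is immaterial because of the factor z.\<close>

definition gpow' :: "real \<Rightarrow> complex \<Rightarrow> complex \<Rightarrow> complex" where
  "gpow' q z v = (cmod z powr q) *\<^sub>R v + (q * cmod z powr (q - 2) * (z \<bullet> v)) *\<^sub>R z"

lemma gpow_has_derivative:
  assumes q: "q \<ge> 2"
  shows "(gpow q has_derivative gpow' q z) (at z within S)"
proof (rule has_derivative_at_withinI, cases "z = 0")
  case False
  have n: "(cmod has_derivative (\<lambda>v. (z \<bullet> v) / cmod z)) (at z)"
    using has_derivative_norm[OF False] by (simp add: sgn_div_norm inner_commute divide_inverse mult.commute)
  have "((\<lambda>x. x powr q) has_real_derivative q * cmod z powr (q - 1)) (at (cmod z))"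
    using False by (intro has_real_derivative_powr) auto
  from DERIV_compose_FDERIV[OF this n]
  have "((\<lambda>z. cmod z powr q) has_derivative (\<lambda>v. (z \<bullet> v) / cmod z * (q * cmod z powr (q - 1)))) (at z)" .
  from has_derivative_scaleR[OF this has_derivative_ident]
  have "((\<lambda>z. (cmod z powr q) *\<^sub>R z) has_derivative (\<lambda>v. (cmod z powr q) *\<^sub>R v + (cmod z powr (q - 1) * (q * ((z \<bullet> v) / cmod z))) *\<^sub>R z)) (at z)"
    by (simp add: mult_ac)
  moreover have "(\<lambda>v. (cmod z powr q) *\<^sub>R v + (cmod z powr (q - 1) * (q * ((z \<bullet> v) / cmod z))) *\<^sub>R z) = gpow' q z"
    using False by (simp add: gpow'_def fun_eq_iff powr_diff power2_eq_square)
  moreover have "(\<lambda>z. (cmod z powr q) *\<^sub>R z) = gpow q"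
    by (simp add: gpow_def fun_eq_iff scaleR_conv_of_real)
  ultimately show "(gpow q has_derivative gpow' q z) (at z)" by simp
next
  case True
  have "((\<lambda>h. norm (gpow q (0 + h) - gpow q 0 - 0) / norm h) \<longlongrightarrow> 0) (at 0)"
  proof (rule Lim_transform_eventually)
    have "((\<lambda>h. cmod h powr q) \<longlongrightarrow> cmod 0 powr q) (at 0)"
      by (rule tendsto_powr'[OF tendsto_norm[OF tendsto_ident_at] tendsto_const]) (use q in auto)
    then show "((\<lambda>h. cmod h powr q) \<longlongrightarrow> 0) (at 0)" by simp
    show "\<forall>\<^sub>F h in at 0. cmod h powr q = norm (gpow q (0 + h) - gpow q 0 - 0) / norm h"
      by (auto simp: eventually_at_filter gpow_def norm_mult)
  qed
  then have "(gpow q has_derivative (\<lambda>h. 0)) (at 0)"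
    unfolding has_derivative_at by simp
  moreover have "gpow' q 0 = (\<lambda>h. 0)" by (simp add: gpow'_def fun_eq_iff)
  ultimately show "(gpow q has_derivative gpow' q z) (at z)" using True by simp
qed

lemma powr_lipschitz_le:
  fixes x y :: real
  assumes s: "s \<ge> 1" and xy: "0 \<le> y" "y \<le> x" "x \<le> M"
  shows "x powr s - y powr s \<le> s * M powr (s - 1) * (x - y)"
proof (cases "y < x")
  case True
  have "\<exists>l z. y < z \<and> z < x \<and> ((\<lambda>x. x powr s) has_real_derivative l) (at z) \<and> x powr s - y powr s = (x - y) * l"
  proof (rule MVT[OF True])
    show "continuous_on {y..x} (\<lambda>x. x powr s)"
      by (rule continuous_on_powr') (use s xy in \<open>auto intro!: continuous_intros\<close>)
    fix z assume "y < z" "z < x"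
    then have "((\<lambda>x. x powr s) has_real_derivative s * z powr (s - 1)) (at z)"
      using xy by (intro has_real_derivative_powr) auto
    then show "(\<lambda>x. x powr s) differentiable (at z)" using real_differentiable_def by blast
  qed
  then obtain l z where z: "y < z" "z < x" "((\<lambda>x. x powr s) has_real_derivative l) (at z)" "x powr s - y powr s = (x - y) * l"
    by blast
  have "((\<lambda>x. x powr s) has_real_derivative s * z powr (s - 1)) (at z)"
    using xy z by (intro has_real_derivative_powr) auto
  then have "l = s * z powr (s - 1)" using z(3) DERIV_unique by blast
  moreover have "z powr (s - 1) \<le> M powr (s - 1)" using xy z s by (intro powr_mono2) auto
  ultimately have "l \<le> s * M powr (s - 1)" using s by simp
  then have "(x - y) * l \<le> (x - y) * (s * M powr (s - 1))" using True by (intro mult_left_mono) auto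
  then show ?thesis using z(4) by (simp add: mult_ac)
qed (use xy in auto)

lemma gpow'_bound:
  assumes q: "q \<ge> 2" and z: "cmod z \<le> M" and M: "M > 0"
  shows "cmod (gpow' q z v) \<le> (1 + q) * M powr q * cmod v"
proof -
  have zq: "cmod z powr q \<le> M powr q" using z q by (intro powr_mono2) auto
  have "\<bar>z \<bullet> v\<bar> \<le> cmod z * cmod v" by (rule Cauchy_Schwarz_ineq2)
  then have "cmod z powr (q - 2) * \<bar>z \<bullet> v\<bar> * cmod z \<le> cmod z powr (q - 2) * (cmod z * cmod v) * cmod z"
    by (intro mult_left_mono mult_right_mono) auto
  also have "\<dots> = cmod z powr q * cmod v"
    by (cases "z = 0") (simp_all add: powr_diff power2_eq_square)
  finally have b: "cmod z powr (q - 2) * \<bar>z \<bullet> v\<bar> * cmod z \<le> cmod z powr q * cmod v" .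
  have "cmod (gpow' q z v) \<le> cmod z powr q * cmod v + q * (cmod z powr (q - 2) * \<bar>z \<bullet> v\<bar> * cmod z)"
    unfolding gpow'_def using q
    by (intro order_trans[OF norm_triangle_ineq]) (simp add: abs_mult mult_ac)
  also have "\<dots> \<le> cmod z powr q * cmod v + q * (cmod z powr q * cmod v)"
    using b q by (intro add_left_mono mult_left_mono) auto
  also have "\<dots> = (1 + q) * (cmod z powr q * cmod v)" by (simp add: algebra_simps)
  also have "\<dots> \<le> (1 + q) * (M powr q * cmod v)"
    using zq q by (intro mult_left_mono mult_right_mono) auto
  finally show ?thesis by (simp add: mult_ac)
qed

text \<open>The estimate is symmetric in a and b, so it is proved for |b| <= |a|. The delicate part
  of the derivative is |z|^r times an expression quadratic in z, where r = q - 2.\<close>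

lemma gpow'_lipschitz_aux:
  assumes q: "q \<ge> 2" and ab: "cmod b \<le> cmod a" "cmod a \<le> M" and M: "M > 0"
  shows "cmod (gpow' q a v - gpow' q b v) \<le> (q + q * (2 + (q - 1))) * M powr (q - 1) * cmod (a - b) * cmod v"
proof -
  define r where "r = q - 2"
  have r: "r \<ge> 0" using q by (simp add: r_def)
  have nab: "cmod a - cmod b \<le> cmod (a - b)" by (rule norm_triangle_ineq2)
  have 1: "cmod a powr q - cmod b powr q \<le> q * M powr (q - 1) * cmod (a - b)"
  proof (rule order_trans)
    show "cmod a powr q - cmod b powr q \<le> q * M powr (q - 1) * (cmod a - cmod b)"
      by (rule powr_lipschitz_le) (use q ab in auto)
    show "q * M powr (q - 1) * (cmod a - cmod b) \<le> q * M powr (q - 1) * cmod (a - b)"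
      using nab q by (intro mult_left_mono) auto
  qed
  have bq: "cmod b powr q \<le> cmod a powr q" using ab q by (intro powr_mono2) auto
  let ?B = "\<lambda>z. (z \<bullet> v) *\<^sub>R z"
  have "?B a - ?B b = (a \<bullet> v) *\<^sub>R (a - b) + ((a - b) \<bullet> v) *\<^sub>R b"
    by (simp add: inner_diff_left scaleR_diff_left scaleR_diff_right)
  then have "cmod (?B a - ?B b) \<le> \<bar>a \<bullet> v\<bar> * cmod (a - b) + \<bar>(a - b) \<bullet> v\<bar> * cmod b"
    by (metis norm_scaleR norm_triangle_ineq)
  also have "\<dots> \<le> (cmod a * cmod v) * cmod (a - b) + (cmod (a - b) * cmod v) * cmod b"
    by (intro add_mono mult_right_mono Cauchy_Schwarz_ineq2) auto
  also have "\<dots> \<le> (M * cmod v) * cmod (a - b) + (cmod (a - b) * cmod v) * M"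
    using ab by (intro add_mono mult_right_mono mult_left_mono) auto
  finally have BB: "cmod (?B a - ?B b) \<le> 2 * M * cmod (a - b) * cmod v" by (simp add: mult_ac)
  have ar: "cmod a powr r \<le> M powr r" using ab r by (intro powr_mono2) auto
  have br: "cmod b powr r \<le> cmod a powr r" using ab r by (intro powr_mono2) auto
  have Bb: "cmod (?B b) \<le> cmod b * cmod b * cmod v"
  proof -
    have "cmod (?B b) = \<bar>b \<bullet> v\<bar> * cmod b" by simp
    also have "\<dots> \<le> (cmod b * cmod v) * cmod b" by (intro mult_right_mono Cauchy_Schwarz_ineq2) simp
    finally show ?thesis by (simp add: mult_ac)
  qed
  have pr: "x * x powr r = x powr (r + 1)" if "x \<ge> 0" for x :: real
    using that by (cases "x = 0") (simp_all add: powr_add)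
  \<comment> \<open>For small r the power \<open>cmod z powr r\<close> alone is not Lipschitz. One
    of the two factors \<open>cmod b\<close> is absorbed, using |b| <= |a|, so that a difference of
    powers r + 1 >= 1 appears, and this one is Lipschitz.\<close>
  have "(cmod a powr r - cmod b powr r) * (cmod b * cmod b) = (cmod b * cmod a powr r - cmod b * cmod b powr r) * cmod b"
    by (simp add: algebra_simps)
  also have "\<dots> \<le> (cmod a * cmod a powr r - cmod b * cmod b powr r) * cmod b"
    using ab by (intro mult_right_mono diff_right_mono) auto
  also have "\<dots> = (cmod a powr (r + 1) - cmod b powr (r + 1)) * cmod b" by (simp add: pr)
  also have "\<dots> \<le> ((r + 1) * M powr r * (cmod a - cmod b)) * cmod b"
    using powr_lipschitz_le[of "r + 1" "cmod b" "cmod a" M] ab r by (intro mult_right_mono) auto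
  also have "\<dots> \<le> ((r + 1) * M powr r * cmod (a - b)) * M"
    using ab nab r by (intro mult_mono mult_left_mono mult_nonneg_nonneg) auto
  finally have D: "(cmod a powr r - cmod b powr r) * (cmod b * cmod b) \<le> (r + 1) * (M * M powr r) * cmod (a - b)"
    by (simp add: mult_ac)
  have tri: "cmod (x *\<^sub>R u - y *\<^sub>R w) \<le> x * cmod (u - w) + (x - y) * cmod w" if "0 \<le> y" "y \<le> x" for x y u w
  proof -
    have "x *\<^sub>R u - y *\<^sub>R w = x *\<^sub>R (u - w) + (x - y) *\<^sub>R w" by (simp add: scaleR_diff_left scaleR_diff_right)
    then have "cmod (x *\<^sub>R u - y *\<^sub>R w) \<le> cmod (x *\<^sub>R (u - w)) + cmod ((x - y) *\<^sub>R w)"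
      by (simp only: norm_triangle_ineq)
    then show ?thesis using that by simp
  qed
  have "cmod (cmod a powr r *\<^sub>R ?B a - cmod b powr r *\<^sub>R ?B b) \<le> cmod a powr r * cmod (?B a - ?B b) + (cmod a powr r - cmod b powr r) * cmod (?B b)"
    by (rule tri[OF _ br]) simp
  also have "\<dots> \<le> M powr r * (2 * M * cmod (a - b) * cmod v) + (cmod a powr r - cmod b powr r) * (cmod b * cmod b * cmod v)"
    using ar br BB Bb M by (intro add_mono mult_mono) auto
  also have "(cmod a powr r - cmod b powr r) * (cmod b * cmod b * cmod v) \<le> (r + 1) * (M * M powr r) * cmod (a - b) * cmod v"
    using mult_right_mono[OF D norm_ge_zero[of v]] by (simp add: mult_ac)
  finally have N0: "cmod (cmod a powr r *\<^sub>R ?B a - cmod b powr r *\<^sub>R ?B b) \<le> M powr r * (2 * M * cmod (a - b) * cmod v) + (r + 1) * (M * M powr r) * cmod (a - b) * cmod v"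
    by simp
  have N: "cmod (cmod a powr r *\<^sub>R ?B a - cmod b powr r *\<^sub>R ?B b) \<le> (2 + (q - 1)) * M powr (q - 1) * cmod (a - b) * cmod v"
  proof -
    have "M powr (q - 1) = M * M powr r" using pr[of M] M by (simp add: r_def)
    moreover have "q = r + 2" by (simp add: r_def)
    ultimately show ?thesis using N0
      by (simp add: algebra_simps)
  qed
  have "gpow' q a v - gpow' q b v = (cmod a powr q - cmod b powr q) *\<^sub>R v + q *\<^sub>R (cmod a powr r *\<^sub>R ?B a - cmod b powr r *\<^sub>R ?B b)"
    by (simp add: gpow'_def r_def scaleR_diff_left scaleR_diff_right mult_ac)
  then have "cmod (gpow' q a v - gpow' q b v) \<le> cmod ((cmod a powr q - cmod b powr q) *\<^sub>R v) + cmod (q *\<^sub>R (cmod a powr r *\<^sub>R ?B a - cmod b powr r *\<^sub>R ?B b))"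
    by (simp only: norm_triangle_ineq)
  also have "\<dots> = (cmod a powr q - cmod b powr q) * cmod v + q * cmod (cmod a powr r *\<^sub>R ?B a - cmod b powr r *\<^sub>R ?B b)"
    using q bq by simp
  also have "\<dots> \<le> (q * M powr (q - 1) * cmod (a - b)) * cmod v + q * ((2 + (q - 1)) * M powr (q - 1) * cmod (a - b) * cmod v)"
    using 1 N q by (intro add_mono mult_right_mono mult_left_mono) auto
  finally show ?thesis by (simp add: algebra_simps)
qed

lemma gpow'_lipschitz:
  assumes q: "q \<ge> 2" and M: "M > 0"
  obtains L where "L > 0" "\<And>a b v. cmod a \<le> M \<Longrightarrow> cmod b \<le> M \<Longrightarrow> cmod (gpow' q a v - gpow' q b v) \<le> L * cmod (a - b) * cmod v"
proof
  show "(q + q * (2 + (q - 1))) * M powr (q - 1) > 0" using q M by (intro mult_pos_pos add_pos_pos) auto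
  fix a b v :: complex assume "cmod a \<le> M" "cmod b \<le> M"
  then show "cmod (gpow' q a v - gpow' q b v) \<le> (q + q * (2 + (q - 1))) * M powr (q - 1) * cmod (a - b) * cmod v"
    using gpow'_lipschitz_aux[OF q, of b a M v] gpow'_lipschitz_aux[OF q, of a b M v] M
    by (cases "cmod b \<le> cmod a") (simp_all add: norm_minus_commute)
qed

lemma gpow_0 [simp]: "gpow q 0 = 0"
  by (simp add: gpow_def)

subsection \<open>The power nonlinearity\<close>

lemma gpow_ball_lipschitz:
  assumes q: "q \<ge> 2" and M: "M > 0" and ab: "cmod a \<le> M" "cmod b \<le> M"
  shows "cmod (gpow q a - gpow q b) \<le> ((1 + q) * M powr q) * cmod (a - b)"
proof (rule differentiable_bound[where S = "cball 0 M" and f' = "gpow' q"])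
  show "onorm (gpow' q z) \<le> (1 + q) * M powr q" if "z \<in> cball 0 M" for z
    by (rule onorm_le) (use gpow'_bound[OF q _ M] that in simp)
qed (use gpow_has_derivative[OF q] ab in auto)

text \<open>The segments from \<open>b\<close> to \<open>a\<close> and from \<open>b'\<close> to \<open>a'\<close> are compared at equal times.\<close>

lemma gpow_second_difference:
  assumes q: "q \<ge> 2" and M: "M > 0"
  obtains K L where "K > 0" "L > 0"
    "\<And>a a' b b'. cmod a \<le> M \<Longrightarrow> cmod a' \<le> M \<Longrightarrow> cmod b \<le> M \<Longrightarrow> cmod b' \<le> M \<Longrightarrow>
      cmod (gpow q a' - gpow q a - (gpow q b' - gpow q b)) \<le> K * cmod ((a' - a) - (b' - b)) + L * cmod (b' - b) * cmod (a - b)"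
proof -
  obtain L where L: "L > 0" "\<And>a b v. cmod a \<le> M \<Longrightarrow> cmod b \<le> M \<Longrightarrow> cmod (gpow' q a v - gpow' q b v) \<le> L * cmod (a - b) * cmod v"
    using gpow'_lipschitz[OF q M] by blast
  \<comment> \<open>The summand \<open>2 * M * L\<close> absorbs the product of the second
    difference with \<open>cmod (a - b)\<close>, which is at most 2 M on the ball.\<close>
  define K where "K = (1 + q) * M powr q + 2 * M * L"
  have "K > 0" using L q M by (auto simp: K_def intro!: add_pos_pos)
  have main: "cmod (gpow q a' - gpow q a - (gpow q b' - gpow q b)) \<le> K * cmod ((a' - a) - (b' - b)) + L * cmod (b' - b) * cmod (a - b)"
    if abs: "cmod a \<le> M" "cmod a' \<le> M" "cmod b \<le> M" "cmod b' \<le> M" for a a' b b'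
  proof -
    define x x' where "x \<theta> = b + \<theta> *\<^sub>R (a - b)" and "x' \<theta> = b' + \<theta> *\<^sub>R (a' - b')" for \<theta>
    define \<Delta> where "\<Delta> = (a' - a) - (b' - b)"
    define B where "B = K * cmod \<Delta> + L * cmod (b' - b) * cmod (a - b)"
    have seg: "cmod (c + \<theta> *\<^sub>R (d - c)) \<le> M" if "cmod c \<le> M" "cmod d \<le> M" "\<theta> \<in> {0..1}" for c d :: complex and \<theta>
    proof -
      have "c + \<theta> *\<^sub>R (d - c) = (1 - \<theta>) *\<^sub>R c + \<theta> *\<^sub>R d" by (simp add: algebra_simps)
      then have "cmod (c + \<theta> *\<^sub>R (d - c)) \<le> (1 - \<theta>) * cmod c + \<theta> * cmod d"
        using norm_triangle_ineq[of "(1 - \<theta>) *\<^sub>R c" "\<theta> *\<^sub>R d"] that by simp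
      also have "\<dots> \<le> (1 - \<theta>) * M + \<theta> * M" using that by (intro add_mono mult_left_mono) auto
      finally show ?thesis by (simp add: algebra_simps)
    qed
    define F where "F \<theta> = gpow q (x' \<theta>) - gpow q (x \<theta>)" for \<theta>
    define F' where "F' \<theta> = gpow' q (x' \<theta>) (a' - b') - gpow' q (x \<theta>) (a - b)" for \<theta>
    have lin: "gpow' q z (r *\<^sub>R v) = r *\<^sub>R gpow' q z v" for z r v
      by (simp add: gpow'_def scaleR_add_right mult_ac)
    have lin2: "gpow' q z (u + v) = gpow' q z u + gpow' q z v" for z u v
      by (simp add: gpow'_def scaleR_add_right scaleR_add_left inner_add_right distrib_left)
    have der: "(F has_derivative (\<lambda>h. h *\<^sub>R F' \<theta>)) (at \<theta> within {0..1})" for \<theta>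
    proof -
      have 1: "(x has_derivative (\<lambda>h. h *\<^sub>R (a - b))) (at \<theta> within {0..1})"
        and 2: "(x' has_derivative (\<lambda>h. h *\<^sub>R (a' - b'))) (at \<theta> within {0..1})"
        unfolding x_def[abs_def] x'_def[abs_def] by (auto intro!: derivative_eq_intros)
      have "((\<lambda>\<theta>. gpow q (x' \<theta>) - gpow q (x \<theta>)) has_derivative (\<lambda>h. gpow' q (x' \<theta>) (h *\<^sub>R (a' - b')) - gpow' q (x \<theta>) (h *\<^sub>R (a - b)))) (at \<theta> within {0..1})"
        by (rule has_derivative_diff[OF has_derivative_compose[OF 2 gpow_has_derivative[OF q]] has_derivative_compose[OF 1 gpow_has_derivative[OF q]]])
      then show ?thesis
        unfolding lin scaleR_diff_right[symmetric] F_def[symmetric] F'_def[symmetric] by simp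
    qed
    have bd: "cmod (F' \<theta>) \<le> B" if \<theta>: "\<theta> \<in> {0..1}" for \<theta>
    proof -
      have xM: "cmod (x \<theta>) \<le> M" "cmod (x' \<theta>) \<le> M" using seg abs \<theta> by (auto simp: x_def x'_def)
      \<comment> \<open>Writing one direction as the other plus \<Delta> separates a change of
        direction, paid by the bound on the derivative, from a change of base point, paid by its
        Lipschitz constant.\<close>
      have "a' - b' = \<Delta> + (a - b)" by (simp add: \<Delta>_def)
      then have "F' \<theta> = gpow' q (x' \<theta>) \<Delta> + (gpow' q (x' \<theta>) (a - b) - gpow' q (x \<theta>) (a - b))"
        by (simp add: F'_def lin2)
      then have "cmod (F' \<theta>) \<le> cmod (gpow' q (x' \<theta>) \<Delta>) + cmod (gpow' q (x' \<theta>) (a - b) - gpow' q (x \<theta>) (a - b))"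
        by (simp only: norm_triangle_ineq)
      also have "\<dots> \<le> (1 + q) * M powr q * cmod \<Delta> + L * cmod (x' \<theta> - x \<theta>) * cmod (a - b)"
        by (intro add_mono gpow'_bound L q M xM)
      also have "\<dots> \<le> (1 + q) * M powr q * cmod \<Delta> + L * (cmod (b' - b) + cmod \<Delta>) * cmod (a - b)"
      proof -
        have "x' \<theta> - x \<theta> = (b' - b) + \<theta> *\<^sub>R \<Delta>" by (simp add: x_def x'_def \<Delta>_def algebra_simps)
        then have "cmod (x' \<theta> - x \<theta>) \<le> cmod (b' - b) + \<theta> * cmod \<Delta>"
          using norm_triangle_ineq[of "b' - b" "\<theta> *\<^sub>R \<Delta>"] \<theta> by simp
        also have "\<dots> \<le> cmod (b' - b) + 1 * cmod \<Delta>" using \<theta> by (intro add_left_mono mult_right_mono) auto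
        finally show ?thesis using L(1) by (intro add_left_mono mult_right_mono mult_left_mono) auto
      qed
      also have "\<dots> = (1 + q) * M powr q * cmod \<Delta> + L * cmod \<Delta> * cmod (a - b) + L * cmod (b' - b) * cmod (a - b)"
        by (simp add: algebra_simps)
      also have "L * cmod \<Delta> * cmod (a - b) \<le> L * cmod \<Delta> * (2 * M)"
      proof (rule mult_left_mono)
        show "cmod (a - b) \<le> 2 * M" using norm_triangle_ineq4[of a b] abs by simp
      qed (use L in simp)
      finally show ?thesis by (simp add: B_def K_def algebra_simps)
    qed
    have "norm (F 1 - F 0) \<le> B * norm (1 - 0 :: real)"
    proof (rule differentiable_bound[OF convex_real_interval(5) der])
      show "onorm (\<lambda>h. h *\<^sub>R F' \<theta>) \<le> B" if "\<theta> \<in> {0..1}" for \<theta>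
        by (rule onorm_le) (use mult_right_mono[OF bd[OF that] abs_ge_zero] in \<open>simp add: mult.commute\<close>)
    qed auto
    then show ?thesis
      by (simp add: F_def x_def x'_def B_def \<Delta>_def algebra_simps)
  qed
  show thesis by (rule that[OF \<open>K > 0\<close> L(1) main])
qed

text \<open>Truncation by nearest-point projection: since the projection is 1-Lipschitz, the
  constant of \<open>gpow\<close> on the ball holds for \<open>gcut\<close> on the whole plane, and
  on the ball nothing is changed.\<close>

definition gcut :: "real \<Rightarrow> real \<Rightarrow> complex \<Rightarrow> complex" where
  "gcut q M z = gpow q (closest_point (cball 0 M) z)"

lemma gcut_eq: "cmod z \<le> M \<Longrightarrow> gcut q M z = gpow q z"
  by (simp add: gcut_def closest_point_self)

lemma gcut_lipschitz:
  assumes q: "q \<ge> 2" and M: "M > 0"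
  shows "cmod (gcut q M a - gcut q M b) \<le> ((1 + q) * M powr q) * cmod (a - b)"
proof -
  let ?P = "closest_point (cball (0::complex) M)"
  have P: "cmod (?P z) \<le> M" for z
    using closest_point_in_set[of "cball (0::complex) M" z] M by auto
  have "cmod (gcut q M a - gcut q M b) \<le> ((1 + q) * M powr q) * cmod (?P a - ?P b)"
    unfolding gcut_def by (rule gpow_ball_lipschitz[OF q M P P])
  also have "\<dots> \<le> ((1 + q) * M powr q) * cmod (a - b)"
    using closest_point_lipschitz[of "cball (0::complex) M" a b] M q
    by (intro mult_left_mono) (auto simp: dist_norm)
  finally show ?thesis .
qed

lemma gcut_measurable [measurable]:
  assumes q: "q \<ge> 2" and M: "M > 0"
  shows "gcut q M \<in> borel_measurable borel"
proof (intro borel_measurable_continuous_onI lipschitz_on_continuous_on lipschitz_onI)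
  show "0 \<le> (1 + q) * M powr q" using q by simp
  show "dist (gcut q M a) (gcut q M b) \<le> ((1 + q) * M powr q) * dist a b" for a b
    using gcut_lipschitz[OF q M] by (simp add: dist_norm)
qed

text \<open>Here b and b' stand for values of the explicit profile, bounded by A, and a and a' for
  values of the solution, about which nothing is known. The truncation radius A + 1 leaves a unit
  gap: if a or a' lies outside, the two distances to the profile add up to at least 1, and their sum
  may be inserted as a factor into the first-order Lipschitz bound.\<close>

lemma gcut_second_difference:
  assumes q: "q \<ge> 2" and A: "A > 0"
  obtains K L where "K > 0" "L > 0"
    "\<And>a a' b b'. cmod b \<le> A \<Longrightarrow> cmod b' \<le> A \<Longrightarrow>
      cmod (gcut q (A + 1) a' - gcut q (A + 1) a - (gcut q (A + 1) b' - gcut q (A + 1) b))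
       \<le> K * cmod ((a' - a) - (b' - b)) + L * cmod (b' - b) * (cmod (a - b) + cmod (a' - b'))"
proof -
  define M where "M = A + 1"
  have M: "M > 0" using A by (simp add: M_def)
  obtain K0 L0 where 0: "K0 > 0" "L0 > 0" "\<And>a a' b b'. cmod a \<le> M \<Longrightarrow> cmod a' \<le> M \<Longrightarrow> cmod b \<le> M \<Longrightarrow> cmod b' \<le> M \<Longrightarrow>
      cmod (gpow q a' - gpow q a - (gpow q b' - gpow q b)) \<le> K0 * cmod ((a' - a) - (b' - b)) + L0 * cmod (b' - b) * cmod (a - b)"
    using gpow_second_difference[OF q M] by blast
  define k where "k = (1 + q) * M powr q"
  have k: "k \<ge> 0" using q by (simp add: k_def)
  have main: "cmod (gcut q M a' - gcut q M a - (gcut q M b' - gcut q M b))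
       \<le> (K0 + k) * cmod ((a' - a) - (b' - b)) + (L0 + 2 * k) * cmod (b' - b) * (cmod (a - b) + cmod (a' - b'))"
    if b: "cmod b \<le> A" "cmod b' \<le> A" for a a' b b'
  proof (cases "cmod a \<le> M \<and> cmod a' \<le> M")
    case True
    have "cmod (gcut q M a' - gcut q M a - (gcut q M b' - gcut q M b)) \<le> K0 * cmod ((a' - a) - (b' - b)) + L0 * cmod (b' - b) * cmod (a - b)"
      using 0(3)[of a a' b b'] True b by (simp add: gcut_eq M_def)
    also have "\<dots> \<le> (K0 + k) * cmod ((a' - a) - (b' - b)) + (L0 + 2 * k) * cmod (b' - b) * (cmod (a - b) + cmod (a' - b'))"
      using k 0(1,2) by (intro add_mono mult_mono mult_nonneg_nonneg add_nonneg_nonneg) auto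
    finally show ?thesis .
  next
    case False
    have "cmod a - cmod b \<le> cmod (a - b)" "cmod a' - cmod b' \<le> cmod (a' - b')"
      by (rule norm_triangle_ineq2)+
    moreover have "0 \<le> cmod (a - b)" "0 \<le> cmod (a' - b')" by simp_all
    moreover have "cmod a > A + 1 \<or> cmod a' > A + 1" using False by (auto simp: M_def)
    ultimately have one: "1 \<le> cmod (a - b) + cmod (a' - b')"
      using b by linarith
    have "cmod (gcut q M a' - gcut q M a - (gcut q M b' - gcut q M b)) \<le> cmod (gcut q M a' - gcut q M a) + cmod (gcut q M b' - gcut q M b)"
      by (rule norm_triangle_ineq4)
    also have "\<dots> \<le> k * cmod (a' - a) + k * cmod (b' - b)"
      unfolding k_def by (intro add_mono gcut_lipschitz q M)
    also have "\<dots> \<le> k * (cmod ((a' - a) - (b' - b)) + cmod (b' - b)) + k * cmod (b' - b)"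
      using norm_triangle_ineq[of "(a' - a) - (b' - b)" "b' - b"] k by (intro add_right_mono mult_left_mono) auto
    also have "\<dots> = k * cmod ((a' - a) - (b' - b)) + 2 * k * cmod (b' - b) * 1" by (simp add: algebra_simps)
    also have "\<dots> \<le> (K0 + k) * cmod ((a' - a) - (b' - b)) + (L0 + 2 * k) * cmod (b' - b) * (cmod (a - b) + cmod (a' - b'))"
      using k 0(1,2) one by (intro add_mono mult_mono mult_nonneg_nonneg add_nonneg_nonneg) auto
    finally show ?thesis .
  qed
  have "K0 + k > 0" "L0 + 2 * k > 0" using 0 k by auto
  then show thesis using main unfolding M_def by (rule that)
qed

section \<open>The truncated nonlinearity as a superposition operator on L2\<close>

definition nem :: "real \<Rightarrow> real \<Rightarrow> l2 \<Rightarrow> l2" where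
  "nem q M f = abs_l2 (\<lambda>z. gcut q M (rep_l2 f z))"

lemma rep_nem:
  assumes q: "q \<ge> 2" and M: "M > 0"
  shows "AE z in lborel. rep_l2 (nem q M f) z = gcut q M (rep_l2 f z)"
  unfolding nem_def
proof (rule rep_abs, rule sq_int_dominated[OF sq_int_rep])
  note [measurable] = gcut_measurable[OF q M]
  show "(\<lambda>z. gcut q M (rep_l2 f z)) \<in> borel_measurable borel" by measurable
  have "gcut q M 0 = 0" using M by (simp add: gcut_eq)
  then show "AE z in lborel. cmod (gcut q M (rep_l2 f z)) \<le> ((1 + q) * M powr q) * cmod (rep_l2 f z)"
    using gcut_lipschitz[OF q M, of _ 0] by simp
qed

lemma nem_lipschitz:
  assumes q: "q \<ge> 2" and M: "M > 0"
  shows "norm (nem q M f - nem q M g) \<le> ((1 + q) * M powr q) * norm (f - g)"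
proof (rule norm_l2_le)
  show "AE z in lborel. cmod (rep_l2 (nem q M f - nem q M g) z) \<le> ((1 + q) * M powr q) * cmod (rep_l2 (f - g) z)"
    using rep_nem[OF q M, of f] rep_nem[OF q M, of g] rep_minus[of "nem q M f" "nem q M g"] rep_minus[of f g]
    by eventually_elim (use gcut_lipschitz[OF q M] in simp)
qed (use q in simp)

definition absl :: "l2 \<Rightarrow> l2" where
  "absl f = abs_l2 (\<lambda>z. complex_of_real (cmod (rep_l2 f z)))"

lemma rep_absl: "AE z in lborel. rep_l2 (absl f) z = complex_of_real (cmod (rep_l2 f z))"
  unfolding absl_def
  by (rule rep_abs, rule sq_int_dominated[OF sq_int_rep[of f], of _ 1]) simp_all

lemma norm_absl [simp]: "norm (absl f) = norm f"
  by (rule norm_l2_eq) (use rep_absl[of f] in \<open>eventually_elim, simp\<close>)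

text \<open>The moduli are lifted to elements of \<open>l2\<close>, so that a pointwise bound by a
  sum becomes the triangle inequality for norms.\<close>

lemma norm_l2_le2:
  assumes "AE z in lborel. cmod (rep_l2 f z) \<le> a * cmod (rep_l2 g z) + b * cmod (rep_l2 h z)" and ab: "a \<ge> 0" "b \<ge> 0"
  shows "norm f \<le> a * norm g + b * norm h"
proof -
  have "norm f \<le> 1 * norm (a *\<^sub>R absl g + b *\<^sub>R absl h)"
  proof (rule norm_l2_le)
    show "AE z in lborel. cmod (rep_l2 f z) \<le> 1 * cmod (rep_l2 (a *\<^sub>R absl g + b *\<^sub>R absl h) z)"
      using assms(1) rep_plus[of "a *\<^sub>R absl g" "b *\<^sub>R absl h"] rep_scaleR[of a "absl g"] rep_scaleR[of b "absl h"] rep_absl[of g] rep_absl[of h]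
    proof eventually_elim
      case (elim z)
      then have "rep_l2 (a *\<^sub>R absl g + b *\<^sub>R absl h) z = complex_of_real (a * cmod (rep_l2 g z) + b * cmod (rep_l2 h z))"
        by (simp add: scaleR_conv_of_real)
      then have "cmod (rep_l2 (a *\<^sub>R absl g + b *\<^sub>R absl h) z) = a * cmod (rep_l2 g z) + b * cmod (rep_l2 h z)"
        using ab by (simp only: norm_of_real) simp
      then show ?case using elim(1) by simp
    qed
  qed simp
  also have "\<dots> \<le> norm (a *\<^sub>R absl g) + norm (b *\<^sub>R absl h)"
    using norm_triangle_ineq[of "a *\<^sub>R absl g" "b *\<^sub>R absl h"] by simp
  finally show ?thesis using ab by simp
qed

text \<open>In the bilinear term the increment of the profile is measured in sup norm, by
  \<open>B\<close>, and the distance between solution and profile in L2, so that the product stays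
  in L2.\<close>

lemma nem_second_difference:
  assumes q: "q \<ge> 2" and A: "A > 0"
  obtains K L where "K > 0" "L > 0"
    "\<And>a a' b b' B. AE z in lborel. cmod (rep_l2 b z) \<le> A \<Longrightarrow> AE z in lborel. cmod (rep_l2 b' z) \<le> A \<Longrightarrow> B \<ge> 0 \<Longrightarrow>
      AE z in lborel. cmod (rep_l2 b' z - rep_l2 b z) \<le> B \<Longrightarrow>
      norm (nem q (A + 1) a' - nem q (A + 1) a - (nem q (A + 1) b' - nem q (A + 1) b))
       \<le> K * norm ((a' - a) - (b' - b)) + L * B * (norm (a - b) + norm (a' - b'))"
proof -
  obtain K L where KL: "K > 0" "L > 0" "\<And>a a' b b'. cmod b \<le> A \<Longrightarrow> cmod b' \<le> A \<Longrightarrow>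
      cmod (gcut q (A + 1) a' - gcut q (A + 1) a - (gcut q (A + 1) b' - gcut q (A + 1) b))
       \<le> K * cmod ((a' - a) - (b' - b)) + L * cmod (b' - b) * (cmod (a - b) + cmod (a' - b'))"
    using gcut_second_difference[OF q A] by blast
  have M: "A + 1 > 0" using A by simp
  have main: "norm (nem q (A + 1) a' - nem q (A + 1) a - (nem q (A + 1) b' - nem q (A + 1) b))
       \<le> K * norm ((a' - a) - (b' - b)) + L * B * (norm (a - b) + norm (a' - b'))"
    if h: "AE z in lborel. cmod (rep_l2 b z) \<le> A" "AE z in lborel. cmod (rep_l2 b' z) \<le> A" "B \<ge> 0"
      "AE z in lborel. cmod (rep_l2 b' z - rep_l2 b z) \<le> B" for a a' b b' B
  proof -
    let ?N = "nem q (A + 1)" and ?g = "gcut q (A + 1)"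
    have "norm (?N a' - ?N a - (?N b' - ?N b)) \<le> K * norm ((a' - a) - (b' - b)) + (L * B) * norm (absl (a - b) + absl (a' - b'))"
    proof (rule norm_l2_le2)
      have "AE z in lborel. rep_l2 (?N a' - ?N a - (?N b' - ?N b)) z = ?g (rep_l2 a' z) - ?g (rep_l2 a z) - (?g (rep_l2 b' z) - ?g (rep_l2 b z))"
        using rep_minus[of "?N a' - ?N a" "?N b' - ?N b"] rep_minus[of "?N a'" "?N a"] rep_minus[of "?N b'" "?N b"]
          rep_nem[OF q M, of a] rep_nem[OF q M, of a'] rep_nem[OF q M, of b] rep_nem[OF q M, of b']
        by eventually_elim simp
      moreover have "AE z in lborel. rep_l2 ((a' - a) - (b' - b)) z = (rep_l2 a' z - rep_l2 a z) - (rep_l2 b' z - rep_l2 b z)"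
        using rep_minus[of "a' - a" "b' - b"] rep_minus[of a' a] rep_minus[of b' b] by eventually_elim simp
      moreover have "AE z in lborel. cmod (rep_l2 (absl (a - b) + absl (a' - b')) z) = cmod (rep_l2 a z - rep_l2 b z) + cmod (rep_l2 a' z - rep_l2 b' z)"
        using rep_plus[of "absl (a - b)" "absl (a' - b')"] rep_absl[of "a - b"] rep_absl[of "a' - b'"] rep_minus[of a b] rep_minus[of a' b']
      proof eventually_elim
        case (elim z)
        then have "rep_l2 (absl (a - b) + absl (a' - b')) z = complex_of_real (cmod (rep_l2 a z - rep_l2 b z) + cmod (rep_l2 a' z - rep_l2 b' z))"
          by simp
        then show ?case by (simp only: norm_of_real) simp
      qed
      ultimately show "AE z in lborel. cmod (rep_l2 (?N a' - ?N a - (?N b' - ?N b)) z) \<le> K * cmod (rep_l2 ((a' - a) - (b' - b)) z) + (L * B) * cmod (rep_l2 (absl (a - b) + absl (a' - b')) z)"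
        using h(1,2,4)
      proof eventually_elim
        case (elim z)
        show ?case unfolding elim(1,2,3)
          using elim(6) KL(1,2)
          by (intro order_trans[OF KL(3)[OF elim(4,5)]] add_left_mono mult_right_mono mult_left_mono) auto
      qed
    qed (use KL h in auto)
    also have "\<dots> \<le> K * norm ((a' - a) - (b' - b)) + (L * B) * (norm (absl (a - b)) + norm (absl (a' - b')))"
      using KL h by (intro add_left_mono mult_left_mono norm_triangle_ineq) auto
    finally show ?thesis by simp
  qed
  show thesis by (rule that[OF KL(1,2) main])
qed

subsection \<open>Fourier multipliers and the linear flow\<close>

definition mult_l2 :: "(real \<times> real \<Rightarrow> complex) \<Rightarrow> l2 \<Rightarrow> l2" where
  "mult_l2 m f = abs_l2 (\<lambda>z. m z * rep_l2 f z)"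

lemma rep_mult:
  assumes "m \<in> borel_measurable borel" "\<And>z. cmod (m z) \<le> B"
  shows "AE z in lborel. rep_l2 (mult_l2 m f) z = m z * rep_l2 f z"
  unfolding mult_l2_def by (rule rep_abs, rule sq_int_mult_bounded[OF sq_int_rep assms])

lemma norm_mult_l2:
  assumes m: "m \<in> borel_measurable borel" "\<And>z. cmod (m z) \<le> B"
  shows "norm (mult_l2 m f) \<le> B * norm f"
proof (rule norm_l2_le)
  show "0 \<le> B" using m(2)[of 0] norm_ge_zero order_trans by blast
  show "AE z in lborel. cmod (rep_l2 (mult_l2 m f) z) \<le> B * cmod (rep_l2 f z)"
    using rep_mult[OF m, of f] by eventually_elim (simp add: norm_mult mult_right_mono m(2))
qed

lemma bounded_linear_mult_l2:
  assumes m: "m \<in> borel_measurable borel" "\<And>z. cmod (m z) \<le> B"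
  shows "bounded_linear (mult_l2 m)"
proof (rule additive_bounded_linear[where K = B])
  show "mult_l2 m (f + g) = mult_l2 m f + mult_l2 m g" for f g
    by (rule l2_eqI) (use rep_mult[OF m, of "f + g"] rep_mult[OF m, of f] rep_mult[OF m, of g] rep_plus[of f g]
      rep_plus[of "mult_l2 m f" "mult_l2 m g"] in \<open>eventually_elim, simp add: distrib_left\<close>)
  show "mult_l2 m (c *\<^sub>R f) = c *\<^sub>R mult_l2 m f" for c f
    by (rule l2_eqI) (use rep_mult[OF m, of "c *\<^sub>R f"] rep_mult[OF m, of f] rep_scaleR[of c f]
      rep_scaleR[of c "mult_l2 m f"] in \<open>eventually_elim, simp\<close>)
qed (use norm_mult_l2[OF m] in \<open>simp add: mult.commute\<close>)

text \<open>\<open>l2\<close> is only a real vector space, so multiplication by a complex scalar is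
  introduced as an operator.\<close>

definition cmul :: "complex \<Rightarrow> l2 \<Rightarrow> l2" where
  "cmul c = mult_l2 (\<lambda>z. c)"

lemma rep_cmul: "AE z in lborel. rep_l2 (cmul c f) z = c * rep_l2 f z"
  unfolding cmul_def by (rule rep_mult[where B = "cmod c"]) auto

lemma bounded_linear_cmul: "bounded_linear (cmul c)"
  unfolding cmul_def by (rule bounded_linear_mult_l2[where B = "cmod c"]) auto

lemma norm_cmul_le: "norm (cmul c f) \<le> cmod c * norm f"
  unfolding cmul_def by (rule norm_mult_l2) auto

lemma omega_nonneg: "omega \<zeta> \<ge> 0"
  by (simp add: omega_def)

lemma omega_measurable [measurable]: "omega \<in> borel_measurable borel"
  unfolding omega_def by (intro borel_measurable_continuous_onI continuous_intros)

text \<open>On the Fourier side this is the inverse of the linear propagator, hence the plus sign: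
  \<open>flow t (FT (u t))\<close> is the interaction picture, in which a linear solution is
  constant.\<close>

definition flow :: "real \<Rightarrow> l2 \<Rightarrow> l2" where
  "flow t = mult_l2 (\<lambda>\<zeta>. cis (t * omega \<zeta>))"

lemma flow_measurable: "(\<lambda>\<zeta>. cis (t * omega \<zeta>)) \<in> borel_measurable borel"
  by measurable

lemma rep_flow: "AE \<zeta> in lborel. rep_l2 (flow t f) \<zeta> = cis (t * omega \<zeta>) * rep_l2 f \<zeta>"
  unfolding flow_def by (rule rep_mult[OF flow_measurable, where B = 1]) simp

lemma bounded_linear_flow: "bounded_linear (flow t)"
  unfolding flow_def by (rule bounded_linear_mult_l2[OF flow_measurable, where B = 1]) simp

lemma norm_flow [simp]: "norm (flow t f) = norm f"
  by (rule norm_l2_eq) (use rep_flow[of t f] in \<open>eventually_elim, simp add: norm_mult\<close>)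

lemma flow_flow: "flow s (flow t f) = flow (s + t) f"
  by (rule l2_eqI) (use rep_flow[of s "flow t f"] rep_flow[of t f] rep_flow[of "s + t" f] in
    \<open>eventually_elim, simp add: cis_mult distrib_right flip: mult.assoc\<close>)

lemma flow_0 [simp]: "flow 0 f = f"
  by (rule l2_eqI) (use rep_flow[of 0 f] in \<open>eventually_elim, simp\<close>)

lemma flow_cmul: "flow t (cmul c f) = cmul c (flow t f)"
  by (rule l2_eqI) (use rep_flow[of t "cmul c f"] rep_cmul[of c f] rep_cmul[of c "flow t f"] rep_flow[of t f] in
    \<open>eventually_elim, simp\<close>)

lemma l2_dominated_convergence:
  assumes lim: "AE z in lborel. (\<lambda>n. rep_l2 (g n) z) \<longlonglongrightarrow> rep_l2 g0 z"
    and bd: "\<And>n. AE z in lborel. cmod (rep_l2 (g n) z - rep_l2 g0 z) \<le> cmod (rep_l2 k z)"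
  shows "g \<longlonglongrightarrow> g0"
proof -
  have "(\<lambda>n. \<integral>z. (cmod (rep_l2 (g n) z - rep_l2 g0 z))\<^sup>2 \<partial>lborel) \<longlonglongrightarrow> (\<integral>z. 0 \<partial>(lborel :: (real \<times> real) measure))"
  proof (rule integral_dominated_convergence[where w = "\<lambda>z. (cmod (rep_l2 k z))\<^sup>2"])
    show "AE z in lborel. (\<lambda>n. (cmod (rep_l2 (g n) z - rep_l2 g0 z))\<^sup>2) \<longlonglongrightarrow> 0"
      using lim
    proof eventually_elim
      case (elim z)
      have "(\<lambda>n. (cmod (rep_l2 (g n) z - rep_l2 g0 z))\<^sup>2) \<longlonglongrightarrow> (cmod (rep_l2 g0 z - rep_l2 g0 z))\<^sup>2"
        by (rule tendsto_power[OF tendsto_norm[OF tendsto_diff[OF elim tendsto_const]]])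
      then show ?case by simp
    qed
    show "AE z in lborel. norm ((cmod (rep_l2 (g n) z - rep_l2 g0 z))\<^sup>2) \<le> (cmod (rep_l2 k z))\<^sup>2" for n
      using bd[of n] by eventually_elim (simp add: power_mono)
  qed (simp_all add: sq_int_integrable)
  moreover have "(\<integral>z. (cmod (rep_l2 (g n) z - rep_l2 g0 z))\<^sup>2 \<partial>lborel) = (norm (g n - g0))\<^sup>2" for n
    using norm_abs_diff_sq[OF sq_int_rep sq_int_rep, of "g n" g0] by simp
  ultimately have "(\<lambda>n. sqrt ((norm (g n - g0))\<^sup>2)) \<longlonglongrightarrow> sqrt 0"
    by (intro tendsto_real_sqrt) simp
  then have "(\<lambda>n. norm (g n - g0)) \<longlonglongrightarrow> 0" by simp
  then show ?thesis by (rule Lim_null[THEN iffD2, OF tendsto_norm_zero_cancel])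
qed

lemma flow_tendsto_seq:
  assumes s: "s \<longlonglongrightarrow> t"
  shows "(\<lambda>n. flow (s n) f) \<longlonglongrightarrow> flow t f"
proof (rule l2_dominated_convergence[where k = "2 *\<^sub>R f"])
  have "AE z in lborel. \<forall>n. rep_l2 (flow (s n) f) z = cis (s n * omega z) * rep_l2 f z"
    using rep_flow by (subst AE_all_countable) blast
  then show "AE z in lborel. (\<lambda>n. rep_l2 (flow (s n) f) z) \<longlonglongrightarrow> rep_l2 (flow t f) z"
    using rep_flow[of t f]
  proof eventually_elim
    case (elim z)
    have "(\<lambda>n. cis (s n * omega z) * rep_l2 f z) \<longlonglongrightarrow> cis (t * omega z) * rep_l2 f z"
      by (intro tendsto_mult tendsto_cis tendsto_const s)
    then show ?case using elim by simp
  qed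
  show "AE z in lborel. cmod (rep_l2 (flow (s n) f) z - rep_l2 (flow t f) z) \<le> cmod (rep_l2 (2 *\<^sub>R f) z)" for n
    using rep_flow[of "s n" f] rep_flow[of t f] rep_scaleR[of 2 f]
  proof eventually_elim
    case (elim z)
    have "cmod (cis (s n * omega z) * rep_l2 f z - cis (t * omega z) * rep_l2 f z) \<le> cmod (rep_l2 f z) + cmod (rep_l2 f z)"
      by (rule order_trans[OF norm_triangle_ineq4]) (simp add: norm_mult)
    then show ?case using elim by simp
  qed
qed

lemma flow_continuous: "continuous_on A (\<lambda>t. flow t f)"
proof (rule continuous_on_sequentiallyI)
  fix u :: "nat \<Rightarrow> real" and a assume "u \<longlonglongrightarrow> a"
  then show "(\<lambda>n. flow (u n) f) \<longlonglongrightarrow> flow a f" by (rule flow_tendsto_seq)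
qed

lemma flow_diff: "flow t (f - g) = flow t f - flow t g"
  by (rule linear_diff[OF bounded_linear.linear[OF bounded_linear_flow]])

lemma flow_add: "flow t (f + g) = flow t f + flow t g"
  by (rule linear_add[OF bounded_linear.linear[OF bounded_linear_flow]])

lemma flow_scaleR: "flow t (c *\<^sub>R f) = c *\<^sub>R flow t f"
  by (rule linear_scale[OF bounded_linear.linear[OF bounded_linear_flow]])

text \<open>Since \<open>omega\<close> is unbounded, \<open>flow\<close> is only strongly continuous
  in time; as each \<open>flow s\<close> is an isometry, this is enough for a moving
  argument.\<close>

lemma flow_joint_tendsto:
  assumes V: "(V \<longlongrightarrow> v) (at t within A)"
  shows "((\<lambda>s. flow s (V s)) \<longlongrightarrow> flow t v) (at t within A)"
proof -
  have 1: "((\<lambda>s. flow s v) \<longlongrightarrow> flow t v) (at t within A)"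
    using flow_continuous[of "insert t A" v] unfolding continuous_on_def
    by (auto intro: tendsto_within_subset)
  have 2: "((\<lambda>s. norm (V s - v)) \<longlongrightarrow> 0) (at t within A)"
    using tendsto_norm[OF tendsto_diff[OF V tendsto_const[of v]]] by simp
  have "((\<lambda>s. flow s (V s - v)) \<longlongrightarrow> 0) (at t within A)"
    by (rule tendsto_norm_zero_cancel) (use 2 in simp)
  from tendsto_add[OF this 1] show ?thesis by (simp add: flow_diff)
qed

text \<open>The graph of the unbounded multiplication by \<open>omega\<close>: the existence of some
  \<open>l\<close> says that \<open>f\<close> lies in the domain, and \<open>l\<close> is then its
  image.\<close>

definition om_rel :: "l2 \<Rightarrow> l2 \<Rightarrow> bool" where
  "om_rel f l \<longleftrightarrow> (AE \<zeta> in lborel. rep_l2 l \<zeta> = complex_of_real (omega \<zeta>) * rep_l2 f \<zeta>)"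

lemma cis_approx_0: "cmod (cis x - 1) \<le> \<bar>x\<bar>"
  using iexp_approx1[of x 0] by (simp add: cis_conv_exp)

lemma cis_approx_1: "cmod (cis x - 1 - \<i> * x) \<le> x\<^sup>2 / 2"
proof -
  have "(\<Sum>k\<le>1. (\<i> * complex_of_real x) ^ k / fact k) = 1 + \<i> * x" by simp
  moreover have "\<bar>x\<bar> ^ Suc 1 / fact (Suc 1) = x\<^sup>2 / 2" by (simp add: power2_eq_square)
  ultimately show ?thesis
    using iexp_approx1[of x 1] by (simp only: cis_conv_exp diff_diff_eq)
qed

text \<open>The remainder of the difference quotient tends to 0 pointwise by the second-order bound
  \<open>eb1\<close>. The first-order bound \<open>eb2\<close> dominates it by twice the modulus of
  \<open>omega * f\<close>, which is square integrable because \<open>f\<close> lies in the domain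
  of \<open>omega\<close>.\<close>

lemma flow_has_vector_derivative:
  assumes "om_rel f l"
  shows "((\<lambda>t. flow t f) has_vector_derivative cmul \<i> (flow t l)) (at t within A)"
  unfolding has_vector_derivative_def has_derivative_within
proof (intro conjI bounded_linear_scaleR_left)
  let ?d = "\<lambda>y. (1 / norm (y - t)) *\<^sub>R (flow y f - (flow t f + (y - t) *\<^sub>R cmul \<i> (flow t l)))"
  define e where "e = (\<lambda>y \<zeta>. (1 / norm (y - t)) *\<^sub>R (cis (t * omega \<zeta>) * (cis ((y - t) * omega \<zeta>) - 1 - \<i> * complex_of_real ((y - t) * omega \<zeta>)) * rep_l2 f \<zeta>))"
  have rep_d: "AE \<zeta> in lborel. rep_l2 (?d y) \<zeta> = e y \<zeta>" for y
    using rep_scaleR[of "1 / norm (y - t)" "flow y f - (flow t f + (y - t) *\<^sub>R cmul \<i> (flow t l))"]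
      rep_minus[of "flow y f" "flow t f + (y - t) *\<^sub>R cmul \<i> (flow t l)"] rep_plus[of "flow t f" "(y - t) *\<^sub>R cmul \<i> (flow t l)"]
      rep_scaleR[of "y - t" "cmul \<i> (flow t l)"] rep_cmul[of \<i> "flow t l"] rep_flow[of t l] rep_flow[of t f] rep_flow[of y f]
      assms[unfolded om_rel_def]
  proof eventually_elim
    case (elim \<zeta>)
    have c: "cis (y * omega \<zeta>) = cis (t * omega \<zeta>) * cis ((y - t) * omega \<zeta>)"
      by (simp add: cis_mult algebra_simps)
    have "C * D * F - (C * F + X * (\<i> * (C * (W * F)))) = C * (D - 1 - \<i> * (X * W)) * F" for C D F X W :: complex
      by (simp add: algebra_simps)
    then show ?case unfolding e_def elim scaleR_conv_of_real c of_real_mult by (simp only:)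
  qed
  define r where "r = (\<lambda>y \<zeta>. cmod (cis ((y - t) * omega \<zeta>) - 1 - \<i> * complex_of_real ((y - t) * omega \<zeta>)))"
  have ne: "cmod (e y \<zeta>) = (1 / \<bar>y - t\<bar>) * (r y \<zeta> * cmod (rep_l2 f \<zeta>))" for y \<zeta>
    unfolding e_def r_def by (simp only: norm_scaleR norm_mult norm_cis real_norm_def abs_divide abs_abs abs_one mult_1)
  have eb1: "cmod (e y \<zeta>) \<le> \<bar>y - t\<bar> * (omega \<zeta>)\<^sup>2 * cmod (rep_l2 f \<zeta>)" for y \<zeta>
  proof -
    have "r y \<zeta> \<le> ((y - t) * omega \<zeta>)\<^sup>2 / 2" unfolding r_def by (rule cis_approx_1)
    then have "cmod (e y \<zeta>) \<le> (1 / \<bar>y - t\<bar>) * (((y - t) * omega \<zeta>)\<^sup>2 / 2 * cmod (rep_l2 f \<zeta>))"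
      unfolding ne by (intro mult_left_mono mult_right_mono) auto
    also have "\<dots> = \<bar>y - t\<bar> * (omega \<zeta>)\<^sup>2 * cmod (rep_l2 f \<zeta>) / 2"
      by (cases "y = t") (auto simp: power2_eq_square field_simps abs_if)
    also have "\<dots> \<le> \<bar>y - t\<bar> * (omega \<zeta>)\<^sup>2 * cmod (rep_l2 f \<zeta>)" by simp
    finally show ?thesis .
  qed
  have eb2: "cmod (e y \<zeta>) \<le> 2 * (omega \<zeta> * cmod (rep_l2 f \<zeta>))" for y \<zeta>
  proof -
    have "cmod (\<i> * complex_of_real ((y - t) * omega \<zeta>)) = \<bar>(y - t) * omega \<zeta>\<bar>"
      by (simp only: norm_mult norm_ii norm_of_real mult_1)
    then have "r y \<zeta> \<le> 2 * (\<bar>y - t\<bar> * omega \<zeta>)"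
      using norm_triangle_ineq4[of "cis ((y - t) * omega \<zeta>) - 1" "\<i> * complex_of_real ((y - t) * omega \<zeta>)"]
        cis_approx_0[of "(y - t) * omega \<zeta>"] omega_nonneg[of \<zeta>]
      unfolding r_def abs_mult by simp
    then have "cmod (e y \<zeta>) \<le> (1 / \<bar>y - t\<bar>) * ((2 * (\<bar>y - t\<bar> * omega \<zeta>)) * cmod (rep_l2 f \<zeta>))"
      unfolding ne by (intro mult_left_mono mult_right_mono) auto
    also have "\<dots> \<le> 2 * (omega \<zeta> * cmod (rep_l2 f \<zeta>))"
      using omega_nonneg[of \<zeta>] by (cases "y = t") simp_all
    finally show ?thesis .
  qed
  show "(?d \<longlongrightarrow> 0) (at t within A)"
    unfolding tendsto_at_iff_sequentially
  proof (intro allI impI)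
    fix X :: "nat \<Rightarrow> real" assume X: "X \<longlonglongrightarrow> t"
    show "(?d \<circ> X) \<longlonglongrightarrow> 0"
    proof (rule l2_dominated_convergence[where k = "2 *\<^sub>R l"])
      have rd: "AE \<zeta> in lborel. \<forall>n. rep_l2 ((?d \<circ> X) n) \<zeta> = e (X n) \<zeta>"
        using rep_d by (subst AE_all_countable) (simp only: o_def, blast)
      show "AE \<zeta> in lborel. (\<lambda>n. rep_l2 ((?d \<circ> X) n) \<zeta>) \<longlonglongrightarrow> rep_l2 0 \<zeta>"
        using rd rep_zero
      proof eventually_elim
        case (elim \<zeta>)
        have "(\<lambda>n. \<bar>X n - t\<bar> * (omega \<zeta>)\<^sup>2 * cmod (rep_l2 f \<zeta>)) \<longlonglongrightarrow> \<bar>t - t\<bar> * (omega \<zeta>)\<^sup>2 * cmod (rep_l2 f \<zeta>)"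
          by (intro tendsto_mult tendsto_rabs tendsto_diff X tendsto_const)
        then have "(\<lambda>n. \<bar>X n - t\<bar> * (omega \<zeta>)\<^sup>2 * cmod (rep_l2 f \<zeta>)) \<longlonglongrightarrow> 0" by simp
        then have "(\<lambda>n. e (X n) \<zeta>) \<longlonglongrightarrow> 0"
          by (rule Lim_null_comparison[OF always_eventually[OF allI[OF eb1]]])
        then show ?case using elim by simp
      qed
      show "AE \<zeta> in lborel. cmod (rep_l2 ((?d \<circ> X) n) \<zeta> - rep_l2 0 \<zeta>) \<le> cmod (rep_l2 (2 *\<^sub>R l) \<zeta>)" for n
        using rd rep_zero rep_scaleR[of 2 l] assms[unfolded om_rel_def]
      proof eventually_elim
        case (elim \<zeta>)
        have "cmod (rep_l2 (2 *\<^sub>R l) \<zeta>) = 2 * (omega \<zeta> * cmod (rep_l2 f \<zeta>))"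
          using omega_nonneg[of \<zeta>] unfolding elim by (simp add: norm_mult)
        then show ?case using eb2[of "X n" \<zeta>] elim(1,2) by simp
      qed
    qed
  qed
qed

text \<open>The increment is split as flow_y (z_y - z_t) plus (flow_y - flow_t) z_t. Strong
  continuity handles the first term, and in the second the generator meets only the value of z at
  the fixed time t, so the domain condition concerns that time alone.\<close>

lemma flow_product_derivative:
  assumes z: "(z has_vector_derivative z') (at t within A)" and l: "om_rel (z t) l"
  shows "((\<lambda>t. flow t (z t)) has_vector_derivative flow t (z' + cmul \<i> l)) (at t within A)"
proof -
  have D: "((\<lambda>y. (1 / (y - t)) *\<^sub>R (f y - f t)) \<longlongrightarrow> f') (at t within A) \<longleftrightarrow> (f has_vector_derivative f') (at t within A)" for f :: "real \<Rightarrow> l2" and f'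
  proof -
    have "norm ((1 / norm (y - t)) *\<^sub>R (f y - (f t + (y - t) *\<^sub>R f'))) = norm ((1 / (y - t)) *\<^sub>R (f y - f t) - f')" if "y \<noteq> t" for y
    proof -
      have "(1 / (y - t)) *\<^sub>R (f y - f t) - f' = (1 / (y - t)) *\<^sub>R (f y - (f t + (y - t) *\<^sub>R f'))"
        using that by (simp add: scaleR_diff_right scaleR_add_right)
      then show ?thesis by simp
    qed
    then have "((\<lambda>y. norm ((1 / norm (y - t)) *\<^sub>R (f y - (f t + (y - t) *\<^sub>R f')))) \<longlongrightarrow> 0) (at t within A) \<longleftrightarrow>
        ((\<lambda>y. norm ((1 / (y - t)) *\<^sub>R (f y - f t) - f')) \<longlongrightarrow> 0) (at t within A)"
      by (intro Lim_cong_within) auto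
    then show ?thesis
      unfolding has_vector_derivative_def has_derivative_within tendsto_norm_zero_iff
      by (simp add: LIM_zero_iff bounded_linear_scaleR_left)
  qed
  have 1: "((\<lambda>y. flow y ((1 / (y - t)) *\<^sub>R (z y - z t))) \<longlongrightarrow> flow t z') (at t within A)"
    by (rule flow_joint_tendsto) (use z D in blast)
  have 2: "((\<lambda>y. (1 / (y - t)) *\<^sub>R (flow y (z t) - flow t (z t))) \<longlongrightarrow> cmul \<i> (flow t l)) (at t within A)"
    using flow_has_vector_derivative[OF l] D[of "\<lambda>t'. flow t' (z t)"] by blast
  have "((\<lambda>y. (1 / (y - t)) *\<^sub>R (flow y (z y) - flow t (z t))) \<longlongrightarrow> flow t z' + cmul \<i> (flow t l)) (at t within A)"
    using tendsto_add[OF 1 2] by (simp add: flow_scaleR flow_diff scaleR_diff_right)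
  from iffD1[OF D[of "\<lambda>t. flow t (z t)"] this] show ?thesis unfolding flow_add flow_cmul .
qed

text \<open>A Lipschitz orbit \<open>t \<mapsto> flow t f\<close> puts \<open>f\<close> into the domain of the multiplier \<open>omega\<close>, by Fatou's lemma.\<close>

lemma om_rel_of_lipschitz:
  assumes C: "C \<ge> 0" and b: "\<And>h. 0 < h \<Longrightarrow> h \<le> 1 \<Longrightarrow> norm (flow (- h) f - f) \<le> C * h"
  obtains l where "om_rel f l" "norm l \<le> C"
proof -
  define h where "h n = 1 / (1 + real n)" for n
  have h: "0 < h n" "h n \<le> 1" for n by (auto simp: h_def)
  have h0: "h \<longlonglongrightarrow> 0" unfolding h_def using LIMSEQ_inverse_real_of_nat by (simp add: inverse_eq_divide)
  \<comment> \<open>Difference quotients of the orbit. They converge pointwise to \<open>w\<close>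
    for every \<open>f\<close>, with L2 norms at most C; no dominating function is at hand, which is
    why Fatou's lemma is used.\<close>
  define g where "g = (\<lambda>n \<zeta>. (1 / h n) *\<^sub>R ((cis (- h n * omega \<zeta>) - 1) * rep_l2 f \<zeta>))"
  define w where "w = (\<lambda>\<zeta>. - \<i> * complex_of_real (omega \<zeta>) * rep_l2 f \<zeta>)"
  have wlim: "(\<lambda>n. g n \<zeta>) \<longlonglongrightarrow> w \<zeta>" for \<zeta>
  proof (rule LIM_zero_cancel)
    have le: "cmod (g n \<zeta> - w \<zeta>) \<le> h n * (omega \<zeta>)\<^sup>2 * cmod (rep_l2 f \<zeta>)" for n
    proof -
      have "g n \<zeta> - w \<zeta> = (1 / h n) *\<^sub>R ((cis (- h n * omega \<zeta>) - 1 - \<i> * complex_of_real (- h n * omega \<zeta>)) * rep_l2 f \<zeta>)"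
      proof -
        have alg: "H * ((D - 1) * F) - - \<i> * W * F = H * ((D - 1 - \<i> * (- K * W)) * F)" if "H * K = 1" for H K D F W :: complex
        proof -
          have "H * ((D - 1 - \<i> * (- K * W)) * F) = H * ((D - 1) * F) + (H * K) * (\<i> * W * F)"
            by (simp add: algebra_simps)
          then show ?thesis using that by simp
        qed
        have "complex_of_real (1 / h n) * complex_of_real (h n) = 1"
          unfolding of_real_mult[symmetric] using h[of n] by simp
        from alg[OF this] show ?thesis
          unfolding g_def w_def scaleR_conv_of_real of_real_mult of_real_minus by (simp only:)
      qed
      also have "cmod \<dots> = (1 / h n) * (cmod (cis (- h n * omega \<zeta>) - 1 - \<i> * complex_of_real (- h n * omega \<zeta>)) * cmod (rep_l2 f \<zeta>))"
        unfolding norm_scaleR norm_mult using h[of n] by simp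
      also have "\<dots> \<le> (1 / h n) * ((- h n * omega \<zeta>)\<^sup>2 / 2 * cmod (rep_l2 f \<zeta>))"
        using h[of n] by (intro mult_left_mono mult_right_mono cis_approx_1) auto
      also have "\<dots> = h n * (omega \<zeta>)\<^sup>2 * cmod (rep_l2 f \<zeta>) / 2"
        using h[of n] by (simp add: power2_eq_square)
      also have "\<dots> \<le> h n * (omega \<zeta>)\<^sup>2 * cmod (rep_l2 f \<zeta>)" using h[of n] by simp
      finally show ?thesis .
    qed
    have "(\<lambda>n. h n * (omega \<zeta>)\<^sup>2 * cmod (rep_l2 f \<zeta>)) \<longlonglongrightarrow> 0 * (omega \<zeta>)\<^sup>2 * cmod (rep_l2 f \<zeta>)"
      by (intro tendsto_mult h0 tendsto_const)
    then have "(\<lambda>n. h n * (omega \<zeta>)\<^sup>2 * cmod (rep_l2 f \<zeta>)) \<longlonglongrightarrow> 0" by simp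
    then show "(\<lambda>n. g n \<zeta> - w \<zeta>) \<longlonglongrightarrow> 0"
      by (rule Lim_null_comparison[OF always_eventually[OF allI[OF le]]])
  qed
  have [measurable]: "w \<in> borel_measurable borel" "g n \<in> borel_measurable borel" for n
    unfolding w_def g_def by measurable
  have fat: "(\<integral>\<^sup>+\<zeta>. ennreal ((cmod (w \<zeta>))\<^sup>2) \<partial>lborel) \<le> ennreal (C\<^sup>2)"
  proof (rule fatou_l2[where g = g and N = 0])
    fix n
    have "(\<integral>\<^sup>+\<zeta>. ennreal ((cmod (g n \<zeta>))\<^sup>2) \<partial>lborel) = (\<integral>\<^sup>+\<zeta>. ennreal ((cmod (rep_l2 ((1 / h n) *\<^sub>R (flow (- h n) f - f)) \<zeta>))\<^sup>2) \<partial>lborel)"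
    proof (rule nn_integral_cong_AE)
      show "AE \<zeta> in lborel. ennreal ((cmod (g n \<zeta>))\<^sup>2) = ennreal ((cmod (rep_l2 ((1 / h n) *\<^sub>R (flow (- h n) f - f)) \<zeta>))\<^sup>2)"
        using rep_scaleR[of "1 / h n" "flow (- h n) f - f"] rep_minus[of "flow (- h n) f" f] rep_flow[of "- h n" f]
      proof eventually_elim
        case (elim \<zeta>)
        have "rep_l2 ((1 / h n) *\<^sub>R (flow (- h n) f - f)) \<zeta> = g n \<zeta>"
          unfolding elim g_def by (simp add: left_diff_distrib)
        then show ?case by (simp only:)
      qed
    qed
    also have "\<dots> = ennreal ((norm ((1 / h n) *\<^sub>R (flow (- h n) f - f)))\<^sup>2)" by (rule nn_integral_l2)
    also have "\<dots> \<le> ennreal (C\<^sup>2)"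
    proof (intro ennreal_leI power_mono)
      have "norm ((1 / h n) *\<^sub>R (flow (- h n) f - f)) = (1 / h n) * norm (flow (- h n) f - f)" using h[of n] by simp
      also have "\<dots> \<le> (1 / h n) * (C * h n)" using h[of n] by (intro mult_left_mono b) auto
      also have "\<dots> = C" using h[of n] by simp
      finally show "norm ((1 / h n) *\<^sub>R (flow (- h n) f - f)) \<le> C" .
    qed simp
    finally show "(\<integral>\<^sup>+\<zeta>. ennreal ((cmod (g n \<zeta>))\<^sup>2) \<partial>lborel) \<le> ennreal (C\<^sup>2)" .
  qed (use wlim in auto)
  define l0 where "l0 = (\<lambda>\<zeta>. complex_of_real (omega \<zeta>) * rep_l2 f \<zeta>)"
  have "l0 \<in> borel_measurable borel" unfolding l0_def by measurable
  have nl: "cmod (l0 \<zeta>) = cmod (w \<zeta>)" for \<zeta> by (simp add: l0_def w_def norm_mult)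
  have "(\<integral>\<^sup>+\<zeta>. ennreal ((cmod (l0 \<zeta>))\<^sup>2) \<partial>lborel) < \<infinity>"
    unfolding nl by (rule le_less_trans[OF fat]) (rule ennreal_less_top[unfolded infinity_ennreal_def[symmetric]])
  then have sl: "sq_int l0" by (rule sq_int_nn[OF \<open>l0 \<in> borel_measurable borel\<close>])
  show thesis
  proof (rule that[of "abs_l2 l0"])
    show "om_rel f (abs_l2 l0)" using rep_abs[OF sl] unfolding om_rel_def by (simp only: l0_def)
    show "norm (abs_l2 l0) \<le> C"
    proof (rule norm_l2_le_nn[OF _ C])
      have "AE \<zeta> in lborel. ennreal ((cmod (rep_l2 (abs_l2 l0) \<zeta>))\<^sup>2) = ennreal ((cmod (w \<zeta>))\<^sup>2)"
        using rep_abs[OF sl] by eventually_elim (simp only: nl)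
      from nn_integral_cong_AE[OF this] fat
      show "(\<integral>\<^sup>+\<zeta>. ennreal ((cmod (rep_l2 (abs_l2 l0) \<zeta>))\<^sup>2) \<partial>lborel) \<le> ennreal (C\<^sup>2)"
        by (simp only:)
    qed
  qed
qed

subsection \<open>A sup norm bound from the dispersion relation\<close>

lemma integrable_powr_line:
  assumes s: "s > 1"
  shows "integrable lborel (\<lambda>x::real. (1 + \<bar>x\<bar>) powr (- s))"
proof -
  let ?f = "\<lambda>x::real. (1 + x) powr (- s) * indicator {0..} x"
  have "(\<integral>\<^sup>+x. ennreal ((1 + x) powr (- s)) * indicator {0..} x \<partial>lborel) = ennreal (0 - (- 1 / (s - 1)) * (1 + 0) powr (1 - s))"
  proof (rule nn_integral_FTC_atLeast)
    fix x :: real assume "0 \<le> x"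
    show "((\<lambda>x. (- 1 / (s - 1)) * (1 + x) powr (1 - s)) has_real_derivative (1 + x) powr (- s)) (at x)"
    proof -
      have "((\<lambda>x. x powr (1 - s)) has_real_derivative (1 - s) * (1 + x) powr (1 - s - 1)) (at (1 + x))"
        using \<open>0 \<le> x\<close> by (intro has_real_derivative_powr) auto
      then have d: "((\<lambda>x. (1 + x) powr (1 - s)) has_real_derivative (1 - s) * (1 + x) powr (- s)) (at x)"
        using DERIV_shift[of "\<lambda>x. x powr (1 - s)" _ x 1] by (simp add: add.commute)
      have "- 1 / (s - 1) * (1 - s) = 1" using s by (simp add: divide_simps)
      then have "- 1 / (s - 1) * ((1 - s) * (1 + x) powr (- s)) = (1 + x) powr (- s)"
        by (simp only: mult.assoc[symmetric] mult_1)
      with DERIV_cmult[OF d, of "- 1 / (s - 1)"] show ?thesis by (simp only:)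
    qed
  next
    have "((\<lambda>x::real. (1 + x) powr (1 - s)) \<longlongrightarrow> 0) at_top"
      by (rule tendsto_neg_powr[OF _ filterlim_tendsto_add_at_top[OF tendsto_const filterlim_ident]]) (use s in simp)
    then show "((\<lambda>x. (- 1 / (s - 1)) * (1 + x) powr (1 - s)) \<longlongrightarrow> 0) at_top"
      by (rule tendsto_mult_right_zero)
  qed simp_all
  moreover have "ennreal (norm (?f x)) = ennreal ((1 + x) powr (- s)) * indicator {0..} x" for x
    by (simp add: indicator_def)
  ultimately have "(\<integral>\<^sup>+x. ennreal (norm (?f x)) \<partial>lborel) < \<infinity>"
    by (simp only: ennreal_less_top infinity_ennreal_def)
  then have f: "integrable lborel ?f"
    by (rule integrableI_bounded[rotated]) simp
  have g: "integrable lborel (\<lambda>x. ?f (0 + (- 1) * x))"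
    by (rule lborel_integrable_real_affine[OF f]) simp
  have "norm ((1 + \<bar>x\<bar>) powr (- s)) \<le> norm (?f x + ?f (0 + (- 1) * x))" for x
  proof (cases "x \<ge> 0")
    case True
    then have "(1 + \<bar>x\<bar>) powr (- s) = ?f x" by simp
    moreover have "0 \<le> ?f (0 + (- 1) * x)" by simp
    ultimately show ?thesis by simp
  next
    case False
    then have "(1 + \<bar>x\<bar>) powr (- s) = ?f (0 + (- 1) * x)" "?f x = 0" by simp_all
    then show ?thesis by simp
  qed
  then show ?thesis
    by (intro Bochner_Integration.integrable_bound[OF Bochner_Integration.integrable_add[OF f g]] AE_I2) simp_all
qed

text \<open>With W = 1 + omega, write W^2 = W^(3/4) W^(5/4) and bound W below by X^2 / 2 in the
  first factor and by Y in the second. The resulting exponents 3/2 of X and 5/4 of Y both exceed 1,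
  so the majorant is a product of two integrable functions of one variable.\<close>

lemma sq_int_resolvent: "sq_int (\<lambda>\<zeta>. complex_of_real (1 / (1 + omega \<zeta>)))"
proof (rule sq_intI)
  let ?a = "\<lambda>x. complex_of_real ((1 + \<bar>x\<bar>) powr (- (3/2)))" and ?b = "\<lambda>x. complex_of_real ((1 + \<bar>x\<bar>) powr (- (5/4)))"
  have i: "integrable lborel (\<lambda>\<zeta>. 2 * (?a (fst \<zeta>) * ?b (snd \<zeta>)))"
    by (intro integrable_mult_right integrable_tensor(1)) (auto intro!: integrable_powr_line)
  show "integrable lborel (\<lambda>\<zeta>. (cmod (complex_of_real (1 / (1 + omega \<zeta>))))\<^sup>2)"
  proof (rule Bochner_Integration.integrable_bound[OF i])
    have "(1 / (1 + omega \<zeta>))\<^sup>2 \<le> 2 * ((1 + \<bar>fst \<zeta>\<bar>) powr (- (3/2)) * (1 + \<bar>snd \<zeta>\<bar>) powr (- (5/4)))" for \<zeta>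
    proof -
      define X where "X = 1 + \<bar>fst \<zeta>\<bar>"
      define Y where "Y = 1 + \<bar>snd \<zeta>\<bar>"
      define W where "W = 1 + omega \<zeta>"
      have X: "X \<ge> 1" and Y: "Y \<ge> 1" by (auto simp: X_def Y_def)
      have W1: "W \<ge> Y" by (simp add: W_def Y_def omega_def)
      have "X\<^sup>2 \<le> 2 * (1 + (fst \<zeta>)\<^sup>2)"
        using sum_squares_bound[of 1 "\<bar>fst \<zeta>\<bar>"] by (simp add: X_def power2_sum)
      also have "\<dots> \<le> 2 * W" by (simp add: W_def omega_def)
      finally have W2: "X\<^sup>2 / 2 \<le> W" by simp
      have "(1/2) * X powr (3/2) \<le> (1/2) powr (3/4) * X powr (3/2)"
      proof (rule mult_right_mono)
        have "(1/2::real) powr 1 \<le> (1/2) powr (3/4)" by (rule powr_mono') auto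
        then show "1/2 \<le> (1/2::real) powr (3/4)" by simp
      qed simp
      also have "\<dots> = (X\<^sup>2 / 2) powr (3/4)"
      proof -
        have "X\<^sup>2 / 2 = (1/2) * (X powr 2)" using X by simp
        then show ?thesis using X by (simp only: powr_mult powr_powr) simp
      qed
      also have "\<dots> \<le> W powr (3/4)" using W2 by (intro powr_mono2) auto
      finally have a: "(1/2) * X powr (3/2) \<le> W powr (3/4)" .
      have b: "Y powr (5/4) \<le> W powr (5/4)" using W1 Y by (intro powr_mono2) auto
      have "(1/2) * X powr (3/2) * Y powr (5/4) \<le> W powr (3/4) * W powr (5/4)"
        by (intro mult_mono a b) auto
      also have "\<dots> = W\<^sup>2" using W1 Y by (simp flip: powr_add)
      finally have le: "(1/2) * X powr (3/2) * Y powr (5/4) \<le> W\<^sup>2" .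
      have "(1 / W)\<^sup>2 = 1 / W\<^sup>2" by (simp add: power_divide)
      also have "\<dots> \<le> 1 / ((1/2) * X powr (3/2) * Y powr (5/4))"
        using X Y by (intro divide_left_mono le mult_pos_pos) (use W1 in auto)
      also have "\<dots> = 2 * (X powr (- (3/2)) * Y powr (- (5/4)))"
      proof -
        have "1 / ((1/2) * a * b) = 2 * (inverse a * inverse b)" for a b :: real by (simp add: divide_simps)
        then show ?thesis by (simp only: powr_minus)
      qed
      finally show ?thesis by (simp add: X_def Y_def W_def)
    qed
    then show "AE \<zeta> in lborel. norm ((cmod (complex_of_real (1 / (1 + omega \<zeta>))))\<^sup>2) \<le> norm (2 * (?a (fst \<zeta>) * ?b (snd \<zeta>)))"
      by (intro AE_I2) (simp only: norm_of_real norm_mult power2_abs real_norm_def abs_power2 norm_numeral abs_of_nonneg powr_ge_zero)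
  qed simp
qed simp

text \<open>\<open>FT f\<close> is the square integrable function 1 / (1 + omega) times
  \<open>FT f + l\<close>, hence integrable by Cauchy-Schwarz, and inversion then bounds
  \<open>f\<close>.\<close>

lemma Linfty_bound_of_om_rel:
  obtains C where "C > 0" "\<And>f l. om_rel (FT f) l \<Longrightarrow> AE z in lborel. cmod (rep_l2 f z) \<le> C * (norm (FT f) + norm l)"
proof -
  let ?r = "\<lambda>\<zeta>. complex_of_real (1 / (1 + omega \<zeta>))"
  define R where "R = sqrt (\<integral>\<zeta>. (cmod (?r \<zeta>))\<^sup>2 \<partial>lborel)"
  have R: "R \<ge> 0" by (simp add: R_def)
  have main: "AE z in lborel. cmod (rep_l2 f z) \<le> (R + 1) / (2 * pi)\<^sup>2 * (norm (FT f) + norm l)" if o: "om_rel (FT f) l" for f l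
  proof -
    define g where "g = absl (FT f + l)"
    have eq: "AE \<zeta> in lborel. rep_l2 (FT f) \<zeta> = ?r \<zeta> * rep_l2 (FT f + l) \<zeta>"
      using rep_plus[of "FT f" l] o[unfolded om_rel_def]
    proof eventually_elim
      case (elim \<zeta>)
      have "?r \<zeta> * (1 + complex_of_real (omega \<zeta>)) = complex_of_real (1 / (1 + omega \<zeta>) * (1 + omega \<zeta>))"
        by (simp only: of_real_mult of_real_add of_real_1)
      also have "\<dots> = 1" using omega_nonneg[of \<zeta>] by simp
      finally have r: "?r \<zeta> * (1 + complex_of_real (omega \<zeta>)) = 1" .
      have "?r \<zeta> * rep_l2 (FT f + l) \<zeta> = (?r \<zeta> * (1 + complex_of_real (omega \<zeta>))) * rep_l2 (FT f) \<zeta>"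
        unfolding elim by (simp only: distrib_left distrib_right mult_1 mult_1_right mult.assoc)
      then show ?case unfolding r by simp
    qed
    have int: "integrable lborel (\<lambda>\<zeta>. ?r \<zeta> * rep_l2 (FT f + l) \<zeta>)"
      by (rule sq_int_mult_integrable[OF sq_int_resolvent sq_int_rep])
    have intF: "integrable lborel (rep_l2 (FT f))"
      using int by (subst integrable_cong_AE[OF _ _ eq]) simp_all
    have "(\<integral>\<zeta>. cmod (rep_l2 (FT f) \<zeta>) \<partial>lborel) \<le> R * norm (FT f + l)"
    proof -
      have "complex_of_real (\<integral>\<zeta>. cmod (rep_l2 (FT f) \<zeta>) \<partial>lborel) = (\<integral>\<zeta>. ?r \<zeta> * rep_l2 g \<zeta> \<partial>lborel)"
        unfolding integral_complex_of_real[symmetric]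
      proof (rule integral_cong_AE)
        show "AE \<zeta> in lborel. complex_of_real (cmod (rep_l2 (FT f) \<zeta>)) = ?r \<zeta> * rep_l2 g \<zeta>"
          using eq rep_absl[of "FT f + l"]
        proof eventually_elim
          case (elim \<zeta>)
          have "cmod (?r \<zeta>) = 1 / (1 + omega \<zeta>)" using omega_nonneg[of \<zeta>] by (simp only: norm_of_real) simp
          then show ?case unfolding elim(1) g_def elim(2) norm_mult of_real_mult by (simp only:)
        qed
      qed simp_all
      from arg_cong[OF this, of cmod]
      have "\<bar>\<integral>\<zeta>. cmod (rep_l2 (FT f) \<zeta>) \<partial>lborel\<bar> = cmod (\<integral>\<zeta>. ?r \<zeta> * rep_l2 g \<zeta> \<partial>lborel)"
        by (simp only: norm_of_real)
      also have "\<dots> \<le> R * sqrt (\<integral>\<zeta>. (cmod (rep_l2 g \<zeta>))\<^sup>2 \<partial>lborel)"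
        unfolding R_def by (rule sq_int_cauchy_schwarz[OF sq_int_resolvent sq_int_rep])
      also have "sqrt (\<integral>\<zeta>. (cmod (rep_l2 g \<zeta>))\<^sup>2 \<partial>lborel) = norm g"
        unfolding norm_l2_sq[symmetric] by simp
      finally show ?thesis by (simp add: g_def)
    qed
    also have "\<dots> \<le> (R + 1) * (norm (FT f) + norm l)"
      using R by (intro mult_mono norm_triangle_ineq) auto
    finally have le: "(\<integral>\<zeta>. cmod (rep_l2 (FT f) \<zeta>) \<partial>lborel) / (2 * pi)\<^sup>2 \<le> (R + 1) / (2 * pi)\<^sup>2 * (norm (FT f) + norm l)"
      by (simp add: divide_right_mono)
    show ?thesis
      using AE_bound_of_integrable_FT[OF intF] by eventually_elim (use le in linarith)
  qed
  have "(R + 1) / (2 * pi)\<^sup>2 > 0" using R by (intro divide_pos_pos) auto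
  then show thesis by (rule that) (rule main)
qed

subsection \<open>Perturbation by small dispersion\<close>

lemma flow_tendsto:
  assumes r: "(r \<longlongrightarrow> r0) F" and V: "(V \<longlongrightarrow> v) F"
  shows "((\<lambda>s. flow (r s) (V s)) \<longlongrightarrow> flow r0 v) F"
proof -
  have "isCont (\<lambda>t. flow t v) r0"
    using flow_continuous[of UNIV v] by (simp add: continuous_on_eq_continuous_at)
  then have 1: "((\<lambda>s. flow (r s) v) \<longlongrightarrow> flow r0 v) F"
    by (rule isCont_tendsto_compose[OF _ r])
  have "((\<lambda>s. norm (V s - v)) \<longlongrightarrow> norm (v - v)) F"
    by (rule tendsto_norm[OF tendsto_diff[OF V tendsto_const]])
  then have "((\<lambda>s. norm (flow (r s) (V s - v))) \<longlongrightarrow> 0) F" by simp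
  then have "((\<lambda>s. flow (r s) (V s - v)) \<longlongrightarrow> 0) F" by (rule tendsto_norm_zero_cancel)
  from tendsto_add[OF this 1] show ?thesis by (simp add: flow_diff)
qed

lemma flow_continuous_on:
  assumes r: "continuous_on A r" and V: "continuous_on A V"
  shows "continuous_on A (\<lambda>s. flow (r s) (V s))"
  using assms unfolding continuous_on_def by (simp add: flow_tendsto)

lemma nem_continuous_on:
  assumes q: "q \<ge> 2" and M: "M > 0" and V: "continuous_on A V"
  shows "continuous_on A (\<lambda>s. nem q M (V s))"
proof (rule continuous_on_compose2[OF _ V subset_UNIV])
  show "continuous_on UNIV (nem q M)"
  proof (intro lipschitz_on_continuous_on lipschitz_onI)
    show "0 \<le> (1 + q) * M powr q" using q by simp
    show "dist (nem q M f) (nem q M g) \<le> ((1 + q) * M powr q) * dist f g" for f g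
      using nem_lipschitz[OF q M] by (simp add: dist_norm)
  qed
qed

lemma FT_diff: "FT (f - g) = FT f - FT g"
  by (rule linear_diff[OF bounded_linear.linear[OF bounded_linear_FT]])

lemma iFT_diff: "iFT (f - g) = iFT f - iFT g"
  by (rule linear_diff[OF bounded_linear.linear[OF bounded_linear_iFT]])

lemma cmul_diff: "cmul c (f - g) = cmul c f - cmul c g"
  by (rule linear_diff[OF bounded_linear.linear[OF bounded_linear_cmul]])

lemma cmul_abs: 
  assumes "sq_int h" shows "cmul c (abs_l2 h) = abs_l2 (\<lambda>z. c * h z)"
  by (rule l2_eqI) (use rep_cmul[of c "abs_l2 h"] rep_abs[OF assms] rep_abs[OF sq_int_cmult[OF assms, of c]] in \<open>eventually_elim, simp\<close>)

text \<open>\<open>FT\<close> was built as a real-linear operator; complex homogeneity holds on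
  truncations and extends by density.\<close>

lemma FT_cmul: "FT (cmul c f) = cmul c (FT f)"
proof (rule LIMSEQ_unique)
  let ?T = "\<lambda>n. trunc (real n) (rep_l2 f)"
  show "(\<lambda>n. FT (cmul c (abs_l2 (?T n)))) \<longlonglongrightarrow> FT (cmul c f)"
    by (rule bounded_linear.tendsto[OF bounded_linear_FT bounded_linear.tendsto[OF bounded_linear_cmul trunc_tendsto_seq]])
  have "FT (cmul c (abs_l2 (?T n))) = cmul c (FT (abs_l2 (?T n)))" for n
  proof -
    note i = integrable_trunc[OF sq_int_rep[of f], of "real n"] sq_int_trunc[OF sq_int_rep[of f], of "real n"]
    have ic: "integrable lborel (\<lambda>z. c * ?T n z)" "sq_int (\<lambda>z. c * ?T n z)"
      using i sq_int_cmult[OF i(2)] by simp_all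
    have "fourier1 (\<lambda>z. c * ?T n z) = (\<lambda>\<zeta>. c * fourier1 (?T n) \<zeta>)" by (rule ext, rule fourier1_cmult)
    then show ?thesis unfolding cmul_abs[OF i(2)] FT_abs[OF ic] FT_abs[OF i] cmul_abs[OF plancherel(1)[OF i]] by simp
  qed
  then show "(\<lambda>n. FT (cmul c (abs_l2 (?T n)))) \<longlonglongrightarrow> cmul c (FT f)"
    using bounded_linear.tendsto[OF bounded_linear_cmul[of c] bounded_linear.tendsto[OF bounded_linear_FT trunc_tendsto_seq[of f]]]
    by (simp only:)
qed

lemmas FT_continuous_on = bounded_linear.continuous_on[OF bounded_linear_FT]
lemmas iFT_continuous_on = bounded_linear.continuous_on[OF bounded_linear_iFT]
lemmas cmul_continuous_on = bounded_linear.continuous_on[OF bounded_linear_cmul]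

lemma integral_shift_interval:
  fixes f :: "real \<Rightarrow> 'a::banach"
  assumes f: "continuous_on {0..t + h} f" and t: "0 \<le> t" "0 \<le> h"
  shows "integral {0..t + h} f = integral {0..h} f + integral {0..t} (\<lambda>s. f (s + h))"
proof -
  let ?G = "\<lambda>u. integral {0..u} f"
  have "((\<lambda>s. f (s + h)) has_integral ?G (t + h) - ?G (0 + h)) {0..t}"
  proof (rule fundamental_theorem_of_calculus[OF t(1)])
    fix s assume s: "s \<in> {0..t}"
    have G: "(?G has_vector_derivative f (s + h)) (at (s + h) within {0..t + h})"
      by (rule integral_has_vector_derivative[OF f]) (use s t in auto)
    have sub: "(\<lambda>s. s + h) ` {0..t} \<subseteq> {0..t + h}" using t by auto
    have "((\<lambda>s. s + h) has_vector_derivative 1) (at s within {0..t})"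
      by (auto intro!: derivative_eq_intros)
    from vector_diff_chain_within[OF this has_vector_derivative_within_subset[OF G sub]]
    show "((\<lambda>s. ?G (s + h)) has_vector_derivative f (s + h)) (at s within {0..t})"
      by (simp add: o_def)
  qed
  then show ?thesis by (simp add: integral_unique)
qed

text \<open>The bound on \<open>omega * FT (v - z)\<close> comes from comparing \<open>v - z\<close> with its own time translates.\<close>

proposition dispersion_perturbation:
  fixes q A B T \<mu> :: real
  assumes q: "q \<ge> 2" and A: "A > 0" and B: "B \<ge> 0" and T: "T > 0"
  obtains C where "C > 0"
    "\<And>\<eta> z L. 0 \<le> \<eta> \<Longrightarrow>
      (\<And>s. s \<in> {0..T + 1} \<Longrightarrow> om_rel (FT (z s)) (L s)) \<Longrightarrow>
      (\<And>s. s \<in> {0..T + 1} \<Longrightarrow> (z has_vector_derivative cmul (- \<i> * \<mu>) (nem q (A + 1) (z s))) (at s within {0..T + 1})) \<Longrightarrow>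
      (\<And>s. s \<in> {0..T + 1} \<Longrightarrow> AE x in lborel. cmod (rep_l2 (z s) x) \<le> A) \<Longrightarrow>
      (\<And>s s'. s \<in> {0..T + 1} \<Longrightarrow> s' \<in> {0..T + 1} \<Longrightarrow> AE x in lborel. cmod (rep_l2 (z s') x - rep_l2 (z s) x) \<le> B * \<bar>s' - s\<bar>) \<Longrightarrow>
      (\<And>s. s \<in> {0..T + 1} \<Longrightarrow> norm (L s) \<le> \<eta>) \<Longrightarrow>
      (\<And>s s'. s \<in> {0..T + 1} \<Longrightarrow> s' \<in> {0..T + 1} \<Longrightarrow> norm (L s' - L s) \<le> \<eta> * \<bar>s' - s\<bar>) \<Longrightarrow>
      \<exists>v. v 0 = z 0 \<and> continuous_on {0..T + 1} v \<and>
        (\<forall>t\<in>{0..T + 1}. flow t (FT (v t)) = FT (z 0) + integral {0..t} (\<lambda>s. cmul (- \<i> * \<mu>) (flow s (FT (nem q (A + 1) (v s)))))) \<and>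
        (\<forall>t\<in>{0..T}. norm (v t - z t) \<le> C * \<eta> \<and> (\<exists>l. om_rel (FT (v t - z t)) l \<and> norm l \<le> C * \<eta>))"
proof -
  define M where "M = A + 1"
  \<comment> \<open>Translates by times h <= 1 are compared on [0, T], so everything is run one unit
    longer.\<close>
  define T1 where "T1 = T + 1"
  define N where "N = nem q M"
  define c where "c = - \<i> * complex_of_real \<mu>"
  have M: "M > 0" using A by (simp add: M_def)
  have T1: "T1 > 0" using T by (simp add: T1_def)
  have cm: "cmod c = \<bar>\<mu>\<bar>" by (simp add: c_def norm_mult)
  obtain K' L' where KL: "K' > 0" "L' > 0"
    "\<And>a a' b b' B. AE z in lborel. cmod (rep_l2 b z) \<le> A \<Longrightarrow> AE z in lborel. cmod (rep_l2 b' z) \<le> A \<Longrightarrow> B \<ge> 0 \<Longrightarrow>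
      AE z in lborel. cmod (rep_l2 b' z - rep_l2 b z) \<le> B \<Longrightarrow>
      norm (nem q (A + 1) a' - nem q (A + 1) a - (nem q (A + 1) b' - nem q (A + 1) b))
       \<le> K' * norm ((a' - a) - (b' - b)) + L' * B * (norm (a - b) + norm (a' - b'))"
    using nem_second_difference[OF q A] by blast
  \<comment> \<open>A single Gronwall constant, both for the difference of the solutions and for its
    time increments; the summand 1 keeps it positive.\<close>
  define K where "K = \<bar>\<mu>\<bar> * ((1 + q) * M powr q) + \<bar>\<mu>\<bar> * K' + 1"
  have Kn: "0 \<le> \<bar>\<mu>\<bar> * ((1 + q) * M powr q)" "0 \<le> \<bar>\<mu>\<bar> * K'" using q KL(1) by simp_all
  then have K: "K > 0" and Kle: "\<bar>\<mu>\<bar> * ((1 + q) * M powr q) \<le> K" "\<bar>\<mu>\<bar> * K' \<le> K" unfolding K_def by linarith+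
  \<comment> \<open>\<open>C1\<close> will bound \<open>W\<close>, \<open>C2\<close> its time
    derivative, \<open>C3\<close> the source in the inequality for the increments \<open>D\<close>,
    and \<open>C4\<close> these increments themselves, each up to the factor \<eta>, and for the
    last two also h.\<close>
  define C1 where "C1 = 2 * T1 * exp (2 * K * T1)"
  define C2 where "C2 = 1 + K * C1"
  define C3 where "C3 = C2 + (\<bar>\<mu>\<bar> * L' * B * (2 * C1) + 1) * T1"
  define C4 where "C4 = 2 * C3 * exp (2 * K * T1)"
  have C1: "C1 > 0" using T1 by (simp add: C1_def)
  then have C2: "C2 > 0" using K by (simp add: C2_def add_pos_pos)
  have C3: "C3 > 0" unfolding C3_def using C2 C1 T1 B KL(2) by (intro add_pos_nonneg mult_nonneg_nonneg add_nonneg_nonneg) auto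
  then have C4: "C4 > 0" by (simp add: C4_def)
  define C where "C = C1 + C4 + C2"
  have Cpos: "C > 0" using C1 C2 C4 by (simp add: C_def)
  have main: "\<exists>v. v 0 = z 0 \<and> continuous_on {0..T1} v \<and>
        (\<forall>t\<in>{0..T1}. flow t (FT (v t)) = FT (z 0) + integral {0..t} (\<lambda>s. cmul c (flow s (FT (N (v s)))))) \<and>
        (\<forall>t\<in>{0..T}. norm (v t - z t) \<le> C * \<eta> \<and> (\<exists>l. om_rel (FT (v t - z t)) l \<and> norm l \<le> C * \<eta>))"
    if \<eta>: "0 \<le> \<eta>" and h1: "\<And>s. s \<in> {0..T1} \<Longrightarrow> om_rel (FT (z s)) (L s)"
      and h2: "\<And>s. s \<in> {0..T1} \<Longrightarrow> (z has_vector_derivative cmul c (N (z s))) (at s within {0..T1})"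
      and h3: "\<And>s. s \<in> {0..T1} \<Longrightarrow> AE x in lborel. cmod (rep_l2 (z s) x) \<le> A"
      and h4: "\<And>s s'. s \<in> {0..T1} \<Longrightarrow> s' \<in> {0..T1} \<Longrightarrow> AE x in lborel. cmod (rep_l2 (z s') x - rep_l2 (z s) x) \<le> B * \<bar>s' - s\<bar>"
      and h5: "\<And>s. s \<in> {0..T1} \<Longrightarrow> norm (L s) \<le> \<eta>"
      and h6: "\<And>s s'. s \<in> {0..T1} \<Longrightarrow> s' \<in> {0..T1} \<Longrightarrow> norm (L s' - L s) \<le> \<eta> * \<bar>s' - s\<bar>"
    for \<eta> z L
  proof -
    \<comment> \<open>The equation in the interaction picture: the unbounded symbol has disappeared
      into isometries, and the field is globally Lipschitz in L2.\<close>
    define F where "F s V = cmul c (flow s (FT (N (iFT (flow (- s) V)))))" for s V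
    have contN: "continuous_on S (\<lambda>s. N (V s))" if "continuous_on S V" for S and V :: "real \<Rightarrow> l2"
      unfolding N_def by (rule nem_continuous_on[OF q M that])
    have contF: "continuous_on {0..T1} (\<lambda>s. F s (V s))" if "continuous_on {0..T1} V" for V
        unfolding F_def
        by (rule cmul_continuous_on, rule flow_continuous_on[OF continuous_on_id], rule FT_continuous_on, rule contN,
            rule iFT_continuous_on, rule flow_continuous_on[OF continuous_on_minus[OF continuous_on_id] that])
    have lipF: "norm (F s x - F s y) \<le> K * norm (x - y)" for s x y
      proof -
        have "norm (F s x - F s y) = norm (cmul c (flow s (FT (N (iFT (flow (- s) x)) - N (iFT (flow (- s) y))))))"
          by (simp only: F_def FT_diff flow_diff cmul_diff)
        also have "\<dots> \<le> \<bar>\<mu>\<bar> * (2 * pi * norm (N (iFT (flow (- s) x)) - N (iFT (flow (- s) y))))"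
          using norm_cmul_le[of c "flow s (FT (N (iFT (flow (- s) x)) - N (iFT (flow (- s) y))))"] by (simp only: cm norm_flow norm_FT)
        also have "\<dots> \<le> \<bar>\<mu>\<bar> * (2 * pi * (((1 + q) * M powr q) * norm (iFT (flow (- s) x) - iFT (flow (- s) y))))"
          unfolding N_def by (intro mult_left_mono nem_lipschitz[OF q M]) auto
        also have "norm (iFT (flow (- s) x) - iFT (flow (- s) y)) = norm (x - y) / (2 * pi)"
          unfolding iFT_diff[symmetric] flow_diff[symmetric] norm_iFT norm_flow ..
        also have "\<bar>\<mu>\<bar> * (2 * pi * (((1 + q) * M powr q) * (norm (x - y) / (2 * pi)))) = (\<bar>\<mu>\<bar> * ((1 + q) * M powr q)) * norm (x - y)"
          by simp
        also have "\<dots> \<le> K * norm (x - y)" by (rule mult_right_mono[OF Kle(1)]) simp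
        finally show ?thesis .
      qed
    have "\<exists>V. continuous_on {0..T1} V \<and> (\<forall>t\<in>{0..T1}. V t = FT (z 0) + integral {0..t} (\<lambda>s. F s (V s)))"
      by (rule ode_exists[OF T1 K contF lipF])
    then obtain V where V: "continuous_on {0..T1} V" "\<And>t. t \<in> {0..T1} \<Longrightarrow> V t = FT (z 0) + integral {0..t} (\<lambda>s. F s (V s))"
      by blast
    define v where "v t = iFT (flow (- t) (V t))" for t
    have fv: "flow t (FT (v t)) = V t" for t by (simp add: v_def flow_flow)
    have contv: "continuous_on {0..T1} v"
      unfolding v_def by (rule iFT_continuous_on, rule flow_continuous_on[OF continuous_on_minus[OF continuous_on_id] V(1)])
    have FV: "F s (V s) = cmul c (flow s (FT (N (v s))))" for s by (simp only: F_def v_def)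
    \<comment> \<open>\<open>flow s (g s)\<close> is the time derivative of \<open>W\<close>; the
      term with \<open>L\<close> is the dispersion that the profile ignores.\<close>
    define g where "g s = cmul c (FT (N (v s) - N (z s))) - cmul \<i> (L s)" for s
    have contz: "continuous_on {0..T1} z"
      using h2 by (rule continuous_on_vector_derivative)
    have contL: "continuous_on {0..T1} L"
    proof (rule lipschitz_on_continuous_on[OF lipschitz_onI])
      show "dist (L x) (L y) \<le> \<eta> * dist x y" if "x \<in> {0..T1}" "y \<in> {0..T1}" for x y
        using h6[OF that(2,1)] by (simp add: dist_norm)
    qed (rule \<eta>)
    have contg: "continuous_on {0..T1} g"
      unfolding g_def
      by (rule continuous_on_diff[OF cmul_continuous_on[OF FT_continuous_on[OF continuous_on_diff[OF contN[OF contv] contN[OF contz]]]] cmul_continuous_on[OF contL]])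
    have contfg: "continuous_on {0..T1} (\<lambda>s. flow s (g s))"
      by (rule flow_continuous_on[OF continuous_on_id contg])
    define W where "W t = V t - flow t (FT (z t))" for t
    have W_int: "W t = integral {0..t} (\<lambda>s. flow s (g s))" if t: "t \<in> {0..T1}" for t
    proof -
      have sub: "{0..t} \<subseteq> {0..T1}" using t by auto
      \<comment> \<open>The profile is differentiated in the interaction picture; for this
        \<open>FT (z s)\<close> has to lie in the domain of \<open>omega\<close>.\<close>
      have "((\<lambda>s. flow s (FT (cmul c (N (z s))) + cmul \<i> (L s))) has_integral flow t (FT (z t)) - flow 0 (FT (z 0))) {0..t}"
      proof (rule fundamental_theorem_of_calculus)
        show "0 \<le> t" using t by simp
        fix s assume s: "s \<in> {0..t}"
        then have s1: "s \<in> {0..T1}" using sub by auto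
        have "((\<lambda>s. FT (z s)) has_vector_derivative FT (cmul c (N (z s)))) (at s within {0..t})"
          by (rule bounded_linear.has_vector_derivative[OF bounded_linear_FT has_vector_derivative_within_subset[OF h2[OF s1] sub]])
        then show "((\<lambda>s. flow s (FT (z s))) has_vector_derivative flow s (FT (cmul c (N (z s))) + cmul \<i> (L s))) (at s within {0..t})"
          by (rule flow_product_derivative[where z = "\<lambda>s. FT (z s)", OF _ h1[OF s1]])
      qed
      then have Z: "integral {0..t} (\<lambda>s. flow s (FT (cmul c (N (z s))) + cmul \<i> (L s))) = flow t (FT (z t)) - FT (z 0)"
        and Zi: "(\<lambda>s. flow s (FT (cmul c (N (z s))) + cmul \<i> (L s))) integrable_on {0..t}"
        by (simp_all add: integral_unique has_integral_integrable)
      have Fi: "(\<lambda>s. cmul c (flow s (FT (N (v s))))) integrable_on {0..t}"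
        by (rule integrable_continuous_real, rule continuous_on_subset[OF _ sub], rule cmul_continuous_on,
            rule flow_continuous_on[OF continuous_on_id], rule FT_continuous_on, rule contN[OF contv])
      have "flow s (g s) = cmul c (flow s (FT (N (v s)))) - flow s (FT (cmul c (N (z s))) + cmul \<i> (L s))" for s
        unfolding g_def FT_diff cmul_diff FT_cmul flow_diff flow_add flow_cmul by simp
      then have "integral {0..t} (\<lambda>s. flow s (g s)) = integral {0..t} (\<lambda>s. cmul c (flow s (FT (N (v s))))) - (flow t (FT (z t)) - FT (z 0))"
        unfolding Z[symmetric] by (simp only: Henstock_Kurzweil_Integration.integral_diff[OF Fi Zi])
      then show ?thesis unfolding W_def V(2)[OF t] FV by simp
    qed
    define w where "w t = v t - z t" for t
    have fw: "flow t (FT (w t)) = W t" for t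
      by (simp only: w_def FT_diff flow_diff fv W_def)
    have nw: "norm (W t) = 2 * pi * norm (w t)" for t
      unfolding fw[symmetric] by (simp only: norm_flow norm_FT)
    have ncmul: "norm (cmul c (FT f)) \<le> \<bar>\<mu>\<bar> * (2 * pi * norm f)" for f
      using norm_cmul_le[of c "FT f"] by (simp only: cm norm_FT)
    have nci: "norm (cmul \<i> f) \<le> norm f" for f using norm_cmul_le[of \<i> f] by simp
    have ng: "norm (g s) \<le> \<eta> + K * norm (W s)" if s: "s \<in> {0..T1}" for s
    proof -
      have "norm (g s) \<le> norm (cmul c (FT (N (v s) - N (z s)))) + norm (cmul \<i> (L s))"
        unfolding g_def by (rule norm_triangle_ineq4)
      also have "\<dots> \<le> \<bar>\<mu>\<bar> * (2 * pi * norm (N (v s) - N (z s))) + \<eta>"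
        by (intro add_mono ncmul order_trans[OF nci h5[OF s]])
      also have "\<dots> \<le> \<bar>\<mu>\<bar> * (2 * pi * (((1 + q) * M powr q) * norm (w s))) + \<eta>"
        unfolding w_def N_def by (intro add_right_mono mult_left_mono nem_lipschitz[OF q M]) auto
      also have "\<dots> = (\<bar>\<mu>\<bar> * ((1 + q) * M powr q)) * norm (W s) + \<eta>" unfolding nw by simp
      also have "\<dots> \<le> K * norm (W s) + \<eta>" by (intro add_right_mono mult_right_mono Kle(1)) simp
      finally show ?thesis by simp
    qed
    have contW: "continuous_on {0..T1} W"
      unfolding W_def by (rule continuous_on_diff[OF V(1) flow_continuous_on[OF continuous_on_id FT_continuous_on[OF contz]]])
    have W1: "norm (W t) \<le> C1 * \<eta>" if t: "t \<in> {0..T1}" for t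
    proof -
      have le: "norm (W t) \<le> \<eta> * T1 + K * integral {0..t} (\<lambda>s. norm (W s))" if t: "t \<in> {0..T1}" for t
      proof -
        have sub: "{0..t} \<subseteq> {0..T1}" using t by auto
        have ci: "(\<lambda>s. norm (W s)) integrable_on {0..t}"
          by (rule integrable_continuous_real[OF continuous_on_norm[OF continuous_on_subset[OF contW sub]]])
        have "norm (W t) \<le> integral {0..t} (\<lambda>s. \<eta> + K * norm (W s))"
          unfolding W_int[OF t]
        proof (rule integral_norm_bound_integral)
          show "(\<lambda>s. flow s (g s)) integrable_on {0..t}"
            by (rule integrable_continuous_real[OF continuous_on_subset[OF contfg sub]])
          show "(\<lambda>s. \<eta> + K * norm (W s)) integrable_on {0..t}"
            by (intro integrable_add integrable_const_ivl integrable_on_mult_right ci)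
          show "norm (flow s (g s)) \<le> \<eta> + K * norm (W s)" if "s \<in> {0..t}" for s
            using ng[of s] that sub by auto
        qed
        also have "\<dots> = \<eta> * t + K * integral {0..t} (\<lambda>s. norm (W s))"
          using t by (subst Henstock_Kurzweil_Integration.integral_add) (auto intro: ci integrable_on_mult_right)
        also have "\<dots> \<le> \<eta> * T1 + K * integral {0..t} (\<lambda>s. norm (W s))"
          using t \<eta> by (intro add_right_mono mult_left_mono) auto
        finally show ?thesis .
      qed
      have "norm (W t) \<le> 2 * (\<eta> * T1) * exp (2 * K * t)"
        by (rule gronwall[OF T1 K _ continuous_on_norm[OF contW] le t]) (use \<eta> T1 in simp)
      also have "\<dots> \<le> 2 * (\<eta> * T1) * exp (2 * K * T1)"
        using \<eta> T1 K t by (intro mult_left_mono) auto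
      finally show ?thesis by (simp add: C1_def mult_ac)
    qed
    have g2: "norm (g s) \<le> C2 * \<eta>" if s: "s \<in> {0..T1}" for s
    proof -
      have "norm (g s) \<le> \<eta> + K * (C1 * \<eta>)"
        using ng[OF s] mult_left_mono[OF W1[OF s], of K] K by linarith
      then show ?thesis by (simp add: C2_def algebra_simps)
    qed
    have W2: "norm (W (t + h) - W t) \<le> h * (C2 * \<eta>)" if t: "0 \<le> t" "0 \<le> h" "t + h \<le> T1" for t h
    proof -
      have "W (t + h) - W t = integral {0..h} (\<lambda>s. flow (s + t) (g (s + t)))"
      proof -
        have "continuous_on {0..h + t} (\<lambda>s. flow s (g s))" by (rule continuous_on_subset[OF contfg]) (use t in auto)
        from integral_shift_interval[OF this t(2,1)]
        show ?thesis using W_int[of "t + h"] W_int[of t] t by (simp add: add.commute)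
      qed
      also have "norm \<dots> \<le> integral {0..h} (\<lambda>s. C2 * \<eta>)"
      proof (rule integral_norm_bound_integral)
        show "(\<lambda>s. flow (s + t) (g (s + t))) integrable_on {0..h}"
          by (rule integrable_continuous_real, rule continuous_on_compose2[OF contfg]) (use t in \<open>auto intro!: continuous_intros\<close>)
        show "norm (flow (s + t) (g (s + t))) \<le> C2 * \<eta>" if "s \<in> {0..h}" for s
          using g2[of "s + t"] that t by simp
      qed (rule integrable_const_ivl)
      also have "\<dots> = h * (C2 * \<eta>)" using t by simp
      finally show ?thesis .
    qed
    \<comment> \<open>This equals \<open>flow t (FT (w (t + h) - w t))\<close>, so its norm measures
      a time increment of w itself, whereas increments of \<open>W\<close> also contain the action
      of the flow.\<close>
    define D where "D h t = flow (- h) (W (t + h)) - W t" for h t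
    have D_bound: "norm (D h t) \<le> C4 * \<eta> * h" if t: "t \<in> {0..T}" and h: "0 < h" "h \<le> 1" for t h
    proof -
      have in1: "s \<in> {0..T1}" "s + h \<in> {0..T1}" if "s \<in> {0..T}" for s
        using that h by (auto simp: T1_def)
      have contgh: "continuous_on {0..T} (\<lambda>s. g (s + h))"
        by (rule continuous_on_compose2[OF contg]) (use in1 h in \<open>auto intro!: continuous_intros\<close>)
      have contg0: "continuous_on {0..T} g"
        by (rule continuous_on_subset[OF contg]) (auto simp: T1_def)
      have contWh: "continuous_on {0..T} (\<lambda>s. W (s + h))"
        by (rule continuous_on_compose2[OF contW]) (use in1 h in \<open>auto intro!: continuous_intros\<close>)
      have contW0: "continuous_on {0..T} W"
        by (rule continuous_on_subset[OF contW]) (auto simp: T1_def)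
      have contD: "continuous_on {0..T} (D h)"
        unfolding D_def by (rule continuous_on_diff[OF flow_continuous_on[OF continuous_on_const contWh] contW0])
      have le: "norm (D h t) \<le> C3 * \<eta> * h + K * integral {0..t} (\<lambda>s. norm (D h s))" if t: "t \<in> {0..T}" for t
      proof -
        have sub: "{0..t} \<subseteq> {0..T}" using t by auto
        have ci: "(\<lambda>s. norm (D h s)) integrable_on {0..t}"
          by (rule integrable_continuous_real[OF continuous_on_norm[OF continuous_on_subset[OF contD sub]]])
        have c2: "continuous_on {0..t + h} (\<lambda>s. flow s (g s))" by (rule continuous_on_subset[OF contfg]) (use in1[OF t] in auto)
        have i1: "(\<lambda>s. flow s (g (s + h))) integrable_on {0..t}"
          by (rule integrable_continuous_real[OF continuous_on_subset[OF flow_continuous_on[OF continuous_on_id contgh] sub]])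
        have i2: "(\<lambda>s. flow s (g s)) integrable_on {0..t}"
          by (rule integrable_continuous_real[OF continuous_on_subset[OF flow_continuous_on[OF continuous_on_id contg0] sub]])
        have i3: "(\<lambda>s. flow (s + h) (g (s + h))) integrable_on {0..t}"
          by (rule integrable_continuous_real[OF continuous_on_subset[OF flow_continuous_on[OF _ contgh] sub]]) (intro continuous_intros)
        have "W (t + h) = W h + integral {0..t} (\<lambda>s. flow (s + h) (g (s + h)))"
          using integral_shift_interval[OF c2] W_int[of "t + h"] W_int[of h] in1[OF t] t h by simp
        \<comment> \<open>Applying \<open>flow (- h)\<close> realigns the shifted integrand, so that
          g at the times s + h and s is compared under the same \<open>flow s\<close>.\<close>
        then have "flow (- h) (W (t + h)) = flow (- h) (W h) + integral {0..t} (\<lambda>s. flow (- h) (flow (s + h) (g (s + h))))"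
          using integral_linear[OF i3 bounded_linear_flow[of "- h"]] by (simp add: flow_add o_def)
        then have "flow (- h) (W (t + h)) = flow (- h) (W h) + integral {0..t} (\<lambda>s. flow s (g (s + h)))"
          by (simp add: flow_flow)
        moreover have "integral {0..t} (\<lambda>s. flow s (g (s + h))) - integral {0..t} (\<lambda>s. flow s (g s)) = integral {0..t} (\<lambda>s. flow s (g (s + h) - g s))"
          unfolding flow_diff by (rule Henstock_Kurzweil_Integration.integral_diff[OF i1 i2, symmetric])
        ultimately have D_eq: "D h t = flow (- h) (W h) + integral {0..t} (\<lambda>s. flow s (g (s + h) - g s))"
          unfolding D_def using W_int[OF in1(1)[OF t]] by simp
        have dg: "norm (g (s + h) - g s) \<le> (\<bar>\<mu>\<bar> * L' * B * (2 * C1) + 1) * \<eta> * h + K * norm (D h s)" if s: "s \<in> {0..T}" for s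
        proof -
          note s1 = in1[OF s]
          have "g (s + h) - g s = cmul c (FT ((N (v (s + h)) - N (v s)) - (N (z (s + h)) - N (z s)))) - cmul \<i> (L (s + h) - L s)"
            unfolding g_def FT_diff cmul_diff by simp
          then have "norm (g (s + h) - g s) \<le> norm (cmul c (FT ((N (v (s + h)) - N (v s)) - (N (z (s + h)) - N (z s))))) + norm (cmul \<i> (L (s + h) - L s))"
            by (simp only: norm_triangle_ineq4)
          also have "\<dots> \<le> \<bar>\<mu>\<bar> * (2 * pi * norm ((N (v (s + h)) - N (v s)) - (N (z (s + h)) - N (z s)))) + \<eta> * h"
            using order_trans[OF nci h6[OF s1]] h by (intro add_mono ncmul) simp
          also have "norm ((N (v (s + h)) - N (v s)) - (N (z (s + h)) - N (z s)))
              \<le> K' * norm ((v (s + h) - v s) - (z (s + h) - z s)) + L' * (B * h) * (norm (v s - z s) + norm (v (s + h) - z (s + h)))"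
            unfolding N_def M_def
          proof (rule KL(3)[OF h3[OF s1(1)] h3[OF s1(2)]])
            show "0 \<le> B * h" using B h by simp
            show "AE x in lborel. cmod (rep_l2 (z (s + h)) x - rep_l2 (z s) x) \<le> B * h"
              using h4[OF s1] h by simp
          qed
          also have "(v (s + h) - v s) - (z (s + h) - z s) = w (s + h) - w s" by (simp add: w_def)
          also have "norm (w (s + h) - w s) = norm (D h s) / (2 * pi)"
          proof -
            have "D h s = flow s (FT (w (s + h) - w s))"
              unfolding D_def fw[symmetric] flow_flow FT_diff flow_diff by simp
            then show ?thesis by (simp add: norm_FT)
          qed
          also have "v s - z s = w s" by (simp add: w_def)
          also have "v (s + h) - z (s + h) = w (s + h)" by (simp add: w_def)
          finally have "norm (g (s + h) - g s) \<le> \<bar>\<mu>\<bar> * (2 * pi * (K' * (norm (D h s) / (2 * pi)) + L' * (B * h) * (norm (w s) + norm (w (s + h))))) + \<eta> * h"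
            by (simp add: mult_left_mono)
          also have "\<dots> = (\<bar>\<mu>\<bar> * K') * norm (D h s) + \<bar>\<mu>\<bar> * L' * B * h * (norm (W s) + norm (W (s + h))) + \<eta> * h"
            unfolding nw by (simp add: field_simps)
          also have "\<dots> \<le> K * norm (D h s) + \<bar>\<mu>\<bar> * L' * B * h * (C1 * \<eta> + C1 * \<eta>) + \<eta> * h"
            using Kle(2) B KL(2) h W1[OF s1(1)] W1[OF s1(2)]
            by (intro add_mono mult_right_mono mult_left_mono order_refl) auto
          also have "\<dots> = (\<bar>\<mu>\<bar> * L' * B * (2 * C1) + 1) * \<eta> * h + K * norm (D h s)"
            by (simp add: algebra_simps)
          finally show ?thesis .
        qed
        define k where "k = (\<bar>\<mu>\<bar> * L' * B * (2 * C1) + 1) * \<eta> * h"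
        have k: "k \<ge> 0" unfolding k_def using B KL(2) C1 \<eta> h by (intro mult_nonneg_nonneg add_nonneg_nonneg) auto
        have "norm (D h t) \<le> norm (flow (- h) (W h)) + norm (integral {0..t} (\<lambda>s. flow s (g (s + h) - g s)))"
          unfolding D_eq by (rule norm_triangle_ineq)
        also have "norm (integral {0..t} (\<lambda>s. flow s (g (s + h) - g s))) \<le> integral {0..t} (\<lambda>s. k + K * norm (D h s))"
        proof (rule integral_norm_bound_integral)
          show "(\<lambda>s. flow s (g (s + h) - g s)) integrable_on {0..t}"
            by (rule integrable_continuous_real[OF continuous_on_subset[OF flow_continuous_on[OF continuous_on_id continuous_on_diff[OF contgh contg0]] sub]])
          show "(\<lambda>s. k + K * norm (D h s)) integrable_on {0..t}"
            by (intro integrable_add integrable_const_ivl integrable_on_mult_right ci)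
          show "norm (flow s (g (s + h) - g s)) \<le> k + K * norm (D h s)" if "s \<in> {0..t}" for s
            using dg[of s] that sub unfolding k_def by auto
        qed
        also have "\<dots> = k * t + K * integral {0..t} (\<lambda>s. norm (D h s))"
          using t by (subst Henstock_Kurzweil_Integration.integral_add) (auto intro: ci integrable_on_mult_right)
        also have "k * t \<le> k * T1" using t k by (intro mult_left_mono) (auto simp: T1_def)
        also have "norm (flow (- h) (W h)) \<le> h * (C2 * \<eta>)"
        proof -
          \<comment> \<open>Solution and profile start from the same datum, so \<open>W h\<close> is
            itself O(h).\<close>
          have "W 0 = 0" using W_int[of 0] T1 by simp
          then show ?thesis using W2[of 0 h] h T by (simp add: T1_def)
        qed
        also have "h * (C2 * \<eta>) + (k * T1 + K * integral {0..t} (\<lambda>s. norm (D h s))) = C3 * \<eta> * h + K * integral {0..t} (\<lambda>s. norm (D h s))"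
          by (simp add: C3_def k_def algebra_simps)
        finally show ?thesis by simp
      qed
      have "norm (D h t) \<le> 2 * (C3 * \<eta> * h) * exp (2 * K * t)"
        by (rule gronwall[OF T K _ continuous_on_norm[OF contD] le t]) (use \<eta> C3 h in simp)
      also have "\<dots> \<le> 2 * (C3 * \<eta> * h) * exp (2 * K * T1)"
        using \<eta> C3 h K t by (intro mult_left_mono) (auto simp: T1_def)
      finally show ?thesis by (simp add: C4_def mult_ac)
    qed
    have fin: "norm (w t) \<le> C * \<eta> \<and> (\<exists>l. om_rel (FT (w t)) l \<and> norm l \<le> C * \<eta>)" if t: "t \<in> {0..T}" for t
    proof
      have t1: "t \<in> {0..T1}" using t by (auto simp: T1_def)
      have "norm (w t) \<le> 2 * pi * norm (w t)"
        using mult_right_mono[of 1 "2 * pi" "norm (w t)"] pi_ge_two by simp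
      also have "\<dots> \<le> C1 * \<eta>" using W1[OF t1] by (simp only: nw)
      also have "\<dots> \<le> C * \<eta>" using C2 C4 \<eta> by (intro mult_right_mono) (auto simp: C_def)
      finally show "norm (w t) \<le> C * \<eta>" .
      \<comment> \<open>The increments of \<open>W\<close> and of w are both O(h); combined they
        control the increment of the orbit of the fixed function \<open>FT (w t)\<close>, which is
        what \<open>om_rel_of_lipschitz\<close> asks for.\<close>
      have lip: "norm (flow (- h) (FT (w t)) - FT (w t)) \<le> (C4 + C2) * \<eta> * h" if h: "0 < h" "h \<le> 1" for h
      proof -
        have FTw: "FT (w t) = flow (- t) (W t)" unfolding fw[symmetric] by (simp add: flow_flow)
        have "flow (- h) (FT (w t)) - FT (w t) = flow (- t) (flow (- h) (W t) - W t)"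
          unfolding FTw flow_flow flow_diff by (simp only: add.commute)
        then have "norm (flow (- h) (FT (w t)) - FT (w t)) = norm (flow (- h) (W t) - W t)"
          by (simp only: norm_flow)
        also have "\<dots> = norm (D h t - flow (- h) (W (t + h) - W t))"
          unfolding D_def flow_diff by simp
        also have "\<dots> \<le> norm (D h t) + norm (W (t + h) - W t)"
          using norm_triangle_ineq4[of "D h t" "flow (- h) (W (t + h) - W t)"] by simp
        also have "\<dots> \<le> C4 * \<eta> * h + h * (C2 * \<eta>)"
          using t h by (intro add_mono D_bound W2) (auto simp: T1_def)
        finally show ?thesis by (simp add: algebra_simps)
      qed
      have "0 \<le> (C4 + C2) * \<eta>" using C4 C2 \<eta> by simp
      then obtain l where l: "om_rel (FT (w t)) l" "norm l \<le> (C4 + C2) * \<eta>"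
        by (rule om_rel_of_lipschitz[OF _ lip])
      have "(C4 + C2) * \<eta> \<le> C * \<eta>" using C1 \<eta> by (intro mult_right_mono) (auto simp: C_def)
      with l show "\<exists>l. om_rel (FT (w t)) l \<and> norm l \<le> C * \<eta>" by (intro exI[of _ l] conjI) auto
    qed
    have v0: "v 0 = z 0" using V(2)[of 0] T1 by (simp add: v_def)
    show ?thesis
    proof (intro exI[of _ v] conjI ballI v0 contv)
      show "flow t (FT (v t)) = FT (z 0) + integral {0..t} (\<lambda>s. cmul c (flow s (FT (N (v s)))))" if "t \<in> {0..T1}" for t
        unfolding fv V(2)[OF that] FV ..
    qed (use fin in \<open>simp_all add: w_def\<close>)
  qed
  show thesis
    by (rule that[OF Cpos]) (rule main[unfolded T1_def N_def c_def M_def])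
qed

subsection \<open>Wide Gaussians\<close>

lemma norm_abs_le:
  assumes f: "sq_int f" and g: "sq_int g" and le: "\<And>z. cmod (f z) \<le> c * cmod (g z)" and c: "c \<ge> 0"
  shows "norm (abs_l2 f) \<le> c * norm (abs_l2 g)"
proof (rule norm_l2_le[OF _ c])
  show "AE z in lborel. cmod (rep_l2 (abs_l2 f) z) \<le> c * cmod (rep_l2 (abs_l2 g) z)"
    using rep_abs[OF f] rep_abs[OF g] by eventually_elim (simp add: le)
qed

lemma sq_int_bounded:
  assumes "sq_int g" "f \<in> borel_measurable borel" "\<And>z. cmod (f z) \<le> c * cmod (g z)"
  shows "sq_int f"
  by (rule sq_int_dominated[OF assms(1,2) AE_I2[OF assms(3)]])

lemma cmod_gaussian: "cmod (gaussian a b z) = exp (- (a * (fst z)\<^sup>2 / 2) - b * (snd z)\<^sup>2 / 2)"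
  unfolding gaussian_def by (simp only: norm_of_real abs_exp_cancel)

lemma sq_int_gaussian:
  assumes "a > 0" "b > 0"
  shows "sq_int (gaussian a b)"
proof (rule sq_intI[OF gaussian_measurable])
  have "(cmod (gaussian a b z))\<^sup>2 = cmod (gaussian (2 * a) (2 * b) z)" for z
    unfolding cmod_gaussian exp_double[symmetric] by (simp add: field_simps)
  then show "integrable lborel (\<lambda>z. (cmod (gaussian a b z))\<^sup>2)"
    using integrable_norm[OF integrable_gaussian[of "2 * a" "2 * b"]] assms by simp
qed

text \<open>The \<alpha>-th power of \<open>gs e 1\<close>; such powers arise from the nonlinearity.
  The coefficients e and e^2 put x-frequencies at size sqrt e and y-frequencies at size e, so that
  both terms of \<open>omega\<close> are O(e).\<close>

definition gs :: "real \<Rightarrow> real \<Rightarrow> fun2" where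
  "gs e \<alpha> = gaussian (\<alpha> * e) (\<alpha> * e\<^sup>2)"

lemma gs_measurable [measurable]: "gs e \<alpha> \<in> borel_measurable borel"
  by (simp add: gs_def)

lemma cmod_gs: "cmod (gs e \<alpha> z) = exp (- \<alpha> * (e * (fst z)\<^sup>2 + e\<^sup>2 * (snd z)\<^sup>2) / 2)"
  unfolding gs_def cmod_gaussian by (simp add: field_simps)

lemma gs_eq_cmod: "gs e \<alpha> z = complex_of_real (cmod (gs e \<alpha> z))"
  unfolding gs_def cmod_gaussian gaussian_def by simp

lemma sq_int_gs: "e > 0 \<Longrightarrow> \<alpha> > 0 \<Longrightarrow> sq_int (gs e \<alpha>)"
  unfolding gs_def by (rule sq_int_gaussian) auto

lemma integrable_gs: "e > 0 \<Longrightarrow> \<alpha> > 0 \<Longrightarrow> integrable lborel (gs e \<alpha>)"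
  unfolding gs_def by (rule integrable_gaussian) auto

lemma cmod_gs_mono:
  assumes "\<alpha> \<le> \<beta>" "e \<ge> 0"
  shows "cmod (gs e \<beta> z) \<le> cmod (gs e \<alpha> z)"
proof -
  have "\<alpha> * (e * (fst z)\<^sup>2 + e\<^sup>2 * (snd z)\<^sup>2) \<le> \<beta> * (e * (fst z)\<^sup>2 + e\<^sup>2 * (snd z)\<^sup>2)"
    using assms by (intro mult_right_mono) auto
  then show ?thesis unfolding cmod_gs by simp
qed

lemma norm_gs_mono:
  assumes "1 \<le> \<beta>" "e > 0"
  shows "norm (abs_l2 (gs e \<beta>)) \<le> norm (abs_l2 (gs e 1))"
  using norm_abs_le[of "gs e \<beta>" "gs e 1" 1] sq_int_gs cmod_gs_mono assms by simp

lemma cmod_gs_le_1: "\<alpha> \<ge> 0 \<Longrightarrow> e \<ge> 0 \<Longrightarrow> cmod (gs e \<alpha> z) \<le> 1"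
  unfolding gs_def by (rule gaussian_norm_le_1) auto

lemma fourier1_gs:
  assumes "e > 0" "\<alpha> > 0"
  shows "cmod (fourier1 (gs e \<alpha>) \<zeta>) = 2 * pi / (\<alpha> * sqrt (e * e\<^sup>2)) * exp (- (((fst \<zeta>)\<^sup>2 / e + (snd \<zeta>)\<^sup>2 / e\<^sup>2) / \<alpha>) / 2)"
proof -
  have "sqrt (\<alpha> * e * (\<alpha> * e\<^sup>2)) = \<alpha> * sqrt (e * e\<^sup>2)"
  proof -
    have "\<alpha> * e * (\<alpha> * e\<^sup>2) = \<alpha>\<^sup>2 * (e * e\<^sup>2)" by (simp add: power2_eq_square)
    then show ?thesis using assms by (simp only: real_sqrt_mult real_sqrt_abs abs_of_pos)
  qed
  moreover have "cmod (fourier1 (gs e \<alpha>) \<zeta>) = 2 * pi / sqrt (\<alpha> * e * (\<alpha> * e\<^sup>2)) * cmod (gaussian (1 / (\<alpha> * e)) (1 / (\<alpha> * e\<^sup>2)) \<zeta>)"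
    unfolding gs_def using assms
    by (subst gaussian_fourier1) (simp_all only: norm_mult norm_of_real mult_pos_pos zero_less_power, simp)
  moreover have "- (1 / (\<alpha> * e) * (fst \<zeta>)\<^sup>2 / 2) - 1 / (\<alpha> * e\<^sup>2) * (snd \<zeta>)\<^sup>2 / 2 = - (((fst \<zeta>)\<^sup>2 / e + (snd \<zeta>)\<^sup>2 / e\<^sup>2) / \<alpha>) / 2"
    by (simp add: add_divide_distrib mult.commute)
  ultimately show ?thesis unfolding cmod_gaussian by (simp only:)
qed

text \<open>Absorbing \<open>omega\<close> into the Gaussian costs a factor \<open>e\<close> and doubles the width parameter.\<close>

lemma omega_fourier1_gs:
  assumes e: "e > 0" and \<alpha>: "\<alpha> \<ge> 1"
  shows "omega \<zeta> * cmod (fourier1 (gs e \<alpha>) \<zeta>) \<le> 8 * \<alpha> * e * cmod (fourier1 (gs e (2 * \<alpha>)) \<zeta>)"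
proof -
  define a where "a = (fst \<zeta>)\<^sup>2 / e / \<alpha>"
  define b where "b = (snd \<zeta>)\<^sup>2 / e\<^sup>2 / \<alpha>"
  have ab: "a \<ge> 0" "b \<ge> 0" using e \<alpha> by (auto simp: a_def b_def)
  define k where "k = 2 * pi / (\<alpha> * sqrt (e * e\<^sup>2))"
  have k: "k \<ge> 0" using e \<alpha> by (simp add: k_def)
  have F1: "cmod (fourier1 (gs e \<alpha>) \<zeta>) = k * exp (- (a + b) / 2)"
    using fourier1_gs[OF e, of \<alpha> \<zeta>] \<alpha> by (simp add: k_def a_def b_def add_divide_distrib)
  have F2: "cmod (fourier1 (gs e (2 * \<alpha>)) \<zeta>) = k / 2 * exp (- (a + b) / 4)"
  proof -
    have "((fst \<zeta>)\<^sup>2 / e + (snd \<zeta>)\<^sup>2 / e\<^sup>2) / (2 * \<alpha>) = (a + b) / 2"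
      by (simp add: a_def b_def add_divide_distrib mult_ac)
    moreover have "- ((a + b) / 2) / 2 = - (a + b) / 4" by linarith
    moreover have "2 * pi / (2 * \<alpha> * sqrt (e * e\<^sup>2)) = k / 2" by (simp add: k_def)
    ultimately show ?thesis using fourier1_gs[OF e, of "2 * \<alpha>" \<zeta>] \<alpha> by (simp only: zero_less_mult_iff) simp
  qed
  \<comment> \<open>|eta| is e times the square root of \<alpha> b; the square root is traded for
    \<alpha> (1 + b), which is allowed since \<alpha> >= 1.\<close>
  have "\<bar>snd \<zeta>\<bar> \<le> e * \<alpha> * (1 + b)"
  proof (rule power2_le_imp_le)
    have "(snd \<zeta>)\<^sup>2 = e\<^sup>2 * \<alpha> * b" using e \<alpha> by (simp add: b_def)
    also have "\<dots> \<le> e\<^sup>2 * \<alpha>\<^sup>2 * (1 + b)\<^sup>2"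
    proof (intro mult_mono)
      show "\<alpha> \<le> \<alpha>\<^sup>2" using \<alpha> by (simp add: power2_eq_square)
      show "b \<le> (1 + b)\<^sup>2" using ab by (simp add: power2_sum)
    qed (use e \<alpha> ab in auto)
    finally show "\<bar>snd \<zeta>\<bar>\<^sup>2 \<le> (e * \<alpha> * (1 + b))\<^sup>2" by (simp add: power_mult_distrib)
    show "0 \<le> e * \<alpha> * (1 + b)" using e \<alpha> ab by simp
  qed
  moreover have "(fst \<zeta>)\<^sup>2 = e * \<alpha> * a" using e \<alpha> by (simp add: a_def)
  ultimately have "omega \<zeta> \<le> e * \<alpha> * a + e * \<alpha> * (1 + b)" by (simp add: omega_def)
  also have "\<dots> = e * \<alpha> * (1 + (a + b))" by (simp add: algebra_simps)
  \<comment> \<open>The linear factor is paid with half of the Gaussian exponent (a + b) / 2. What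
    remains is the exponent belonging to 2 \<alpha>, whose prefactor k / 2 turns 4 into 8.\<close>
  also have "\<dots> \<le> e * \<alpha> * (4 * exp ((a + b) / 4))"
  proof (rule mult_left_mono)
    have "1 + (a + b) / 4 \<le> exp ((a + b) / 4)" by (rule exp_ge_add_one_self)
    then have 4: "4 * (1 + (a + b) / 4) \<le> 4 * exp ((a + b) / 4)" by (rule mult_left_mono) simp
    have "1 + x \<le> 4 * (1 + x / 4)" for x :: real by (simp add: distrib_left)
    then have "1 + (a + b) \<le> 4 * (1 + (a + b) / 4)" .
    with 4 show "1 + (a + b) \<le> 4 * exp ((a + b) / 4)" by (rule order_trans[rotated])
  qed (use e \<alpha> in simp)
  finally have "omega \<zeta> * (k * exp (- (a + b) / 2)) \<le> e * \<alpha> * (4 * exp ((a + b) / 4)) * (k * exp (- (a + b) / 2))"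
    using k by (intro mult_right_mono) auto
  also have "\<dots> = 4 * \<alpha> * e * k * (exp ((a + b) / 4) * exp (- (a + b) / 2))" by (simp only: mult_ac)
  also have "exp ((a + b) / 4) * exp (- (a + b) / 2) = exp (- (a + b) / 4)"
    unfolding exp_add[symmetric] by (rule arg_cong[of _ _ exp]) (simp add: field_simps)
  also have "4 * \<alpha> * e * k * exp (- (a + b) / 4) = 8 * \<alpha> * e * (k / 2 * exp (- (a + b) / 4))" by simp
  finally show ?thesis unfolding F1 F2 .
qed

definition om_gs :: "real \<Rightarrow> real \<Rightarrow> l2" where
  "om_gs e \<alpha> = abs_l2 (\<lambda>\<zeta>. complex_of_real (omega \<zeta>) * fourier1 (gs e \<alpha>) \<zeta>)"

text \<open>The bound grows only linearly in \<alpha> and refers to the fixed \<open>gs e 1\<close>;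
  both matter when these terms are summed over \<alpha> = 1 + n q.\<close>

lemma om_gs:
  assumes e: "e > 0" and \<alpha>: "\<alpha> \<ge> 1"
  shows "om_rel (FT (abs_l2 (gs e \<alpha>))) (om_gs e \<alpha>)"
    and "norm (om_gs e \<alpha>) \<le> 16 * pi * \<alpha> * e * norm (abs_l2 (gs e 1))"
proof -
  have s: "sq_int (gs e \<alpha>)" "integrable lborel (gs e \<alpha>)" "sq_int (gs e (2 * \<alpha>))" "integrable lborel (gs e (2 * \<alpha>))"
    using sq_int_gs integrable_gs e \<alpha> by auto
  note F = plancherel(1)[OF s(2,1)] and F2 = plancherel(1)[OF s(4,3)]
  let ?l = "\<lambda>\<zeta>. complex_of_real (omega \<zeta>) * fourier1 (gs e \<alpha>) \<zeta>"
  have le: "cmod (?l \<zeta>) \<le> 8 * \<alpha> * e * cmod (fourier1 (gs e (2 * \<alpha>)) \<zeta>)" for \<zeta>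
    using omega_fourier1_gs[OF e \<alpha>] omega_nonneg[of \<zeta>] by (simp add: norm_mult)
  have sl: "sq_int ?l" by (rule sq_int_bounded[OF F2 _ le]) simp
  show "om_rel (FT (abs_l2 (gs e \<alpha>))) (om_gs e \<alpha>)"
    unfolding om_rel_def om_gs_def FT_abs[OF s(2,1)]
    using rep_abs[OF sl] rep_abs[OF F] by eventually_elim simp
  have "norm (om_gs e \<alpha>) \<le> 8 * \<alpha> * e * norm (abs_l2 (fourier1 (gs e (2 * \<alpha>))))"
    unfolding om_gs_def by (rule norm_abs_le[OF sl F2 le]) (use e \<alpha> in simp)
  also have "norm (abs_l2 (fourier1 (gs e (2 * \<alpha>)))) = 2 * pi * norm (abs_l2 (gs e (2 * \<alpha>)))"
    unfolding FT_abs[OF s(4,3), symmetric] by (rule norm_FT)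
  also have "8 * \<alpha> * e * (2 * pi * norm (abs_l2 (gs e (2 * \<alpha>)))) \<le> 8 * \<alpha> * e * (2 * pi * norm (abs_l2 (gs e 1)))"
    using e \<alpha> norm_gs_mono[of "2 * \<alpha>" e] by (intro mult_left_mono) auto
  finally show "norm (om_gs e \<alpha>) \<le> 16 * pi * \<alpha> * e * norm (abs_l2 (gs e 1))" by (simp add: mult_ac)
qed

lemma om_rel_0: "om_rel 0 0"
  unfolding om_rel_def using rep_zero by eventually_elim simp

lemma om_rel_add:
  assumes "om_rel f l" "om_rel g k"
  shows "om_rel (f + g) (l + k)"
  unfolding om_rel_def
  using rep_plus[of f g] rep_plus[of l k] assms[unfolded om_rel_def] by eventually_elim (simp add: distrib_left)

lemma om_rel_cmul:
  assumes "om_rel f l"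
  shows "om_rel (cmul c f) (cmul c l)"
  unfolding om_rel_def
  using rep_cmul[of c f] rep_cmul[of c l] assms[unfolded om_rel_def] by eventually_elim (simp add: mult_ac)

lemma om_rel_diff:
  assumes "om_rel f l" "om_rel g k"
  shows "om_rel (f - g) (l - k)"
  unfolding om_rel_def
  using rep_minus[of f g] rep_minus[of l k] assms[unfolded om_rel_def] by eventually_elim (simp add: right_diff_distrib)

lemma om_rel_sum:
  assumes "\<And>i. om_rel (f i) (l i)"
  shows "om_rel (\<Sum>i<n::nat. f i) (\<Sum>i<n. l i)"
  by (induction n) (simp_all add: om_rel_0 om_rel_add assms)

text \<open>Multiplication by \<open>omega\<close> is a closed operator: after division by 1 + omega
  the relation becomes an identity between bounded multipliers, which passes to the limit.\<close>

lemma om_rel_closed: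
  assumes o: "\<And>n. om_rel (f n) (l n)" and f: "f \<longlonglongrightarrow> f0" and l: "l \<longlonglongrightarrow> l0"
  shows "om_rel f0 l0"
proof -
  define b where "b = (\<lambda>\<zeta>. complex_of_real (1 / (1 + omega \<zeta>)))"
  define b' where "b' = (\<lambda>\<zeta>. complex_of_real (omega \<zeta> / (1 + omega \<zeta>)))"
  have [measurable]: "b \<in> borel_measurable borel" "b' \<in> borel_measurable borel" unfolding b_def b'_def by measurable
  have b1: "cmod (b \<zeta>) \<le> 1" "cmod (b' \<zeta>) \<le> 1" for \<zeta>
    unfolding b_def b'_def norm_of_real using omega_nonneg[of \<zeta>] by (auto simp: abs_of_nonneg divide_le_eq_1)
  have eq: "mult_l2 b (l n) = mult_l2 b' (f n)" for n
  proof (rule l2_eqI)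
    show "AE \<zeta> in lborel. rep_l2 (mult_l2 b (l n)) \<zeta> = rep_l2 (mult_l2 b' (f n)) \<zeta>"
      using rep_mult[of b 1 "l n"] rep_mult[of b' 1 "f n"] o[of n, unfolded om_rel_def] b1
      by (auto elim!: eventually_rev_mp simp: b_def b'_def)
  qed
  have "(\<lambda>n. mult_l2 b (l n)) \<longlonglongrightarrow> mult_l2 b l0"
    by (rule bounded_linear.tendsto[OF bounded_linear_mult_l2[where B = 1] l]) (use b1 in simp_all)
  moreover have "(\<lambda>n. mult_l2 b' (f n)) \<longlonglongrightarrow> mult_l2 b' f0"
    by (rule bounded_linear.tendsto[OF bounded_linear_mult_l2[where B = 1] f]) (use b1 in simp_all)
  ultimately have "mult_l2 b l0 = mult_l2 b' f0" unfolding eq by (rule LIMSEQ_unique)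
  moreover have "AE \<zeta> in lborel. rep_l2 (mult_l2 b l0) \<zeta> = b \<zeta> * rep_l2 l0 \<zeta>"
    by (rule rep_mult[where B = 1]) (use b1 in simp_all)
  moreover have "AE \<zeta> in lborel. rep_l2 (mult_l2 b' f0) \<zeta> = b' \<zeta> * rep_l2 f0 \<zeta>"
    by (rule rep_mult[where B = 1]) (use b1 in simp_all)
  ultimately have "AE \<zeta> in lborel. b \<zeta> * rep_l2 l0 \<zeta> = b' \<zeta> * rep_l2 f0 \<zeta>" by (auto elim: eventually_elim2)
  then show ?thesis unfolding om_rel_def
  proof eventually_elim
    case (elim \<zeta>)
    have nz: "b \<zeta> \<noteq> 0" unfolding b_def of_real_eq_0_iff using omega_nonneg[of \<zeta>] by simp
    have "b' \<zeta> = b \<zeta> * complex_of_real (omega \<zeta>)" unfolding b_def b'_def of_real_mult[symmetric] by simp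
    with elim nz show ?case by simp
  qed
qed

subsection \<open>The dispersionless profile\<close>

lemma has_vector_derivative_quadratic:
  fixes f :: "real \<Rightarrow> 'a::real_normed_vector"
  assumes le: "\<And>y. y \<in> S \<Longrightarrow> norm (f y - f t - (y - t) *\<^sub>R d) \<le> C * (y - t)\<^sup>2"
  shows "(f has_vector_derivative d) (at t within S)"
  unfolding has_vector_derivative_def has_derivative_iff_norm
proof (intro conjI bounded_linear_scaleR_left)
  show "((\<lambda>y. norm (f y - f t - (y - t) *\<^sub>R d) / norm (y - t)) \<longlongrightarrow> 0) (at t within S)"
  proof (rule Lim_null_comparison)
    have "norm (f y - f t - (y - t) *\<^sub>R d) / norm (y - t) \<le> C * \<bar>y - t\<bar>" if "y \<in> S" "y \<noteq> t" for y
    proof -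
      have "norm (f y - f t - (y - t) *\<^sub>R d) / norm (y - t) \<le> (C * (y - t)\<^sup>2) / norm (y - t)"
        by (intro divide_right_mono le that) simp
      also have "\<dots> = C * \<bar>y - t\<bar>"
      proof -
        have sq: "(y - t)\<^sup>2 = \<bar>y - t\<bar> * \<bar>y - t\<bar>" by (simp add: power2_eq_square)
        have cancel: "C * (d * d) / d = C * d" if "d \<noteq> 0" for d :: real using that by simp
        show ?thesis unfolding sq real_norm_def by (rule cancel) (use that in simp)
      qed
      finally show ?thesis .
    qed
    then show "\<forall>\<^sub>F y in at t within S. norm (norm (f y - f t - (y - t) *\<^sub>R d) / norm (y - t)) \<le> C * \<bar>y - t\<bar>"
      by (auto simp: eventually_at_filter)
    have "((\<lambda>y. C * \<bar>y - t\<bar>) \<longlongrightarrow> C * \<bar>t - t\<bar>) (at t within S)"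
      by (intro tendsto_intros)
    then show "((\<lambda>y. C * \<bar>y - t\<bar>) \<longlongrightarrow> 0) (at t within S)" by simp
  qed
qed

text \<open>The solution \<open>A \<phi> exp (-i \<mu> t (A \<phi>)^q)\<close> of the dispersionless equation, with Gaussian \<open>\<phi>\<close>.\<close>

definition prof :: "real \<Rightarrow> real \<Rightarrow> real \<Rightarrow> real \<Rightarrow> real \<Rightarrow> fun2" where
  "prof q \<mu> A e t z = complex_of_real (A * cmod (gs e 1 z)) * cis (- \<mu> * t * (A powr q * cmod (gs e q z)))"

lemma cmod_prof: "A \<ge> 0 \<Longrightarrow> cmod (prof q \<mu> A e t z) = A * cmod (gs e 1 z)"
  unfolding prof_def norm_mult norm_cis norm_of_real by simp

lemma prof_measurable [measurable]: "prof q \<mu> A e t \<in> borel_measurable borel"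
  unfolding prof_def by measurable

lemma sq_int_prof: "A \<ge> 0 \<Longrightarrow> e > 0 \<Longrightarrow> sq_int (prof q \<mu> A e t)"
  by (rule sq_int_bounded[OF sq_int_gs[of e 1], where c = A]) (simp_all add: cmod_prof)

lemma cmod_gs_powr: "cmod (gs e 1 z) powr q = cmod (gs e q z)"
  unfolding cmod_gs by (simp add: powr_def algebra_simps)

lemma cmod_gs_mult: "cmod (gs e a z) * cmod (gs e b z) = cmod (gs e (a + b) z)"
proof -
  have "- a * S / 2 + - b * S / 2 = - (a + b) * S / 2" for S by (simp add: field_simps)
  then show ?thesis unfolding cmod_gs exp_add[symmetric] by (simp only:)
qed

lemma cmod_gs_power: "cmod (gs e a z) ^ n = cmod (gs e (real n * a) z)"
  unfolding cmod_gs exp_of_nat_mult[symmetric] by (simp add: mult_ac)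

lemma prof_diff_le:
  assumes A: "A \<ge> 0" and e: "e > 0" and q: "q \<ge> 0"
  shows "cmod (prof q \<mu> A e t z - prof q \<mu> A e s z) \<le> A * (\<bar>\<mu>\<bar> * A powr q) * \<bar>t - s\<bar>"
proof -
  define \<theta> where "\<theta> = A powr q * cmod (gs e q z)"
  have \<theta>: "0 \<le> \<theta>" "\<theta> \<le> A powr q"
    using cmod_gs_le_1[of q e z] e q mult_left_mono[of "cmod (gs e q z)" 1 "A powr q"] by (auto simp: \<theta>_def)
  have "cis (- \<mu> * t * \<theta>) = cis (- \<mu> * s * \<theta>) * cis (- \<mu> * (t - s) * \<theta>)"
    unfolding cis_mult by (rule arg_cong[of _ _ cis]) (simp add: algebra_simps)
  then have "prof q \<mu> A e t z - prof q \<mu> A e s z = prof q \<mu> A e s z * (cis (- \<mu> * (t - s) * \<theta>) - 1)"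
    unfolding prof_def \<theta>_def[symmetric] by (simp only: right_diff_distrib mult_1_right mult.assoc)
  then have "cmod (prof q \<mu> A e t z - prof q \<mu> A e s z) = A * cmod (gs e 1 z) * cmod (cis (- \<mu> * (t - s) * \<theta>) - 1)"
    by (simp only: norm_mult cmod_prof[OF A])
  also have "\<dots> \<le> A * 1 * \<bar>- \<mu> * (t - s) * \<theta>\<bar>"
    using A e cmod_gs_le_1[of 1 e z] by (intro mult_mono cis_approx_0) auto
  also have "\<dots> = A * (\<bar>\<mu>\<bar> * \<theta>) * \<bar>t - s\<bar>" using \<theta> by (simp add: abs_mult)
  also have "\<dots> \<le> A * (\<bar>\<mu>\<bar> * A powr q) * \<bar>t - s\<bar>"
    using A \<theta> by (intro mult_right_mono mult_left_mono) auto
  finally show ?thesis .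
qed

text \<open>The profile never exceeds A, so the truncation at A + 1 is inactive and the pointwise
  differential equation holds with \<open>gcut\<close>. The Taylor remainder carries the Gaussian
  factor, which makes it quadratic in L2 and not only pointwise.\<close>

lemma prof_derivative:
  assumes A: "A > 0" and e: "e > 0" and q: "q \<ge> 2"
  shows "((\<lambda>t. abs_l2 (prof q \<mu> A e t)) has_vector_derivative
     cmul (- \<i> * \<mu>) (nem q (A + 1) (abs_l2 (prof q \<mu> A e t)))) (at t within S)"
proof (rule has_vector_derivative_quadratic)
  fix y
  define g where "g = gs e 1"
  have sg: "sq_int g" unfolding g_def by (rule sq_int_gs) (use e in auto)
  have sp: "sq_int (prof q \<mu> A e s)" for s by (rule sq_int_prof) (use A e in auto)
  have M: "A + 1 > 0" using A by simp
  define \<theta> where "\<theta> z = A powr q * cmod (gs e q z)" for z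
  have \<theta>: "0 \<le> \<theta> z" "\<theta> z \<le> A powr q" for z
    using cmod_gs_le_1[of q e z] e q mult_left_mono[of "cmod (gs e q z)" 1 "A powr q"] by (auto simp: \<theta>_def)
  define R where "R z = prof q \<mu> A e t z * (cis (- \<mu> * (y - t) * \<theta> z) - 1 - \<i> * complex_of_real (- \<mu> * (y - t) * \<theta> z))" for z
  have [measurable]: "R \<in> borel_measurable borel" unfolding R_def \<theta>_def by measurable
  have Rle: "cmod (R z) \<le> (A * (\<mu> * A powr q)\<^sup>2 * (y - t)\<^sup>2) * cmod (g z)" for z
  proof -
    have "cmod (R z) = A * cmod (g z) * cmod (cis (- \<mu> * (y - t) * \<theta> z) - 1 - \<i> * complex_of_real (- \<mu> * (y - t) * \<theta> z))"
      unfolding R_def norm_mult[of "prof q \<mu> A e t z"] g_def cmod_prof[OF less_imp_le[OF A]] ..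
    also have "\<dots> \<le> A * cmod (g z) * ((- \<mu> * (y - t) * \<theta> z)\<^sup>2 / 2)"
      by (rule mult_left_mono[OF cis_approx_1]) (use A in simp)
    also have "\<dots> \<le> A * cmod (g z) * ((\<mu> * A powr q)\<^sup>2 * (y - t)\<^sup>2)"
    proof (rule mult_left_mono)
      have "(\<theta> z)\<^sup>2 \<le> (A powr q)\<^sup>2" using \<theta> by (intro power_mono)
      then have "\<mu>\<^sup>2 * (y - t)\<^sup>2 * (\<theta> z)\<^sup>2 \<le> \<mu>\<^sup>2 * (y - t)\<^sup>2 * (A powr q)\<^sup>2" by (intro mult_left_mono) auto
      moreover have "0 \<le> \<mu>\<^sup>2 * (y - t)\<^sup>2 * (\<theta> z)\<^sup>2" by simp
      ultimately show "(- \<mu> * (y - t) * \<theta> z)\<^sup>2 / 2 \<le> (\<mu> * A powr q)\<^sup>2 * (y - t)\<^sup>2"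
        unfolding power_mult_distrib power2_minus by (simp only: mult_ac)
    qed (use A in simp)
    finally show ?thesis by (simp only: mult_ac)
  qed
  have sR: "sq_int R" by (rule sq_int_bounded[OF sg _ Rle]) simp
  let ?d = "cmul (- \<i> * \<mu>) (nem q (A + 1) (abs_l2 (prof q \<mu> A e t)))"
  have "abs_l2 (prof q \<mu> A e y) - abs_l2 (prof q \<mu> A e t) - (y - t) *\<^sub>R ?d = abs_l2 R"
  proof (rule l2_eqI)
    show "AE z in lborel. rep_l2 (abs_l2 (prof q \<mu> A e y) - abs_l2 (prof q \<mu> A e t) - (y - t) *\<^sub>R ?d) z = rep_l2 (abs_l2 R) z"
      using rep_minus[of "abs_l2 (prof q \<mu> A e y) - abs_l2 (prof q \<mu> A e t)" "(y - t) *\<^sub>R ?d"]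
        rep_minus[of "abs_l2 (prof q \<mu> A e y)" "abs_l2 (prof q \<mu> A e t)"] rep_scaleR[of "y - t" ?d]
        rep_cmul[of "- \<i> * \<mu>" "nem q (A + 1) (abs_l2 (prof q \<mu> A e t))"]
        rep_nem[OF q M, of "abs_l2 (prof q \<mu> A e t)"] rep_abs[OF sp[of y]] rep_abs[OF sp[of t]] rep_abs[OF sR]
    proof eventually_elim
      case (elim z)
      have small: "cmod (prof q \<mu> A e t z) \<le> A + 1"
      proof -
        have "A * cmod (gs e 1 z) \<le> A * 1" using A cmod_gs_le_1[of 1 e z] e by (intro mult_left_mono) auto
        then show ?thesis unfolding cmod_prof[OF less_imp_le[OF A]] using A by linarith
      qed
      have "gpow q (prof q \<mu> A e t z) = complex_of_real (\<theta> z) * prof q \<mu> A e t z"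
        unfolding gpow_def \<theta>_def using A by (simp add: cmod_prof powr_mult cmod_gs_powr)
      then have G: "gcut q (A + 1) (prof q \<mu> A e t z) = complex_of_real (\<theta> z) * prof q \<mu> A e t z"
        by (simp only: gcut_eq[OF small])
      have "cis (- \<mu> * y * \<theta> z) = cis (- \<mu> * t * \<theta> z) * cis (- \<mu> * (y - t) * \<theta> z)"
        unfolding cis_mult by (rule arg_cong[of _ _ cis]) (simp add: algebra_simps)
      then have P: "prof q \<mu> A e y z = prof q \<mu> A e t z * cis (- \<mu> * (y - t) * \<theta> z)"
        unfolding prof_def \<theta>_def[symmetric] by (simp only: mult.assoc)
      have alg: "p * c - p - X * (- \<i> * m * (th * p)) = p * (c - 1 - \<i> * (- m * X * th))" for p c X m th :: complex
        by (simp add: algebra_simps)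
      show ?case
        unfolding elim G P R_def scaleR_conv_of_real of_real_mult of_real_minus by (rule alg)
    qed
  qed
  then have "norm (abs_l2 (prof q \<mu> A e y) - abs_l2 (prof q \<mu> A e t) - (y - t) *\<^sub>R ?d) = norm (abs_l2 R)" by (simp only:)
  also have "\<dots> \<le> (A * (\<mu> * A powr q)\<^sup>2 * (y - t)\<^sup>2) * norm (abs_l2 g)"
    by (rule norm_abs_le[OF sR sg Rle]) (use A in simp)
  finally show "norm (abs_l2 (prof q \<mu> A e y) - abs_l2 (prof q \<mu> A e t) - (y - t) *\<^sub>R ?d)
     \<le> (A * (\<mu> * A powr q)\<^sup>2 * norm (abs_l2 g)) * (y - t)\<^sup>2"
    by (simp only: mult_ac)
qed

text \<open>Coefficients of the expansion of \<open>prof\<close> into the Gaussians \<open>gs e (1 + n q)\<close>.\<close>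

definition cf :: "real \<Rightarrow> real \<Rightarrow> real \<Rightarrow> real \<Rightarrow> nat \<Rightarrow> complex" where
  "cf q \<mu> A t n = complex_of_real A * (\<i> * complex_of_real (- \<mu> * t * A powr q)) ^ n / fact n"

text \<open>Taylor expansion of the phase factor. Each term is a constant times the power 1 + n q of
  the basic Gaussian, again a Gaussian even for non-integer q. Its transform is explicit, which
  gives access to \<open>omega\<close> acting on the transform of the profile.\<close>

lemma prof_series:
  assumes A: "A > 0" and e: "e > 0" and q: "q \<ge> 2"
  shows "(\<lambda>N. \<Sum>n<N. cmul (cf q \<mu> A t n) (abs_l2 (gs e (1 + real n * q)))) \<longlonglongrightarrow> abs_l2 (prof q \<mu> A e t)"
proof -
  define g where "g = gs e 1"
  have sg: "sq_int g" unfolding g_def by (rule sq_int_gs) (use e in auto)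
  have sp: "sq_int (prof q \<mu> A e t)" by (rule sq_int_prof) (use A e in auto)
  have pos: "0 < 1 + real n * q" for n using q by (simp add: add_pos_nonneg)
  have sn: "sq_int (gs e (1 + real n * q))" for n by (rule sq_int_gs[OF e pos])
  define x where "x z = - \<mu> * t * (A powr q * cmod (gs e q z))" for z
  define X where "X = \<bar>\<mu>\<bar> * \<bar>t\<bar> * A powr q"
  have X0: "X \<ge> 0" by (simp add: X_def)
  have xX: "\<bar>x z\<bar> \<le> X" for z
  proof -
    have "\<bar>x z\<bar> = X * cmod (gs e q z)" by (simp add: x_def X_def abs_mult)
    also have "\<dots> \<le> X * 1" using cmod_gs_le_1[of q e z] e q X0 by (intro mult_left_mono) auto
    finally show ?thesis by simp
  qed
  define P where "P N z = (\<Sum>n<N. cf q \<mu> A t n * gs e (1 + real n * q) z)" for N z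
  have Psq: "sq_int (P N) \<and> (\<Sum>n<N. cmul (cf q \<mu> A t n) (abs_l2 (gs e (1 + real n * q)))) = abs_l2 (P N)" for N
  proof (induction N)
    case 0
    have "P 0 = (\<lambda>z. 0)" by (simp add: P_def fun_eq_iff)
    then show ?case by (simp add: zero_l2_def)
  next
    case (Suc N)
    have "P (Suc N) = (\<lambda>z. P N z + cf q \<mu> A t N * gs e (1 + real N * q) z)" by (simp add: P_def fun_eq_iff)
    then show ?case using Suc sq_int_add[OF _ sq_int_cmult[OF sn]] abs_l2_add[OF _ sq_int_cmult[OF sn]]
      by (simp add: cmul_abs[OF sn])
  qed
  have P_eq: "P N z = complex_of_real A * g z * (\<Sum>n<N. (\<i> * complex_of_real (x z)) ^ n / fact n)" for N z
  proof -
    have "cf q \<mu> A t n * gs e (1 + real n * q) z = complex_of_real A * g z * ((\<i> * complex_of_real (x z)) ^ n / fact n)" for n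
    proof -
      have "gs e (1 + real n * q) z = g z * complex_of_real (cmod (gs e q z) ^ n)"
        unfolding g_def cmod_gs_power by (subst (1 2) gs_eq_cmod) (simp only: of_real_mult[symmetric] cmod_gs_mult)
      moreover have "(\<i> * complex_of_real (x z)) ^ n = (\<i> * complex_of_real (- \<mu> * t * A powr q)) ^ n * complex_of_real (cmod (gs e q z) ^ n)"
        unfolding of_real_power power_mult_distrib[symmetric] x_def by (simp add: mult_ac)
      ultimately show ?thesis by (simp only: cf_def) (simp add: divide_inverse mult_ac)
    qed
    then show ?thesis unfolding P_def by (simp add: sum_distrib_left)
  qed
  have pg: "prof q \<mu> A e t z = complex_of_real A * g z * cis (x z)" for z
    unfolding prof_def g_def x_def by (subst gs_eq_cmod[of e 1 z]) (simp add: mult_ac)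
  have le: "cmod (P (Suc N) z - prof q \<mu> A e t z) \<le> (A * (X ^ Suc N / fact (Suc N))) * cmod (g z)" for N z
  proof -
    have "cmod (P (Suc N) z - prof q \<mu> A e t z) = A * cmod (g z) * cmod (cis (x z) - (\<Sum>n\<le>N. (\<i> * complex_of_real (x z)) ^ n / fact n))"
      unfolding P_eq pg right_diff_distrib[symmetric] norm_mult norm_of_real lessThan_Suc_atMost using A
      by (simp add: norm_minus_commute)
    also have "\<dots> \<le> A * cmod (g z) * (\<bar>x z\<bar> ^ Suc N / fact (Suc N))"
      unfolding cis_conv_exp using A by (intro mult_left_mono iexp_approx1) auto
    also have "\<dots> \<le> A * cmod (g z) * (X ^ Suc N / fact (Suc N))"
      using A xX by (intro mult_left_mono divide_right_mono power_mono) auto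
    finally show ?thesis by (simp only: mult_ac)
  qed
  have "(\<lambda>N. \<Sum>n<Suc N. cmul (cf q \<mu> A t n) (abs_l2 (gs e (1 + real n * q)))) \<longlonglongrightarrow> abs_l2 (prof q \<mu> A e t)"
  proof (rule LIM_zero_cancel, rule Lim_null_comparison[OF always_eventually], rule allI)
    fix N
    have "norm (abs_l2 (P (Suc N)) - abs_l2 (prof q \<mu> A e t)) \<le> (A * (X ^ Suc N / fact (Suc N))) * norm (abs_l2 g)"
      unfolding abs_l2_diff[OF conjunct1[OF Psq] sp, symmetric]
      by (rule norm_abs_le[OF sq_int_diff[OF conjunct1[OF Psq] sp] sg le]) (use A X0 in simp)
    then show "norm ((\<Sum>n<Suc N. cmul (cf q \<mu> A t n) (abs_l2 (gs e (1 + real n * q)))) - abs_l2 (prof q \<mu> A e t))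
       \<le> (A * (X ^ Suc N / fact (Suc N))) * norm (abs_l2 g)"
      by (simp only: conjunct2[OF Psq])
  next
    have "(\<lambda>N. X ^ N /\<^sub>R fact N) \<longlonglongrightarrow> 0" by (rule summable_LIMSEQ_zero[OF summable_exp_generic])
    then have "(\<lambda>N. X ^ N / fact N) \<longlonglongrightarrow> 0" by (simp add: divide_inverse mult.commute)
    then have "(\<lambda>N. X ^ Suc N / fact (Suc N)) \<longlonglongrightarrow> 0" by (rule LIMSEQ_Suc)
    from tendsto_mult[OF tendsto_mult[OF tendsto_const this] tendsto_const]
    have "(\<lambda>N. (A * (X ^ Suc N / fact (Suc N))) * norm (abs_l2 g)) \<longlonglongrightarrow> A * 0 * norm (abs_l2 g)" .
    then show "(\<lambda>N. (A * (X ^ Suc N / fact (Suc N))) * norm (abs_l2 g)) \<longlonglongrightarrow> 0" by simp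
  qed
  then show ?thesis by (rule LIMSEQ_imp_Suc)
qed

text \<open>With M >= 1 the exponent n can stand in place of n - 1, which avoids a separate
  treatment of n = 0 in the series below.\<close>

lemma power_diff_le:
  fixes x y :: real
  assumes "\<bar>x\<bar> \<le> M" "\<bar>y\<bar> \<le> M" "M \<ge> 1"
  shows "\<bar>x ^ n - y ^ n\<bar> \<le> real n * M ^ n * \<bar>x - y\<bar>"
proof (induction n)
  case (Suc n)
  have "x ^ Suc n - y ^ Suc n = x * (x ^ n - y ^ n) + (x - y) * y ^ n" by (simp add: algebra_simps)
  then have "\<bar>x ^ Suc n - y ^ Suc n\<bar> \<le> \<bar>x\<bar> * \<bar>x ^ n - y ^ n\<bar> + \<bar>x - y\<bar> * \<bar>y\<bar> ^ n"
    by (simp only: abs_mult[symmetric] power_abs[symmetric] abs_triangle_ineq)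
  also have "\<dots> \<le> M * (real n * M ^ n * \<bar>x - y\<bar>) + \<bar>x - y\<bar> * M ^ n"
    using assms Suc by (intro add_mono mult_mono power_mono) auto
  also have "\<dots> \<le> M * (real n * M ^ n * \<bar>x - y\<bar>) + \<bar>x - y\<bar> * M ^ Suc n"
    using assms by (intro add_left_mono mult_left_mono power_increasing) auto
  also have "\<dots> = real (Suc n) * M ^ Suc n * \<bar>x - y\<bar>" by (simp add: algebra_simps)
  finally show ?case .
qed simp

lemma exp_series_bound:
  fixes f :: "nat \<Rightarrow> 'a::banach"
  assumes "\<And>n. norm (f n) \<le> c * (Y ^ n / fact n)"
  shows "summable f" "norm (suminf f) \<le> c * exp Y"
proof -
  have s: "(\<lambda>n. c * (Y ^ n / fact n)) sums (c * exp Y)"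
    using sums_mult[OF exp_converges[of Y]] by (simp add: divide_inverse mult_ac)
  then have sc: "summable (\<lambda>n. c * (Y ^ n / fact n))" by (rule sums_summable)
  have sn: "summable (\<lambda>n. norm (f n))"
    by (rule summable_comparison_test'[OF sc, of 0]) (simp only: real_norm_def abs_norm_cancel assms)
  then show "summable f" by (rule summable_norm_cancel)
  have "norm (suminf f) \<le> (\<Sum>n. norm (f n))" by (rule summable_norm[OF sn])
  also have "\<dots> \<le> (\<Sum>n. c * (Y ^ n / fact n))" by (rule suminf_le[OF assms sn sc])
  also have "\<dots> = c * exp Y" using s by (simp add: sums_iff)
  finally show "norm (suminf f) \<le> c * exp Y" .
qed

text \<open>\<open>om_gs\<close> is summed along the expansion of the profile: factorials beat the
  growth in n, and closedness of the multiplier identifies the sum. The Lipschitz bound in time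
  comes from the same series with powers of s replaced by their differences.\<close>

lemma prof_omega:
  assumes q: "q \<ge> 2" and A: "A > 0" and T: "T \<ge> 1"
  obtains C where "C > 0"
    "\<And>e. e > 0 \<Longrightarrow> \<exists>L. (\<forall>s. \<bar>s\<bar> \<le> T \<longrightarrow> om_rel (FT (abs_l2 (prof q \<mu> A e s))) (L s)) \<and>
       (\<forall>s. \<bar>s\<bar> \<le> T \<longrightarrow> norm (L s) \<le> C * e * norm (abs_l2 (gs e 1))) \<and>
       (\<forall>s s'. \<bar>s\<bar> \<le> T \<longrightarrow> \<bar>s'\<bar> \<le> T \<longrightarrow> norm (L s' - L s) \<le> C * e * norm (abs_l2 (gs e 1)) * \<bar>s' - s\<bar>)"
proof -
  define k where "k = \<bar>\<mu>\<bar> * A powr q"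
  define Y where "Y = k * T"
  have k: "k \<ge> 0" by (simp add: k_def)
  have Y: "Y \<ge> 0" using k T by (simp add: Y_def)
  \<comment> \<open>The linear factors 1 + n q and n are each bounded by a multiple of 2^n; together
    they turn Y into 4 Y in the exponential.\<close>
  define C where "C = A * (16 * pi * (1 + q)) * exp (4 * Y)"
  have C: "C > 0" using A q by (simp add: C_def)
  have n2: "real n \<le> 2 ^ n" for n by (simp add: less_imp_le of_nat_less_two_power)
  have nq: "1 + real n * q \<le> (1 + q) * 2 ^ n" for n
  proof -
    have "1 \<le> (2::real) ^ n" by simp
    moreover have "real n * q \<le> 2 ^ n * q" using n2 q by (intro mult_right_mono) auto
    moreover have "(1 + q) * 2 ^ n = 2 ^ n + 2 ^ n * q" by (simp add: distrib_right mult.commute)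
    ultimately show ?thesis by linarith
  qed
  have main: "\<exists>L. (\<forall>s. \<bar>s\<bar> \<le> T \<longrightarrow> om_rel (FT (abs_l2 (prof q \<mu> A e s))) (L s)) \<and>
       (\<forall>s. \<bar>s\<bar> \<le> T \<longrightarrow> norm (L s) \<le> C * e * norm (abs_l2 (gs e 1))) \<and>
       (\<forall>s s'. \<bar>s\<bar> \<le> T \<longrightarrow> \<bar>s'\<bar> \<le> T \<longrightarrow> norm (L s' - L s) \<le> C * e * norm (abs_l2 (gs e 1)) * \<bar>s' - s\<bar>)"
    if e: "e > 0" for e
  proof -
    define m where "m = norm (abs_l2 (gs e 1))"
    have m: "m \<ge> 0" by (simp add: m_def)
    define l where "l n = om_gs e (1 + real n * q)" for n
    have one: "1 \<le> 1 + real n * q" for n using q by simp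
    have nl: "norm (l n) \<le> (16 * pi * (1 + q) * e * m) * 2 ^ n" for n
    proof -
      have "norm (l n) \<le> 16 * pi * (1 + real n * q) * e * m"
        unfolding l_def m_def by (rule om_gs(2)[OF e one])
      also have "\<dots> \<le> 16 * pi * ((1 + q) * 2 ^ n) * e * m"
        using e m nq by (intro mult_right_mono mult_left_mono) auto
      finally show ?thesis by (simp only: mult_ac)
    qed
    define c0 where "c0 = A * (16 * pi * (1 + q) * e * m)"
    have c0: "c0 \<ge> 0" unfolding c0_def using A q e m by simp
    have cf_norm: "cmod (cf q \<mu> A s n) = A * (k * \<bar>s\<bar>) ^ n / fact n" for s n
      using A by (simp add: cf_def k_def norm_mult norm_divide norm_power abs_mult mult_ac)
    have tb: "norm (cmul a (l n)) \<le> b * ((16 * pi * (1 + q) * e * m) * 2 ^ n)" if "cmod a \<le> b" for a b n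
      using that by (intro order_trans[OF norm_cmul_le] mult_mono nl) (auto intro: order_trans[OF norm_ge_zero])
    have t1: "norm (cmul (cf q \<mu> A s n) (l n)) \<le> c0 * ((2 * Y) ^ n / fact n)" if s: "\<bar>s\<bar> \<le> T" for s n
    proof -
      have "cmod (cf q \<mu> A s n) \<le> A * Y ^ n / fact n"
        unfolding cf_norm Y_def using A k s by (intro divide_right_mono mult_left_mono power_mono) auto
      from tb[OF this, of n] show ?thesis by (simp add: c0_def power_mult_distrib mult_ac)
    qed
    have t2: "norm (cmul (cf q \<mu> A s' n - cf q \<mu> A s n) (l n)) \<le> (c0 * \<bar>s' - s\<bar>) * ((4 * Y) ^ n / fact n)"
      if s: "\<bar>s\<bar> \<le> T" "\<bar>s'\<bar> \<le> T" for s s' n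
    proof -
      have "cf q \<mu> A s' n - cf q \<mu> A s n = complex_of_real (A * (s' ^ n - s ^ n) / fact n) * (\<i> * complex_of_real (- \<mu> * A powr q)) ^ n"
      proof -
        have "cf q \<mu> A s n = complex_of_real (A * s ^ n / fact n) * (\<i> * complex_of_real (- \<mu> * A powr q)) ^ n" for s
        proof -
          have "\<i> * complex_of_real (- \<mu> * s * A powr q) = complex_of_real s * (\<i> * complex_of_real (- \<mu> * A powr q))" by simp
          then show ?thesis unfolding cf_def by (simp only: power_mult_distrib) simp
        qed
        then show ?thesis by (simp add: algebra_simps diff_divide_distrib)
      qed
      then have "cmod (cf q \<mu> A s' n - cf q \<mu> A s n) = A * \<bar>s' ^ n - s ^ n\<bar> / fact n * k ^ n"
        using A by (simp add: norm_mult norm_power k_def abs_mult del: of_real_mult of_real_minus of_real_diff of_real_divide)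
      also have "\<dots> \<le> A * (2 ^ n * T ^ n * \<bar>s' - s\<bar>) / fact n * k ^ n"
      proof -
        have "\<bar>s' ^ n - s ^ n\<bar> \<le> real n * T ^ n * \<bar>s' - s\<bar>" by (rule power_diff_le[OF s(2,1) T])
        also have "\<dots> \<le> 2 ^ n * T ^ n * \<bar>s' - s\<bar>" using n2 T by (intro mult_right_mono) auto
        finally show ?thesis using A k by (intro mult_right_mono divide_right_mono mult_left_mono) auto
      qed
      finally have "cmod (cf q \<mu> A s' n - cf q \<mu> A s n) \<le> A * (2 ^ n * T ^ n * \<bar>s' - s\<bar>) / fact n * k ^ n" .
      from tb[OF this, of n] have "norm (cmul (cf q \<mu> A s' n - cf q \<mu> A s n) (l n)) \<le> A * (2 ^ n * T ^ n * \<bar>s' - s\<bar>) / fact n * k ^ n * (16 * pi * (1 + q) * e * m * 2 ^ n)" .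
      also have "\<dots> = (c0 * \<bar>s' - s\<bar>) * ((4 * Y) ^ n / fact n)"
      proof -
        have "(4 * Y) ^ n = 2 ^ n * 2 ^ n * k ^ n * T ^ n"
        proof -
          have f: "(4::real) ^ n = 2 ^ n * 2 ^ n" unfolding power_mult_distrib[symmetric] by simp
          show ?thesis unfolding Y_def power_mult_distrib f by (simp only: mult_ac)
        qed
        then show ?thesis by (simp add: c0_def mult_ac)
      qed
      finally show ?thesis .
    qed
    define L where "L s = (\<Sum>n. cmul (cf q \<mu> A s n) (l n))" for s
    have Ceq: "c0 * exp (4 * Y) = C * e * m" by (simp add: C_def c0_def mult_ac)
    have L1: "summable (\<lambda>n. cmul (cf q \<mu> A s n) (l n))" "norm (L s) \<le> C * e * m" if s: "\<bar>s\<bar> \<le> T" for s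
    proof -
      show "summable (\<lambda>n. cmul (cf q \<mu> A s n) (l n))" by (rule exp_series_bound(1)[OF t1[OF s]])
      have "norm (L s) \<le> c0 * exp (2 * Y)" unfolding L_def by (rule exp_series_bound(2)[OF t1[OF s]])
      also have "\<dots> \<le> c0 * exp (4 * Y)" using c0 Y by (intro mult_left_mono) auto
      finally show "norm (L s) \<le> C * e * m" unfolding Ceq .
    qed
    have L2: "norm (L s' - L s) \<le> C * e * m * \<bar>s' - s\<bar>" if s: "\<bar>s\<bar> \<le> T" "\<bar>s'\<bar> \<le> T" for s s'
    proof -
      have d: "cmul (a - b) f = cmul a f - cmul b f" for a b f
        by (rule l2_eqI) (use rep_cmul[of "a - b" f] rep_cmul[of a f] rep_cmul[of b f] rep_minus[of "cmul a f" "cmul b f"] in \<open>eventually_elim, simp add: left_diff_distrib\<close>)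
      have "L s' - L s = (\<Sum>n. cmul (cf q \<mu> A s' n - cf q \<mu> A s n) (l n))"
        unfolding L_def d by (rule suminf_diff[OF L1(1)[OF s(2)] L1(1)[OF s(1)]])
      also have "norm \<dots> \<le> (c0 * \<bar>s' - s\<bar>) * exp (4 * Y)" by (rule exp_series_bound(2)[OF t2[OF s]])
      also have "\<dots> = C * e * m * \<bar>s' - s\<bar>" unfolding Ceq[symmetric] by (simp only: mult_ac)
      finally show ?thesis .
    qed
    have L3: "om_rel (FT (abs_l2 (prof q \<mu> A e s))) (L s)" if s: "\<bar>s\<bar> \<le> T" for s
    proof (rule om_rel_closed)
      show "(\<lambda>N. \<Sum>n<N. cmul (cf q \<mu> A s n) (l n)) \<longlonglongrightarrow> L s"
        unfolding L_def by (rule summable_LIMSEQ[OF L1(1)[OF s]])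
      show "(\<lambda>N. FT (\<Sum>n<N. cmul (cf q \<mu> A s n) (abs_l2 (gs e (1 + real n * q))))) \<longlonglongrightarrow> FT (abs_l2 (prof q \<mu> A e s))"
        by (rule bounded_linear.tendsto[OF bounded_linear_FT prof_series[OF A e q]])
      show "om_rel (FT (\<Sum>n<N. cmul (cf q \<mu> A s n) (abs_l2 (gs e (1 + real n * q))))) (\<Sum>n<N. cmul (cf q \<mu> A s n) (l n))" for N
        unfolding linear_sum[OF bounded_linear.linear[OF bounded_linear_FT]] FT_cmul l_def
        by (rule om_rel_sum, rule om_rel_cmul, rule om_gs(1)[OF e one])
    qed
    show ?thesis
      unfolding m_def[symmetric] using L1(2) L2 L3 by (intro exI[of _ L]) simp
  qed
  show thesis by (rule that[OF C main])
qed

text \<open>The L2 norm of the wide Gaussian grows like e^(-3/4), yet its product with e tends to 0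
  like e^(1/4). Hence dispersive errors proportional to this product are small even in absolute
  terms.\<close>

lemma norm_gs: "e > 0 \<Longrightarrow> (e * norm (abs_l2 (gs e 1)))\<^sup>2 = pi * sqrt e"
proof -
  assume e: "e > 0"
  have "(norm (abs_l2 (gs e 1)))\<^sup>2 = (\<integral>z. (cmod (gs e 1 z))\<^sup>2 \<partial>lborel)"
    by (rule norm_abs_sq[OF sq_int_gs]) (use e in auto)
  also have "\<dots> = (\<integral>z. cmod (gs e 2 z) \<partial>lborel)"
    by (simp only: cmod_gs_mult power2_eq_square one_add_one)
  also have "complex_of_real \<dots> = (\<integral>z. gs e 2 z \<partial>lborel)"
    unfolding integral_complex_of_real[symmetric] gs_eq_cmod[symmetric] ..
  then have "(\<integral>z. cmod (gs e 2 z) \<partial>lborel) = 2 * pi / sqrt (2 * e * (2 * e\<^sup>2))"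
    using e unfolding gs_def by (subst (asm) integral_gaussian) (simp_all only: of_real_eq_iff mult_pos_pos zero_less_power zero_less_numeral)
  also have "sqrt (2 * e * (2 * e\<^sup>2)) = 2 * (e * sqrt e)"
  proof -
    have "2 * e * (2 * e\<^sup>2) = (2 * e)\<^sup>2 * e" by (simp add: power2_eq_square)
    then have "sqrt (2 * e * (2 * e\<^sup>2)) = sqrt ((2 * e)\<^sup>2) * sqrt e" by (simp only: real_sqrt_mult)
    moreover have "sqrt ((2 * e)\<^sup>2) = 2 * e" using e by (intro real_sqrt_unique) auto
    ultimately show ?thesis by (simp only: mult.assoc)
  qed
  finally have "(norm (abs_l2 (gs e 1)))\<^sup>2 = pi / (e * sqrt e)" by simp
  then have "(e * norm (abs_l2 (gs e 1)))\<^sup>2 = e\<^sup>2 * (pi / (e * sqrt e))" by (simp only: power_mult_distrib)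
  also have "\<dots> = pi * (e / sqrt e)" using e by (simp add: power2_eq_square)
  also have "e / sqrt e = sqrt e" using e by (simp add: real_div_sqrt)
  finally show ?thesis .
qed

lemma e_norm_gs_small:
  assumes "d > 0"
  obtains e0 where "e0 > 0" "\<And>e. 0 < e \<Longrightarrow> e \<le> e0 \<Longrightarrow> e * norm (abs_l2 (gs e 1)) \<le> d"
proof
  show "(d\<^sup>2 / pi)\<^sup>2 > 0" using assms by simp
  fix e :: real assume e: "0 < e" "e \<le> (d\<^sup>2 / pi)\<^sup>2"
  have "sqrt e \<le> sqrt ((d\<^sup>2 / pi)\<^sup>2)" using e by (intro real_sqrt_le_mono)
  also have "\<dots> = d\<^sup>2 / pi" by (simp only: real_sqrt_abs) simp
  finally have "pi * sqrt e \<le> pi * (d\<^sup>2 / pi)" by (intro mult_left_mono) auto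
  also have "\<dots> = d\<^sup>2" by simp
  finally have "pi * sqrt e \<le> d\<^sup>2" .
  then have "(e * norm (abs_l2 (gs e 1)))\<^sup>2 \<le> d\<^sup>2" unfolding norm_gs[OF e(1)] .
  then show "e * norm (abs_l2 (gs e 1)) \<le> d" by (rule power2_le_imp_le) (use assms in simp)
qed

section \<open>From the truncated equation in L2 back to \<open>nls_solution\<close>\<close>

lemma gpow_measurable [measurable]:
  assumes q: "q \<ge> 2"
  shows "gpow q \<in> borel_measurable borel"
proof (rule borel_measurable_continuous_onI)
  show "continuous_on UNIV (gpow q)"
    using has_derivative_continuous[OF gpow_has_derivative[OF q]] by (simp add: continuous_on_eq_continuous_within)
qed

lemma nonlin_gpow: "nonlin (q + 1) f = (\<lambda>z. gpow q (f z))"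
  by (simp add: nonlin_def gpow_def fun_eq_iff)

text \<open>As long as |f| <= M the truncation is invisible, and the operator on classes is the
  actual nonlinearity.\<close>

lemma nonlin_nem:
  assumes q: "q \<ge> 2" and M: "M > 0" and f: "sq_int f" and b: "AE z in lborel. cmod (f z) \<le> M"
  shows "sq_int (nonlin (q + 1) f)" "abs_l2 (nonlin (q + 1) f) = nem q M (abs_l2 f)"
proof -
  note [measurable] = sq_int_measurable[OF f] gpow_measurable[OF q]
  have ae: "AE z in lborel. rep_l2 (nem q M (abs_l2 f)) z = nonlin (q + 1) f z"
    using rep_nem[OF q M, of "abs_l2 f"] rep_abs[OF f] b
    unfolding nonlin_gpow by eventually_elim (simp add: gcut_eq)
  show s: "sq_int (nonlin (q + 1) f)"
  proof (rule sq_int_dominated[OF sq_int_rep[of "nem q M (abs_l2 f)"], of _ 1])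
    show "nonlin (q + 1) f \<in> borel_measurable borel" unfolding nonlin_gpow by measurable
    show "AE z in lborel. cmod (nonlin (q + 1) f z) \<le> 1 * cmod (rep_l2 (nem q M (abs_l2 f)) z)"
      using ae by eventually_elim simp
  qed
  show "abs_l2 (nonlin (q + 1) f) = nem q M (abs_l2 f)"
    by (rule l2_eqI) (use ae rep_abs[OF s] in \<open>eventually_elim, simp\<close>)
qed

text \<open>The full complex pairing: \<open>inner\<close> retains only a real part, while the weak
  form of Duhamel's formula is an identity of complex numbers.\<close>

definition pair_l2 :: "fun2 \<Rightarrow> l2 \<Rightarrow> complex" where
  "pair_l2 \<psi> f = (\<integral>\<zeta>. rep_l2 f \<zeta> * cnj (\<psi> \<zeta>) \<partial>lborel)"

lemma pair_l2_eq:
  assumes \<psi>: "sq_int \<psi>" and g: "g \<in> borel_measurable borel" and ae: "AE \<zeta> in lborel. g \<zeta> = rep_l2 f \<zeta>"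
  shows "(\<integral>\<zeta>. g \<zeta> * cnj (\<psi> \<zeta>) \<partial>lborel) = pair_l2 \<psi> f"
  unfolding pair_l2_def
proof (rule integral_cong_AE)
  note [measurable] = sq_int_measurable[OF \<psi>] g
  show "AE \<zeta> in lborel. g \<zeta> * cnj (\<psi> \<zeta>) = rep_l2 f \<zeta> * cnj (\<psi> \<zeta>)" using ae by eventually_elim simp
  show "(\<lambda>\<zeta>. g \<zeta> * cnj (\<psi> \<zeta>)) \<in> borel_measurable lborel" by simp
  show "(\<lambda>\<zeta>. rep_l2 f \<zeta> * cnj (\<psi> \<zeta>)) \<in> borel_measurable lborel" by simp
qed

lemma bounded_linear_pair:
  assumes \<psi>: "sq_int \<psi>"
  shows "bounded_linear (pair_l2 \<psi>)"
proof (rule additive_bounded_linear)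
  note [measurable] = sq_int_measurable[OF \<psi>]
  have i: "integrable lborel (\<lambda>\<zeta>. rep_l2 f \<zeta> * cnj (\<psi> \<zeta>))" for f
    by (rule sq_int_mult_cnj_integrable[OF sq_int_rep \<psi>])
  show "pair_l2 \<psi> (f + g) = pair_l2 \<psi> f + pair_l2 \<psi> g" for f g
  proof -
    have "pair_l2 \<psi> (f + g) = (\<integral>\<zeta>. rep_l2 f \<zeta> * cnj (\<psi> \<zeta>) + rep_l2 g \<zeta> * cnj (\<psi> \<zeta>) \<partial>lborel)"
      unfolding pair_l2_def
      by (rule integral_cong_AE) (simp, simp, use rep_plus[of f g] in \<open>eventually_elim, simp add: distrib_right\<close>)
    then show ?thesis unfolding pair_l2_def by (simp only: Bochner_Integration.integral_add[OF i i])
  qed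
  show "pair_l2 \<psi> (c *\<^sub>R f) = c *\<^sub>R pair_l2 \<psi> f" for c f
  proof -
    have "pair_l2 \<psi> (c *\<^sub>R f) = (\<integral>\<zeta>. c *\<^sub>R (rep_l2 f \<zeta> * cnj (\<psi> \<zeta>)) \<partial>lborel)"
      unfolding pair_l2_def
      by (rule integral_cong_AE) (simp, simp, use rep_scaleR[of c f] in \<open>eventually_elim, simp\<close>)
    then show ?thesis unfolding pair_l2_def by (simp only: integral_scaleR_right)
  qed
  show "norm (pair_l2 \<psi> f) \<le> norm f * sqrt (\<integral>\<zeta>. (cmod (cnj (\<psi> \<zeta>)))\<^sup>2 \<partial>lborel)" for f
  proof -
    have n: "norm f = sqrt (\<integral>z. (cmod (rep_l2 f z))\<^sup>2 \<partial>lborel)" unfolding norm_l2_sq[symmetric] by simp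
    show ?thesis unfolding pair_l2_def n by (rule sq_int_cauchy_schwarz[OF sq_int_rep sq_int_cnj[OF \<psi>]])
  qed
qed

lemma pair_cmul:
  assumes \<psi>: "sq_int \<psi>"
  shows "pair_l2 \<psi> (cmul c f) = c * pair_l2 \<psi> f"
proof -
  note [measurable] = sq_int_measurable[OF \<psi>]
  have "pair_l2 \<psi> (cmul c f) = (\<integral>\<zeta>. c * (rep_l2 f \<zeta> * cnj (\<psi> \<zeta>)) \<partial>lborel)"
    unfolding pair_l2_def
    by (rule integral_cong_AE) (simp, simp, use rep_cmul[of c f] in \<open>eventually_elim, simp\<close>)
  then show ?thesis unfolding pair_l2_def by (simp only: integral_mult_right_zero)
qed

lemma fourier_measurable: "sq_int f \<Longrightarrow> fourier f \<in> borel_measurable borel"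
  by (rule sq_int_measurable[OF fourier_FT(1)])

lemma pair_fourier: "sq_int \<psi> \<Longrightarrow> sq_int f \<Longrightarrow> (\<integral>\<zeta>. fourier f \<zeta> * cnj (\<psi> \<zeta>) \<partial>lborel) = pair_l2 \<psi> (FT (abs_l2 f))"
  by (rule pair_l2_eq[OF _ fourier_measurable fourier_AE])

lemma pair_flow_fourier:
  assumes \<psi>: "sq_int \<psi>" and f: "sq_int f"
  shows "(\<integral>\<zeta>. cis (- (t * omega \<zeta>)) * fourier f \<zeta> * cnj (\<psi> \<zeta>) \<partial>lborel) = pair_l2 \<psi> (flow (- t) (FT (abs_l2 f)))"
proof (rule pair_l2_eq[OF \<psi>])
  note [measurable] = fourier_measurable[OF f]
  show "(\<lambda>\<zeta>. cis (- (t * omega \<zeta>)) * fourier f \<zeta>) \<in> borel_measurable borel" by measurable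
  show "AE \<zeta> in lborel. cis (- (t * omega \<zeta>)) * fourier f \<zeta> = rep_l2 (flow (- t) (FT (abs_l2 f))) \<zeta>"
    using rep_flow[of "- t" "FT (abs_l2 f)"] fourier_AE[OF f] by eventually_elim simp
qed

text \<open>\<open>flow (- t)\<close> turns the interaction picture into Duhamel's formula. The
  pairing with \<psi> is a bounded linear map and so moves under the integral, which by continuity
  of the integrand agrees with the Lebesgue integral of the definition.\<close>

lemma nls_solution_of_duhamel:
  fixes u :: "real \<Rightarrow> fun2"
  assumes q: "q \<ge> 2" and M: "M > 0" and T: "T > 0"
    and su: "\<And>t. sq_int (u t)" and cu: "continuous_on {0..T} (\<lambda>t. abs_l2 (u t))"
    and bd: "\<And>t. t \<in> {0..T} \<Longrightarrow> AE z in lborel. cmod (u t z) \<le> M"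
    and duh: "\<And>t. t \<in> {0..T} \<Longrightarrow> flow t (FT (abs_l2 (u t))) = FT (abs_l2 (u 0)) +
       integral {0..t} (\<lambda>s. cmul (- \<i> * \<mu>) (flow s (FT (nem q M (abs_l2 (u s))))))"
  shows "nls_solution \<mu> (q + 1) T u"
proof -
  define N where "N t = nem q M (abs_l2 (u t))" for t
  have N: "sq_int (nonlin (q + 1) (u t))" "abs_l2 (nonlin (q + 1) (u t)) = N t" if "t \<in> {0..T}" for t
    using nonlin_nem[OF q M su bd[OF that]] by (simp_all add: N_def)
  have cN: "continuous_on {0..T} N" unfolding N_def by (rule nem_continuous_on[OF q M cu])
  have lim: "((\<lambda>\<tau>. \<integral>z. (cmod (f \<tau> z - f \<tau>0 z))\<^sup>2 \<partial>lborel) \<longlongrightarrow> 0) (at \<tau>0 within {0..T})"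
    if f: "\<And>t. t \<in> {0..T} \<Longrightarrow> sq_int (f t)" and c: "continuous_on {0..T} (\<lambda>t. abs_l2 (f t))" and t0: "\<tau>0 \<in> {0..T}"
    for f :: "real \<Rightarrow> fun2" and \<tau>0
  proof -
    have "((\<lambda>\<tau>. abs_l2 (f \<tau>)) \<longlongrightarrow> abs_l2 (f \<tau>0)) (at \<tau>0 within {0..T})"
      using c t0 by (simp add: continuous_on_def)
    then have "((\<lambda>\<tau>. (norm (abs_l2 (f \<tau>) - abs_l2 (f \<tau>0)))\<^sup>2) \<longlongrightarrow> (norm (abs_l2 (f \<tau>0) - abs_l2 (f \<tau>0)))\<^sup>2) (at \<tau>0 within {0..T})"
      by (intro tendsto_power tendsto_norm tendsto_diff tendsto_const)
    then have "((\<lambda>\<tau>. (norm (abs_l2 (f \<tau>) - abs_l2 (f \<tau>0)))\<^sup>2) \<longlongrightarrow> 0) (at \<tau>0 within {0..T})" by simp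
    then show ?thesis
    proof (rule Lim_transform_eventually)
      show "\<forall>\<^sub>F \<tau> in at \<tau>0 within {0..T}. (norm (abs_l2 (f \<tau>) - abs_l2 (f \<tau>0)))\<^sup>2 = (\<integral>z. (cmod (f \<tau> z - f \<tau>0 z))\<^sup>2 \<partial>lborel)"
        unfolding eventually_at_filter using norm_abs_diff_sq[OF f f[OF t0]] by (intro always_eventually) simp
    qed
  qed
  have duh': "(\<integral>\<zeta>. fourier (u s) \<zeta> * cnj (\<psi> \<zeta>) \<partial>lborel) =
        (\<integral>\<zeta>. cis (- (s * omega \<zeta>)) * fourier (u 0) \<zeta> * cnj (\<psi> \<zeta>) \<partial>lborel)
        - \<i> * complex_of_real \<mu> *
          (LINT \<tau>:{0..s}|lborel.
             (\<integral>\<zeta>. cis (- ((s - \<tau>) * omega \<zeta>)) * fourier (nonlin (q + 1) (u \<tau>)) \<zeta> * cnj (\<psi> \<zeta>) \<partial>lborel))"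
    if s: "s \<in> {0..T}" and \<psi>: "sq_int \<psi>" for s \<psi>
  proof -
    have sub: "{0..s} \<subseteq> {0..T}" using s by auto
    note bl = bounded_linear_pair[OF \<psi>]
    define h where "h \<tau> = pair_l2 \<psi> (flow (- (s - \<tau>)) (FT (N \<tau>)))" for \<tau>
    have ch: "continuous_on {0..s} h"
      unfolding h_def
      by (intro bounded_linear.continuous_on[OF bl] flow_continuous_on FT_continuous_on continuous_on_subset[OF cN sub] continuous_intros)
    define k where "k \<tau> = cmul (- \<i> * \<mu>) (flow \<tau> (FT (N \<tau>)))" for \<tau>
    have ck: "continuous_on {0..s} k"
      unfolding k_def
      by (intro cmul_continuous_on flow_continuous_on FT_continuous_on continuous_on_subset[OF cN sub] continuous_intros)
    have "FT (abs_l2 (u s)) = flow (- s) (flow s (FT (abs_l2 (u s))))" by (simp add: flow_flow)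
    also have "flow s (FT (abs_l2 (u s))) = FT (abs_l2 (u 0)) + integral {0..s} k"
      unfolding duh[OF s] k_def N_def ..
    also have "flow (- s) \<dots> = flow (- s) (FT (abs_l2 (u 0))) + flow (- s) (integral {0..s} k)" by (rule flow_add)
    finally have "pair_l2 \<psi> (FT (abs_l2 (u s))) = pair_l2 \<psi> (flow (- s) (FT (abs_l2 (u 0)))) + pair_l2 \<psi> (flow (- s) (integral {0..s} k))"
      by (simp only: linear_add[OF bounded_linear.linear[OF bl]])
    also have "pair_l2 \<psi> (flow (- s) (integral {0..s} k)) = integral {0..s} (\<lambda>\<tau>. pair_l2 \<psi> (flow (- s) (k \<tau>)))"
      using integral_linear[OF integrable_continuous_real[OF ck] bounded_linear_compose[OF bl bounded_linear_flow[of "- s"]]]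
      by (simp add: o_def)
    also have "(\<lambda>\<tau>. pair_l2 \<psi> (flow (- s) (k \<tau>))) = (\<lambda>\<tau>. (- \<i> * \<mu>) * h \<tau>)"
      unfolding k_def h_def flow_cmul pair_cmul[OF \<psi>] flow_flow by simp
    also have "integral {0..s} (\<lambda>\<tau>. (- \<i> * \<mu>) * h \<tau>) = (- \<i> * \<mu>) * integral {0..s} h"
      by (rule integral_mult_right)
    also have "integral {0..s} h = (LINT \<tau>:{0..s}|lborel. h \<tau>)"
      by (rule set_borel_integral_eq_integral(2)[OF borel_integrable_atLeastAtMost'[OF ch], symmetric])
    also have "\<dots> = (LINT \<tau>:{0..s}|lborel. (\<integral>\<zeta>. cis (- ((s - \<tau>) * omega \<zeta>)) * fourier (nonlin (q + 1) (u \<tau>)) \<zeta> * cnj (\<psi> \<zeta>) \<partial>lborel))"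
    proof (rule set_lebesgue_integral_cong)
      show "\<forall>\<tau>. \<tau> \<in> {0..s} \<longrightarrow> h \<tau> = (\<integral>\<zeta>. cis (- ((s - \<tau>) * omega \<zeta>)) * fourier (nonlin (q + 1) (u \<tau>)) \<zeta> * cnj (\<psi> \<zeta>) \<partial>lborel)"
      proof (intro allI impI)
        fix \<tau> assume "\<tau> \<in> {0..s}"
        then have t: "\<tau> \<in> {0..T}" using sub by auto
        show "h \<tau> = (\<integral>\<zeta>. cis (- ((s - \<tau>) * omega \<zeta>)) * fourier (nonlin (q + 1) (u \<tau>)) \<zeta> * cnj (\<psi> \<zeta>) \<partial>lborel)"
          unfolding pair_flow_fourier[OF \<psi> N(1)[OF t]] N(2)[OF t] h_def ..
      qed
    qed simp
    finally show ?thesis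
      unfolding pair_fourier[OF \<psi> su] pair_flow_fourier[OF \<psi> su] by simp
  qed
  have cN': "continuous_on {0..T} (\<lambda>t. abs_l2 (nonlin (q + 1) (u t)))"
    by (rule continuous_on_eq[OF cN]) (simp add: N(2))
  show ?thesis
    unfolding nls_solution_def
    by (intro conjI ballI allI impI su N(1) lim[OF su cu] lim[OF N(1) cN'] duh')
qed

subsection \<open>Solutions close to the profile\<close>

text \<open>For small e the perturbation result and the sup norm bound keep the truncated solution
  within 1 of the profile, so it never exceeds the truncation radius A + 1 and solves the true
  equation. The image under \<open>omega\<close> is recorded for the later comparison of Sobolev and
  L2 norms.\<close>

lemma nls_profile:
  assumes q: "q \<ge> 2" and A: "A > 0" and T: "T > 0"
  obtains K e0 where "K > 0" "e0 > 0"
    "\<And>e. 0 < e \<Longrightarrow> e \<le> e0 \<Longrightarrow> \<exists>u. nls_solution \<mu> (q + 1) T u \<and> u 0 = prof q \<mu> A e 0 \<and> sq_int (u T) \<and>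
       norm (abs_l2 (u T) - abs_l2 (prof q \<mu> A e T)) \<le> K * (e * norm (abs_l2 (gs e 1))) \<and>
       (\<exists>l. om_rel (FT (abs_l2 (u T))) l \<and> norm l \<le> K * (e * norm (abs_l2 (gs e 1))))"
proof -
  define B where "B = A * (\<bar>\<mu>\<bar> * A powr q)"
  have B: "B \<ge> 0" using A by (simp add: B_def)
  have T1: "T + 1 \<ge> 1" using T by simp
  obtain C0 where C0: "C0 > 0" "\<And>e. e > 0 \<Longrightarrow> \<exists>L. (\<forall>s. \<bar>s\<bar> \<le> T + 1 \<longrightarrow> om_rel (FT (abs_l2 (prof q \<mu> A e s))) (L s)) \<and>
       (\<forall>s. \<bar>s\<bar> \<le> T + 1 \<longrightarrow> norm (L s) \<le> C0 * e * norm (abs_l2 (gs e 1))) \<and>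
       (\<forall>s s'. \<bar>s\<bar> \<le> T + 1 \<longrightarrow> \<bar>s'\<bar> \<le> T + 1 \<longrightarrow> norm (L s' - L s) \<le> C0 * e * norm (abs_l2 (gs e 1)) * \<bar>s' - s\<bar>)"
    using prof_omega[OF q A T1] by blast
  obtain C1 where C1: "C1 > 0"
    and pert: "\<And>\<eta> z L. 0 \<le> \<eta> \<Longrightarrow>
      (\<And>s. s \<in> {0..T + 1} \<Longrightarrow> om_rel (FT (z s)) (L s)) \<Longrightarrow>
      (\<And>s. s \<in> {0..T + 1} \<Longrightarrow> (z has_vector_derivative cmul (- \<i> * \<mu>) (nem q (A + 1) (z s))) (at s within {0..T + 1})) \<Longrightarrow>
      (\<And>s. s \<in> {0..T + 1} \<Longrightarrow> AE x in lborel. cmod (rep_l2 (z s) x) \<le> A) \<Longrightarrow>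
      (\<And>s s'. s \<in> {0..T + 1} \<Longrightarrow> s' \<in> {0..T + 1} \<Longrightarrow> AE x in lborel. cmod (rep_l2 (z s') x - rep_l2 (z s) x) \<le> B * \<bar>s' - s\<bar>) \<Longrightarrow>
      (\<And>s. s \<in> {0..T + 1} \<Longrightarrow> norm (L s) \<le> \<eta>) \<Longrightarrow>
      (\<And>s s'. s \<in> {0..T + 1} \<Longrightarrow> s' \<in> {0..T + 1} \<Longrightarrow> norm (L s' - L s) \<le> \<eta> * \<bar>s' - s\<bar>) \<Longrightarrow>
      \<exists>v. v 0 = z 0 \<and> continuous_on {0..T + 1} v \<and>
        (\<forall>t\<in>{0..T + 1}. flow t (FT (v t)) = FT (z 0) + integral {0..t} (\<lambda>s. cmul (- \<i> * \<mu>) (flow s (FT (nem q (A + 1) (v s)))))) \<and>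
        (\<forall>t\<in>{0..T}. norm (v t - z t) \<le> C1 * \<eta> \<and> (\<exists>l. om_rel (FT (v t - z t)) l \<and> norm l \<le> C1 * \<eta>))"
    using dispersion_perturbation[OF q A B T] by blast
  obtain CL where CL: "CL > 0" "\<And>f l. om_rel (FT f) l \<Longrightarrow> AE z in lborel. cmod (rep_l2 f z) \<le> CL * (norm (FT f) + norm l)"
    using Linfty_bound_of_om_rel by blast
  \<comment> \<open>\<open>K2\<close> times \<open>e * norm (abs_l2 (gs e 1))\<close> bounds the sup
    norm distance to the profile: 2 pi stems from the norm of \<open>FT\<close>, the 1 beside it
    from the image under \<open>omega\<close>.\<close>
  define K2 where "K2 = CL * ((2 * pi + 1) * (C1 * C0))"
  have K2: "K2 > 0" unfolding K2_def using CL(1) C1 C0(1) by (intro mult_pos_pos add_pos_pos) auto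
  obtain e0 where e0: "e0 > 0" "\<And>e. 0 < e \<Longrightarrow> e \<le> e0 \<Longrightarrow> e * norm (abs_l2 (gs e 1)) \<le> 1 / K2"
    using e_norm_gs_small[of "1 / K2"] K2 by auto
  define K where "K = C1 * C0 + C0"
  have K: "K > 0" unfolding K_def using C1 C0(1) by (intro add_pos_pos mult_pos_pos)
  have main: "\<exists>u. nls_solution \<mu> (q + 1) T u \<and> u 0 = prof q \<mu> A e 0 \<and> sq_int (u T) \<and>
       norm (abs_l2 (u T) - abs_l2 (prof q \<mu> A e T)) \<le> K * (e * norm (abs_l2 (gs e 1))) \<and>
       (\<exists>l. om_rel (FT (abs_l2 (u T))) l \<and> norm l \<le> K * (e * norm (abs_l2 (gs e 1))))"
    if e: "0 < e" "e \<le> e0" for e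
  proof -
    define em where "em = e * norm (abs_l2 (gs e 1))"
    have em: "em \<ge> 0" "em \<le> 1 / K2" using e e0(2)[OF e] by (auto simp: em_def)
    define \<eta> where "\<eta> = C0 * em"
    have \<eta>: "\<eta> \<ge> 0" using em C0(1) by (simp add: \<eta>_def)
    have \<eta>': "C0 * e * norm (abs_l2 (gs e 1)) = \<eta>" by (simp add: \<eta>_def em_def)
    define z where "z s = abs_l2 (prof q \<mu> A e s)" for s
    have sp: "sq_int (prof q \<mu> A e s)" for s by (rule sq_int_prof) (use A e in auto)
    have q0: "q \<ge> 0" using q by simp
    have pb: "cmod (prof q \<mu> A e s x) \<le> A" for s x
    proof -
      have "A * cmod (gs e 1 x) \<le> A * 1" using A cmod_gs_le_1[of 1 e x] e by (intro mult_left_mono) auto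
      then show ?thesis unfolding cmod_prof[OF less_imp_le[OF A]] by simp
    qed
    obtain L where L0: "(\<forall>s. \<bar>s\<bar> \<le> T + 1 \<longrightarrow> om_rel (FT (z s)) (L s)) \<and> (\<forall>s. \<bar>s\<bar> \<le> T + 1 \<longrightarrow> norm (L s) \<le> \<eta>) \<and>
        (\<forall>s s'. \<bar>s\<bar> \<le> T + 1 \<longrightarrow> \<bar>s'\<bar> \<le> T + 1 \<longrightarrow> norm (L s' - L s) \<le> \<eta> * \<bar>s' - s\<bar>)"
      using C0(2)[OF e(1), folded z_def, unfolded \<eta>'] by (rule exE)
    have L: "om_rel (FT (z s)) (L s)" "norm (L s) \<le> \<eta>" if "\<bar>s\<bar> \<le> T + 1" for s
      using L0 that by simp_all
    have L3: "norm (L s' - L s) \<le> \<eta> * \<bar>s' - s\<bar>" if "\<bar>s\<bar> \<le> T + 1" "\<bar>s'\<bar> \<le> T + 1" for s s'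
      using L0 that by simp
    have "\<exists>v. v 0 = z 0 \<and> continuous_on {0..T + 1} v \<and>
        (\<forall>t\<in>{0..T + 1}. flow t (FT (v t)) = FT (z 0) + integral {0..t} (\<lambda>s. cmul (- \<i> * \<mu>) (flow s (FT (nem q (A + 1) (v s)))))) \<and>
        (\<forall>t\<in>{0..T}. norm (v t - z t) \<le> C1 * \<eta> \<and> (\<exists>l. om_rel (FT (v t - z t)) l \<and> norm l \<le> C1 * \<eta>))"
    proof (rule pert[OF \<eta>])
      show "om_rel (FT (z s)) (L s)" if "s \<in> {0..T + 1}" for s using L(1)[of s] that by simp
      show "norm (L s) \<le> \<eta>" if "s \<in> {0..T + 1}" for s using L(2)[of s] that by simp
      show "norm (L s' - L s) \<le> \<eta> * \<bar>s' - s\<bar>" if "s \<in> {0..T + 1}" "s' \<in> {0..T + 1}" for s s'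
        using L3[of s s'] that by simp
      show "(z has_vector_derivative cmul (- \<i> * \<mu>) (nem q (A + 1) (z s))) (at s within {0..T + 1})" for s
        unfolding z_def by (rule prof_derivative[OF A e(1) q])
      show "AE x in lborel. cmod (rep_l2 (z s) x) \<le> A" for s
        unfolding z_def using rep_abs[OF sp[of s]] by eventually_elim (simp add: pb)
      show "AE x in lborel. cmod (rep_l2 (z s') x - rep_l2 (z s) x) \<le> B * \<bar>s' - s\<bar>" for s s'
        unfolding z_def B_def using rep_abs[OF sp[of s]] rep_abs[OF sp[of s']]
        by eventually_elim (simp only: prof_diff_le[OF less_imp_le[OF A] e(1) q0])
    qed
    then obtain v where v: "v 0 = z 0" "continuous_on {0..T + 1} v"
      "\<And>t. t \<in> {0..T + 1} \<Longrightarrow> flow t (FT (v t)) = FT (z 0) + integral {0..t} (\<lambda>s. cmul (- \<i> * \<mu>) (flow s (FT (nem q (A + 1) (v s)))))"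
      "\<And>t. t \<in> {0..T} \<Longrightarrow> norm (v t - z t) \<le> C1 * \<eta>" "\<And>t. t \<in> {0..T} \<Longrightarrow> \<exists>l. om_rel (FT (v t - z t)) l \<and> norm l \<le> C1 * \<eta>"
      by blast
    \<comment> \<open>\<open>rep_l2\<close> gives an arbitrary representative, whereas the datum
      must be a genuine Schwartz function; at t = 0 the profile itself is therefore used.\<close>
    define u where "u t = (if t = 0 then prof q \<mu> A e 0 else rep_l2 (v t))" for t
    have au: "abs_l2 (u t) = v t" for t by (simp add: u_def v(1) z_def)
    have u0: "u 0 = prof q \<mu> A e 0" by (simp add: u_def)
    have su: "sq_int (u t)" for t by (simp add: u_def sp)
    have M: "A + 1 > 0" using A by simp
    have vb: "AE x in lborel. cmod (rep_l2 (v t) x) \<le> A + 1" if t: "t \<in> {0..T}" for t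
    proof -
      obtain l where l: "om_rel (FT (v t - z t)) l" "norm l \<le> C1 * \<eta>" using v(5)[OF t] by blast
      have "CL * (norm (FT (v t - z t)) + norm l) \<le> CL * (2 * pi * (C1 * \<eta>) + C1 * \<eta>)"
        using CL(1) v(4)[OF t] l(2) unfolding norm_FT by (intro mult_left_mono add_mono) auto
      also have "\<dots> = K2 * em" by (simp add: K2_def \<eta>_def algebra_simps)
      also have "\<dots> \<le> K2 * (1 / K2)" using em K2 by (intro mult_left_mono) auto
      also have "\<dots> = 1" using K2 by simp
      finally have one: "CL * (norm (FT (v t - z t)) + norm l) \<le> 1" .
      show ?thesis
        using CL(2)[OF l(1)] rep_minus[of "v t" "z t"] rep_abs[OF sp[of t]]
      proof eventually_elim
        case (elim x)
        have "cmod (rep_l2 (v t) x - prof q \<mu> A e t x) \<le> 1" using elim one by (simp add: z_def)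
        then show ?case using norm_triangle_ineq2[of "rep_l2 (v t) x" "prof q \<mu> A e t x"] pb[of t x] by linarith
      qed
    qed
    have nls: "nls_solution \<mu> (q + 1) T u"
    proof (rule nls_solution_of_duhamel[OF q M T su])
      show "continuous_on {0..T} (\<lambda>t. abs_l2 (u t))"
        unfolding au by (rule continuous_on_subset[OF v(2)]) auto
      show "AE x in lborel. cmod (u t x) \<le> A + 1" if "t \<in> {0..T}" for t
      proof (cases "t = 0")
        case True
        show ?thesis by (rule AE_I2) (use pb[of 0] in \<open>simp add: u_def True add_increasing2\<close>)
      next
        case False
        then show ?thesis using vb[OF that] by (simp add: u_def)
      qed
      show "flow t (FT (abs_l2 (u t))) = FT (abs_l2 (u 0)) + integral {0..t} (\<lambda>s. cmul (- \<i> * \<mu>) (flow s (FT (nem q (A + 1) (abs_l2 (u s))))))"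
        if "t \<in> {0..T}" for t
        unfolding au v(1) by (rule v(3)) (use that in auto)
    qed
    have TT: "T \<in> {0..T}" using T by simp
    obtain l where l: "om_rel (FT (v T - z T)) l" "norm l \<le> C1 * \<eta>" using v(5)[OF TT] by blast
    have "om_rel (FT (v T - z T) + FT (z T)) (l + L T)"
      by (rule om_rel_add[OF l(1) L(1)]) (use T in simp)
    then have ol: "om_rel (FT (v T)) (l + L T)" by (simp add: FT_diff)
    have "norm (l + L T) \<le> C1 * \<eta> + \<eta>"
      using L(2)[of T] T by (intro order_trans[OF norm_triangle_ineq] add_mono l) simp
    also have "\<dots> = K * em" by (simp add: K_def \<eta>_def algebra_simps)
    finally have nl: "norm (l + L T) \<le> K * em" .
    have "norm (v T - z T) \<le> C1 * \<eta>" by (rule v(4)[OF TT])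
    also have "\<dots> \<le> C1 * \<eta> + \<eta>" using \<eta> by simp
    also have "\<dots> = K * em" by (simp add: K_def \<eta>_def algebra_simps)
    finally have nv: "norm (v T - z T) \<le> K * em" .
    show ?thesis
      unfolding em_def[symmetric]
      by (intro exI[of _ u] conjI nls su exI[of _ "l + L T"]) (use ol nl nv in \<open>simp_all only: au z_def u0\<close>)
  qed
  show thesis by (rule that[OF K e0(1) main])
qed

subsection \<open>Sobolev norms of low-frequency functions\<close>

definition wt :: "real \<Rightarrow> real \<Rightarrow> real \<times> real \<Rightarrow> real" where
  "wt s1 s2 \<zeta> = jbr (fst \<zeta>) powr s1 * jbr (snd \<zeta>) powr s2"

lemma jbr_ge_1: "jbr x \<ge> 1"
  by (simp add: jbr_def)

text \<open>From 1 - exp (- a) <= a and two bounds for the logarithm of the bracket, by x^2 and by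
  |x|. They match the two terms of \<open>omega\<close>: the quadratic bound serves for xi and the
  linear one for eta.\<close>

lemma jbr_powr_bounds:
  assumes "s \<le> 0"
  shows "0 \<le> jbr x powr s" "jbr x powr s \<le> 1" "1 - jbr x powr s \<le> \<bar>s\<bar> * x\<^sup>2" "1 - jbr x powr s \<le> \<bar>s\<bar> * \<bar>x\<bar>"
proof -
  have l0: "0 \<le> ln (jbr x)" using jbr_ge_1[of x] by simp
  have p: "jbr x powr s = exp (s * ln (jbr x))" using jbr_ge_1[of x] by (simp add: powr_def)
  show "0 \<le> jbr x powr s" by simp
  have "s * ln (jbr x) \<le> 0" using assms l0 by (rule mult_nonpos_nonneg)
  then show "jbr x powr s \<le> 1" unfolding p by simp
  have "1 + s * ln (jbr x) \<le> exp (s * ln (jbr x))" by (rule exp_ge_add_one_self)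
  then have b: "1 - jbr x powr s \<le> \<bar>s\<bar> * ln (jbr x)" unfolding p abs_of_nonpos[OF assms] by linarith
  have pos: "0 < 1 + x\<^sup>2" by (simp add: add_pos_nonneg)
  have "ln (jbr x) = ln (1 + x\<^sup>2) / 2" unfolding jbr_def by (rule ln_sqrt[OF less_imp_le[OF pos]])
  moreover have "ln (1 + x\<^sup>2) \<le> x\<^sup>2" by (rule ln_add_one_self_le_self) simp
  ultimately have "ln (jbr x) \<le> x\<^sup>2" using l0 by simp
  then show "1 - jbr x powr s \<le> \<bar>s\<bar> * x\<^sup>2" using b mult_left_mono[of "ln (jbr x)" "x\<^sup>2" "\<bar>s\<bar>"] by linarith
  have "jbr x \<le> 1 + \<bar>x\<bar>" unfolding jbr_def by (rule real_le_lsqrt) (simp_all add: power2_sum)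
  then have "ln (jbr x) \<le> ln (1 + \<bar>x\<bar>)" using jbr_ge_1[of x] by simp
  also have "\<dots> \<le> \<bar>x\<bar>" by (rule ln_add_one_self_le_self) simp
  finally have "ln (jbr x) \<le> \<bar>x\<bar>" .
  then show "1 - jbr x powr s \<le> \<bar>s\<bar> * \<bar>x\<bar>" using b mult_left_mono[of "ln (jbr x)" "\<bar>x\<bar>" "\<bar>s\<bar>"] by linarith
qed

lemma wt_bounds:
  assumes "s1 \<le> 0" "s2 \<le> 0"
  shows "0 \<le> wt s1 s2 \<zeta>" "wt s1 s2 \<zeta> \<le> 1" "1 - wt s1 s2 \<zeta> \<le> (\<bar>s1\<bar> + \<bar>s2\<bar>) * omega \<zeta>"
proof -
  note a = jbr_powr_bounds[OF assms(1), of "fst \<zeta>"] and b = jbr_powr_bounds[OF assms(2), of "snd \<zeta>"]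
  define x where "x = jbr (fst \<zeta>) powr s1"
  define y where "y = jbr (snd \<zeta>) powr s2"
  have xy: "0 \<le> x" "x \<le> 1" "0 \<le> y" "y \<le> 1" using a b by (auto simp: x_def y_def)
  have w: "wt s1 s2 \<zeta> = x * y" by (simp add: wt_def x_def y_def)
  show "0 \<le> wt s1 s2 \<zeta>" "wt s1 s2 \<zeta> \<le> 1" unfolding w using xy by (auto intro: mult_le_one)
  have "0 \<le> (1 - x) * (1 - y)" using xy by (intro mult_nonneg_nonneg) auto
  then have "1 - x * y \<le> (1 - x) + (1 - y)" by (simp add: algebra_simps)
  also have "\<dots> \<le> \<bar>s1\<bar> * (fst \<zeta>)\<^sup>2 + \<bar>s2\<bar> * \<bar>snd \<zeta>\<bar>"
    using a(3) b(4) unfolding x_def y_def by (rule add_mono)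
  also have "\<dots> \<le> (\<bar>s1\<bar> + \<bar>s2\<bar>) * omega \<zeta>"
    unfolding omega_def distrib_left distrib_right by (simp add: add_mono)
  finally show "1 - wt s1 s2 \<zeta> \<le> (\<bar>s1\<bar> + \<bar>s2\<bar>) * omega \<zeta>" unfolding w .
qed

lemma wt_measurable [measurable]: "wt s1 s2 \<in> borel_measurable borel"
proof (rule borel_measurable_continuous_onI)
  have "jbr x \<noteq> 0" for x using jbr_ge_1[of x] by simp
  then have "continuous_on UNIV (\<lambda>x. jbr x powr s)" for s
    by (intro continuous_on_powr continuous_on_const) (auto simp: jbr_def[abs_def] intro!: continuous_intros)
  then have c: "continuous_on UNIV (\<lambda>z. jbr (h z) powr s)" if "continuous_on UNIV h" for h :: "real \<times> real \<Rightarrow> real" and s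
    using continuous_on_compose2[of UNIV "\<lambda>x. jbr x powr s" UNIV h] that by simp
  show "continuous_on UNIV (wt s1 s2)"
    unfolding wt_def[abs_def] by (intro continuous_on_mult c continuous_intros)
qed

lemma hnorm_eq:
  assumes s: "s1 \<le> 0" "s2 \<le> 0" and f: "sq_int f"
  shows "hnorm s1 s2 f = norm (mult_l2 (\<lambda>\<zeta>. complex_of_real (wt s1 s2 \<zeta>)) (FT (abs_l2 f)))"
proof -
  note [measurable] = fourier_measurable[OF f]
  let ?m = "\<lambda>\<zeta>. complex_of_real (wt s1 s2 \<zeta>)"
  have jm: "jbr \<in> borel_measurable borel" unfolding jbr_def[abs_def] by measurable
  have m: "?m \<in> borel_measurable borel" "\<And>\<zeta>. cmod (?m \<zeta>) \<le> 1"
    using wt_bounds[OF s] by (simp_all add: abs_of_nonneg)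
  have sq: "jbr x powr (2 * s) = (jbr x powr s)\<^sup>2" for x s
    by (simp add: power2_eq_square flip: powr_add)
  have "(\<integral>\<zeta>. (jbr (fst \<zeta>)) powr (2 * s1) * (jbr (snd \<zeta>)) powr (2 * s2) * (cmod (fourier f \<zeta>))\<^sup>2 \<partial>lborel)
     = (\<integral>\<zeta>. (wt s1 s2 \<zeta> * cmod (fourier f \<zeta>))\<^sup>2 \<partial>lborel)"
    unfolding sq wt_def power_mult_distrib ..
  also have "\<dots> = (\<integral>\<zeta>. (cmod (rep_l2 (mult_l2 ?m (FT (abs_l2 f))) \<zeta>))\<^sup>2 \<partial>lborel)"
  proof (rule integral_cong_AE)
    show "AE \<zeta> in lborel. (wt s1 s2 \<zeta> * cmod (fourier f \<zeta>))\<^sup>2 = (cmod (rep_l2 (mult_l2 ?m (FT (abs_l2 f))) \<zeta>))\<^sup>2"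
      using rep_mult[OF m, of "FT (abs_l2 f)"] fourier_AE[OF f]
      by eventually_elim (simp add: norm_mult power_mult_distrib)
  qed simp_all
  also have "\<dots> = (norm (mult_l2 ?m (FT (abs_l2 f))))\<^sup>2" by (rule norm_l2_sq[symmetric])
  finally show ?thesis unfolding hnorm_def by simp
qed

lemma hnorm_upper:
  assumes s: "s1 \<le> 0" "s2 \<le> 0" and f: "sq_int f"
  shows "hnorm s1 s2 f \<le> 2 * pi * norm (abs_l2 f)"
proof -
  have "hnorm s1 s2 f \<le> 1 * norm (FT (abs_l2 f))"
    unfolding hnorm_eq[OF s f]
    by (rule norm_mult_l2) (use wt_bounds[OF s] in \<open>simp_all add: abs_of_nonneg\<close>)
  then show ?thesis by (simp add: norm_FT)
qed

text \<open>At frequencies where \<open>omega\<close> is small the weight of a negative Sobolev norm is close to 1.\<close>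

lemma hnorm_lower:
  assumes s: "s1 \<le> 0" "s2 \<le> 0" and f: "sq_int f" and o: "om_rel (FT (abs_l2 f)) l"
  shows "2 * pi * norm (abs_l2 f) - (\<bar>s1\<bar> + \<bar>s2\<bar>) * norm l \<le> hnorm s1 s2 f"
proof -
  let ?m = "\<lambda>\<zeta>. complex_of_real (wt s1 s2 \<zeta>)" and ?F = "FT (abs_l2 f)"
  have m: "?m \<in> borel_measurable borel" "\<And>\<zeta>. cmod (?m \<zeta>) \<le> 1"
    using wt_bounds[OF s] by (simp_all add: abs_of_nonneg)
  have "norm (?F - mult_l2 ?m ?F) \<le> (\<bar>s1\<bar> + \<bar>s2\<bar>) * norm l"
  proof (rule norm_l2_le)
    show "AE \<zeta> in lborel. cmod (rep_l2 (?F - mult_l2 ?m ?F) \<zeta>) \<le> (\<bar>s1\<bar> + \<bar>s2\<bar>) * cmod (rep_l2 l \<zeta>)"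
      using rep_minus[of ?F "mult_l2 ?m ?F"] rep_mult[OF m, of ?F] o[unfolded om_rel_def]
    proof eventually_elim
      case (elim \<zeta>)
      have "rep_l2 (?F - mult_l2 ?m ?F) \<zeta> = complex_of_real (1 - wt s1 s2 \<zeta>) * rep_l2 ?F \<zeta>"
        unfolding elim by (simp add: left_diff_distrib)
      then have "cmod (rep_l2 (?F - mult_l2 ?m ?F) \<zeta>) = (1 - wt s1 s2 \<zeta>) * cmod (rep_l2 ?F \<zeta>)"
        using wt_bounds(2)[OF s, of \<zeta>] by (simp only: norm_mult norm_of_real abs_of_nonneg diff_ge_0_iff_ge)
      also have "\<dots> \<le> ((\<bar>s1\<bar> + \<bar>s2\<bar>) * omega \<zeta>) * cmod (rep_l2 ?F \<zeta>)"
        by (intro mult_right_mono wt_bounds(3)[OF s]) simp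
      also have "\<dots> = (\<bar>s1\<bar> + \<bar>s2\<bar>) * cmod (rep_l2 l \<zeta>)"
        unfolding elim norm_mult norm_of_real using omega_nonneg[of \<zeta>] by simp
      finally show ?case .
    qed
  qed simp
  moreover have "norm ?F - norm (mult_l2 ?m ?F) \<le> norm (?F - mult_l2 ?m ?F)" by (rule norm_triangle_ineq2)
  ultimately show ?thesis unfolding hnorm_eq[OF s f] norm_FT by linarith
qed

subsection \<open>Oscillation of the phase difference\<close>

text \<open>Anisotropic scaling carries \<open>gs 1\<close> to \<open>gs e\<close>; it makes the
  oscillation estimate uniform in e.\<close>

lemma integral_scale_pair:
  fixes f :: "real \<times> real \<Rightarrow> real"
  assumes a: "a > 0" and b: "b > 0" and [measurable]: "f \<in> borel_measurable borel"
  shows "(\<integral>z. f z \<partial>lborel) = a * b * (\<integral>z. f (a * fst z, b * snd z) \<partial>lborel)"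
proof -
  define c :: "real \<times> real \<Rightarrow> real" where "c j = a * fst j + b * snd j" for j
  define T :: "real \<times> real \<Rightarrow> real \<times> real" where "T z = 0 + (\<Sum>j\<in>Basis. (c j * (z \<bullet> j)) *\<^sub>R j)" for z
  have B: "(Basis :: (real \<times> real) set) = {(1, 0), (0, 1)}" by (auto simp: Basis_prod_def)
  have T: "T z = (a * fst z, b * snd z)" for z
    unfolding T_def B by (cases z) (simp add: c_def)
  have c: "(\<Prod>j\<in>Basis. \<bar>c j\<bar>) = a * b" unfolding B using a b by (simp add: c_def)
  have Tm: "T \<in> borel_measurable borel"
    unfolding T[abs_def] by (intro borel_measurable_continuous_onI continuous_intros)
  have L: "lborel = density (distr lborel borel T) (\<lambda>_. ennreal (a * b))"
    unfolding c[symmetric] T_def[abs_def]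
    by (rule lborel_affine_euclidean) (use a b in \<open>auto simp: B c_def\<close>)
  have "(\<integral>z. f z \<partial>lborel) = (\<integral>z. f z \<partial>density (distr lborel borel T) (\<lambda>_. ennreal (a * b)))"
    using L by (rule arg_cong)
  also have "\<dots> = (\<integral>z. (a * b) *\<^sub>R f z \<partial>distr lborel borel T)"
    by (rule integral_density) (use a b in auto)
  also have "\<dots> = (\<integral>z. (a * b) *\<^sub>R f (T z) \<partial>lborel)"
    by (rule integral_distr) (use Tm in auto)
  finally show ?thesis unfolding T by simp
qed

text \<open>The cosines are real parts of a geometric progression with ratio \<open>cis x\<close>,
  different from 1, so the partial sums stay bounded by \<open>2 / cmod (1 - cis x)\<close>.\<close>

lemma cesaro_cos:
  assumes x: "0 < x" "x < pi"
  shows "(\<lambda>N. (\<Sum>k<Suc N. cos (real (Suc k) * x)) / real (Suc N)) \<longlonglongrightarrow> 0"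
proof (rule Lim_null_comparison[OF always_eventually], rule allI)
  have ne: "cis x \<noteq> 1" using sin_gt_zero[OF x] by (auto simp: complex_eq_iff)
  define c where "c = 2 / cmod (1 - cis x)"
  fix N
  have "cos (real (Suc k) * x) = Re (cis x * cis x ^ k)" for k
    by (subst power_Suc[symmetric], subst Complex.DeMoivre) (simp only: cis.sel)
  then have "(\<Sum>k<Suc N. cos (real (Suc k) * x)) = Re (cis x * (\<Sum>k<Suc N. cis x ^ k))"
    by (simp only: sum_distrib_left Re_sum)
  also have "\<bar>\<dots>\<bar> \<le> cmod (cis x * (\<Sum>k<Suc N. cis x ^ k))" by (rule abs_Re_le_cmod)
  also have "\<dots> = cmod (1 - cis x ^ Suc N) / cmod (1 - cis x)"
    unfolding sum_gp_strict using ne by (simp add: norm_mult norm_divide del: power_Suc)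
  also have "\<dots> \<le> c"
    unfolding c_def
    by (intro divide_right_mono order_trans[OF norm_triangle_ineq4]) (simp_all add: norm_power del: power_Suc)
  finally show "norm ((\<Sum>k<Suc N. cos (real (Suc k) * x)) / real (Suc N)) \<le> c / real (Suc N)"
    by (simp only: real_norm_def abs_divide abs_of_nat divide_right_mono of_nat_0_le_iff)
next
  show "(\<lambda>N. 2 / cmod (1 - cis x) / real (Suc N)) \<longlonglongrightarrow> 0"
    by (rule LIMSEQ_Suc[OF lim_const_over_n])
qed

text \<open>Pointwise |1 - cis x|^2 = 2 - 2 cos x, so the square of the right-hand norm is twice
  that of the Gaussian minus twice the integral \<open>I\<close>. If \<open>I 1 k\<close> stayed
  above c for all k >= 1, so would its Cesaro means, which tend to 0 by dominated convergence.
  Scaling makes k independent of e.\<close>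

lemma oscillation:
  assumes q: "q > 0"
  obtains k :: nat where "k \<ge> 1"
    "\<And>e. e > 0 \<Longrightarrow> 13 / 10 * norm (abs_l2 (gs e 1)) \<le> norm (abs_l2 (\<lambda>z. gs e 1 z * (1 - cis (real k * cmod (gs e q z)))))"
proof -
  define I where "I e x = (\<integral>z. (cmod (gs e 1 z))\<^sup>2 * cos (x * cmod (gs e q z)) \<partial>lborel)" for e x :: real
  have int: "integrable lborel (\<lambda>z. (cmod (gs e 1 z))\<^sup>2)" if "e > 0" for e
    using sq_int_gs[OF that, of 1] unfolding sq_int_def by simp
  have m2: "(norm (abs_l2 (gs e 1)))\<^sup>2 = (\<integral>z. (cmod (gs e 1 z))\<^sup>2 \<partial>lborel)" if "e > 0" for e
    by (rule norm_abs_sq[OF sq_int_gs]) (use that in auto)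
  have scale: "gs e \<alpha> z = gs 1 \<alpha> (sqrt e * fst z, e * snd z)" if "e > 0" for e \<alpha> z
    unfolding gs_def gaussian_def using that by (simp add: power_mult_distrib mult_ac)
  have S: "(\<integral>z. F (cmod (gs 1 1 z)) (cmod (gs 1 q z)) \<partial>lborel) = sqrt e * e * (\<integral>z. F (cmod (gs e 1 z)) (cmod (gs e q z)) \<partial>lborel)"
    if e: "e > 0" and [measurable]: "(\<lambda>z. F (cmod (gs 1 1 z)) (cmod (gs 1 q z))) \<in> borel_measurable borel" for e and F :: "real \<Rightarrow> real \<Rightarrow> real"
    using integral_scale_pair[of "sqrt e" e "\<lambda>z. F (cmod (gs 1 1 z)) (cmod (gs 1 q z))"] e
    by (simp add: scale[OF e, symmetric])
  \<comment> \<open>A tenth of the squared norm leaves 2 - 2/10 = 1.8, which is above 1.3^2 =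
    1.69.\<close>
  define c where "c = (norm (abs_l2 (gs 1 1)))\<^sup>2 / 10"
  have c: "c > 0"
  proof -
    have "0 < pi * sqrt 1" using pi_gt_zero by simp
    then show ?thesis unfolding c_def using norm_gs[of 1] by simp
  qed
  have "\<exists>k::nat. k \<ge> 1 \<and> I 1 (real k) \<le> c"
  proof (rule ccontr)
    assume "\<not> ?thesis"
    then have "\<forall>k::nat. k \<ge> 1 \<longrightarrow> \<not> I 1 (real k) \<le> c" by blast
    from this[rule_format, of "Suc _"] have big: "c \<le> I 1 (real (Suc k))" for k
      by (simp only: not_le less_imp_le le_add1 plus_1_eq_Suc[symmetric])
    let ?s = "\<lambda>N z. (cmod (gs 1 1 z))\<^sup>2 * ((\<Sum>k<Suc N. cos (real (Suc k) * cmod (gs 1 q z))) / real (Suc N))"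
    have lim: "(\<lambda>N. \<integral>z. ?s N z \<partial>lborel) \<longlonglongrightarrow> (\<integral>z. 0 \<partial>(lborel :: (real \<times> real) measure))"
    proof (rule integral_dominated_convergence[where w = "\<lambda>z. (cmod (gs 1 1 z))\<^sup>2"])
      show "AE z in lborel. (\<lambda>N. ?s N z) \<longlonglongrightarrow> 0"
      proof (rule AE_I2)
        fix z
        have "0 < cmod (gs 1 q z)" unfolding cmod_gs by simp
        moreover have "cmod (gs 1 q z) < pi" using cmod_gs_le_1[of q 1 z] q pi_gt3 by simp
        ultimately show "(\<lambda>N. ?s N z) \<longlonglongrightarrow> 0"
          by (intro tendsto_mult_right_zero cesaro_cos)
      qed
      show "AE z in lborel. norm (?s N z) \<le> (cmod (gs 1 1 z))\<^sup>2" for N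
      proof (rule AE_I2)
        fix z
        have "\<bar>\<Sum>k<Suc N. cos (real (Suc k) * cmod (gs 1 q z))\<bar> \<le> (\<Sum>k<Suc N. 1)"
          by (intro order_trans[OF sum_abs] sum_mono) simp
        then have "\<bar>(\<Sum>k<Suc N. cos (real (Suc k) * cmod (gs 1 q z))) / real (Suc N)\<bar> \<le> 1"
          unfolding abs_divide by (simp add: divide_le_eq_1 del: sum.lessThan_Suc)
        from mult_left_mono[OF this, of "(cmod (gs 1 1 z))\<^sup>2"]
        show "norm (?s N z) \<le> (cmod (gs 1 1 z))\<^sup>2" by (simp only: real_norm_def abs_mult abs_power2 zero_le_power2 mult_1_right)
      qed
    qed (use int[of 1] in simp_all)
    have ik: "integrable lborel (\<lambda>z. (cmod (gs 1 1 z))\<^sup>2 * cos (x * cmod (gs 1 q z)))" for x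
      by (rule Bochner_Integration.integrable_bound[OF int[of 1]]) (auto simp: abs_mult intro!: mult_left_le)
    have "c \<le> (\<integral>z. ?s N z \<partial>lborel)" for N
    proof -
      have "(\<integral>z. ?s N z \<partial>lborel) = (\<integral>z. (\<Sum>k<Suc N. (cmod (gs 1 1 z))\<^sup>2 * cos (real (Suc k) * cmod (gs 1 q z))) / real (Suc N) \<partial>lborel)"
        by (simp only: times_divide_eq_right sum_distrib_left)
      also have "\<dots> = (\<Sum>k<Suc N. I 1 (real (Suc k))) / real (Suc N)"
        unfolding I_def integral_divide_zero by (subst Bochner_Integration.integral_sum) (rule ik, rule refl)
      finally have eq: "(\<integral>z. ?s N z \<partial>lborel) = (\<Sum>k<Suc N. I 1 (real (Suc k))) / real (Suc N)" .
      have "(\<Sum>k<Suc N. c) \<le> (\<Sum>k<Suc N. I 1 (real (Suc k)))" by (intro sum_mono big)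
      then have "c * real (Suc N) \<le> (\<Sum>k<Suc N. I 1 (real (Suc k)))" by (simp only: sum_constant card_lessThan mult.commute)
      then show ?thesis unfolding eq by (subst pos_le_divide_eq) simp_all
    qed
    then have "c \<le> (\<integral>z. 0 \<partial>(lborel :: (real \<times> real) measure))"
      by (intro LIMSEQ_le_const[OF lim]) blast
    with c show False by simp
  qed
  then obtain k :: nat where k: "k \<ge> 1" "I 1 (real k) \<le> c" by blast
  have "13 / 10 * norm (abs_l2 (gs e 1)) \<le> norm (abs_l2 (\<lambda>z. gs e 1 z * (1 - cis (real k * cmod (gs e q z)))))" if e: "e > 0" for e
  proof -
    let ?f = "\<lambda>z. gs e 1 z * (1 - cis (real k * cmod (gs e q z)))"
    define w where "w = sqrt e * e"
    have w: "w > 0" using e by (simp add: w_def)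
    have "I 1 (real k) = w * I e (real k)"
      unfolding I_def w_def by (rule S[OF e, of "\<lambda>u v. u\<^sup>2 * cos (real k * v)"]) simp
    moreover have "(norm (abs_l2 (gs 1 1)))\<^sup>2 = w * (norm (abs_l2 (gs e 1)))\<^sup>2"
      unfolding m2[OF e] m2[OF zero_less_one] w_def by (rule S[OF e, of "\<lambda>u v. u\<^sup>2"]) simp
    ultimately have "w * I e (real k) \<le> w * ((norm (abs_l2 (gs e 1)))\<^sup>2 / 10)" using k(2) by (simp add: c_def)
    then have Ie: "I e (real k) \<le> (norm (abs_l2 (gs e 1)))\<^sup>2 / 10" using w by (simp only: mult_le_cancel_left_pos)
    have ie: "integrable lborel (\<lambda>z. (cmod (gs e 1 z))\<^sup>2 * cos (real k * cmod (gs e q z)))"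
      by (rule Bochner_Integration.integrable_bound[OF int[OF e]]) (auto simp: abs_mult intro!: mult_left_le)
    have f2: "(cmod (?f z))\<^sup>2 = 2 * (cmod (gs e 1 z))\<^sup>2 - 2 * ((cmod (gs e 1 z))\<^sup>2 * cos (real k * cmod (gs e q z)))" for z
    proof -
      have "(cmod (1 - cis x))\<^sup>2 = 2 - 2 * cos x" for x
      proof -
        have "(cmod (1 - cis x))\<^sup>2 = (1 - cos x)\<^sup>2 + (sin x)\<^sup>2" by (simp add: cmod_power2)
        also have "\<dots> = 1 - 2 * cos x + ((sin x)\<^sup>2 + (cos x)\<^sup>2)" by (simp add: power2_diff)
        finally show ?thesis by simp
      qed
      then show ?thesis unfolding norm_mult power_mult_distrib by (simp add: right_diff_distrib)
    qed
    have "cmod (?f z) \<le> 2 * cmod (gs e 1 z)" for z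
    proof -
      have "cmod (1 - cis x) \<le> 2" for x using norm_triangle_ineq4[of 1 "cis x"] by simp
      from mult_left_mono[OF this[of "real k * cmod (gs e q z)"] norm_ge_zero[of "gs e 1 z"]]
      show ?thesis by (simp only: norm_mult mult.commute[of 2])
    qed
    then have sf: "sq_int ?f" using e by (intro sq_int_bounded[OF sq_int_gs[of e 1]]) simp_all
    have "(norm (abs_l2 ?f))\<^sup>2 = 2 * (norm (abs_l2 (gs e 1)))\<^sup>2 - 2 * I e (real k)"
      unfolding norm_abs_sq[OF sf] f2 m2[OF e] I_def
      using int[OF e] ie by (simp only: Bochner_Integration.integral_diff integrable_mult_right integral_mult_right_zero)
    moreover have sq: "(13 / 10 :: real)\<^sup>2 = 169 / 100" by (simp add: power2_eq_square)
    moreover have "0 \<le> (norm (abs_l2 (gs e 1)))\<^sup>2" by (rule zero_le_power2)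
    ultimately have "(13 / 10 * norm (abs_l2 (gs e 1)))\<^sup>2 \<le> (norm (abs_l2 ?f))\<^sup>2"
      using Ie unfolding power_mult_distrib sq by linarith
    then show ?thesis by (rule power2_le_imp_le) simp
  qed
  with k(1) show thesis by (rule that)
qed

subsection \<open>Schwartz data\<close>

text \<open>A family closed under both partial derivatives and under multiplication by monomials, so
  that the Schwartz conditions reduce to differentiability and boundedness of its members.\<close>

definition poly_gauss :: "real \<Rightarrow> real \<Rightarrow> real poly \<Rightarrow> real poly \<Rightarrow> fun2" where
  "poly_gauss a b P Q z = complex_of_real
     ((poly P (fst z) * exp (- (a * (fst z)\<^sup>2 / 2))) * (poly Q (snd z) * exp (- (b * (snd z)\<^sup>2 / 2))))"

lemma poly_gauss1_derivative:
  "((\<lambda>x::real. poly P x * exp (- (a * x\<^sup>2 / 2))) has_real_derivative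
     poly (pderiv P - smult a (pCons 0 P)) x * exp (- (a * x\<^sup>2 / 2))) (at x)"
  by (auto intro!: derivative_eq_intros poly_DERIV simp: algebra_simps)

lemma px_poly_gauss: "px (poly_gauss a b P Q) = poly_gauss a b (pderiv P - smult a (pCons 0 P)) Q"
proof
  fix z :: "real \<times> real"
  have "((\<lambda>s. poly_gauss a b P Q (s, snd z)) has_vector_derivative
      poly_gauss a b (pderiv P - smult a (pCons 0 P)) Q (fst z, snd z)) (at (fst z))"
    unfolding poly_gauss_def fst_conv snd_conv
    by (intro has_vector_derivative_of_real DERIV_cmult_right[OF poly_gauss1_derivative])
  then show "px (poly_gauss a b P Q) z = poly_gauss a b (pderiv P - smult a (pCons 0 P)) Q z"
    unfolding px_def by (simp add: case_prod_beta vector_derivative_at)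
qed

lemma py_poly_gauss: "py (poly_gauss a b P Q) = poly_gauss a b P (pderiv Q - smult b (pCons 0 Q))"
proof
  fix z :: "real \<times> real"
  have "((\<lambda>s. poly_gauss a b P Q (fst z, s)) has_vector_derivative
      poly_gauss a b P (pderiv Q - smult b (pCons 0 Q)) (fst z, snd z)) (at (snd z))"
    unfolding poly_gauss_def fst_conv snd_conv
    by (intro has_vector_derivative_of_real DERIV_cmult[OF poly_gauss1_derivative])
  then show "py (poly_gauss a b P Q) z = poly_gauss a b P (pderiv Q - smult b (pCons 0 Q)) z"
    unfolding py_def by (simp add: case_prod_beta vector_derivative_at)
qed

lemma pd_poly_gauss: "\<exists>P' Q'. pd m n (poly_gauss a b P Q) = poly_gauss a b P' Q'"
proof -
  have "\<exists>Q'. (py ^^ n) (poly_gauss a b P Q) = poly_gauss a b P Q'"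
    by (induction n) (auto simp: py_poly_gauss)
  moreover have "\<exists>P'. (px ^^ m) (poly_gauss a b P Q') = poly_gauss a b P' Q'" for Q'
    by (induction m) (auto simp: px_poly_gauss)
  ultimately show ?thesis unfolding pd_def by metis
qed

lemma poly_gauss_differentiable: "poly_gauss a b P Q differentiable (at z)"
proof -
  have d: "(\<lambda>x. poly R x * exp (- (c * x\<^sup>2 / 2))) differentiable (at x)" for R and c x :: real
    using poly_gauss1_derivative unfolding real_differentiable_def by blast
  have fs: "fst differentiable (at z)" "snd differentiable (at z)"
    by (auto intro: bounded_linear_imp_differentiable bounded_linear_fst bounded_linear_snd)
  have "(\<lambda>z. poly P (fst z) * exp (- (a * (fst z)\<^sup>2 / 2))) differentiable (at z)"
    by (rule differentiable_compose[of "\<lambda>x. poly P x * exp (- (a * x\<^sup>2 / 2))" fst, OF d fs(1)])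
  moreover have "(\<lambda>z. poly Q (snd z) * exp (- (b * (snd z)\<^sup>2 / 2))) differentiable (at z)"
    by (rule differentiable_compose[of "\<lambda>x. poly Q x * exp (- (b * x\<^sup>2 / 2))" snd, OF d fs(2)])
  ultimately have m: "(\<lambda>z. (poly P (fst z) * exp (- (a * (fst z)\<^sup>2 / 2))) * (poly Q (snd z) * exp (- (b * (snd z)\<^sup>2 / 2)))) differentiable (at z)"
    by (rule differentiable_mult)
  show ?thesis
    unfolding poly_gauss_def[abs_def]
    by (rule differentiable_compose[of complex_of_real, OF bounded_linear_imp_differentiable[OF bounded_linear_of_real] m])
qed

text \<open>Exponential growth is a form of the bound that survives the recursion over
  \<open>pCons\<close>: each factor x costs one more unit of k.\<close>

lemma poly_exp_bound: "\<exists>C k. C \<ge> 0 \<and> k \<ge> 0 \<and> (\<forall>x::real. \<bar>poly P x\<bar> \<le> C * exp (k * \<bar>x\<bar>))"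
proof (induction P)
  case 0
  show ?case by (intro exI[of _ 0]) simp
next
  case (pCons c P)
  then obtain C k where Ck: "C \<ge> 0" "k \<ge> 0" "\<And>x. \<bar>poly P x\<bar> \<le> C * exp (k * \<bar>x\<bar>)" by blast
  show ?case
  proof (rule exI[of _ "\<bar>c\<bar> + C"], rule exI[of _ "k + 1"], intro conjI allI)
    fix x :: real
    have 1: "\<bar>c\<bar> * 1 \<le> \<bar>c\<bar> * exp ((k + 1) * \<bar>x\<bar>)" using Ck(2) by (intro mult_left_mono) auto
    have "\<bar>x\<bar> \<le> exp \<bar>x\<bar>" using exp_ge_add_one_self[of "\<bar>x\<bar>"] by linarith
    then have "\<bar>x\<bar> * \<bar>poly P x\<bar> \<le> exp \<bar>x\<bar> * (C * exp (k * \<bar>x\<bar>))" by (intro mult_mono Ck(3)) auto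
    also have "\<dots> = C * exp ((k + 1) * \<bar>x\<bar>)" proof -
      have "\<bar>x\<bar> + k * \<bar>x\<bar> = (k + 1) * \<bar>x\<bar>" by (simp add: distrib_right)
      then have "exp \<bar>x\<bar> * exp (k * \<bar>x\<bar>) = exp ((k + 1) * \<bar>x\<bar>)" by (simp only: exp_add[symmetric])
      then show ?thesis by (simp only: mult.left_commute)
    qed
    finally have 2: "\<bar>x\<bar> * \<bar>poly P x\<bar> \<le> C * exp ((k + 1) * \<bar>x\<bar>)" .
    have "\<bar>poly (pCons c P) x\<bar> \<le> \<bar>c\<bar> + \<bar>x\<bar> * \<bar>poly P x\<bar>"
      unfolding poly_pCons abs_mult[symmetric] by (rule abs_triangle_ineq)
    with 1 2 show "\<bar>poly (pCons c P) x\<bar> \<le> (\<bar>c\<bar> + C) * exp ((k + 1) * \<bar>x\<bar>)" by (simp only: distrib_right)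
  qed (use Ck in auto)
qed

lemma poly_gauss1_bounded:
  assumes a: "a > 0"
  shows "\<exists>C. \<forall>x::real. \<bar>poly P x * exp (- (a * x\<^sup>2 / 2))\<bar> \<le> C"
proof -
  obtain C k where Ck: "C \<ge> 0" "k \<ge> 0" "\<And>x. \<bar>poly P x\<bar> \<le> C * exp (k * \<bar>x\<bar>)"
    using poly_exp_bound[of P] by blast
  have "\<bar>poly P x * exp (- (a * x\<^sup>2 / 2))\<bar> \<le> C * exp (k\<^sup>2 / (2 * a))" for x
  proof -
    \<comment> \<open>Completing the square bounds the exponent k |x| - a x^2 / 2.\<close>
    have "0 \<le> (a * \<bar>x\<bar> - k)\<^sup>2 / (2 * a)" using a by simp
    also have "\<dots> = a * x\<^sup>2 / 2 - k * \<bar>x\<bar> + k\<^sup>2 / (2 * a)"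
      using a by (simp add: power2_diff power_mult_distrib field_simps power2_eq_square[of a])
    finally have le: "k * \<bar>x\<bar> + - (a * x\<^sup>2 / 2) \<le> k\<^sup>2 / (2 * a)" by linarith
    have "\<bar>poly P x * exp (- (a * x\<^sup>2 / 2))\<bar> = \<bar>poly P x\<bar> * exp (- (a * x\<^sup>2 / 2))" by (simp only: abs_mult abs_exp_cancel)
    also have "\<dots> \<le> C * exp (k * \<bar>x\<bar>) * exp (- (a * x\<^sup>2 / 2))" by (intro mult_right_mono Ck(3)) simp
    also have "\<dots> = C * exp (k * \<bar>x\<bar> + - (a * x\<^sup>2 / 2))" by (simp only: exp_add mult.assoc)
    also have "\<dots> \<le> C * exp (k\<^sup>2 / (2 * a))" using le Ck(1) by (intro mult_left_mono) auto
    finally show ?thesis .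
  qed
  then show ?thesis by blast
qed

lemma poly_gauss_bounded:
  assumes "a > 0" "b > 0"
  shows "bounded (range (poly_gauss a b P Q))"
proof -
  obtain C where C: "\<forall>x::real. \<bar>poly P x * exp (- (a * x\<^sup>2 / 2))\<bar> \<le> C"
    using poly_gauss1_bounded[OF assms(1)] by (rule exE)
  obtain D where D: "\<forall>x::real. \<bar>poly Q x * exp (- (b * x\<^sup>2 / 2))\<bar> \<le> D"
    using poly_gauss1_bounded[OF assms(2)] by (rule exE)
  have "0 \<le> C" by (rule order_trans[OF abs_ge_zero C[rule_format]])
  then have "cmod (poly_gauss a b P Q z) \<le> C * D" for z
    unfolding poly_gauss_def norm_of_real abs_mult[of "_ * _" "_ * _"]
    by (rule mult_mono[OF C[rule_format] D[rule_format] _ abs_ge_zero])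
  then show ?thesis by (auto simp: bounded_iff)
qed

lemma schwartz_poly_gauss:
  assumes "a > 0" "b > 0"
  shows "schwartz (poly_gauss a b P Q)"
  unfolding schwartz_def
proof (intro conjI allI)
  fix m n i j z
  obtain P' Q' where PQ: "pd m n (poly_gauss a b P Q) = poly_gauss a b P' Q'" using pd_poly_gauss by blast
  show "pd m n (poly_gauss a b P Q) differentiable (at z)" unfolding PQ by (rule poly_gauss_differentiable)
  have "(\<lambda>z. (fst z ^ i * snd z ^ j) *\<^sub>R pd m n (poly_gauss a b P Q) z) = poly_gauss a b (monom 1 i * P') (monom 1 j * Q')"
    unfolding PQ poly_gauss_def fun_eq_iff scaleR_conv_of_real of_real_mult[symmetric]
    by (simp add: poly_monom mult_ac)
  then show "bounded (range (\<lambda>z. (fst z ^ i * snd z ^ j) *\<^sub>R pd m n (poly_gauss a b P Q) z))"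
    by (simp only: poly_gauss_bounded[OF assms])
qed

text \<open>At time 0 the phase factor is 1, so the datum is a plain Gaussian, with constant
  polynomials.\<close>

lemma schwartz_prof:
  assumes "e > 0"
  shows "schwartz (prof q \<mu> A e 0)"
proof -
  have "prof q \<mu> A e 0 z = poly_gauss e (e\<^sup>2) [:A:] 1 z" for z
  proof -
    have "cmod (gs e 1 z) = exp (- (e * (fst z)\<^sup>2 / 2)) * exp (- (e\<^sup>2 * (snd z)\<^sup>2 / 2))"
      unfolding gs_def cmod_gaussian exp_add[symmetric] by simp
    moreover have "cis (- \<mu> * 0 * (A powr q * cmod (gs e q z))) = 1" by simp
    moreover have "poly [:A:] x = A" "poly 1 x = 1" for x by simp_all
    ultimately show ?thesis unfolding prof_def poly_gauss_def by (simp only: mult_1 mult_1_right mult.assoc)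
  qed
  then have "prof q \<mu> A e 0 = poly_gauss e (e\<^sup>2) [:A:] 1" ..
  then show ?thesis using schwartz_poly_gauss assms by simp
qed

subsection \<open>Norm inflation of the difference\<close>

text \<open>By the choice of \<open>k\<close> the two phases at time t differ by k times
  \<open>cmod (gs e q z)\<close>. The amplitudes differ as well, by the factor 1 + r; the correction
  \<open>h\<close> makes them equal and costs the last term. The sign of \<mu> only conjugates the
  phase factor.\<close>

lemma prof_separation:
  assumes A: "A > 0" and r: "r \<ge> 0" and e: "e > 0" and \<mu>: "\<bar>\<mu>\<bar> = 1"
    and k: "t * (A powr q * ((1 + r) powr q - 1)) = k"
  shows "A * norm (abs_l2 (\<lambda>z. gs e 1 z * (1 - cis (k * cmod (gs e q z)))))
     \<le> norm (abs_l2 (prof q \<mu> (A * (1 + r)) e t) - abs_l2 (prof q \<mu> A e t)) + A * r * norm (abs_l2 (gs e 1))"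
proof -
  let ?f = "\<lambda>z. gs e 1 z * (1 - cis (k * cmod (gs e q z)))"
  let ?p1 = "prof q \<mu> (A * (1 + r)) e t" and ?p2 = "prof q \<mu> A e t"
  define h where "h z = complex_of_real (A * r) * (gs e 1 z * (cis (- \<mu> * t * (A powr q * cmod (gs e q z))) * cis (- \<mu> * (k * cmod (gs e q z)))))" for z
  have s: "sq_int ?p1" "sq_int ?p2" "sq_int (gs e 1)"
    using A r e by (auto intro!: sq_int_prof sq_int_gs)
  have [measurable]: "h \<in> borel_measurable borel" unfolding h_def[abs_def] by measurable
  have hle: "cmod (h z) \<le> (A * r) * cmod (gs e 1 z)" for z
    unfolding h_def norm_mult norm_cis norm_of_real using A r by simp
  have sh: "sq_int h" by (rule sq_int_bounded[OF s(3) _ hle]) simp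
  have f: "cmod (?f z) \<le> (1 / A) * cmod ((?p2 z - ?p1 z) + h z)" for z
  proof -
    define \<phi> where "\<phi> = cmod (gs e q z)"
    define c where "c = cis (- \<mu> * t * (A powr q * \<phi>))"
    define d where "d = cis (- \<mu> * (k * \<phi>))"
    have g: "complex_of_real (cmod (gs e 1 z)) = gs e 1 z" by (rule gs_eq_cmod[symmetric])
    have "(A * (1 + r)) powr q = A powr q * (1 + r) powr q" using A r by (simp add: powr_mult)
    then have "- \<mu> * t * ((A * (1 + r)) powr q * \<phi>) = - \<mu> * t * (A powr q * \<phi>) + - \<mu> * (k * \<phi>)"
      unfolding k[symmetric] by (simp add: algebra_simps)
    then have "?p1 z = complex_of_real (A * (1 + r)) * gs e 1 z * (c * d)"
      unfolding prof_def of_real_mult g \<phi>_def[symmetric] c_def d_def cis_mult by (simp only: of_real_mult)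
    moreover have "?p2 z = complex_of_real A * gs e 1 z * c"
      unfolding prof_def of_real_mult g c_def \<phi>_def ..
    moreover have "h z = complex_of_real (A * r) * (gs e 1 z * (c * d))"
      by (simp only: h_def c_def d_def \<phi>_def)
    ultimately have "(?p2 z - ?p1 z) + h z = complex_of_real A * (c * (gs e 1 z * (1 - d)))"
      by (simp add: algebra_simps)
    then have "cmod ((?p2 z - ?p1 z) + h z) = A * (cmod (gs e 1 z) * cmod (1 - d))"
      using A by (simp add: norm_mult c_def)
    moreover have "cmod (1 - d) = cmod (1 - cis (k * \<phi>))"
    proof -
      have "\<mu> = 1 \<or> \<mu> = -1" using \<mu> by (auto simp: abs_if split: if_splits)
      then show ?thesis
      proof
        assume "\<mu> = 1"
        then have "1 - d = cnj (1 - cis (k * \<phi>))" by (simp add: d_def cis_cnj)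
        then show ?thesis by (simp only: complex_mod_cnj)
      qed (simp add: d_def)
    qed
    ultimately show ?thesis using A by (simp add: norm_mult \<phi>_def)
  qed
  have sd: "sq_int (\<lambda>z. (?p2 z - ?p1 z) + h z)" by (intro sq_int_add sq_int_diff s sh)
  have sf: "sq_int ?f" by (rule sq_int_bounded[OF sd _ f]) simp
  have "norm (abs_l2 ?f) \<le> (1 / A) * norm (abs_l2 (\<lambda>z. (?p2 z - ?p1 z) + h z))"
    by (rule norm_abs_le[OF sf sd f]) (use A in simp)
  then have "A * norm (abs_l2 ?f) \<le> norm (abs_l2 (\<lambda>z. (?p2 z - ?p1 z) + h z))"
    using A by (simp add: field_simps)
  also have "abs_l2 (\<lambda>z. (?p2 z - ?p1 z) + h z) = (abs_l2 ?p2 - abs_l2 ?p1) + abs_l2 h"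
    by (simp only: abs_l2_add[OF sq_int_diff[OF s(2,1)] sh] abs_l2_diff[OF s(2,1)])
  also have "norm \<dots> \<le> norm (abs_l2 ?p2 - abs_l2 ?p1) + norm (abs_l2 h)" by (rule norm_triangle_ineq)
  also have "norm (abs_l2 h) \<le> A * r * norm (abs_l2 (gs e 1))"
    by (rule norm_abs_le[OF sh s(3) hle]) (use A r in simp)
  finally show ?thesis by (simp only: norm_minus_commute add_left_mono)
qed

theorem theorem1p2:
  fixes p \<mu> s1 s2 \<delta> \<epsilon> t :: real
  assumes "p > 1"
    and "\<mu> = 1 \<or> \<mu> = -1"
    and "(\<exists>m::nat. p = 2 * real m + 1) \<or> (\<exists>k::nat. real k > 3/2 \<and> p \<ge> real k + 1)"
    and "s1 \<le> 0" and "s2 \<le> 0"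
    and "0 < \<delta>" and "\<delta> < 1" and "0 < \<epsilon>" and "\<epsilon> < 1"
    and "t > 0"
  shows "\<exists>C>0. \<exists>u1 u2.
           nls_solution \<mu> p t u1 \<and> nls_solution \<mu> p t u2 \<and>
           schwartz (u1 0) \<and> schwartz (u2 0) \<and>
           hnorm s1 s2 (u1 0) \<le> C * \<epsilon> \<and> hnorm s1 s2 (u2 0) \<le> C * \<epsilon> \<and>
           hnorm s1 s2 (\<lambda>z. u1 0 z - u2 0 z) \<le> C * \<delta> \<and>
           hnorm s1 s2 (\<lambda>z. u1 t z - u2 t z) \<ge> C * \<epsilon>"
proof -
  note s = \<open>s1 \<le> 0\<close> \<open>s2 \<le> 0\<close>
  define q where "q = p - 1"
  \<comment> \<open>An odd integer above 1 has m >= 1, and an integer above 3/2 is at least 2; both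
    alternatives thus lead to p >= 3.\<close>
  have "p \<ge> 3"
    using assms(3)
  proof
    assume "\<exists>m::nat. p = 2 * real m + 1"
    then obtain m :: nat where m: "p = 2 * real m + 1" by blast
    then have "real m > 0" using \<open>p > 1\<close> by simp
    then have "m \<ge> 1" by simp
    then have "real m \<ge> 1" by simp
    then show ?thesis unfolding m by linarith
  next
    assume "\<exists>k::nat. real k > 3/2 \<and> p \<ge> real k + 1"
    then obtain k :: nat where k: "real k > 3/2" "p \<ge> real k + 1" by blast
    then have "k \<ge> 2" by linarith
    then have "real k \<ge> 2" by simp
    with k(2) show ?thesis by linarith
  qed
  then have q: "q \<ge> 2" and p: "p = q + 1" by (simp_all add: q_def)
  have \<mu>: "\<bar>\<mu>\<bar> = 1" using assms(2) by auto
  \<comment> \<open>The relative gap between the amplitudes: 1/10 is what the factor 1.3 can afford,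
    and \<open>\<delta> / \<epsilon>\<close> limits the initial difference to that fraction of the
    size of the data.\<close>
  define r where "r = min (1 / 10) (\<delta> / \<epsilon>)"
  have r: "r > 0" "r \<le> 1 / 10" "r * \<epsilon> \<le> \<delta>"
  proof -
    show "r > 0" using assms(6,8) by (simp add: r_def)
    show "r \<le> 1 / 10" unfolding r_def by (rule min.cobounded1)
    have "r \<le> \<delta> / \<epsilon>" by (simp add: r_def)
    then show "r * \<epsilon> \<le> \<delta>" using assms(8) by (simp add: pos_le_divide_eq)
  qed
  have q0: "q > 0" using q by simp
  obtain k :: nat where k: "k \<ge> 1"
    and osc: "\<And>e. e > 0 \<Longrightarrow> 13 / 10 * norm (abs_l2 (gs e 1)) \<le> norm (abs_l2 (\<lambda>z. gs e 1 z * (1 - cis (real k * cmod (gs e q z)))))"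
    by (rule oscillation[OF q0], rule that, assumption+)
  define R where "R = (1 + r) powr q - 1"
  have R: "R > 0"
    using powr_less_mono2[of q 1 "1 + r"] q0 r by (simp add: R_def)
  \<comment> \<open>The amplitude for which \<open>t * (A powr q * R)\<close> is exactly k; it is
    large when r is small, since R is then small.\<close>
  define A where "A = (real k / (t * R)) powr (1 / q)"
  have base: "real k / (t * R) > 0" using k R \<open>t > 0\<close> by simp
  have A: "A > 0" unfolding A_def using base by (simp only: powr_gt_zero less_imp_neq[symmetric] not_False_eq_True)
  have A1: "A * (1 + r) > 0" using A r by simp
  have "A powr q = real k / (t * R)" proof -
    have "1 / q * q = 1" using q by simp
    then show ?thesis unfolding A_def powr_powr by (simp only: powr_one[OF less_imp_le[OF base]])
  qed
  then have phase: "t * (A powr q * ((1 + r) powr q - 1)) = real k"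
    unfolding R_def[symmetric] using R \<open>t > 0\<close> by simp
  obtain K1 e1 where K1: "K1 > 0" "e1 > 0" and sol1: "\<And>e. 0 < e \<Longrightarrow> e \<le> e1 \<Longrightarrow>
       \<exists>u. nls_solution \<mu> (q + 1) t u \<and> u 0 = prof q \<mu> (A * (1 + r)) e 0 \<and> sq_int (u t) \<and>
       norm (abs_l2 (u t) - abs_l2 (prof q \<mu> (A * (1 + r)) e t)) \<le> K1 * (e * norm (abs_l2 (gs e 1))) \<and>
       (\<exists>l. om_rel (FT (abs_l2 (u t))) l \<and> norm l \<le> K1 * (e * norm (abs_l2 (gs e 1))))"
    by (rule nls_profile[OF q A1 \<open>t > 0\<close>], rule that, assumption+)
  obtain K2 e2 where K2: "K2 > 0" "e2 > 0" and sol2: "\<And>e. 0 < e \<Longrightarrow> e \<le> e2 \<Longrightarrow>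
       \<exists>u. nls_solution \<mu> (q + 1) t u \<and> u 0 = prof q \<mu> A e 0 \<and> sq_int (u t) \<and>
       norm (abs_l2 (u t) - abs_l2 (prof q \<mu> A e t)) \<le> K2 * (e * norm (abs_l2 (gs e 1))) \<and>
       (\<exists>l. om_rel (FT (abs_l2 (u t))) l \<and> norm l \<le> K2 * (e * norm (abs_l2 (gs e 1))))"
    by (rule nls_profile[OF q A \<open>t > 0\<close>], rule that, assumption+)
  define S where "S = \<bar>s1\<bar> + \<bar>s2\<bar>"
  define W where "W = (2 * pi + S) * (K1 + K2)"
  have W: "W > 0" unfolding W_def S_def using K1 K2 by (intro mult_pos_pos add_pos_nonneg) auto
  \<comment> \<open>The last entry limits the dispersive errors, those in the L2 norm together with
    those from the Sobolev weights, to a tenth of the amplitude.\<close>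
  define e where "e = min (min e1 e2) (2 * pi * (A / 10) / W)"
  have e: "e > 0" "e \<le> e1" "e \<le> e2" "W * e \<le> 2 * pi * (A / 10)"
  proof -
    show "e > 0" "e \<le> e1" "e \<le> e2" using K1 K2 A W by (auto simp: e_def)
    have "e \<le> 2 * pi * (A / 10) / W" by (simp add: e_def)
    then have "e * W \<le> 2 * pi * (A / 10)" by (simp only: pos_le_divide_eq[OF W])
    then show "W * e \<le> 2 * pi * (A / 10)" by (simp only: mult.commute)
  qed
  define m where "m = norm (abs_l2 (gs e 1))"
  have m: "m > 0"
  proof -
    have "0 < pi * sqrt e" using e(1) by simp
    then have "e * m \<noteq> 0" unfolding norm_gs[OF e(1), symmetric] m_def by auto
    then have "m \<noteq> 0" by auto
    then show ?thesis by (simp add: m_def)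
  qed
  obtain u1 l1 where u1: "nls_solution \<mu> p t u1" "u1 0 = prof q \<mu> (A * (1 + r)) e 0" "sq_int (u1 t)"
      "norm (abs_l2 (u1 t) - abs_l2 (prof q \<mu> (A * (1 + r)) e t)) \<le> K1 * (e * m)"
      "om_rel (FT (abs_l2 (u1 t))) l1" "norm l1 \<le> K1 * (e * m)"
    using sol1[OF e(1,2)] unfolding m_def[symmetric] p[symmetric] by blast
  obtain u2 l2 where u2: "nls_solution \<mu> p t u2" "u2 0 = prof q \<mu> A e 0" "sq_int (u2 t)"
      "norm (abs_l2 (u2 t) - abs_l2 (prof q \<mu> A e t)) \<le> K2 * (e * m)"
      "om_rel (FT (abs_l2 (u2 t))) l2" "norm l2 \<le> K2 * (e * m)"
    using sol2[OF e(1,3)] unfolding m_def[symmetric] p[symmetric] by blast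
  have sg: "sq_int (gs e 1)" by (rule sq_int_gs) (use e in auto)
  \<comment> \<open>The separation at time t itself. With C = \<open>D / \<epsilon>\<close> the last
    claim becomes an equality, and the others become upper bounds for the data by D and by
    \<open>D / \<epsilon> * \<delta>\<close>.\<close>
  define D where "D = hnorm s1 s2 (\<lambda>z. u1 t z - u2 t z)"
  have D: "2 * pi * (A * (1 + r) * m) \<le> D"
  proof -
    let ?P1 = "abs_l2 (prof q \<mu> (A * (1 + r)) e t)" and ?P2 = "abs_l2 (prof q \<mu> A e t)"
    have "A * (13 / 10 * m) \<le> norm (?P1 - ?P2) + A * r * m"
      using mult_left_mono[OF osc[OF e(1)] less_imp_le[OF A]] prof_separation[OF A less_imp_le[OF r(1)] e(1) \<mu> phase]
      unfolding m_def by linarith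
    moreover have "norm (?P1 - ?P2) \<le> norm (abs_l2 (u1 t) - abs_l2 (u2 t)) + K1 * (e * m) + K2 * (e * m)"
    proof -
      have "norm (x - y) \<le> norm (v - w) + norm (v - x) + norm (w - y)" for x y v w :: l2
      proof -
        have "norm (x - y) = norm (((v - w) - (v - x)) + (w - y))" by simp
        also have "\<dots> \<le> norm (v - w) + norm (v - x) + norm (w - y)"
          by (intro order_trans[OF norm_triangle_ineq] add_mono norm_triangle_ineq4 order_refl)
        finally show ?thesis .
      qed
      from this[of ?P1 ?P2 "abs_l2 (u1 t)" "abs_l2 (u2 t)"] u1(4) u2(4) show ?thesis by linarith
    qed
    ultimately have N: "A * (13 / 10 * m) - A * r * m - (K1 + K2) * (e * m) \<le> norm (abs_l2 (u1 t) - abs_l2 (u2 t))"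
      unfolding distrib_right by linarith
    have sd: "sq_int (\<lambda>z. u1 t z - u2 t z)" by (rule sq_int_diff[OF u1(3) u2(3)])
    have ad: "abs_l2 (\<lambda>z. u1 t z - u2 t z) = abs_l2 (u1 t) - abs_l2 (u2 t)" by (rule abs_l2_diff[OF u1(3) u2(3)])
    have o: "om_rel (FT (abs_l2 (\<lambda>z. u1 t z - u2 t z))) (l1 - l2)"
      unfolding ad FT_diff by (rule om_rel_diff[OF u1(5) u2(5)])
    have "norm (l1 - l2) \<le> (K1 + K2) * (e * m)"
      unfolding distrib_right by (intro order_trans[OF norm_triangle_ineq4] add_mono u1 u2)
    then have "S * norm (l1 - l2) \<le> S * ((K1 + K2) * (e * m))" by (intro mult_left_mono) (auto simp: S_def)
    moreover have "2 * pi * norm (abs_l2 (u1 t) - abs_l2 (u2 t)) - S * norm (l1 - l2) \<le> D"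
      using hnorm_lower[OF s sd o] unfolding ad S_def D_def .
    moreover have "2 * pi * (A * (13 / 10 * m) - A * r * m - (K1 + K2) * (e * m)) \<le> 2 * pi * norm (abs_l2 (u1 t) - abs_l2 (u2 t))"
      by (intro mult_left_mono N) simp
    ultimately have "2 * pi * (A * (13 / 10 * m) - A * r * m - (K1 + K2) * (e * m)) - S * ((K1 + K2) * (e * m)) \<le> D" by linarith
    moreover have "2 * pi * (A * (13 / 10 * m) - A * r * m - (K1 + K2) * (e * m)) - S * ((K1 + K2) * (e * m))
       = 2 * pi * (A * (13 / 10 - r) * m) - (W * e) * m" by (simp add: W_def algebra_simps)
    moreover have "(W * e) * m \<le> 2 * pi * (A / 10) * m" using e(4) m by (intro mult_right_mono) auto
    \<comment> \<open>The constants fit because 13/10 - r - 1/10 >= 1 + r, that is, r <=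
      1/10.\<close>
    moreover have "2 * pi * (A * (1 + r) * m) \<le> 2 * pi * (A * (13 / 10 - r) * m) - 2 * pi * (A / 10) * m"
    proof -
      have "A * (1 + r) * m \<le> A * (12 / 10 - r) * m"
        using A m r by (intro mult_right_mono mult_left_mono) auto
      then have "2 * pi * (A * (1 + r) * m) \<le> 2 * pi * (A * (12 / 10 - r) * m)" by (intro mult_left_mono) auto
      also have "\<dots> = 2 * pi * (A * (13 / 10 - r) * m) - 2 * pi * (A / 10) * m" by (simp add: algebra_simps)
      finally show ?thesis .
    qed
    ultimately show ?thesis by linarith
  qed
  have "0 < 2 * pi * (A * (1 + r) * m)" using A1 m by simp
  then have Dpos: "D > 0" using D by linarith
  have init: "hnorm s1 s2 f \<le> D" if f: "sq_int f" "\<And>z. cmod (f z) \<le> c * cmod (gs e 1 z)" "0 \<le> c" "c \<le> A * (1 + r)" for f c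
  proof -
    have "hnorm s1 s2 f \<le> 2 * pi * norm (abs_l2 f)" by (rule hnorm_upper[OF s f(1)])
    also have "\<dots> \<le> 2 * pi * (c * m)" unfolding m_def by (intro mult_left_mono norm_abs_le f sg) simp
    also have "\<dots> \<le> 2 * pi * (A * (1 + r) * m)" using f m by (intro mult_left_mono mult_right_mono) auto
    finally show ?thesis using D by linarith
  qed
  have sp: "sq_int (prof q \<mu> (A * (1 + r)) e 0)" "sq_int (prof q \<mu> A e 0)"
    using A A1 e by (auto intro!: sq_int_prof)
  have d0: "prof q \<mu> (A * (1 + r)) e 0 z - prof q \<mu> A e 0 z = complex_of_real (A * r) * gs e 1 z" for z
    unfolding prof_def of_real_mult gs_eq_cmod[symmetric] by (simp add: algebra_simps)
  have cd: "cmod (prof q \<mu> (A * (1 + r)) e 0 z - prof q \<mu> A e 0 z) \<le> A * r * cmod (gs e 1 z)" for z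
    unfolding d0 norm_mult norm_of_real using A r by simp
  have sd: "sq_int (\<lambda>z. prof q \<mu> (A * (1 + r)) e 0 z - prof q \<mu> A e 0 z)" by (rule sq_int_diff[OF sp])
  have hd: "hnorm s1 s2 (\<lambda>z. prof q \<mu> (A * (1 + r)) e 0 z - prof q \<mu> A e 0 z) \<le> D / \<epsilon> * \<delta>"
  proof -
    have "hnorm s1 s2 (\<lambda>z. prof q \<mu> (A * (1 + r)) e 0 z - prof q \<mu> A e 0 z) \<le> 2 * pi * norm (abs_l2 (\<lambda>z. prof q \<mu> (A * (1 + r)) e 0 z - prof q \<mu> A e 0 z))"
      by (rule hnorm_upper[OF s sd])
    also have "\<dots> \<le> 2 * pi * (A * r * m)"
      unfolding m_def using A r by (intro mult_left_mono norm_abs_le[OF sd sg cd]) auto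
    \<comment> \<open>Enlarging by the factor 1 + r brings in the quantity that is known to lie
      below D.\<close>
    also have "\<dots> \<le> 2 * pi * (A * (1 + r) * m) * r"
    proof -
      have "1 * (2 * pi * A * m * r) \<le> (1 + r) * (2 * pi * A * m * r)"
        using A m r by (intro mult_right_mono) auto
      then show ?thesis by (simp only: mult_ac mult_1)
    qed
    also have "\<dots> \<le> D * r" using D r by (intro mult_right_mono) auto
    also have "\<dots> \<le> D * (\<delta> / \<epsilon>)" using Dpos by (intro mult_left_mono) (auto simp: r_def)
    finally show ?thesis by simp
  qed
  have CE: "D / \<epsilon> * \<epsilon> = D" using \<open>0 < \<epsilon>\<close> by simp
  show ?thesis
  proof (rule exI[of _ "D / \<epsilon>"], rule conjI[OF divide_pos_pos[OF Dpos \<open>0 < \<epsilon>\<close>]],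
      rule exI[of _ u1], rule exI[of _ u2], intro conjI)
    show "schwartz (u1 0)" "schwartz (u2 0)" unfolding u1(2) u2(2) by (rule schwartz_prof[OF e(1)])+
    show "hnorm s1 s2 (u1 0) \<le> D / \<epsilon> * \<epsilon>"
      unfolding CE u1(2) by (rule init[OF sp(1)]) (use A1 in \<open>auto simp: cmod_prof\<close>)
    show "hnorm s1 s2 (u2 0) \<le> D / \<epsilon> * \<epsilon>"
      unfolding CE u2(2) by (rule init[OF sp(2)]) (use A r in \<open>auto simp: cmod_prof\<close>)
    show "hnorm s1 s2 (\<lambda>z. u1 0 z - u2 0 z) \<le> D / \<epsilon> * \<delta>" unfolding u1(2) u2(2) by (rule hd)
    show "hnorm s1 s2 (\<lambda>z. u1 t z - u2 t z) \<ge> D / \<epsilon> * \<epsilon>" unfolding CE unfolding D_def by (rule order_refl)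
  qed (fact u1(1) u2(1))+
qed

end
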